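(* Let $n\ge 2$ and $0\le m<n$ be integers, and let $$A=\mathbb R[x_0,\ldots,x_n]\Big/\Big(\sum_{i=0}^m x_i^2-\sum_{i=m+1}^n x_i^2-1\Big).$$ Then the Euler class group $E(A)$ and the Chow group of zero-cycles $CH_0(A)$ both vanish: $E(A)=0$ and $CH_0(A)=0$.
   Context: $CH_0(A)$ is the group of zero-cycles of $\mathrm{Spec}(A)$ (the free abelian group on the maximal ideals of $A$) modulo rational equivalence. Euler class group $E(A)$ (with respect to $A$), for a Noetherian ring $A\supseteq\mathbb Q$ of dimension $n\ge2$: for an ideal $J\subset A$ of height $n$ such that $J/J^2$ is generated by $n$ elements, two surjections $\alpha,\beta:(A/J)^n\to J/J^2$ are called related if $\beta=\alpha\sigma$ for some $\sigma\in SL_n(A/J)$; an equivalence class $\omega_J$ of surjections is called a local orientation of $J$. It is called a global orientation if some (equivalently every) surjection in the class lifts to a surjection $A^n\to J$. Let $G$ be the free abelian group on pairs $(N,\omega_N)$, where $N$ is an ideal of height $n$ that is primary for a maximal ideal of height $n$, $N/N^2$ is generated by $n$ elements, and $\omega_N$ is a local orientation of $N$. If $J=\bigcap_i N_i$ is the (irredundant) primary decomposition of an ideal $J$ of height $n$ with $J/J^2$ generated by $n$ elements, a local orientation $\omega_J$ induces local orientations $\omega_{N_i}$ of the $N_i$, and one puts $(J,\omega_J)=\sum_i(N_i,\omega_{N_i})\in G$. Let $H\subseteq G$ be the subgroup generated by all $(J,\omega_J)$ with $\omega_J$ a global orientation of $J$. Then $E(A)=G/H$. *)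

theory Defs
  imports Complex_Main "HOL-Algebra.Algebra" "HOL-Combinatorics.Permutations"
    "HOL-Library.Poly_Mapping" "HOL-Library.Extended_Nat"
begin

section \<open>Real quadrics\<close>

text \<open>Polynomials are finitely supported maps from monomials (exponent vectors, themselves
  finitely supported) to coefficients; the ring operations are those of the type.\<close>

definition mpoly_ring :: "nat \<Rightarrow> ((nat \<Rightarrow>\<^sub>0 nat) \<Rightarrow>\<^sub>0 'a::comm_ring_1) ring"
  where "mpoly_ring n =
    \<lparr>carrier = {p. \<forall>mon \<in> Poly_Mapping.keys p. Poly_Mapping.keys mon \<subseteq> {0..n}},
     monoid.mult = (*), one = 1, ring.zero = 0, add = (+)\<rparr>"

definition mpoly_var :: "nat \<Rightarrow> ((nat \<Rightarrow>\<^sub>0 nat) \<Rightarrow>\<^sub>0 'a::comm_ring_1)"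
  where "mpoly_var i = Poly_Mapping.single (Poly_Mapping.single i 1) 1"

definition quadric_poly :: "nat \<Rightarrow> nat \<Rightarrow> ((nat \<Rightarrow>\<^sub>0 nat) \<Rightarrow>\<^sub>0 real)"
  where "quadric_poly m n =
    (\<Sum>i = 0..m. mpoly_var i ^ 2) - (\<Sum>i = m+1..n. mpoly_var i ^ 2) - 1"

definition quadric_ring :: "nat \<Rightarrow> nat \<Rightarrow> ((nat \<Rightarrow>\<^sub>0 nat) \<Rightarrow>\<^sub>0 real) set ring"
  where "quadric_ring m n = mpoly_ring n Quot (Idl\<^bsub>mpoly_ring n\<^esub> {quadric_poly m n})"

lemma cring_mpoly_ring: "cring (mpoly_ring n :: ((nat \<Rightarrow>\<^sub>0 nat) \<Rightarrow>\<^sub>0 'a::comm_ring_1) ring)"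
proof (rule cringI)
  let ?P = "mpoly_ring n :: ((nat \<Rightarrow>\<^sub>0 nat) \<Rightarrow>\<^sub>0 'a) ring"
  have add_closed: "p + q \<in> carrier ?P" if "p \<in> carrier ?P" "q \<in> carrier ?P" for p q
    using that Poly_Mapping.keys_add[of p q] unfolding mpoly_ring_def by fastforce
  have mult_closed: "p * q \<in> carrier ?P" if "p \<in> carrier ?P" "q \<in> carrier ?P" for p q
  proof -
    have "Poly_Mapping.keys mon \<subseteq> {0..n}" if mon: "mon \<in> Poly_Mapping.keys (p * q)" for mon
    proof -
      obtain a b where "mon = a + b" "a \<in> Poly_Mapping.keys p" "b \<in> Poly_Mapping.keys q"
        using mon keys_mult[of p q] by blast
      then show ?thesis
        using \<open>p \<in> carrier ?P\<close> \<open>q \<in> carrier ?P\<close> Poly_Mapping.keys_add[of a b]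
        unfolding mpoly_ring_def by fastforce
    qed
    then show ?thesis by (simp add: mpoly_ring_def)
  qed
  have ops: "p \<oplus>\<^bsub>?P\<^esub> q = p + q" "p \<otimes>\<^bsub>?P\<^esub> q = p * q" "\<zero>\<^bsub>?P\<^esub> = 0" "\<one>\<^bsub>?P\<^esub> = 1" for p q
    by (simp_all add: mpoly_ring_def)
  have units_closed: "0 \<in> carrier ?P" "1 \<in> carrier ?P"
    by (simp_all add: mpoly_ring_def)
  show "abelian_group ?P"
  proof (rule abelian_groupI)
    fix p assume "p \<in> carrier ?P"
    then have "- p \<in> carrier ?P" by (simp add: mpoly_ring_def)
    then show "\<exists>q\<in>carrier ?P. q \<oplus>\<^bsub>?P\<^esub> p = \<zero>\<^bsub>?P\<^esub>" by (rule bexI[rotated]) (simp add: ops)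
  qed (simp_all add: ops add_closed units_closed add.assoc add.commute)
  show "Group.comm_monoid ?P"
    by (rule comm_monoidI) (simp_all add: ops mult_closed units_closed mult.assoc mult.commute)
qed (simp add: mpoly_ring_def distrib_right)


section \<open>Dimension, height, length, primary decomposition\<close>

definition chain_of_length :: "('a set \<Rightarrow> bool) \<Rightarrow> nat \<Rightarrow> (nat \<Rightarrow> 'a set) \<Rightarrow> bool"
  where "chain_of_length Q k C \<longleftrightarrow> (\<forall>i\<le>k. Q (C i)) \<and> (\<forall>i<k. C i \<subset> C (Suc i))"

definition krull_dim :: "('a, 'b) ring_scheme \<Rightarrow> enat"
  where "krull_dim R = Sup {enat k | k. \<exists>C. chain_of_length (\<lambda>P. primeideal P R) k C}"

definition prime_height :: "('a, 'b) ring_scheme \<Rightarrow> 'a set \<Rightarrow> enat"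
  where "prime_height R P =
    Sup {enat k | k. \<exists>C. chain_of_length (\<lambda>P. primeideal P R) k C \<and> C k = P}"

text \<open>The unit ideal gets height \<open>\<infinity>\<close>.\<close>

definition ideal_height :: "('a, 'b) ring_scheme \<Rightarrow> 'a set \<Rightarrow> enat"
  where "ideal_height R I = Inf (prime_height R ` {P. primeideal P R \<and> I \<subseteq> P})"

text \<open>Length of a ring as a module over itself: its submodules are its ideals.\<close>

definition ring_length :: "('a, 'b) ring_scheme \<Rightarrow> enat"
  where "ring_length R = Sup {enat k | k. \<exists>C. chain_of_length (\<lambda>I. ideal I R) k C}"

definition ideal_radical :: "('a, 'b) ring_scheme \<Rightarrow> 'a set \<Rightarrow> 'a set"
  where "ideal_radical R I = {x \<in> carrier R. \<exists>k::nat. x [^]\<^bsub>R\<^esub> k \<in> I}"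

definition primary_ideal :: "('a, 'b) ring_scheme \<Rightarrow> 'a set \<Rightarrow> bool"
  where "primary_ideal R Q \<longleftrightarrow> ideal Q R \<and> Q \<noteq> carrier R \<and>
    (\<forall>x\<in>carrier R. \<forall>y\<in>carrier R. x \<otimes>\<^bsub>R\<^esub> y \<in> Q \<longrightarrow> x \<in> Q \<or> y \<in> ideal_radical R Q)"

definition irredundant_primary_decomposition ::
    "('a, 'b) ring_scheme \<Rightarrow> 'a set \<Rightarrow> 'a set set \<Rightarrow> bool"
  where "irredundant_primary_decomposition R J S \<longleftrightarrow>
    finite S \<and> (\<forall>Q\<in>S. primary_ideal R Q) \<and> \<Inter>S = J \<and>
    inj_on (ideal_radical R) S \<and> (\<forall>Q\<in>S. \<not> \<Inter>(S - {Q}) \<subseteq> Q)"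


section \<open>Zero-cycles modulo rational equivalence\<close>

definition loc_frac :: "('a, 'b) ring_scheme \<Rightarrow> 'a set \<Rightarrow> 'a \<Rightarrow> 'a \<Rightarrow> ('a \<times> 'a) set"
  where "loc_frac R S a s = {(b, t). b \<in> carrier R \<and> t \<in> S \<and>
    (\<exists>u\<in>S. u \<otimes>\<^bsub>R\<^esub> (a \<otimes>\<^bsub>R\<^esub> t \<ominus>\<^bsub>R\<^esub> b \<otimes>\<^bsub>R\<^esub> s) = \<zero>\<^bsub>R\<^esub>)}"

definition localization :: "('a, 'b) ring_scheme \<Rightarrow> 'a set \<Rightarrow> ('a \<times> 'a) set ring"
  where "localization R S =
    \<lparr>carrier = {loc_frac R S a s | a s. a \<in> carrier R \<and> s \<in> S},
     monoid.mult = (\<lambda>U V. \<Union>x\<in>U. \<Union>y\<in>V.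
       loc_frac R S (fst x \<otimes>\<^bsub>R\<^esub> fst y) (snd x \<otimes>\<^bsub>R\<^esub> snd y)),
     one = loc_frac R S \<one>\<^bsub>R\<^esub> \<one>\<^bsub>R\<^esub>,
     ring.zero = loc_frac R S \<zero>\<^bsub>R\<^esub> \<one>\<^bsub>R\<^esub>,
     add = (\<lambda>U V. \<Union>x\<in>U. \<Union>y\<in>V.
       loc_frac R S (fst x \<otimes>\<^bsub>R\<^esub> snd y \<oplus>\<^bsub>R\<^esub> fst y \<otimes>\<^bsub>R\<^esub> snd x)
         (snd x \<otimes>\<^bsub>R\<^esub> snd y))\<rparr>"

text \<open>Order of vanishing at \<open>P\<close> of a nonzero element of a one-dimensional domain \<open>B\<close>:
  the length of \<open>B\<^sub>P / (f)\<close>, which is finite when \<open>B\<close> is Noetherian.\<close>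

definition vanishing_order :: "('a, 'b) ring_scheme \<Rightarrow> 'a set \<Rightarrow> 'a \<Rightarrow> nat"
  where "vanishing_order B P f =
    (let L = localization B (carrier B - P)
     in the_enat (ring_length (L Quot (PIdl\<^bsub>L\<^esub> (loc_frac B (carrier B - P) f \<one>\<^bsub>B\<^esub>)))))"

definition max_spectrum :: "('a, 'b) ring_scheme \<Rightarrow> 'a set set"
  where "max_spectrum R = {M. maximalideal M R}"

text \<open>\<open>c\<close> is the divisor of the rational function \<open>f / g\<close> on the integral curve \<open>Spec (R / p)\<close>,
  pushed forward to \<open>Spec R\<close>. The point \<open>M \<supseteq> p\<close> of the curve is the ideal \<open>M / p\<close>.\<close>

definition is_divisor_on_curve ::
    "('a, 'b) ring_scheme \<Rightarrow> 'a set \<Rightarrow> 'a set \<Rightarrow> 'a set \<Rightarrow> ('a set \<Rightarrow>\<^sub>0 int) \<Rightarrow> bool"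
  where "is_divisor_on_curve R p f g c \<longleftrightarrow>
    Poly_Mapping.keys c \<subseteq> max_spectrum R \<and>
    (\<forall>M\<in>max_spectrum R. Poly_Mapping.lookup c M =
      (if p \<subseteq> M
       then int (vanishing_order (R Quot p) ((\<lambda>x. p +>\<^bsub>R\<^esub> x) ` M) f)
          - int (vanishing_order (R Quot p) ((\<lambda>x. p +>\<^bsub>R\<^esub> x) ` M) g)
       else 0))"

definition principal_zero_cycles :: "('a, 'b) ring_scheme \<Rightarrow> ('a set \<Rightarrow>\<^sub>0 int) set"
  where "principal_zero_cycles R = {c. \<exists>p f g. primeideal p R \<and> krull_dim (R Quot p) = 1 \<and>
    f \<in> carrier (R Quot p) - {\<zero>\<^bsub>R Quot p\<^esub>} \<and> g \<in> carrier (R Quot p) - {\<zero>\<^bsub>R Quot p\<^esub>} \<and>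
    is_divisor_on_curve R p f g c}"

definition chow_group_0 :: "('a, 'b) ring_scheme \<Rightarrow> ('a set \<Rightarrow>\<^sub>0 int) set monoid"
  where "chow_group_0 R = (let Z = free_Abelian_group (max_spectrum R)
    in Z Mod generate Z (principal_zero_cycles R))"


section \<open>Local orientations\<close>

text \<open>The library's module records extend rings; the multiplicative fields of the three modules
  below are never used.\<close>

definition free_module :: "('a, 'b) ring_scheme \<Rightarrow> nat \<Rightarrow> ('a, nat \<Rightarrow> 'a) module"
  where "free_module S n =
    \<lparr>carrier = {..<n} \<rightarrow>\<^sub>E carrier S,
     monoid.mult = undefined, one = undefined,
     ring.zero = (\<lambda>i\<in>{..<n}. \<zero>\<^bsub>S\<^esub>),
     add = (\<lambda>v w. \<lambda>i\<in>{..<n}. v i \<oplus>\<^bsub>S\<^esub> w i),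
     smult = (\<lambda>a v. \<lambda>i\<in>{..<n}. a \<otimes>\<^bsub>S\<^esub> v i)\<rparr>"

definition ideal_module :: "('a, 'b) ring_scheme \<Rightarrow> 'a set \<Rightarrow> ('a, 'a) module"
  where "ideal_module R J =
    \<lparr>carrier = J,
     monoid.mult = monoid.mult R, one = undefined,
     ring.zero = \<zero>\<^bsub>R\<^esub>,
     add = add R,
     smult = monoid.mult R\<rparr>"

text \<open>\<open>J / J\<^sup>2\<close> as a module over \<open>R Quot J\<close>.\<close>

definition conormal_module :: "('a, 'b) ring_scheme \<Rightarrow> 'a set \<Rightarrow> ('a set, 'a set) module"
  where "conormal_module R J =
    \<lparr>carrier = (\<lambda>x. (J \<cdot>\<^bsub>R\<^esub> J) +>\<^bsub>R\<^esub> x) ` J,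
     monoid.mult = rcoset_mult R (J \<cdot>\<^bsub>R\<^esub> J), one = undefined,
     ring.zero = J \<cdot>\<^bsub>R\<^esub> J,
     add = set_add R,
     smult = rcoset_mult R (J \<cdot>\<^bsub>R\<^esub> J)\<rparr>"

definition module_epis ::
    "('a, 'b) ring_scheme \<Rightarrow> ('a, 'c) module \<Rightarrow> ('a, 'd) module \<Rightarrow> ('c \<Rightarrow> 'd) set"
  where "module_epis S M N = {f \<in> carrier M \<rightarrow>\<^sub>E carrier N.
    (\<forall>x\<in>carrier M. \<forall>y\<in>carrier M. f (x \<oplus>\<^bsub>M\<^esub> y) = f x \<oplus>\<^bsub>N\<^esub> f y) \<and>
    (\<forall>a\<in>carrier S. \<forall>x\<in>carrier M. f (a \<odot>\<^bsub>M\<^esub> x) = a \<odot>\<^bsub>N\<^esub> f x) \<and>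
    f ` carrier M = carrier N}"

definition ring_det :: "('a, 'b) ring_scheme \<Rightarrow> nat \<Rightarrow> (nat \<Rightarrow> nat \<Rightarrow> 'a) \<Rightarrow> 'a"
  where "ring_det S n A =
    (\<Oplus>\<^bsub>S\<^esub>p\<in>{p. p permutes {..<n}}. add_pow S (sign p :: int) (\<Otimes>\<^bsub>S\<^esub>i\<in>{..<n}. A i (p i)))"

definition special_linear :: "('a, 'b) ring_scheme \<Rightarrow> nat \<Rightarrow> (nat \<Rightarrow> nat \<Rightarrow> 'a) set"
  where "special_linear S n =
    {A. (\<forall>i<n. \<forall>j<n. A i j \<in> carrier S) \<and> ring_det S n A = \<one>\<^bsub>S\<^esub>}"

definition mat_vec :: "('a, 'b) ring_scheme \<Rightarrow> nat \<Rightarrow> (nat \<Rightarrow> nat \<Rightarrow> 'a) \<Rightarrow> (nat \<Rightarrow> 'a) \<Rightarrow> nat \<Rightarrow> 'a"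
  where "mat_vec S n A v = (\<lambda>i\<in>{..<n}. \<Oplus>\<^bsub>S\<^esub>j\<in>{..<n}. A i j \<otimes>\<^bsub>S\<^esub> v j)"

definition conormal_surjections ::
    "('a, 'b) ring_scheme \<Rightarrow> nat \<Rightarrow> 'a set \<Rightarrow> ((nat \<Rightarrow> 'a set) \<Rightarrow> 'a set) set"
  where "conormal_surjections R n J =
    module_epis (R Quot J) (free_module (R Quot J) n) (conormal_module R J)"

definition orientation_rel ::
    "('a, 'b) ring_scheme \<Rightarrow> nat \<Rightarrow> 'a set \<Rightarrow>
      (((nat \<Rightarrow> 'a set) \<Rightarrow> 'a set) \<times> ((nat \<Rightarrow> 'a set) \<Rightarrow> 'a set)) set"
  where "orientation_rel R n J =
    {(\<alpha>, \<beta>). \<alpha> \<in> conormal_surjections R n J \<and> \<beta> \<in> conormal_surjections R n J \<and>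
      (\<exists>\<sigma>\<in>special_linear (R Quot J) n. \<forall>v\<in>carrier (free_module (R Quot J) n).
        \<beta> v = \<alpha> (mat_vec (R Quot J) n \<sigma> v))}"

text \<open>This set is nonempty exactly when \<open>J / J\<^sup>2\<close> is generated by \<open>n\<close> elements.\<close>

definition local_orientations ::
    "('a, 'b) ring_scheme \<Rightarrow> nat \<Rightarrow> 'a set \<Rightarrow> ((nat \<Rightarrow> 'a set) \<Rightarrow> 'a set) set set"
  where "local_orientations R n J = conormal_surjections R n J // orientation_rel R n J"

definition lifts_to_surjection ::
    "('a, 'b) ring_scheme \<Rightarrow> nat \<Rightarrow> 'a set \<Rightarrow> ((nat \<Rightarrow> 'a set) \<Rightarrow> 'a set) \<Rightarrow> bool"
  where "lifts_to_surjection R n J \<alpha> \<longleftrightarrow>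
    (\<exists>\<phi>\<in>module_epis R (free_module R n) (ideal_module R J).
      \<forall>v\<in>carrier (free_module R n).
        \<alpha> (\<lambda>i\<in>{..<n}. J +>\<^bsub>R\<^esub> v i) = (J \<cdot>\<^bsub>R\<^esub> J) +>\<^bsub>R\<^esub> \<phi> v)"

definition global_orientations ::
    "('a, 'b) ring_scheme \<Rightarrow> nat \<Rightarrow> 'a set \<Rightarrow> ((nat \<Rightarrow> 'a set) \<Rightarrow> 'a set) set set"
  where "global_orientations R n J =
    {\<omega> \<in> local_orientations R n J. \<exists>\<alpha>\<in>\<omega>. lifts_to_surjection R n J \<alpha>}"

text \<open>For \<open>J \<subseteq> N\<close>, \<open>\<beta>\<close> is compatible with \<open>\<alpha>\<close> along the natural maps
  \<open>(R / J)\<^sup>n \<rightarrow> (R / N)\<^sup>n\<close> and \<open>J / J\<^sup>2 \<rightarrow> N / N\<^sup>2\<close>; on cosets these are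
  \<open>X \<mapsto> N + X\<close> and \<open>X \<mapsto> N\<^sup>2 + X\<close>. If \<open>N\<close> is one of the (pairwise comaximal) primary
  components of \<open>J\<close>, exactly one surjection \<open>\<beta>\<close> is compatible with \<open>\<alpha>\<close>.\<close>

definition induces_surjection ::
    "('a, 'b) ring_scheme \<Rightarrow> nat \<Rightarrow> 'a set \<Rightarrow> 'a set \<Rightarrow>
      ((nat \<Rightarrow> 'a set) \<Rightarrow> 'a set) \<Rightarrow> ((nat \<Rightarrow> 'a set) \<Rightarrow> 'a set) \<Rightarrow> bool"
  where "induces_surjection R n J N \<alpha> \<beta> \<longleftrightarrow>
    \<beta> \<in> conormal_surjections R n N \<and>
    (\<forall>v\<in>carrier (free_module (R Quot J) n).
      \<beta> (\<lambda>i\<in>{..<n}. N <+>\<^bsub>R\<^esub> v i) = (N \<cdot>\<^bsub>R\<^esub> N) <+>\<^bsub>R\<^esub> \<alpha> v)"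

definition induced_orientation ::
    "('a, 'b) ring_scheme \<Rightarrow> nat \<Rightarrow> 'a set \<Rightarrow> ((nat \<Rightarrow> 'a set) \<Rightarrow> 'a set) set \<Rightarrow> 'a set \<Rightarrow>
      ((nat \<Rightarrow> 'a set) \<Rightarrow> 'a set) set"
  where "induced_orientation R n J \<omega> N =
    orientation_rel R n N `` {\<beta>. \<exists>\<alpha>\<in>\<omega>. induces_surjection R n J N \<alpha> \<beta>}"


section \<open>The Euler class group\<close>

type_synonym 'a oriented_ideal = "'a set \<times> ((nat \<Rightarrow> 'a set) \<Rightarrow> 'a set) set"

definition oriented_primaries :: "('a, 'b) ring_scheme \<Rightarrow> nat \<Rightarrow> 'a oriented_ideal set"
  where "oriented_primaries R n = {(N, \<omega>).
    primary_ideal R N \<and> ideal_height R N = enat n \<and>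
    maximalideal (ideal_radical R N) R \<and> ideal_height R (ideal_radical R N) = enat n \<and>
    \<omega> \<in> local_orientations R n N}"

text \<open>The elements \<open>(J, \<omega>)\<close> of the free group with \<open>\<omega>\<close> a global orientation. In a Noetherian ring
  of dimension \<open>n\<close> an ideal \<open>J\<close> of height \<open>n\<close> has exactly one decomposition \<open>S\<close>.\<close>

definition global_orientation_cycles ::
    "('a, 'b) ring_scheme \<Rightarrow> nat \<Rightarrow> ('a oriented_ideal \<Rightarrow>\<^sub>0 int) set"
  where "global_orientation_cycles R n = {c. \<exists>J \<omega> S.
    ideal J R \<and> ideal_height R J = enat n \<and> \<omega> \<in> global_orientations R n J \<and>
    irredundant_primary_decomposition R J S \<and>
    c = (\<Sum>N\<in>S. frag_of (N, induced_orientation R n J \<omega> N))}"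

definition euler_class_group :: "('a, 'b) ring_scheme \<Rightarrow> ('a oriented_ideal \<Rightarrow>\<^sub>0 int) set monoid"
  where "euler_class_group R =
    (let n = the_enat (krull_dim R);
         G = free_Abelian_group (oriented_primaries R n)
     in G Mod generate G (global_orientation_cycles R n))"

end

theory Submission
  imports Defs "Jordan_Normal_Form.Determinant" "HOL-Computational_Algebra.Fundamental_Theorem_Algebra"
    "HOL-Analysis.Continuum_Not_Denumerable"
begin

text \<open>Let \<open>X\<close> be the set of complex points of the quadric, so that the closed points of
  \<open>Spec A\<close> are the real points of \<open>X\<close> and the pairs of conjugate nonreal
  ones. Because \<open>m < n\<close>, the quadratic form takes both signs, and then every closed
  point \<open>M\<close> lies on a rational curve cut out of the quadric by a real plane, on which
  a single function \<open>f\<close> vanishes exactly at \<open>M\<close>, to first order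
  (\<open>every_point_good\<close>).

  This kills zero-cycles at once: the divisor of \<open>f\<close> on that curve is \<open>M\<close>
  itself, so \<open>[M] = 0\<close> in \<open>CH\<^sub>0(A)\<close>
  (\<open>principal_point\<close>).

  For the Euler class group the same data show that \<open>M\<close> is generated by
  \<open>n\<close> elements: the \<open>n - 1\<close> linear equations of the plane, and
  \<open>f\<close>. A second orientation of \<open>M\<close> differs from this one by a unit
  \<open>d\<close> of the residue field \<open>A / M\<close>, which is the field of real or of
  complex numbers. A real \<open>d\<close> lifts to a unit of \<open>A\<close> and one rescales a
  generator. A complex \<open>d\<close> is a square, and the Swan-Towber matrix of determinant
  \<open>v\<^sup>2\<close> changes the generators without changing the ideal; this is where
  \<open>n \<ge> 2\<close> enters. Hence every local orientation of a closed point is global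
  (\<open>point_orientation_global\<close>).

  A general generator \<open>(N, \<omega>)\<close> of the Euler class group is moved to closed
  points. Represent \<open>\<omega>\<close> by \<open>f\<^sub>1, \<dots>, f\<^sub>n\<close> and
  change each \<open>f\<^sub>i\<close> by an element of \<open>N\<^sup>2\<close>, which does not
  affect \<open>\<omega>\<close>. By a Bertini theorem (\<open>bertini\<close>) one can do so such
  that all zeros away from \<open>N\<close> are nondegenerate. Nakayama's lemma then gives
  \<open>(F\<^sub>1, \<dots>, F\<^sub>n) = N \<inter> M\<^sub>1 \<inter> \<dots> \<inter>
  M\<^sub>r\<close> with maximal ideals \<open>M\<^sub>i\<close> (\<open>move_primary\<close>).
  This is a relation \<open>(N, \<omega>) + (M\<^sub>1, \<omega>\<^sub>1) + \<dots> + (M\<^sub>r,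
  \<omega>\<^sub>r) = 0\<close>, and the classes of the \<open>M\<^sub>i\<close> vanish
  (\<open>primary_cycle\<close>).

  The commutative algebra rests on two elementary principles. The first is counting: modulo the
  equation, the polynomials of degree at most \<open>D\<close> span a real vector space of
  dimension at most \<open>2 (D + 1)\<^sup>n\<close>. Any family indexed by more than
  \<open>n\<close> exponents is therefore linearly dependent, which bounds chains of primes, gives
  the Nullstellensatz (together with the uncountability of the real numbers), and provides the
  algebraic relation behind the Bertini theorem. The second is that the ideal of a set of points
  is prime as soon as any two of its points are joined by a rational curve inside the set; this
  yields irreducibility and long chains of primes.

  Ideals of a quotient of the polynomial ring are handled through their preimages. The predicates
  \<open>idl\<close>, \<open>prm\<close> and \<open>mxm\<close> express that a set is an ideal, a
  prime ideal or a maximal ideal, and the locale \<open>presented\<close> translates between these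
  sets and the ideals of the quotient.\<close>

section \<open>Real polynomials and their complex points\<close>

type_synonym pp = "(nat \<Rightarrow>\<^sub>0 nat) \<Rightarrow>\<^sub>0 real"

abbreviation cst :: "real \<Rightarrow> pp" where "cst c \<equiv> Poly_Mapping.single 0 c"

text \<open>The extension to all polynomials of a map \<open>\<kappa>\<close> on coefficients and
  a map \<open>\<chi>\<close> on monomials. Evaluation, and the substitution of 0 for some of the
  variables, are both of this form.\<close>

definition mono_ext :: "(real \<Rightarrow> 'b::comm_ring_1) \<Rightarrow> ((nat \<Rightarrow>\<^sub>0 nat) \<Rightarrow> 'b) \<Rightarrow> pp \<Rightarrow> 'b"
  where "mono_ext \<kappa> \<chi> f = (\<Sum>a\<in>Poly_Mapping.keys f. \<kappa> (Poly_Mapping.lookup f a) * \<chi> a)"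

lemma poly_mapping_as_sum:
  "f = (\<Sum>a\<in>Poly_Mapping.keys f. Poly_Mapping.single a (Poly_Mapping.lookup f a))"
  for f :: "'k \<Rightarrow>\<^sub>0 'c::comm_monoid_add"
proof (rule poly_mapping_eqI)
  fix b
  have "Poly_Mapping.lookup (\<Sum>a\<in>Poly_Mapping.keys f. Poly_Mapping.single a (Poly_Mapping.lookup f a)) b
      = (\<Sum>a\<in>Poly_Mapping.keys f. if a = b then Poly_Mapping.lookup f a else 0)"
    by (simp add: lookup_sum lookup_single when_def)
  also have "\<dots> = Poly_Mapping.lookup f b"
    by (simp add: in_keys_iff)
  finally show "Poly_Mapping.lookup f b = Poly_Mapping.lookup
      (\<Sum>a\<in>Poly_Mapping.keys f. Poly_Mapping.single a (Poly_Mapping.lookup f a)) b" by simp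
qed

lemma single_sum_induct:
  fixes f :: "'k \<Rightarrow>\<^sub>0 'c::comm_monoid_add"
  assumes "P 0" "\<And>a c. P (Poly_Mapping.single a c)" "\<And>f g. P f \<Longrightarrow> P g \<Longrightarrow> P (f + g)"
  shows "P f"
proof -
  have "P (\<Sum>a\<in>A. Poly_Mapping.single a (Poly_Mapping.lookup f a))" if "finite A" for A
    using that by (induction A) (use assms in auto)
  then show ?thesis using poly_mapping_as_sum[of f] by (metis finite_keys)
qed

lemma pp_induct [case_names const var add mult]:
  fixes f :: pp
  assumes c: "\<And>c. P (cst c)" and v: "\<And>k. P (mpoly_var k)"
    and a: "\<And>f g. P f \<Longrightarrow> P g \<Longrightarrow> P (f + g)" and m: "\<And>f g. P f \<Longrightarrow> P g \<Longrightarrow> P (f * g)"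
  shows "P f"
proof -
  have pw: "P (Poly_Mapping.single (Poly_Mapping.single k j) 1)" for k j
  proof (induction j)
    case 0 show ?case using c[of 1] by simp
  next
    case (Suc j)
    have "Poly_Mapping.single (Poly_Mapping.single k (Suc j)) (1::real)
      = mpoly_var k * Poly_Mapping.single (Poly_Mapping.single k j) 1"
      by (simp add: mpoly_var_def mult_single single_add[symmetric])
    then show ?case using m[OF v Suc] by metis
  qed
  have mon: "P (Poly_Mapping.single a 1)" for a
  proof (induction a rule: single_sum_induct)
    case 1 show ?case using c[of 1] by simp
  next
    case 2 show ?case by (rule pw)
  next
    case (3 f g)
    have "Poly_Mapping.single (f + g) (1::real) = Poly_Mapping.single f 1 * Poly_Mapping.single g 1"
      by (simp add: mult_single)
    then show ?case using m[OF 3] by metis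
  qed
  show ?thesis
  proof (induction f rule: single_sum_induct)
    case 1 show ?case using c[of 0] by simp
  next
    case (2 b d)
    have "Poly_Mapping.single b d = cst d * Poly_Mapping.single b 1" by (simp add: mult_single)
    then show ?case using m[OF c mon] by metis
  qed (rule a)
qed

locale mono_ext_hom =
  fixes \<kappa> :: "real \<Rightarrow> 'b::comm_ring_1" and \<chi> :: "(nat \<Rightarrow>\<^sub>0 nat) \<Rightarrow> 'b"
  assumes \<kappa>_add: "\<kappa> (x + y) = \<kappa> x + \<kappa> y" and \<kappa>_mult: "\<kappa> (x * y) = \<kappa> x * \<kappa> y" and \<kappa>_one: "\<kappa> 1 = 1"
    and \<chi>_add: "\<chi> (a + b) = \<chi> a * \<chi> b" and \<chi>_zero: "\<chi> 0 = 1"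
begin

lemma \<kappa>_zero: "\<kappa> 0 = 0" using \<kappa>_add[of 0 0] by simp

lemma mono_ext_superset:
  assumes "finite A" "Poly_Mapping.keys f \<subseteq> A"
  shows "mono_ext \<kappa> \<chi> f = (\<Sum>a\<in>A. \<kappa> (Poly_Mapping.lookup f a) * \<chi> a)"
  unfolding mono_ext_def
  by (rule sum.mono_neutral_left) (use assms in \<open>auto simp: in_keys_iff \<kappa>_zero\<close>)

lemma mono_ext_add: "mono_ext \<kappa> \<chi> (f + g) = mono_ext \<kappa> \<chi> f + mono_ext \<kappa> \<chi> g"
proof -
  let ?A = "Poly_Mapping.keys f \<union> Poly_Mapping.keys g"
  have "mono_ext \<kappa> \<chi> (f + g) = (\<Sum>a\<in>?A. \<kappa> (Poly_Mapping.lookup (f+g) a) * \<chi> a)"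
    by (rule mono_ext_superset) (use Poly_Mapping.keys_add[of f g] in auto)
  also have "\<dots> = (\<Sum>a\<in>?A. \<kappa> (Poly_Mapping.lookup f a) * \<chi> a) + (\<Sum>a\<in>?A. \<kappa> (Poly_Mapping.lookup g a) * \<chi> a)"
    by (simp add: lookup_add \<kappa>_add distrib_right sum.distrib)
  finally show ?thesis by (simp add: mono_ext_superset[of ?A f] mono_ext_superset[of ?A g])
qed

lemma mono_ext_single: "mono_ext \<kappa> \<chi> (Poly_Mapping.single a c) = \<kappa> c * \<chi> a"
  by (cases "c = 0") (simp_all add: mono_ext_def \<kappa>_zero)

lemma mono_ext_mult: "mono_ext \<kappa> \<chi> (f * g) = mono_ext \<kappa> \<chi> f * mono_ext \<kappa> \<chi> g"
proof (induction f rule: single_sum_induct)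
  case 1 show ?case by (simp add: mono_ext_def)
next
  case (2 a c)
  show ?case
  proof (induction g rule: single_sum_induct)
    case 1 show ?case by (simp add: mono_ext_def)
  next
    case (2 b d) then show ?case by (simp add: mono_ext_single mult_single \<kappa>_mult \<chi>_add mult_ac)
  next
    case (3 f g) then show ?case by (simp add: distrib_left mono_ext_add)
  qed
next
  case (3 f g) then show ?case by (simp add: distrib_right mono_ext_add)
qed

lemma mono_ext_one: "mono_ext \<kappa> \<chi> 1 = 1"
  using mono_ext_single[of 0 1] by (simp add: \<kappa>_one \<chi>_zero)

lemma comm_ring_hom: "comm_ring_hom (mono_ext \<kappa> \<chi>)"
  by unfold_locales (simp_all add: mono_ext_add mono_ext_mult mono_ext_one mono_ext_def[of _ _ 0])

end

subsection \<open>Evaluation\<close>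

definition ev :: "pp \<Rightarrow> (nat \<Rightarrow> complex) \<Rightarrow> complex"
  where "ev f p = mono_ext complex_of_real (\<lambda>a. \<Prod>k\<in>Poly_Mapping.keys a. p k ^ Poly_Mapping.lookup a k) f"

lemma mono_ext_hom_ev: "mono_ext_hom complex_of_real (\<lambda>a. \<Prod>k\<in>Poly_Mapping.keys a. p k ^ Poly_Mapping.lookup a k)"
proof
  fix a b :: "nat \<Rightarrow>\<^sub>0 nat"
  let ?A = "Poly_Mapping.keys a \<union> Poly_Mapping.keys b"
  have ext: "(\<Prod>k\<in>Poly_Mapping.keys c. p k ^ Poly_Mapping.lookup c k) = (\<Prod>k\<in>?A. p k ^ Poly_Mapping.lookup c k)"
    if "Poly_Mapping.keys c \<subseteq> ?A" for c
    by (rule prod.mono_neutral_left) (use that in \<open>auto simp: in_keys_iff\<close>)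
  show "(\<Prod>k\<in>Poly_Mapping.keys (a + b). p k ^ Poly_Mapping.lookup (a + b) k)
      = (\<Prod>k\<in>Poly_Mapping.keys a. p k ^ Poly_Mapping.lookup a k) * (\<Prod>k\<in>Poly_Mapping.keys b. p k ^ Poly_Mapping.lookup b k)"
    unfolding ext[OF Un_upper1] ext[OF Un_upper2] ext[OF Poly_Mapping.keys_add]
    by (simp add: lookup_add power_add prod.distrib)
qed simp_all

lemma ev_hom: "comm_ring_hom (\<lambda>f. ev f p)"
  using mono_ext_hom.comm_ring_hom[OF mono_ext_hom_ev[of p]] by (simp add: ev_def[abs_def])

interpretation ev: comm_ring_hom "\<lambda>f. ev f p" for p by (rule ev_hom)

lemma ev_cst [simp]: "ev (cst c) p = of_real c"
  by (simp add: ev_def mono_ext_hom.mono_ext_single[OF mono_ext_hom_ev])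

lemma ev_var [simp]: "ev (mpoly_var k) p = p k"
  by (simp add: ev_def mpoly_var_def mono_ext_hom.mono_ext_single[OF mono_ext_hom_ev])

lemmas ev_simps [simp] = ev.hom_add ev.hom_mult ev.hom_zero ev.hom_one ev.hom_minus ev.hom_uminus ev.hom_power ev.hom_sum ev.hom_prod

lemma ev_cnj: "ev f (\<lambda>k. cnj (p k)) = cnj (ev f p)"
  by (induction f rule: pp_induct) simp_all

text \<open>A partial derivative is represented by any polynomial whose values are the derivatives
  of the values. Only these values enter below, and in this form the rules of differentiation come
  from the complex derivative.\<close>

lemma ex_pd: "\<exists>g. \<forall>p. ((\<lambda>t. ev f (p(k:=t))) has_field_derivative ev g p) (at (p k))"
proof (induction f rule: pp_induct)
  case (const c)
  show ?case by (rule exI[of _ 0]) simp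
next
  case (var j)
  show ?case
  proof (cases "j = k")
    case True then show ?thesis by (intro exI[of _ 1]) (simp)
  next
    case False then show ?thesis by (intro exI[of _ 0]) (simp)
  qed
next
  case (add f g)
  then obtain f' g' where *: "\<And>p. ((\<lambda>t. ev f (p(k:=t))) has_field_derivative ev f' p) (at (p k))"
     "\<And>p. ((\<lambda>t. ev g (p(k:=t))) has_field_derivative ev g' p) (at (p k))" by blast
  have "((\<lambda>t. ev (f + g) (p(k:=t))) has_field_derivative ev (f' + g') p) (at (p k))" for p
    using DERIV_add[OF *(1)[of p] *(2)[of p]] by simp
  then show ?case by blast
next
  case (mult f g)
  then obtain f' g' where *: "\<And>p. ((\<lambda>t. ev f (p(k:=t))) has_field_derivative ev f' p) (at (p k))"
     "\<And>p. ((\<lambda>t. ev g (p(k:=t))) has_field_derivative ev g' p) (at (p k))" by blast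
  have "((\<lambda>t. ev (f * g) (p(k:=t))) has_field_derivative ev (f' * g + f * g') p) (at (p k))" for p
    using DERIV_mult[OF *(1)[of p] *(2)[of p]] by (simp add: mult_ac)
  then show ?case by blast
qed

definition pd :: "nat \<Rightarrow> pp \<Rightarrow> pp"
  where "pd k f = (SOME g. \<forall>p. ((\<lambda>t. ev f (p(k:=t))) has_field_derivative ev g p) (at (p k)))"

lemma pd_deriv: "((\<lambda>t. ev f (p(k:=t))) has_field_derivative ev (pd k f) p) (at (p k))"
  using someI_ex[OF ex_pd[of f k]] unfolding pd_def by blast

lemma pd_unique: "((\<lambda>t. ev f (p(k:=t))) has_field_derivative d) (at (p k)) \<Longrightarrow> ev (pd k f) p = d"
  using DERIV_unique[OF pd_deriv] .

lemma pd_cst [simp]: "ev (pd k (cst c)) p = 0"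
  by (rule pd_unique) simp

lemma pd_one [simp]: "ev (pd k 1) p = 0"
  using pd_cst[of k 1] by (simp del: pd_cst)

lemma pd_zero [simp]: "ev (pd k 0) p = 0"
  using pd_cst[of k 0] by (simp del: pd_cst)

lemma pd_var [simp]: "ev (pd k (mpoly_var j)) p = (if j = k then 1 else 0)"
  by (rule pd_unique) (cases "j = k", simp_all)

lemma pd_add [simp]: "ev (pd k (f + g)) p = ev (pd k f) p + ev (pd k g) p"
  using DERIV_add[OF pd_deriv[of f p k] pd_deriv[of g p k]] by (intro pd_unique) simp

lemma pd_uminus [simp]: "ev (pd k (- f)) p = - ev (pd k f) p"
  using DERIV_minus[OF pd_deriv[of f p k]] by (intro pd_unique) simp

lemma pd_diff [simp]: "ev (pd k (f - g)) p = ev (pd k f) p - ev (pd k g) p"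
  using DERIV_diff[OF pd_deriv[of f p k] pd_deriv[of g p k]] by (intro pd_unique) simp

lemma pd_mult [simp]: "ev (pd k (f * g)) p = ev (pd k f) p * ev g p + ev f p * ev (pd k g) p"
  using DERIV_mult[OF pd_deriv[of f p k] pd_deriv[of g p k]]
  by (intro pd_unique) (simp add: algebra_simps)

lemma pd_sum [simp]: "ev (pd k (\<Sum>i\<in>A. f i)) p = (\<Sum>i\<in>A. ev (pd k (f i)) p)"
  by (induction A rule: infinite_finite_induct) simp_all

lemma pd_square [simp]: "ev (pd k (f^2)) p = 2 * ev f p * ev (pd k f) p"
  by (simp add: power2_eq_square algebra_simps)

subsection \<open>The quadric\<close>

text \<open>The quadratic form is \<open>\<Sum>k\<le>n. sg m k * x\<^sub>k\<^sup>2\<close>, with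
  polarization \<open>bil\<close>.\<close>

definition sg :: "nat \<Rightarrow> nat \<Rightarrow> 'a::comm_ring_1" where "sg m k = (if k \<le> m then 1 else - 1)"

definition bil :: "nat \<Rightarrow> nat \<Rightarrow> (nat \<Rightarrow> 'a::comm_ring_1) \<Rightarrow> (nat \<Rightarrow> 'a) \<Rightarrow> 'a"
  where "bil m n p r = (\<Sum>k\<le>n. sg m k * p k * r k)"

definition quadric :: "nat \<Rightarrow> nat \<Rightarrow> (nat \<Rightarrow> complex) set"
  where "quadric m n = {p. (\<forall>k>n. p k = 0) \<and> bil m n p p = 1}"

lemma quadric_poly_eq:
  assumes "m < n"
  shows "quadric_poly m n = (\<Sum>k\<le>n. cst (sg m k) * mpoly_var k ^ 2) - 1"
proof -
  have split: "{..n} = {0..m} \<union> {m+1..n}" "{0..m} \<inter> {m+1..n} = {}" using assms by auto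
  have "cst (-1) = (-1::pp)" using single_uminus[of 0 "1::real"] by simp
  then show ?thesis
    unfolding quadric_poly_def split(1)
    by (subst sum.union_disjoint) (simp_all add: sg_def sum_negf)
qed

lemma of_real_sg: "complex_of_real (sg m k) = sg m k"
  by (simp add: sg_def)

lemma ev_quadric_poly: "m < n \<Longrightarrow> ev (quadric_poly m n) p = bil m n p p - 1"
  by (simp add: quadric_poly_eq bil_def power2_eq_square mult.assoc of_real_sg)

lemma pd_quadric_poly: "m < n \<Longrightarrow> k \<le> n \<Longrightarrow> ev (pd k (quadric_poly m n)) p = 2 * sg m k * p k"
  by (simp add: quadric_poly_eq of_real_sg if_distrib[of "\<lambda>x. _ * x"] sum.delta' mult_ac cong: if_cong)

subsection \<open>The coordinate ring as a quotient of all polynomials\<close>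

text \<open>Setting the variables beyond \<open>n\<close> to zero maps all polynomials onto those
  in \<open>x\<^sub>0, \<dots>, x\<^sub>n\<close>. In this way the coordinate ring becomes a
  quotient of the whole polynomial type.\<close>

definition restr :: "nat \<Rightarrow> pp \<Rightarrow> pp"
  where "restr n = mono_ext (Poly_Mapping.single 0) (\<lambda>a. if Poly_Mapping.keys a \<subseteq> {0..n} then Poly_Mapping.single a 1 else 0)"

lemma keys_add_nat: "Poly_Mapping.keys (a + b) = Poly_Mapping.keys a \<union> Poly_Mapping.keys b"
  for a b :: "nat \<Rightarrow>\<^sub>0 nat"
  by (auto simp: in_keys_iff lookup_add)

lemma mono_ext_hom_restr: "mono_ext_hom (Poly_Mapping.single 0)
    (\<lambda>a. if Poly_Mapping.keys a \<subseteq> {0..n} then Poly_Mapping.single a (1::real) else 0)"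
  by unfold_locales (auto simp: keys_add_nat mult_single single_add)

interpretation restr: comm_ring_hom "restr n" for n
  unfolding restr_def by (rule mono_ext_hom.comm_ring_hom[OF mono_ext_hom_restr])

lemma restr_single: "restr n (Poly_Mapping.single a c) = (if Poly_Mapping.keys a \<subseteq> {0..n} then Poly_Mapping.single a c else 0)"
  by (simp add: restr_def mono_ext_hom.mono_ext_single[OF mono_ext_hom_restr] mult_single)

lemma restr_var: "restr n (mpoly_var k) = (if k \<le> n then mpoly_var k else 0)"
  by (simp add: mpoly_var_def restr_single)

lemma restr_cst: "restr n (cst c) = cst c"
  by (simp add: restr_single)

lemma restr_in_carrier: "restr n f \<in> carrier (mpoly_ring n)"
proof -
  interpret P: cring "mpoly_ring n :: pp ring" by (rule cring_mpoly_ring)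
  show ?thesis
  proof (induction f rule: single_sum_induct)
    case 1 show ?case by (simp add: mpoly_ring_def)
  next
    case (2 a c) show ?case by (auto simp: mpoly_ring_def restr_single)
  next
    case (3 f g) then show ?case using P.a_closed[OF 3] by (simp add: restr.hom_add mpoly_ring_def)
  qed
qed

lemma restr_id:
  assumes "f \<in> carrier (mpoly_ring n)" shows "restr n f = f"
proof -
  have "restr n f = (\<Sum>a\<in>Poly_Mapping.keys f. restr n (Poly_Mapping.single a (Poly_Mapping.lookup f a)))"
    by (subst poly_mapping_as_sum[of f]) (rule restr.hom_sum)
  also have "\<dots> = (\<Sum>a\<in>Poly_Mapping.keys f. Poly_Mapping.single a (Poly_Mapping.lookup f a))"
    by (rule sum.cong) (use assms in \<open>auto simp: restr_single mpoly_ring_def\<close>)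
  finally show ?thesis by (simp add: poly_mapping_as_sum[symmetric])
qed

lemma ev_restr:
  assumes "\<And>k. k > n \<Longrightarrow> p k = 0"
  shows "ev (restr n f) p = ev f p"
  by (induction f rule: pp_induct) (auto simp: restr_cst restr_var restr.hom_add restr.hom_mult assms)

lemma pd_restr:
  assumes "\<And>k. k > n \<Longrightarrow> p k = 0" "j \<le> n"
  shows "ev (pd j (restr n f)) p = ev (pd j f) p"
  by (induction f rule: pp_induct) (use assms in \<open>auto simp: restr_cst restr_var restr.hom_add restr.hom_mult ev_restr\<close>)

definition proj :: "nat \<Rightarrow> nat \<Rightarrow> pp \<Rightarrow> pp set"
  where "proj m n f = (Idl\<^bsub>mpoly_ring n\<^esub> {quadric_poly m n}) +>\<^bsub>mpoly_ring n\<^esub> restr n f"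

section \<open>Ideals of a ring presented as a quotient\<close>

definition idl :: "'p::comm_ring_1 set \<Rightarrow> bool"
  where "idl Z \<longleftrightarrow> 0 \<in> Z \<and> (\<forall>a\<in>Z. \<forall>b\<in>Z. a + b \<in> Z) \<and> (\<forall>a\<in>Z. \<forall>r. r * a \<in> Z)"

definition prm :: "'p::comm_ring_1 set \<Rightarrow> bool"
  where "prm Q \<longleftrightarrow> idl Q \<and> 1 \<notin> Q \<and> (\<forall>a b. a * b \<in> Q \<longrightarrow> a \<in> Q \<or> b \<in> Q)"

text \<open>Maximality is stated as invertibility modulo \<open>M\<close>, the form in which it is
  used; \<open>mxmI\<close> and \<open>mxm_maximal\<close> connect it with the order-theoretic
  notion.\<close>

definition mxm :: "'p::comm_ring_1 set \<Rightarrow> bool"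
  where "mxm M \<longleftrightarrow> idl M \<and> 1 \<notin> M \<and> (\<forall>a. a \<notin> M \<longrightarrow> (\<exists>r. 1 - r * a \<in> M))"

lemma idl_zero: "idl Z \<Longrightarrow> 0 \<in> Z" by (simp add: idl_def)
lemma idl_add: "idl Z \<Longrightarrow> a \<in> Z \<Longrightarrow> b \<in> Z \<Longrightarrow> a + b \<in> Z" by (simp add: idl_def)
lemma idl_mult: "idl Z \<Longrightarrow> a \<in> Z \<Longrightarrow> r * a \<in> Z" by (simp add: idl_def)
lemma idl_mult2: "idl Z \<Longrightarrow> a \<in> Z \<Longrightarrow> a * r \<in> Z" by (simp add: idl_def mult.commute)
lemma idl_minus: "idl Z \<Longrightarrow> a \<in> Z \<Longrightarrow> - a \<in> Z" using idl_mult[of Z a "-1"] by simp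
lemma idl_diff: "idl Z \<Longrightarrow> a \<in> Z \<Longrightarrow> b \<in> Z \<Longrightarrow> a - b \<in> Z"
  using idl_add[of Z a "- b"] idl_minus[of Z b] by simp
lemma idl_sum: "idl Z \<Longrightarrow> (\<And>i. i \<in> A \<Longrightarrow> f i \<in> Z) \<Longrightarrow> sum f A \<in> Z"
  by (induction A rule: infinite_finite_induct) (auto simp: idl_zero idl_add)
lemma idl_diff_sym: "idl Z \<Longrightarrow> a - b \<in> Z \<Longrightarrow> b - a \<in> Z"
  using idl_minus[of Z "a - b"] by simp
lemma idl_eqI: "idl Z \<Longrightarrow> a - b \<in> Z \<Longrightarrow> b \<in> Z \<Longrightarrow> a \<in> Z"
  using idl_add[of Z "a - b" b] by simp
lemma idl_unit: "idl Z \<Longrightarrow> 1 \<in> Z \<Longrightarrow> Z = UNIV"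
  using idl_mult[of Z 1] by auto

lemma prm_idl: "prm Q \<Longrightarrow> idl Q" by (simp add: prm_def)
lemma mxm_idl: "mxm Q \<Longrightarrow> idl Q" by (simp add: mxm_def)

lemma mxm_prm:
  assumes "mxm M" shows "prm M"
  unfolding prm_def
proof (intro conjI allI impI)
  show i: "idl M" "1 \<notin> M" using assms by (auto simp: mxm_def)
  fix a b assume ab: "a * b \<in> M"
  show "a \<in> M \<or> b \<in> M"
  proof (cases "a \<in> M")
    case False
    then obtain r where r: "1 - r * a \<in> M" using assms by (auto simp: mxm_def)
    have "b = (1 - r * a) * b + r * (a * b)" by (simp add: algebra_simps)
    then show ?thesis using idl_add[OF i(1) idl_mult2[OF i(1) r] idl_mult[OF i(1) ab]] by metis
  qed simp
qed

lemma mxm_maximal: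
  assumes "mxm M" "idl Q" "M \<subseteq> Q" "1 \<notin> Q" shows "Q = M"
proof (rule ccontr)
  assume "Q \<noteq> M"
  then obtain a where a: "a \<in> Q" "a \<notin> M" using assms by blast
  then obtain r where r: "1 - r * a \<in> M" using assms by (auto simp: mxm_def)
  have "(1 - r * a) + r * a \<in> Q" by (rule idl_add[OF assms(2)]) (use r a assms in \<open>auto intro: idl_mult\<close>)
  then show False using assms(4) by simp
qed

definition isum :: "'p::comm_ring_1 set \<Rightarrow> 'p set \<Rightarrow> 'p set"
  where "isum A B = {a + b | a b. a \<in> A \<and> b \<in> B}"

lemma isum_idl: assumes "idl A" "idl B" shows "idl (isum A B)"
  unfolding idl_def
proof (intro conjI ballI allI)
  show "0 \<in> isum A B" unfolding isum_def using idl_zero assms by force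
next
  fix x y assume "x \<in> isum A B" "y \<in> isum A B"
  then obtain a b c d where *: "x = a + b" "y = c + d" "a \<in> A" "b \<in> B" "c \<in> A" "d \<in> B"
    unfolding isum_def by blast
  have "x + y = (a + c) + (b + d)" by (simp add: * algebra_simps)
  then show "x + y \<in> isum A B" unfolding isum_def using * assms idl_add by blast
next
  fix x r assume "x \<in> isum A B"
  then obtain a b where *: "x = a + b" "a \<in> A" "b \<in> B" unfolding isum_def by blast
  have "r * x = r * a + r * b" by (simp add: * algebra_simps)
  then show "r * x \<in> isum A B" unfolding isum_def using * assms idl_mult by blast
qed

lemma isum_l: "idl B \<Longrightarrow> A \<subseteq> isum A B" unfolding isum_def using idl_zero by force
lemma isum_r: "idl A \<Longrightarrow> B \<subseteq> isum A B" unfolding isum_def using idl_zero by force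

definition princ :: "'p::comm_ring_1 \<Rightarrow> 'p set" where "princ a = range (\<lambda>r. r * a)"

lemma princ_idl: "idl (princ a)"
  unfolding idl_def princ_def
proof (intro conjI ballI allI)
  show "0 \<in> range (\<lambda>r. r * a)" by (rule range_eqI[of _ _ 0]) simp
  fix x y assume "x \<in> range (\<lambda>r. r * a)" "y \<in> range (\<lambda>r. r * a)"
  then show "x + y \<in> range (\<lambda>r. r * a)" by (auto simp: distrib_right[symmetric])
next
  fix x s assume "x \<in> range (\<lambda>r. r * a)"
  then show "s * x \<in> range (\<lambda>r. r * a)" by (auto simp: mult.assoc[symmetric])
qed

lemma mxmI:
  assumes "idl M" "1 \<notin> M" "\<And>Q. idl Q \<Longrightarrow> M \<subseteq> Q \<Longrightarrow> 1 \<notin> Q \<Longrightarrow> Q = M"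
  shows "mxm M"
  unfolding mxm_def
proof (intro conjI allI impI)
  fix a assume a: "a \<notin> M"
  have "a \<in> isum M (princ a)"
    using isum_r[OF assms(1), of "princ a"] by (force simp: princ_def intro: range_eqI[of _ _ 1])
  then have "isum M (princ a) \<noteq> M" using a by blast
  then have "1 \<in> isum M (princ a)"
    using assms(3)[OF isum_idl[OF assms(1) princ_idl] isum_l[OF princ_idl]] by blast
  then obtain b r where "1 = b + r * a" "b \<in> M" unfolding isum_def princ_def by blast
  then have "1 - r * a \<in> M" by (metis add_diff_cancel_right')
  then show "\<exists>r. 1 - r * a \<in> M" by blast
qed (use assms in auto)

lemma ex_mxm:
  assumes "idl Z" "1 \<notin> Z"
  shows "\<exists>M. mxm M \<and> Z \<subseteq> M"
proof -
  let ?A = "{Q. idl Q \<and> 1 \<notin> Q \<and> Z \<subseteq> Q}"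
  have "\<exists>N\<in>?A. (\<forall>K\<in>?A. (N \<subseteq> K \<longrightarrow> K = N))"
  proof (rule subset_Zorn)
    fix C assume C: "subset.chain ?A C"
    show "\<exists>U\<in>?A. \<forall>K\<in>C. K \<subseteq> U"
    proof (cases "C = {}")
      case True then show ?thesis using assms by auto
    next
      case False
      have CA: "C \<subseteq> ?A" and lin: "\<And>P Q. P \<in> C \<Longrightarrow> Q \<in> C \<Longrightarrow> P \<subseteq> Q \<or> Q \<subseteq> P"
        using C by (auto simp: subset_chain_def)
      have "idl (\<Union>C)" unfolding idl_def
      proof (intro conjI ballI allI)
        obtain T where "T \<in> C" using False by blast
        then show "0 \<in> \<Union>C" using CA idl_zero[of T] by auto
        fix a b assume "a \<in> \<Union>C" "b \<in> \<Union>C"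
        then obtain P Q where PQ: "P \<in> C" "Q \<in> C" "a \<in> P" "b \<in> Q" by blast
        then have "\<exists>T\<in>C. a \<in> T \<and> b \<in> T" using lin[of P Q] by blast
        then obtain T where T: "T \<in> C" "a \<in> T" "b \<in> T" by blast
        then have "a + b \<in> T" using CA idl_add[of T a b] by auto
        then show "a + b \<in> \<Union>C" using T by blast
      next
        fix a r assume "a \<in> \<Union>C"
        then obtain T where T: "T \<in> C" "a \<in> T" by blast
        then have "r * a \<in> T" using CA idl_mult[of T a r] by auto
        then show "r * a \<in> \<Union>C" using T by blast
      qed
      moreover have "1 \<notin> \<Union>C" "Z \<subseteq> \<Union>C" using False CA by auto
      ultimately have "\<Union>C \<in> ?A" by simp
      then show ?thesis by blast
    qed
  qed
  then obtain M where M: "idl M" "1 \<notin> M" "Z \<subseteq> M" "\<And>K. idl K \<Longrightarrow> 1 \<notin> K \<Longrightarrow> Z \<subseteq> K \<Longrightarrow> M \<subseteq> K \<Longrightarrow> K = M" by auto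
  have "mxm M" by (rule mxmI[OF M(1,2)]) (use M in auto)
  then show ?thesis using M by blast
qed

locale presented = cring R for R :: "('a, 'b) ring_scheme" (structure) +
  fixes \<pi> :: "'p::comm_ring_1 \<Rightarrow> 'a"
  assumes pi_add: "\<pi> (x + y) = \<pi> x \<oplus> \<pi> y" and pi_mult: "\<pi> (x * y) = \<pi> x \<otimes> \<pi> y"
    and pi_one: "\<pi> 1 = \<one>" and pi_range: "range \<pi> = carrier R"
begin

definition pre :: "'a set \<Rightarrow> 'p set" where "pre J = {x. \<pi> x \<in> J}"

lemma mem_pre [simp]: "x \<in> pre J \<longleftrightarrow> \<pi> x \<in> J" by (simp add: pre_def)

abbreviation "ker \<equiv> pre {\<zero>}"

lemma pi_closed [simp, intro]: "\<pi> x \<in> carrier R" using pi_range by blast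

lemma pi_zero [simp]: "\<pi> 0 = \<zero>"
proof -
  have "\<pi> 0 \<oplus> \<pi> 0 = \<pi> 0" using pi_add[of 0 0] by simp
  then show ?thesis using pi_closed local.add.l_cancel_one' by metis
qed

lemma pi_minus: "\<pi> (- x) = \<ominus> \<pi> x"
proof -
  have "\<pi> (- x) \<oplus> \<pi> x = \<zero>" using pi_add[of "-x" x] by simp
  then show ?thesis by (simp add: minus_equality)
qed

lemma pi_diff: "\<pi> (x - y) = \<pi> x \<ominus> \<pi> y"
  using pi_add[of x "- y"] by (simp add: pi_minus minus_eq)

lemma pi_sum: "finite A \<Longrightarrow> \<pi> (sum f A) = finsum R (\<lambda>i. \<pi> (f i)) A"
  by (induction A rule: finite_induct) (auto simp: pi_add)

lemma pi_prod: "finite A \<Longrightarrow> \<pi> (prod f A) = finprod R (\<lambda>i. \<pi> (f i)) A"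
  by (induction A rule: finite_induct) (auto simp: pi_mult pi_one)

lemma pi_power: "\<pi> (x ^ k) = \<pi> x [^] (k::nat)"
  by (induction k) (auto simp: pi_one pi_mult m_comm)

lemma ex_lift: "a \<in> carrier R \<Longrightarrow> \<exists>x. a = \<pi> x" using pi_range by auto

lemma image_pre: "J \<subseteq> carrier R \<Longrightarrow> \<pi> ` pre J = J" using ex_lift unfolding pre_def by blast

lemma pre_mono_iff: "J \<subseteq> carrier R \<Longrightarrow> pre J \<subseteq> pre K \<longleftrightarrow> J \<subseteq> K"
  using ex_lift unfolding pre_def by blast

lemma pre_inj: "J \<subseteq> carrier R \<Longrightarrow> K \<subseteq> carrier R \<Longrightarrow> pre J = pre K \<Longrightarrow> J = K"
  using image_pre by metis

lemma ideal_carrier: "ideal J R \<Longrightarrow> J \<subseteq> carrier R" by (simp add: ideal.Icarr subsetI)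

lemma idl_pre: assumes "ideal J R" shows "idl (pre J)"
proof -
  interpret ideal J R by fact
  show ?thesis unfolding idl_def by (auto simp: pi_add pi_mult I_l_closed)
qed

lemma ker_sub: "ideal J R \<Longrightarrow> ker \<subseteq> pre J"
  by (auto simp: additive_subgroup.zero_closed ideal.axioms(1))

lemma ideal_imageI: assumes "idl Q" shows "ideal (\<pi> ` Q) R"
proof (rule idealI)
  show "ring R" by (rule ring_axioms)
  show "subgroup (\<pi> ` Q) (add_monoid R)"
  proof (rule add.subgroupI)
    show "\<pi> ` Q \<subseteq> carrier R" by auto
    show "\<pi> ` Q \<noteq> {}" using idl_zero[OF assms] by auto
    show "\<ominus> a \<in> \<pi> ` Q" if "a \<in> \<pi> ` Q" for a
      using that idl_minus[OF assms] by (auto simp: pi_minus[symmetric])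
    show "a \<oplus> b \<in> \<pi> ` Q" if "a \<in> \<pi> ` Q" "b \<in> \<pi> ` Q" for a b
      using that idl_add[OF assms] by (auto simp: pi_add[symmetric])
  qed
  have l: "x \<otimes> a \<in> \<pi> ` Q" if a: "a \<in> \<pi> ` Q" and x: "x \<in> carrier R" for a x
    using a idl_mult[OF assms] ex_lift[OF x] by (auto simp: pi_mult[symmetric])
  show "x \<otimes> a \<in> \<pi> ` Q" if "a \<in> \<pi> ` Q" "x \<in> carrier R" for a x
    by (rule l[OF that])
  show "a \<otimes> x \<in> \<pi> ` Q" if a: "a \<in> \<pi> ` Q" and x: "x \<in> carrier R" for a x
  proof -
    have "a \<in> carrier R" using a by auto
    then show ?thesis using l[OF a x] m_comm[OF x] by simp
  qed
qed

lemma pre_image: assumes "idl Q" "ker \<subseteq> Q" shows "pre (\<pi> ` Q) = Q"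
proof -
  have "x \<in> Q" if "\<pi> x = \<pi> y" "y \<in> Q" for x y
  proof -
    have "x - y \<in> ker" using that by (simp add: pi_diff)
    then show ?thesis using idl_eqI[OF assms(1) _ that(2)] assms by blast
  qed
  then show ?thesis by auto
qed

lemma prm_pre: assumes "primeideal P R" shows "prm (pre P)"
proof -
  interpret primeideal P R by fact
  show ?thesis unfolding prm_def
  proof (intro conjI allI impI)
    show "idl (pre P)" by (rule idl_pre[OF is_ideal])
    show "1 \<notin> pre P" using I_notcarr one_imp_carrier by (auto simp: pi_one)
    fix a b assume "a * b \<in> pre P"
    then show "a \<in> pre P \<or> b \<in> pre P" using I_prime[OF pi_closed pi_closed] by (simp add: pi_mult)
  qed
qed

lemma primeideal_image: assumes "prm Q" "ker \<subseteq> Q" shows "primeideal (\<pi> ` Q) R"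
proof (rule primeidealI)
  note pq = pre_image[OF prm_idl[OF assms(1)] assms(2)]
  show "ideal (\<pi> ` Q) R" by (rule ideal_imageI[OF prm_idl[OF assms(1)]])
  show "cring R" by (rule cring_axioms)
  have "\<pi> 1 \<notin> \<pi> ` Q" using assms pq unfolding prm_def by (metis mem_pre)
  then show "carrier R \<noteq> \<pi> ` Q" using pi_closed[of 1] by metis
  show "a \<in> \<pi> ` Q \<or> b \<in> \<pi> ` Q" if ab: "a \<in> carrier R" "b \<in> carrier R" "a \<otimes> b \<in> \<pi> ` Q" for a b
  proof -
    obtain x y where xy: "a = \<pi> x" "b = \<pi> y" using ex_lift[OF ab(1)] ex_lift[OF ab(2)] by blast
    then have "x * y \<in> pre (\<pi> ` Q)" using ab(3) by (simp add: pi_mult)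
    then have "x * y \<in> Q" by (simp add: pq del: mem_pre)
    then have "x \<in> Q \<or> y \<in> Q" using assms(1) unfolding prm_def by blast
    then show ?thesis using xy by blast
  qed
qed

lemma mxm_pre: assumes "maximalideal M R" shows "mxm (pre M)"
proof (rule mxmI)
  interpret maximalideal M R by fact
  show "idl (pre M)" by (rule idl_pre[OF is_ideal])
  show "1 \<notin> pre M" using I_notcarr one_imp_carrier by (auto simp: pi_one)
  fix Q assume Q: "idl Q" "pre M \<subseteq> Q" "1 \<notin> Q"
  then have kQ: "ker \<subseteq> Q" using ker_sub[OF is_ideal] by blast
  have "\<pi> ` Q = M \<or> \<pi> ` Q = carrier R"
  proof (rule I_maximal)
    show "ideal (\<pi> ` Q) R" by (rule ideal_imageI[OF Q(1)])
    show "M \<subseteq> \<pi> ` Q" using Q(2) image_pre[OF ideal_carrier[OF is_ideal]] by blast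
  qed auto
  moreover have "\<pi> ` Q \<noteq> carrier R"
    using Q(3) pre_image[OF Q(1) kQ] pi_closed[of 1] by (metis mem_pre)
  ultimately show "Q = pre M" using pre_image[OF Q(1) kQ] by auto
qed

lemma maximalideal_image: assumes "mxm Q" "ker \<subseteq> Q" shows "maximalideal (\<pi> ` Q) R"
proof (rule maximalidealI)
  note pq = pre_image[OF mxm_idl[OF assms(1)] assms(2)]
  show "ideal (\<pi> ` Q) R" by (rule ideal_imageI[OF mxm_idl[OF assms(1)]])
  show "carrier R \<noteq> \<pi> ` Q" using assms(1) pq pi_closed[of 1] unfolding mxm_def by (metis mem_pre)
  fix J assume J: "ideal J R" "\<pi> ` Q \<subseteq> J" "J \<subseteq> carrier R"
  show "J = \<pi> ` Q \<or> J = carrier R"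
  proof (cases "1 \<in> pre J")
    case True
    then have "pre J = UNIV" using idl_unit[OF idl_pre[OF J(1)]] by blast
    then show ?thesis using image_pre[OF J(3)] pi_range by auto
  next
    case False
    have "Q \<subseteq> pre J" using J(2) by auto
    then have "pre J = Q" using mxm_maximal[OF assms(1) idl_pre[OF J(1)]] False by blast
    then show ?thesis using image_pre[OF J(3)] by auto
  qed
qed

lemma coset_eq_iff:
  assumes "ideal J R" shows "J +> \<pi> x = J +> \<pi> y \<longleftrightarrow> x - y \<in> pre J"
  using quotient_eq_iff_same_a_r_cos[OF assms, of "\<pi> x" "\<pi> y"] by (simp add: pi_diff)

lemma presented_Quot: assumes "ideal J R" shows "presented (R Quot J) (\<lambda>x. J +> \<pi> x)"
proof -
  interpret J: ideal J R by fact
  interpret Q: cring "R Quot J" by (rule J.quotient_is_cring[OF cring_axioms])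
  note h = J.rcos_ring_hom
  show ?thesis
  proof
    show "J +> \<pi> (x + y) = (J +> \<pi> x) \<oplus>\<^bsub>R Quot J\<^esub> (J +> \<pi> y)" for x y
      using ring_hom_add[OF h] by (simp add: pi_add)
    show "J +> \<pi> (x * y) = (J +> \<pi> x) \<otimes>\<^bsub>R Quot J\<^esub> (J +> \<pi> y)" for x y
      using ring_hom_mult[OF h] by (simp add: pi_mult)
    show "J +> \<pi> 1 = \<one>\<^bsub>R Quot J\<^esub>" using ring_hom_one[OF h] by (simp add: pi_one)
    have "carrier (R Quot J) = (\<lambda>a. J +> a) ` carrier R"
      unfolding FactRing_def A_RCOSETS_def' by auto
    then show "range (\<lambda>x. J +> \<pi> x) = carrier (R Quot J)"
      by (simp add: pi_range[symmetric] image_image)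
  qed
qed

lemma ker_Quot: assumes "ideal J R" shows "presented.pre (\<lambda>x. J +> \<pi> x) {\<zero>\<^bsub>R Quot J\<^esub>} = pre J"
proof -
  interpret Q: presented "R Quot J" "\<lambda>x. J +> \<pi> x" by (rule presented_Quot[OF assms])
  have "J +> \<pi> x = \<zero>\<^bsub>R Quot J\<^esub> \<longleftrightarrow> \<pi> x \<in> J" for x
    using coset_eq_iff[OF assms, of x 0] Q.pi_zero by simp
  then show ?thesis by (auto simp: pre_def Q.pre_def)
qed

end

subsection \<open>The coordinate ring of the quadric\<close>

lemma presented_restr: "presented (mpoly_ring n :: pp ring) (restr n)"
proof -
  interpret P: cring "mpoly_ring n :: pp ring" by (rule cring_mpoly_ring)
  show ?thesis
  proof
    show "range (restr n) = carrier (mpoly_ring n :: pp ring)"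
      using restr_in_carrier restr_id[THEN sym] by blast
  qed (simp_all add: mpoly_ring_def restr.hom_add restr.hom_mult restr.hom_one)
qed

lemma quadric_poly_carrier:
  assumes "m < n" shows "quadric_poly m n \<in> carrier (mpoly_ring n)"
proof -
  have "restr n (quadric_poly m n) = quadric_poly m n"
    by (simp add: quadric_poly_eq[OF assms] restr.hom_minus restr.hom_sum restr.hom_mult restr.hom_power restr_cst restr_var)
  then show ?thesis by (metis restr_in_carrier)
qed

lemma ideal_quadric:
  assumes "m < n" shows "ideal (Idl\<^bsub>mpoly_ring n\<^esub> {quadric_poly m n}) (mpoly_ring n)"
proof -
  interpret P: cring "mpoly_ring n :: pp ring" by (rule cring_mpoly_ring)
  show ?thesis using quadric_poly_carrier[OF assms] by (intro P.genideal_ideal) simp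
qed

lemma presented_proj: assumes "m < n" shows "presented (quadric_ring m n) (proj m n)"
  using presented.presented_Quot[OF presented_restr ideal_quadric[OF assms]]
  by (simp add: quadric_ring_def proj_def[abs_def])

lemma proj_zero_iff:
  assumes "m < n"
  shows "proj m n f = \<zero>\<^bsub>quadric_ring m n\<^esub> \<longleftrightarrow> (\<exists>g. restr n f = g * quadric_poly m n)"
proof -
  let ?P = "mpoly_ring n :: pp ring"
  let ?q = "quadric_poly m n"
  interpret P: presented ?P "restr n" by (rule presented_restr)
  note I = ideal_quadric[OF assms] and q = quadric_poly_carrier[OF assms]
  have "proj m n f = \<zero>\<^bsub>quadric_ring m n\<^esub> \<longleftrightarrow> restr n f \<in> Idl\<^bsub>?P\<^esub> {?q}"
    using P.ker_Quot[OF I] unfolding proj_def quadric_ring_def P.pre_def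
    by (auto simp: presented.pre_def[OF P.presented_Quot[OF I]])
  also have "Idl\<^bsub>?P\<^esub> {?q} = PIdl\<^bsub>?P\<^esub> ?q" using P.cgenideal_eq_genideal[OF q] by simp
  also have "restr n f \<in> PIdl\<^bsub>?P\<^esub> ?q \<longleftrightarrow> (\<exists>g. restr n f = g * ?q)"
  proof
    assume "restr n f \<in> PIdl\<^bsub>?P\<^esub> ?q"
    then show "\<exists>g. restr n f = g * ?q" by (auto simp: cgenideal_def mpoly_ring_def)
  next
    assume "\<exists>g. restr n f = g * ?q"
    then obtain g where "restr n f = g * ?q" by blast
    then have "restr n (restr n f) = restr n g * restr n ?q" by (simp add: restr.hom_mult)
    then have "restr n f = restr n g * ?q" by (simp add: restr_id[OF restr_in_carrier] restr_id[OF q])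
    then show "restr n f \<in> PIdl\<^bsub>?P\<^esub> ?q" using restr_in_carrier[of n g]
      by (auto simp: cgenideal_def mpoly_ring_def)
  qed
  finally show ?thesis .
qed

text \<open>This is the kernel of \<open>proj\<close> (\<open>ker_proj\<close>): applying
  \<open>restr\<close> to the equation brings the cofactor \<open>g\<close> into the variables up
  to \<open>n\<close>.\<close>

definition Zq :: "nat \<Rightarrow> nat \<Rightarrow> pp set"
  where "Zq m n = {f. \<exists>g. restr n f = g * quadric_poly m n}"

lemma ker_proj: "m < n \<Longrightarrow> presented.pre (proj m n) {\<zero>\<^bsub>quadric_ring m n\<^esub>} = Zq m n"
  using proj_zero_iff presented.pre_def[OF presented_proj] by (auto simp: Zq_def)

lemma Zq_idl: "m < n \<Longrightarrow> idl (Zq m n)"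
  unfolding idl_def Zq_def
  by (auto simp: restr.hom_add restr.hom_mult distrib_right[symmetric] mult.assoc[symmetric] intro: exI[of _ 0])

lemma Zq_quadric: "m < n \<Longrightarrow> quadric_poly m n \<in> Zq m n"
  unfolding Zq_def by (auto simp: restr_id[OF quadric_poly_carrier] intro: exI[of _ 1])

lemma Zq_var: "k > n \<Longrightarrow> mpoly_var k \<in> Zq m n"
  unfolding Zq_def by (auto simp: restr_var intro: exI[of _ 0])

lemma Zq_ev: "m < n \<Longrightarrow> f \<in> Zq m n \<Longrightarrow> p \<in> quadric m n \<Longrightarrow> ev f p = 0"
  using ev_restr[of n p f] by (auto simp: Zq_def quadric_def ev_quadric_poly)

text \<open>The differential of a multiple \<open>g q\<close> at a point of the quadric is
  \<open>g(p)\<close> times the differential of \<open>q\<close>: tangent vectors of the quadric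
  annihilate the equations.\<close>

lemma Zq_pd:
  assumes "m < n" "f \<in> Zq m n" "p \<in> quadric m n"
  shows "\<exists>e. \<forall>k\<le>n. ev (pd k f) p = e * ev (pd k (quadric_poly m n)) p"
proof -
  obtain g where g: "restr n f = g * quadric_poly m n" using assms by (auto simp: Zq_def)
  have "ev (pd k f) p = ev g p * ev (pd k (quadric_poly m n)) p" if "k \<le> n" for k
    using pd_restr[of n p k f] assms that by (auto simp: g quadric_def ev_quadric_poly)
  then show ?thesis by blast
qed

section \<open>Counting monomials: algebraic dependence and dimension\<close>

text \<open>Elimination of one unknown by means of one equation.\<close>

lemma nontrivial_solution:
  fixes A :: "'i \<Rightarrow> 'j \<Rightarrow> 'f::field"
  assumes "finite I" "finite J" "card I < card J"
  shows "\<exists>c. (\<exists>j\<in>J. c j \<noteq> 0) \<and> (\<forall>i\<in>I. (\<Sum>j\<in>J. A i j * c j) = 0)"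
  using assms
proof (induction I arbitrary: J A rule: finite_induct)
  case empty
  then have "J \<noteq> {}" by auto
  then show ?case by (intro exI[of _ "\<lambda>_. 1"]) auto
next
  case (insert i0 I)
  show ?case
  proof (cases "\<forall>j\<in>J. A i0 j = 0")
    case True
    obtain c where "\<exists>j\<in>J. c j \<noteq> 0" "\<forall>i\<in>I. (\<Sum>j\<in>J. A i j * c j) = 0"
      using insert.IH[OF insert.prems(1), of A] insert.prems insert.hyps by auto
    then show ?thesis using True by (intro exI[of _ c]) auto
  next
    case False
    then obtain j0 where j0: "j0 \<in> J" "A i0 j0 \<noteq> 0" by blast
    let ?J = "J - {j0}"
    let ?A = "\<lambda>i j. A i j - A i j0 * A i0 j / A i0 j0"
    have "card I < card ?J" using insert.prems insert.hyps j0 by simp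
    then obtain c where c: "\<exists>j\<in>?J. c j \<noteq> 0" "\<forall>i\<in>I. (\<Sum>j\<in>?J. ?A i j * c j) = 0"
      using insert.IH[of ?J ?A] insert.prems by auto
    define S where "S = (\<Sum>j\<in>?J. A i0 j * c j)"
    define c' where "c' = c(j0 := - S / A i0 j0)"
    have sp: "(\<Sum>j\<in>J. A i j * c' j) = A i j0 * (- S / A i0 j0) + (\<Sum>j\<in>?J. A i j * c j)" for i
    proof -
      have "(\<Sum>j\<in>J. A i j * c' j) = A i j0 * c' j0 + (\<Sum>j\<in>?J. A i j * c' j)"
        by (rule sum.remove) (use insert.prems j0 in auto)
      also have "(\<Sum>j\<in>?J. A i j * c' j) = (\<Sum>j\<in>?J. A i j * c j)"
        by (rule sum.cong) (auto simp: c'_def)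
      finally show ?thesis by (simp add: c'_def)
    qed
    have "(\<Sum>j\<in>J. A i0 j * c' j) = 0" using j0 by (simp add: sp S_def)
    moreover have "(\<Sum>j\<in>J. A i j * c' j) = 0" if "i \<in> I" for i
    proof -
      have "0 = (\<Sum>j\<in>?J. ?A i j * c j)" using c that by simp
      also have "\<dots> = (\<Sum>j\<in>?J. A i j * c j - A i j0 / A i0 j0 * (A i0 j * c j))"
        by (rule sum.cong) (auto simp: field_simps)
      also have "\<dots> = (\<Sum>j\<in>?J. A i j * c j) - A i j0 / A i0 j0 * S"
        by (simp add: sum_subtractf S_def sum_distrib_left)
      finally show ?thesis unfolding sp by (simp add: field_simps)
    qed
    moreover have "\<exists>j\<in>J. c' j \<noteq> 0" using c(1) by (auto simp: c'_def)
    ultimately show ?thesis by blast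
  qed
qed

subsection \<open>Real spans modulo an ideal\<close>

lemma cst_hom: "comm_ring_hom cst"
  by unfold_locales (simp_all add: single_add mult_single)

interpretation cst: comm_ring_hom cst by (rule cst_hom)

definition mspan :: "pp set \<Rightarrow> pp set \<Rightarrow> pp set"
  where "mspan Z B = {f. \<exists>c. f - (\<Sum>b\<in>B. cst (c b) * b) \<in> Z}"

lemma mspanI: "f - (\<Sum>b\<in>B. cst (c b) * b) \<in> Z \<Longrightarrow> f \<in> mspan Z B"
  unfolding mspan_def by blast

lemma mspan_zero: "idl Z \<Longrightarrow> 0 \<in> mspan Z B"
  unfolding mspan_def by (auto intro!: exI[of _ "\<lambda>_. 0"] simp: idl_zero)

lemma mspan_add: assumes "idl Z" "f \<in> mspan Z B" "g \<in> mspan Z B" shows "f + g \<in> mspan Z B"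
proof -
  obtain c d where cd: "f - (\<Sum>b\<in>B. cst (c b) * b) \<in> Z" "g - (\<Sum>b\<in>B. cst (d b) * b) \<in> Z"
    using assms by (auto simp: mspan_def)
  have eq: "f + g - (\<Sum>b\<in>B. cst (c b + d b) * b) = (f - (\<Sum>b\<in>B. cst (c b) * b)) + (g - (\<Sum>b\<in>B. cst (d b) * b))"
    by (simp add: cst.hom_add distrib_right sum.distrib)
  show ?thesis by (rule mspanI[where c="\<lambda>b. c b + d b"]) (simp only: eq idl_add[OF assms(1) cd])
qed

lemma mspan_scale: assumes "idl Z" "f \<in> mspan Z B" shows "cst a * f \<in> mspan Z B"
proof -
  obtain c where c: "f - (\<Sum>b\<in>B. cst (c b) * b) \<in> Z" using assms by (auto simp: mspan_def)
  have eq: "cst a * f - (\<Sum>b\<in>B. cst (a * c b) * b) = cst a * (f - (\<Sum>b\<in>B. cst (c b) * b))"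
    by (simp add: cst.hom_mult right_diff_distrib sum_distrib_left mult.assoc)
  show ?thesis by (rule mspanI[where c="\<lambda>b. a * c b"]) (simp only: eq idl_mult[OF assms(1) c])
qed

lemma mspan_sum: "idl Z \<Longrightarrow> (\<And>i. i \<in> I \<Longrightarrow> f i \<in> mspan Z B) \<Longrightarrow> sum f I \<in> mspan Z B"
  by (induction I rule: infinite_finite_induct) (auto simp: mspan_zero mspan_add)

lemma mspan_base: assumes "idl Z" "finite B" "b \<in> B" shows "b \<in> mspan Z B"
proof -
  have "(\<Sum>b'\<in>B. cst (if b' = b then 1 else 0) * b') = (\<Sum>b'\<in>B. if b' = b then b' else 0)"
    by (rule sum.cong) auto
  then have eq: "b - (\<Sum>b'\<in>B. cst (if b' = b then 1 else 0) * b') = 0" using assms by simp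
  show ?thesis by (rule mspanI[where c="\<lambda>b'. if b' = b then 1 else 0"]) (simp only: eq idl_zero[OF assms(1)])
qed

lemma mspan_cong: assumes "idl Z" "f - g \<in> Z" "g \<in> mspan Z B" shows "f \<in> mspan Z B"
proof -
  obtain c where c: "g - (\<Sum>b\<in>B. cst (c b) * b) \<in> Z" using assms by (auto simp: mspan_def)
  have eq: "f - (\<Sum>b\<in>B. cst (c b) * b) = (f - g) + (g - (\<Sum>b\<in>B. cst (c b) * b))" by simp
  show ?thesis by (rule mspanI[where c=c]) (simp only: eq idl_add[OF assms(1,2) c])
qed

lemma mspan_trans:
  assumes "idl Z" "f \<in> mspan Z B" "\<And>b. b \<in> B \<Longrightarrow> h * b \<in> mspan Z D"
  shows "h * f \<in> mspan Z D"
proof -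
  obtain c where c: "f - (\<Sum>b\<in>B. cst (c b) * b) \<in> Z" using assms by (auto simp: mspan_def)
  have eq: "h * f - (\<Sum>b\<in>B. cst (c b) * (h * b)) = h * (f - (\<Sum>b\<in>B. cst (c b) * b))"
    by (simp add: right_diff_distrib sum_distrib_left mult_ac)
  have S: "(\<Sum>b\<in>B. cst (c b) * (h * b)) \<in> mspan Z D"
    by (intro mspan_sum mspan_scale assms)
  show ?thesis by (rule mspan_cong[OF assms(1) _ S]) (simp only: eq idl_mult[OF assms(1) c])
qed

lemma mspan_mult:
  assumes "idl Z" "f \<in> mspan Z B" "g \<in> mspan Z B'" "\<And>b b'. b \<in> B \<Longrightarrow> b' \<in> B' \<Longrightarrow> b * b' \<in> mspan Z D"
  shows "f * g \<in> mspan Z D"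
proof (rule mspan_trans[OF assms(1,3)])
  fix b' assume b': "b' \<in> B'"
  have "b' * f \<in> mspan Z D"
    by (rule mspan_trans[OF assms(1,2)]) (use assms(4) b' in \<open>simp add: mult.commute\<close>)
  then show "f * b' \<in> mspan Z D" by (simp add: mult.commute)
qed

lemma mspan_mono: assumes "idl Z" "finite D" "B \<subseteq> D" "f \<in> mspan Z B" shows "f \<in> mspan Z D"
  using mspan_trans[OF assms(1,4), of 1 D] mspan_base[OF assms(1,2)] assms(3) by auto

text \<open>Expanding the \<open>g j\<close> in the spanning set turns a relation among them into
  \<open>card B\<close> homogeneous equations in \<open>card J\<close> unknowns.\<close>

lemma mspan_dependent:
  assumes "idl Z" "finite B" "finite J" "card B < card J" "\<And>j. j \<in> J \<Longrightarrow> g j \<in> mspan Z B"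
  shows "\<exists>c. (\<exists>j\<in>J. c j \<noteq> 0) \<and> (\<Sum>j\<in>J. cst (c j) * g j) \<in> Z"
proof -
  have "\<forall>j\<in>J. \<exists>a. g j - (\<Sum>b\<in>B. cst (a b) * b) \<in> Z" using assms(5) by (auto simp: mspan_def)
  then obtain a where a: "\<And>j. j \<in> J \<Longrightarrow> g j - (\<Sum>b\<in>B. cst (a j b) * b) \<in> Z"
    unfolding bchoice_iff by blast
  obtain c where c: "\<exists>j\<in>J. c j \<noteq> 0" "\<And>b. b \<in> B \<Longrightarrow> (\<Sum>j\<in>J. a j b * c j) = 0"
    using nontrivial_solution[OF assms(2-4), of "\<lambda>b j. a j b"] by blast
  have "(\<Sum>j\<in>J. cst (c j) * (\<Sum>b\<in>B. cst (a j b) * b)) = (\<Sum>j\<in>J. \<Sum>b\<in>B. cst (a j b * c j) * b)"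
    by (simp add: sum_distrib_left cst.hom_mult mult_ac)
  also have "\<dots> = (\<Sum>b\<in>B. cst (\<Sum>j\<in>J. a j b * c j) * b)"
    by (subst sum.swap) (simp add: sum_distrib_right cst.hom_sum)
  also have "\<dots> = 0" using c(2) by simp
  finally have "(\<Sum>j\<in>J. cst (c j) * g j) = (\<Sum>j\<in>J. cst (c j) * (g j - (\<Sum>b\<in>B. cst (a j b) * b)))"
    by (simp add: right_diff_distrib sum_subtractf)
  also have "\<dots> \<in> Z" by (intro idl_sum idl_mult assms a)
  finally show ?thesis using c(1) by blast
qed

subsection \<open>Polynomial growth\<close>

text \<open>The exponents are bounded separately, so that there are at most \<open>(D +
  1)\<^sup>d\<close> of these monomials and products stay in the family with added bounds.\<close>

definition zmon :: "nat \<Rightarrow> (nat \<Rightarrow> pp) \<Rightarrow> nat \<Rightarrow> pp set"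
  where "zmon d z D = (\<lambda>e. \<Prod>i<d. z i ^ e i) ` ({..<d} \<rightarrow>\<^sub>E {..D})"

lemma finite_zmon: "finite (zmon d z D)" unfolding zmon_def by (intro finite_imageI finite_PiE) auto

text \<open>The quotient by \<open>Z\<close> behaves like a quadratic extension of a polynomial
  ring in \<open>d\<close> variables: it is spanned by the monomials in the \<open>z i\<close> and
  \<open>w\<close> times these. This single property controls dimension and residue
  fields.\<close>

locale growth =
  fixes Z :: "pp set" and d :: nat and z :: "nat \<Rightarrow> pp" and w :: pp
  assumes Z: "idl Z" and w2: "w^2 \<in> mspan Z (zmon d z 2)"
    and vars: "\<And>k. mpoly_var k \<in> mspan Z (zmon d z 1 \<union> (\<lambda>b. w * b) ` zmon d z 1)"
begin

definition Bs where "Bs D = zmon d z D \<union> (\<lambda>b. w * b) ` zmon d z D"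

definition V where "V D = mspan Z (Bs D)"

lemma finite_Bs: "finite (Bs D)" unfolding Bs_def using finite_zmon by simp

lemma card_zmon: "card (zmon d z D) \<le> (D + 1) ^ d"
  using card_image_le[of "{..<d} \<rightarrow>\<^sub>E {..D}"] unfolding zmon_def by (simp add: card_PiE finite_PiE)

lemma card_Bs: "card (Bs D) \<le> 2 * (D + 1) ^ d"
  unfolding Bs_def using card_zmon[of D] card_image_le[OF finite_zmon[of d z D], of "\<lambda>b. w * b"]
    card_Un_le[of "zmon d z D" "(\<lambda>b. w * b) ` zmon d z D"] by linarith

lemma zmon_mult:
  assumes "a \<in> zmon d z D" "b \<in> zmon d z E" shows "a * b \<in> zmon d z (D + E)"
proof -
  obtain e f where e: "a = (\<Prod>i<d. z i ^ e i)" "e \<in> {..<d} \<rightarrow>\<^sub>E {..D}"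
    and f: "b = (\<Prod>i<d. z i ^ f i)" "f \<in> {..<d} \<rightarrow>\<^sub>E {..E}"
    using assms unfolding zmon_def by blast
  have "a * b = (\<Prod>i<d. z i ^ ((\<lambda>i\<in>{..<d}. e i + f i) i))"
    by (simp add: e f power_add prod.distrib)
  moreover have "(\<lambda>i\<in>{..<d}. e i + f i) \<in> {..<d} \<rightarrow>\<^sub>E {..D + E}"
    using e(2) f(2) by (auto simp: PiE_iff add_mono)
  ultimately show ?thesis unfolding zmon_def by blast
qed

lemma zmon_mono: "D \<le> E \<Longrightarrow> zmon d z D \<subseteq> zmon d z E"
  unfolding zmon_def by (intro image_mono PiE_mono) auto

lemma V_mono: "D \<le> E \<Longrightarrow> f \<in> V D \<Longrightarrow> f \<in> V E"
  unfolding V_def by (rule mspan_mono[OF Z finite_Bs]) (use zmon_mono in \<open>auto simp: Bs_def\<close>)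

lemma V_base: "f \<in> Bs D \<Longrightarrow> f \<in> V D" unfolding V_def by (rule mspan_base[OF Z finite_Bs])

text \<open>The product of two elements with a factor \<open>w\<close> contains
  \<open>w\<^sup>2\<close>, of degree 2 in the \<open>z i\<close>; this is the summand 2 in the
  bound.\<close>

lemma V_mult: assumes "f \<in> V D" "g \<in> V E" shows "f * g \<in> V (D + E + 2)"
  unfolding V_def
proof (rule mspan_mult[OF Z assms[unfolded V_def]])
  have pure: "a * b \<in> V (D + E + 2)" "w * (a * b) \<in> V (D + E + 2)"
    if "a \<in> zmon d z D" "b \<in> zmon d z E" for a b
    using zmon_mult[OF that] V_base[of _ "D + E"] V_mono[of "D + E" "D + E + 2"] by (auto simp: Bs_def)
  have sq: "w^2 * (a * b) \<in> V (D + E + 2)"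
    if "a \<in> zmon d z D" "b \<in> zmon d z E" for a b
  proof -
    have "(a * b) * w^2 \<in> mspan Z (zmon d z (D + E + 2))"
    proof (rule mspan_trans[OF Z w2])
      fix c assume "c \<in> zmon d z 2"
      then show "a * b * c \<in> mspan Z (zmon d z (D + E + 2))"
        using zmon_mult[OF zmon_mult[OF that]] mspan_base[OF Z finite_zmon] by blast
    qed
    then show ?thesis unfolding V_def
      by (intro mspan_mono[OF Z finite_Bs, of "zmon d z (D + E + 2)"]) (auto simp: Bs_def mult.commute)
  qed
  fix b b' assume "b \<in> Bs D" "b' \<in> Bs E"
  then obtain a a' where a: "a \<in> zmon d z D" "a' \<in> zmon d z E"
    and "b = a \<or> b = w * a" "b' = a' \<or> b' = w * a'" unfolding Bs_def by blast
  then have "b * b' = a * a' \<or> b * b' = w * (a * a') \<or> b * b' = w^2 * (a * a')"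
    by (auto simp: power2_eq_square mult_ac)
  then show "b * b' \<in> mspan Z (Bs (D + E + 2))" using pure[OF a] sq[OF a] unfolding V_def by auto
qed

lemma V_cst: "cst c \<in> V D"
proof -
  have "1 \<in> zmon d z D" unfolding zmon_def
    by (rule image_eqI[of _ _ "\<lambda>i\<in>{..<d}. 0"]) auto
  then have "1 \<in> Bs D" unfolding Bs_def by blast
  from mspan_scale[OF Z V_base[OF this, unfolded V_def], of c] show ?thesis unfolding V_def by simp
qed

lemma V_all: "\<exists>D. f \<in> V D"
proof (induction f rule: pp_induct)
  case (const c) then show ?case using V_cst by blast
next
  case (var k) show ?case using vars[of k] unfolding V_def Bs_def by blast
next
  case (add f g)
  then obtain D E where "f \<in> V D" "g \<in> V E" by blast
  then have "f \<in> V (max D E)" "g \<in> V (max D E)"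
    using V_mono[of D "max D E" f] V_mono[of E "max D E" g] by auto
  then show ?case using mspan_add[OF Z] unfolding V_def by blast
next
  case (mult f g) then show ?case using V_mult by blast
qed

lemma V_common: "finite I \<Longrightarrow> \<exists>D. \<forall>i\<in>I. f i \<in> V D"
proof (induction I rule: finite_induct)
  case (insert i I)
  then obtain D E where "\<forall>i\<in>I. f i \<in> V D" "f i \<in> V E" using V_all by blast
  then have "\<forall>j\<in>insert i I. f j \<in> V (max D E)" using V_mono by (metis insert_iff max.cobounded1 max.cobounded2)
  then show ?case by blast
qed simp

lemma V_power: "f \<in> V D \<Longrightarrow> f ^ j \<in> V (j * (D + 2))"
proof (induction j)
  case 0 show ?case using V_cst[of 1] by simp
next
  case (Suc j)
  have "f * f ^ j \<in> V (D + j * (D + 2) + 2)" by (rule V_mult) (use Suc in auto)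
  then show ?case by (simp add: algebra_simps)
qed

lemma V_prod:
  assumes "finite I" "\<And>i. i \<in> I \<Longrightarrow> f i \<in> V D" "\<And>i. i \<in> I \<Longrightarrow> e i \<le> E"
  shows "(\<Prod>i\<in>I. f i ^ e i) \<in> V (card I * (E * (D + 2) + 2))"
  using assms
proof (induction I rule: finite_induct)
  case empty show ?case using V_cst[of 1] by simp
next
  case (insert i I)
  have "f i ^ e i \<in> V (E * (D + 2))"
  proof (rule V_mono)
    show "f i ^ e i \<in> V (e i * (D + 2))" by (rule V_power) (use insert.prems in auto)
    show "e i * (D + 2) \<le> E * (D + 2)" using insert.prems by (intro mult_le_mono1) auto
  qed
  then have "f i ^ e i * (\<Prod>i\<in>I. f i ^ e i) \<in> V (E * (D + 2) + card I * (E * (D + 2) + 2) + 2)"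
    by (rule V_mult) (use insert in auto)
  then show ?case using insert.hyps by (simp add: algebra_simps)
qed

text \<open>There are \<open>E\<^sup>k\<close> exponent vectors, but a space of degree \<open>c
  E\<close> has dimension \<open>O(E\<^sup>d)\<close>, so for \<open>d < k\<close> a relation
  appears once \<open>E\<close> is large.\<close>

lemma dependent_family:
  assumes dk: "d < k" and g: "\<And>E e. E \<ge> 1 \<Longrightarrow> e \<in> {..<k} \<rightarrow>\<^sub>E {..<E} \<Longrightarrow> g E e \<in> V (c * E)"
  shows "\<exists>E a. (\<exists>e\<in>{..<k} \<rightarrow>\<^sub>E {..<E}. a e \<noteq> 0) \<and> (\<Sum>e\<in>{..<k} \<rightarrow>\<^sub>E {..<E}. cst (a e) * g E e) \<in> Z"
proof -
  \<comment> \<open>large enough that \<open>2 (c E + 1)\<^sup>d <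
    E\<^sup>d\<^sup>+\<^sup>1\<close>\<close>
  define E where "E = 2 * (c + 1) ^ d + 1"
  have E1: "E \<ge> 1" by (simp add: E_def)
  have "card (Bs (c * E)) \<le> 2 * (c * E + 1) ^ d" by (rule card_Bs)
  also have "\<dots> \<le> 2 * ((c + 1) * E) ^ d"
    using E1 by (intro mult_left_mono power_mono) (auto simp: algebra_simps)
  also have "\<dots> = (2 * (c + 1) ^ d) * E ^ d" by (simp only: power_mult_distrib mult.assoc)
  also have "\<dots> < E * E ^ d" using E1 by (intro mult_strict_right_mono) (auto simp: E_def)
  also have "\<dots> \<le> E ^ k" using dk E1 power_increasing[of "Suc d" k E] by simp
  also have "\<dots> = card ({..<k} \<rightarrow>\<^sub>E {..<E})" by (simp add: card_PiE)
  finally have "card (Bs (c * E)) < card ({..<k} \<rightarrow>\<^sub>E {..<E})" .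
  from mspan_dependent[OF Z finite_Bs _ this, of "g E"] show ?thesis
    using g[OF E1] by (auto simp: V_def finite_PiE)
qed

end

subsection \<open>Chains of primes\<close>

lemma sum_PiE_insert:
  assumes "i \<notin> S" "finite S"
  shows "(\<Sum>e\<in>insert i S \<rightarrow>\<^sub>E T. F e) = (\<Sum>l\<in>T. \<Sum>e\<in>S \<rightarrow>\<^sub>E T. F (e(i := l)))"
proof -
  have "(\<Sum>e\<in>insert i S \<rightarrow>\<^sub>E T. F e) = (\<Sum>e\<in>(\<lambda>(y, g). g(i := y)) ` (T \<times> (S \<rightarrow>\<^sub>E T)). F e)"
    by (simp add: PiE_insert_eq)
  also have "\<dots> = (\<Sum>(l, e)\<in>T \<times> (S \<rightarrow>\<^sub>E T). F (e(i := l)))"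
    by (subst sum.reindex) (use inj_combinator[OF assms(1)] in \<open>auto simp: case_prod_unfold\<close>)
  finally show ?thesis by (simp add: sum.cartesian_product)
qed

text \<open>The shape of a nonzero polynomial expression in \<open>a\<^sub>1, \<dots>,
  a\<^sub>k\<close>: extract the lowest power of \<open>a\<^sub>1\<close>, look at the coefficient
  of that power as an expression in the remaining elements, and end with a nonzero constant. An
  element of this shape cannot lie at the bottom of a chain of primes for which each
  \<open>a\<^sub>i\<close> enters exactly at step \<open>i\<close>.\<close>

fun nzp :: "pp list \<Rightarrow> pp \<Rightarrow> bool" where
  "nzp [] f = (\<exists>c. c \<noteq> 0 \<and> f = cst c)"
| "nzp (a # as) f = (\<exists>l g h. f = a ^ l * (g + a * h) \<and> nzp as g)"

lemma sum_least_power: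
  fixes r :: "nat \<Rightarrow> 'a::comm_ring_1"
  assumes "l0 < E" "\<And>l. l < l0 \<Longrightarrow> r l = 0"
  shows "(\<Sum>l<E. a ^ l * r l) = a ^ l0 * (r l0 + a * (\<Sum>l\<in>{Suc l0..<E}. a ^ (l - Suc l0) * r l))"
proof -
  have "(\<Sum>l<E. a ^ l * r l) = (\<Sum>l\<in>{l0..<E}. a ^ l * r l)"
    by (rule sum.mono_neutral_right) (use assms in auto)
  also have "\<dots> = a ^ l0 * r l0 + (\<Sum>l\<in>{Suc l0..<E}. a ^ l * r l)"
    using assms by (simp add: sum.atLeast_Suc_lessThan)
  also have "(\<Sum>l\<in>{Suc l0..<E}. a ^ l * r l) = (\<Sum>l\<in>{Suc l0..<E}. a ^ l0 * (a * (a ^ (l - Suc l0) * r l)))"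
  proof (rule sum.cong[OF refl])
    fix l assume "l \<in> {Suc l0..<E}"
    then have "l = l0 + Suc (l - Suc l0)" by simp
    then have "a ^ l = a ^ l0 * (a * a ^ (l - Suc l0))" by (metis power_Suc power_add)
    then show "a ^ l * r l = a ^ l0 * (a * (a ^ (l - Suc l0) * r l))" by (simp add: mult.assoc)
  qed
  finally show ?thesis by (simp add: distrib_left sum_distrib_left)
qed

lemma nzp_relation:
  assumes "distinct is" "\<exists>e\<in>set is \<rightarrow>\<^sub>E {..<E}. c e \<noteq> 0"
  shows "nzp (map a is) (\<Sum>e\<in>set is \<rightarrow>\<^sub>E {..<E}. cst (c e) * (\<Prod>i\<in>set is. a i ^ e i))"
  using assms
proof (induction "is" arbitrary: c)
  case Nil then show ?case by auto
next
  case (Cons i "is")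
  let ?S = "set is"
  define r where "r l = (\<Sum>e\<in>?S \<rightarrow>\<^sub>E {..<E}. cst (c (e(i := l))) * (\<Prod>i\<in>?S. a i ^ e i))" for l
  have i: "i \<notin> ?S" using Cons.prems by simp
  have "(\<Sum>e\<in>set (i # is) \<rightarrow>\<^sub>E {..<E}. cst (c e) * (\<Prod>i\<in>set (i # is). a i ^ e i))
    = (\<Sum>l<E. \<Sum>e\<in>?S \<rightarrow>\<^sub>E {..<E}. cst (c (e(i := l))) * (\<Prod>j\<in>insert i ?S. a j ^ (e(i := l)) j))"
    using sum_PiE_insert[OF i, of "\<lambda>e. cst (c e) * (\<Prod>j\<in>insert i ?S. a j ^ e j)" "{..<E}"] by simp
  also have "\<dots> = (\<Sum>l<E. a i ^ l * r l)"
    unfolding r_def sum_distrib_left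
  proof (intro sum.cong refl)
    fix l e
    have "(\<Prod>j\<in>?S. a j ^ (e(i := l)) j) = (\<Prod>j\<in>?S. a j ^ e j)"
      by (rule prod.cong) (use i in auto)
    then show "cst (c (e(i := l))) * (\<Prod>j\<in>insert i ?S. a j ^ (e(i := l)) j)
        = a i ^ l * (cst (c (e(i := l))) * (\<Prod>j\<in>?S. a j ^ e j))"
      using i by (simp add: mult_ac)
  qed
  finally have eq: "(\<Sum>e\<in>set (i # is) \<rightarrow>\<^sub>E {..<E}. cst (c e) * (\<Prod>i\<in>set (i # is). a i ^ e i)) = (\<Sum>l<E. a i ^ l * r l)" .
  let ?P = "\<lambda>l. l < E \<and> (\<exists>e\<in>?S \<rightarrow>\<^sub>E {..<E}. c (e(i := l)) \<noteq> 0)"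
  obtain e where e: "e \<in> set (i # is) \<rightarrow>\<^sub>E {..<E}" "c e \<noteq> 0" using Cons.prems by blast
  then obtain l' e' where "l' < E" "e' \<in> ?S \<rightarrow>\<^sub>E {..<E}" "e = e'(i := l')"
    by (auto simp: PiE_insert_eq)
  then have ex: "\<exists>l. ?P l" using e by blast
  define l0 where "l0 = (LEAST l. ?P l)"
  have l0: "?P l0" unfolding l0_def by (rule LeastI_ex[OF ex])
  have low: "r l = 0" if "l < l0" for l
    unfolding r_def using not_less_Least[OF that[unfolded l0_def]] l0 that by (intro sum.neutral) auto
  have "distinct is" using Cons.prems(1) by simp
  then have "nzp (map a is) (r l0)" unfolding r_def by (rule Cons.IH) (use l0 in blast)
  then show ?case unfolding eq using sum_least_power[of l0 E r "a i"] l0 low by auto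
qed

lemma cst_notin: assumes "idl Q" "1 \<notin> Q" "c \<noteq> 0" shows "cst c \<notin> Q"
proof
  assume "cst c \<in> Q"
  then have "cst (inverse c) * cst c \<in> Q" by (rule idl_mult[OF assms(1)])
  then show False using assms by (simp add: cst.hom_mult[symmetric] del: cst.hom_mult)
qed

lemma prm_power: "prm Q \<Longrightarrow> a ^ l \<in> Q \<Longrightarrow> a \<in> Q"
  by (induction l) (auto simp: prm_def)

text \<open>If \<open>a ^ l * (g + a * h)\<close> lies in a prime that does not contain
  \<open>a\<close>, then \<open>g + a * h\<close> lies in it, and \<open>g\<close> lies in the
  next prime, which contains \<open>a\<close>.\<close>

lemma nzp_chain:
  assumes Q: "\<And>i. i \<le> k \<Longrightarrow> prm (Q i)" "\<And>i. i < k \<Longrightarrow> Q i \<subseteq> Q (Suc i)"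
    and a: "\<And>i. i < k \<Longrightarrow> a i \<in> Q (Suc i)" "\<And>i. i < k \<Longrightarrow> a i \<notin> Q i"
  shows "j \<le> k \<Longrightarrow> nzp (map a [j..<k]) f \<Longrightarrow> f \<notin> Q j"
proof (induction "k - j" arbitrary: j f)
  case 0
  then show ?case using cst_notin Q(1)[of k] by (auto simp: prm_def)
next
  case (Suc r)
  then have jk: "j < k" by simp
  then have "map a [j..<k] = a j # map a [Suc j..<k]" by (simp add: upt_conv_Cons)
  then obtain l g h where f: "f = a j ^ l * (g + a j * h)" "nzp (map a [Suc j..<k]) g"
    using Suc.prems by auto
  have g: "g \<notin> Q (Suc j)" using Suc.hyps(1)[of "Suc j" g] f Suc.hyps(2) jk by simp
  have pj: "prm (Q j)" "prm (Q (Suc j))" using Q(1) jk by auto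
  show ?case
  proof
    assume "f \<in> Q j"
    then have "a j ^ l \<in> Q j \<or> g + a j * h \<in> Q j" using pj(1) f(1) unfolding prm_def by blast
    then have "g + a j * h \<in> Q (Suc j)" using prm_power[OF pj(1)] a(2)[OF jk] Q(2)[OF jk] by blast
    then have "g + a j * h - a j * h \<in> Q (Suc j)"
      by (rule idl_diff[OF prm_idl[OF pj(2)]]) (rule idl_mult2[OF prm_idl[OF pj(2)] a(1)[OF jk]])
    then show False using g by simp
  qed
qed

context growth begin

text \<open>Choose in each step of the chain an element that is new. By counting, more than
  \<open>d\<close> such elements satisfy a relation modulo \<open>Z\<close>, and
  \<open>nzp_chain\<close> forbids relations among them.\<close>

lemma chain_bound:
  assumes Q: "\<And>i. i \<le> k \<Longrightarrow> prm (Q i)" "\<And>i. i < k \<Longrightarrow> Q i \<subset> Q (Suc i)" and ZQ: "Z \<subseteq> Q 0"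
  shows "k \<le> d"
proof (rule ccontr)
  assume "\<not> k \<le> d"
  then have dk: "d < k" by simp
  have "\<exists>a. i < k \<longrightarrow> a \<in> Q (Suc i) \<and> a \<notin> Q i" for i using Q(2)[of i] by blast
  then obtain a where a: "\<And>i. i < k \<Longrightarrow> a i \<in> Q (Suc i)" "\<And>i. i < k \<Longrightarrow> a i \<notin> Q i" by metis
  obtain D where D: "\<forall>i\<in>{..<k}. a i \<in> V D" using V_common[of "{..<k}" a] by auto
  have "(\<Prod>i<k. a i ^ e i) \<in> V ((k * (D + 4)) * E)" if "E \<ge> 1" "e \<in> {..<k} \<rightarrow>\<^sub>E {..<E}" for E e
  proof -
    have "(\<Prod>i<k. a i ^ e i) \<in> V (card {..<k} * (E * (D + 2) + 2))"
      by (rule V_prod) (use D that in \<open>auto simp: PiE_iff less_imp_le\<close>)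
    moreover have "card {..<k} * (E * (D + 2) + 2) \<le> (k * (D + 4)) * E"
    proof -
      have "E * (D + 2) + 2 \<le> (D + 4) * E" using that(1) by (simp add: algebra_simps)
      then show ?thesis using mult_le_mono2[of "E * (D + 2) + 2" "(D + 4) * E" k] by (simp add: mult.assoc)
    qed
    ultimately show ?thesis using V_mono by blast
  qed
  from dependent_family[OF dk, of "\<lambda>E e. (\<Prod>i<k. a i ^ e i)", OF this]
  obtain E c where "\<exists>e\<in>{..<k} \<rightarrow>\<^sub>E {..<E}. c e \<noteq> 0"
    and inZ: "(\<Sum>e\<in>{..<k} \<rightarrow>\<^sub>E {..<E}. cst (c e) * (\<Prod>i<k. a i ^ e i)) \<in> Z" by blast
  then have "nzp (map a [0..<k]) (\<Sum>e\<in>{..<k} \<rightarrow>\<^sub>E {..<E}. cst (c e) * (\<Prod>i<k. a i ^ e i))"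
    using nzp_relation[of "[0..<k]" E c a] by (simp add: atLeast0LessThan)
  then have "(\<Sum>e\<in>{..<k} \<rightarrow>\<^sub>E {..<E}. cst (c e) * (\<Prod>i<k. a i ^ e i)) \<notin> Q 0"
    using nzp_chain[of k Q a 0] Q a by blast
  then show False using inZ ZQ by blast
qed

end

lemma (in presented) krull_dim_le:
  assumes "\<And>k Q. (\<And>i. i \<le> k \<Longrightarrow> prm (Q i)) \<Longrightarrow> (\<And>i. i < k \<Longrightarrow> Q i \<subset> Q (Suc i)) \<Longrightarrow> ker \<subseteq> Q 0 \<Longrightarrow> k \<le> d"
  shows "krull_dim R \<le> enat d"
  unfolding krull_dim_def
proof (rule Sup_least)
  fix x assume "x \<in> {enat k |k. \<exists>C. chain_of_length (\<lambda>P. primeideal P R) k C}"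
  then obtain k C where x: "x = enat k" and C: "\<And>i. i \<le> k \<Longrightarrow> primeideal (C i) R" "\<And>i. i < k \<Longrightarrow> C i \<subset> C (Suc i)"
    unfolding chain_of_length_def by blast
  have id: "ideal (C i) R" if "i \<le> k" for i using C(1)[OF that] by (simp add: primeideal_def)
  have "k \<le> d"
  proof (rule assms[of k "\<lambda>i. pre (C i)"])
    show "prm (pre (C i))" if "i \<le> k" for i by (rule prm_pre[OF C(1)[OF that]])
    show "ker \<subseteq> pre (C 0)" by (rule ker_sub[OF id]) simp
    show "pre (C i) \<subset> pre (C (Suc i))" if "i < k" for i
    proof -
      have "pre (C i) \<subseteq> pre (C (Suc i))" "\<not> pre (C (Suc i)) \<subseteq> pre (C i)"
        using C(2)[OF that] that pre_mono_iff[OF ideal_carrier[OF id]] by auto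
      then show ?thesis by blast
    qed
  qed
  then show "x \<le> enat d" by (simp add: x)
qed

section \<open>Maximal ideals are complex points\<close>

definition peval :: "(real \<Rightarrow> 'b::comm_ring_1) \<Rightarrow> real poly \<Rightarrow> 'b \<Rightarrow> 'b"
  where "peval \<kappa> p x = poly (map_poly \<kappa> p) x"

context comm_ring_hom begin

lemma map_poly_add_hom: "map_poly hom (p + q) = map_poly hom p + map_poly hom q"
  by (rule poly_eqI) (simp add: coeff_map_poly hom_add)

lemma map_poly_smult_hom: "map_poly hom (smult a q) = smult (hom a) (map_poly hom q)"
  by (rule poly_eqI) (simp add: coeff_map_poly hom_mult)

lemma map_poly_mult_hom: "map_poly hom (p * q) = map_poly hom p * map_poly hom q"
proof (induction p)
  case (pCons a p)
  then show ?case
    by (simp add: map_poly_add_hom map_poly_smult_hom map_poly_pCons)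
qed simp

end

lemma peval_hom: assumes "comm_ring_hom \<kappa>" shows "comm_ring_hom (\<lambda>p. peval \<kappa> p x)"
proof -
  interpret comm_ring_hom \<kappa> by fact
  show ?thesis
    by unfold_locales (simp_all add: peval_def map_poly_add_hom map_poly_mult_hom)
qed

interpretation pc: comm_ring_hom "\<lambda>p. peval cst p a" for a by (rule peval_hom[OF cst_hom])

lemma peval_pCons:
  assumes "comm_ring_hom \<kappa>" shows "peval \<kappa> (pCons c p) x = \<kappa> c + x * peval \<kappa> p x"
proof -
  interpret comm_ring_hom \<kappa> by fact
  show ?thesis by (simp add: peval_def map_poly_pCons)
qed

context growth begin

text \<open>Residue fields are algebraic over the real numbers. If no \<open>a - x\<close> with
  real \<open>x\<close> were in \<open>M\<close>, all of them would have inverses modulo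
  \<open>M\<close>. These are uncountably many, while the spaces \<open>V D\<close> exhaust the
  ring, so infinitely many inverses lie in one finite-dimensional \<open>V D\<close> and are
  dependent; clearing denominators gives a polynomial relation for \<open>a\<close>.\<close>

lemma ex_annihilating_poly:
  assumes M: "mxm M" and ZM: "Z \<subseteq> M"
  shows "\<exists>h. h \<noteq> 0 \<and> peval cst h a \<in> M"
proof (cases "\<exists>x. a - cst x \<in> M")
  case True
  then obtain x where "a - cst x \<in> M" by blast
  moreover have "peval cst [:- x, 1:] a = a - cst x"
    by (simp add: peval_pCons[OF cst_hom] cst.hom_uminus)
  ultimately show ?thesis by (intro exI[of _ "[:- x, 1:]"]) simp
next
  case False
  note iM = mxm_idl[OF M]
  have "\<forall>x. \<exists>b. 1 - b * (a - cst x) \<in> M" using False M by (auto simp: mxm_def)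
  then obtain b where b: "\<And>x. 1 - b x * (a - cst x) \<in> M" by metis
  let ?S = "\<lambda>D. {x. b x \<in> V D}"
  have "\<exists>D. infinite (?S D)"
  proof (rule ccontr)
    assume "\<not> ?thesis"
    then have "countable (\<Union>D. ?S D)" by (intro countable_UN) (auto intro: countable_finite)
    moreover have "(\<Union>D. ?S D) = (UNIV :: real set)" using V_all by blast
    ultimately show False using uncountable_UNIV_real by simp
  qed
  then obtain D where "infinite (?S D)" by blast
  then obtain L where L: "finite L" "card L = Suc (card (Bs D))" "L \<subseteq> ?S D"
    using infinite_arbitrarily_large by metis
  have "\<exists>c. (\<exists>x\<in>L. c x \<noteq> 0) \<and> (\<Sum>x\<in>L. cst (c x) * b x) \<in> Z"
    by (rule mspan_dependent[OF Z finite_Bs[of D] L(1)]) (use L in \<open>auto simp: V_def\<close>)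
  then obtain c x0 where x0: "x0 \<in> L" "c x0 \<noteq> 0" and cZ: "(\<Sum>x\<in>L. cst (c x) * b x) \<in> M"
    using ZM by blast
  define P where "P y = (\<Prod>x\<in>L - {y}. a - cst x)" for y
  \<comment> \<open>the numerator of \<open>\<Sum>x\<in>L. c x / (a - x)\<close>; it is nonzero
    because it does not vanish at \<open>x0\<close>\<close>
  define h where "h = (\<Sum>x\<in>L. smult (c x) (\<Prod>y\<in>L - {x}. [:- y, 1:]))"
  have lin: "peval cst [:- y, 1:] a = a - cst y" for y
    by (simp add: peval_pCons[OF cst_hom] cst.hom_uminus)
  have sm: "peval cst (smult r p) a = cst r * peval cst p a" for r p
    by (simp add: peval_def cst.map_poly_smult_hom)
  have ph: "peval cst h a = (\<Sum>x\<in>L. cst (c x) * P x)"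
    unfolding h_def P_def by (simp add: pc.hom_sum sm pc.hom_prod lin)
  have "(\<Sum>x\<in>L. cst (c x) * P x) - (\<Prod>x\<in>L. a - cst x) * (\<Sum>x\<in>L. cst (c x) * b x)
      = (\<Sum>x\<in>L. cst (c x) * P x * (1 - b x * (a - cst x)))"
  proof -
    have "(\<Prod>x\<in>L. a - cst x) * (cst (c y) * b y) = cst (c y) * P y * (b y * (a - cst y))" if "y \<in> L" for y
      using prod.remove[OF L(1) that, of "\<lambda>x. a - cst x"] by (simp add: P_def mult_ac)
    then show ?thesis by (simp add: sum_distrib_left sum_subtractf right_diff_distrib)
  qed
  also have "\<dots> \<in> M" by (intro idl_sum[OF iM] idl_mult[OF iM] b)
  finally have "peval cst h a \<in> M" unfolding ph using idl_eqI[OF iM] idl_mult[OF iM cZ] by blast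
  moreover have "poly h x0 = c x0 * (\<Prod>y\<in>L - {x0}. x0 - y)"
  proof -
    have "poly h x0 = (\<Sum>x\<in>L. c x * (\<Prod>y\<in>L - {x}. x0 - y))"
      by (simp add: h_def poly_sum poly_prod)
    also have "\<dots> = c x0 * (\<Prod>y\<in>L - {x0}. x0 - y) + (\<Sum>x\<in>L - {x0}. c x * (\<Prod>y\<in>L - {x}. x0 - y))"
      by (rule sum.remove[OF L(1) x0(1)])
    also have "(\<Sum>x\<in>L - {x0}. c x * (\<Prod>y\<in>L - {x}. x0 - y)) = 0"
    proof (rule sum.neutral, intro ballI)
      fix x assume "x \<in> L - {x0}"
      then have "(\<Prod>y\<in>L - {x}. x0 - y) = 0" using x0 L by (subst prod_zero_iff) auto
      then show "c x * (\<Prod>y\<in>L - {x}. x0 - y) = 0" by simp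
    qed
    finally show ?thesis by simp
  qed
  then have "h \<noteq> 0" using x0 L by auto
  ultimately show ?thesis by blast
qed

end

text \<open>A real polynomial is a product of factors of degree at most two, and a prime that
  contains the product contains one of them. The factor is the minimal polynomial of a complex
  root.\<close>

lemma root_in_prime:
  assumes M: "prm M"
  shows "h \<noteq> 0 \<Longrightarrow> peval cst h a \<in> M \<Longrightarrow>
    (\<exists>x. a - cst x \<in> M) \<or> (\<exists>r s. s \<noteq> 0 \<and> (a - cst r)^2 + cst (s^2) \<in> M)"
proof (induction "degree h" arbitrary: h rule: less_induct)
  case less
  have co_hom: "comm_ring_hom complex_of_real" by unfold_locales simp_all
  interpret cp: comm_ring_hom "\<lambda>p. peval complex_of_real p z" for z
    by (rule peval_hom[OF co_hom])
  show ?case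
  proof (cases "degree h = 0")
    case True
    then obtain c where c: "h = [:c:]" by (auto elim: degree_eq_zeroE)
    then have "peval cst h a = cst c" by (simp add: peval_pCons[OF cst_hom])
    then show ?thesis using less.prems c cst_notin[of M c] M by (auto simp: prm_def)
  next
    case False
    have "degree (map_poly complex_of_real h) = degree h" by (rule degree_map_poly) simp
    then have "\<not> constant (poly (map_poly complex_of_real h))" using False by (simp add: constant_degree)
    then obtain z where z: "peval complex_of_real h z = 0"
      using fundamental_theorem_of_algebra unfolding peval_def by blast
    define d where "d = (if Im z = 0 then [:- Re z, 1:] else [:(Re z)^2 + (Im z)^2, - 2 * Re z, 1:])"
    have d0: "d \<noteq> 0" "degree d \<ge> 1" by (auto simp: d_def)
    have pd: "peval complex_of_real d z = 0"
      by (auto simp: d_def peval_pCons[OF co_hom] complex_eq_iff power2_eq_square algebra_simps)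
    have dm: "h = d * (h div d) + h mod d" by simp
    have rz: "peval complex_of_real (h mod d) z = 0"
      using z pd dm cp.hom_add[of "d * (h div d)" "h mod d"] by (simp add: cp.hom_mult)
    have "h mod d = 0"
    proof (rule ccontr)
      assume nz: "h mod d \<noteq> 0"
      then have deg: "degree (h mod d) < degree d" using degree_mod_less[OF d0(1), of h] by auto
      show False
      proof (cases "Im z = 0")
        case True
        then have "degree (h mod d) = 0" using deg by (simp add: d_def)
        then obtain c where c: "h mod d = [:c:]" by (auto elim: degree_eq_zeroE)
        then show False using rz nz by (simp add: peval_pCons[OF co_hom])
      next
        case False
        then have "degree (h mod d) \<le> 1" using deg by (simp add: d_def)
        obtain c p where cp: "h mod d = pCons c p" by (cases "h mod d")
        have "degree p = 0" using \<open>degree (h mod d) \<le> 1\<close> unfolding cp by (auto split: if_splits)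
        then obtain e where c: "h mod d = [:c, e:]" using cp by (auto elim: degree_eq_zeroE)
        then show False using rz nz False
          by (auto simp: peval_pCons[OF co_hom] complex_eq_iff)
      qed
    qed
    then have hd: "h = d * (h div d)" using dm by simp
    then have q0: "h div d \<noteq> 0" using less.prems by auto
    have "degree h = degree d + degree (h div d)" using degree_mult_eq[OF d0(1) q0] hd by simp
    then have lt: "degree (h div d) < degree h" using d0 by simp
    have "peval cst d a * peval cst (h div d) a \<in> M" using less.prems(2) hd pc.hom_mult by metis
    then consider "peval cst d a \<in> M" | "peval cst (h div d) a \<in> M" using M unfolding prm_def by blast
    then show ?thesis
    proof cases
      case 1
      show ?thesis
      proof (cases "Im z = 0")
        case True
        then have "peval cst d a = a - cst (Re z)"
          by (simp add: d_def peval_pCons[OF cst_hom] cst.hom_uminus)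
        then show ?thesis using 1 by auto
      next
        case False
        then have "peval cst d a = cst ((Re z)^2 + (Im z)^2) + a * (cst (- 2 * Re z) + a)"
          by (simp add: d_def peval_pCons[OF cst_hom])
        also have "\<dots> = (a - cst (Re z))^2 + cst ((Im z)^2)"
          by (simp add: cst.hom_add cst.hom_mult cst.hom_uminus power2_eq_square algebra_simps)
        finally show ?thesis using 1 False by auto
      qed
    next
      case 2
      then show ?thesis using less.hyps[OF lt q0] by blast
    qed
  qed
qed

text \<open>Polynomials here have real coefficients, so conjugate points have the same
  ideal.\<close>

definition pt_ideal :: "(nat \<Rightarrow> complex) \<Rightarrow> pp set" where "pt_ideal p = {f. ev f p = 0}"

lemma pt_ideal_mxm: "mxm (pt_ideal p)"
proof -
  have i: "idl (pt_ideal p)" by (simp add: idl_def pt_ideal_def)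
  have "\<exists>r. 1 - r * f \<in> pt_ideal p" if "f \<notin> pt_ideal p" for f
  proof -
    let ?A = "Re (ev f p)" and ?B = "Im (ev f p)"
    let ?r = "cst (- 1 / (?A^2 + ?B^2)) * (f - cst (2 * ?A))"
    have nz: "ev f p \<noteq> 0" using that by (simp add: pt_ideal_def)
    have "ev f p - 2 * ?A = - cnj (ev f p)" by (simp add: complex_eq_iff)
    moreover have "ev f p * cnj (ev f p) = of_real (?A^2 + ?B^2)"
      by (metis complex_norm_square cmod_power2 of_real_power)
    moreover have "?A^2 + ?B^2 \<noteq> 0" using nz by (metis complex_neq_0 less_irrefl)
    ultimately have "ev (?r * f) p = 1"
    proof -
      assume a: "ev f p - 2 * ?A = - cnj (ev f p)" "ev f p * cnj (ev f p) = of_real (?A^2 + ?B^2)" and n: "?A^2 + ?B^2 \<noteq> 0"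
      have "ev (?r * f) p = of_real (- 1 / (?A^2 + ?B^2)) * ((ev f p - 2 * ?A) * ev f p)" by simp
      also have "\<dots> = of_real (- 1 / (?A^2 + ?B^2)) * (- of_real (?A^2 + ?B^2))"
        using a by (simp add: mult.commute)
      also have "\<dots> = of_real ((- 1 / (?A^2 + ?B^2)) * (- (?A^2 + ?B^2)))" by (simp only: of_real_mult of_real_minus)
      also have "(- 1 / (?A^2 + ?B^2)) * (- (?A^2 + ?B^2)) = 1" using n by (simp del: minus_add_distrib)
      also have "complex_of_real 1 = 1" by simp
      finally show ?thesis .
    qed
    then show ?thesis by (intro exI[of _ ?r]) (simp add: pt_ideal_def)
  qed
  then show ?thesis using i by (simp add: mxm_def pt_ideal_def)
qed

text \<open>\<open>\<tau>\<close> is an imaginary unit modulo \<open>Q\<close>. Once each variable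
  is congruent to its value at \<open>p\<close>, with \<open>\<tau>\<close> in place of the
  imaginary unit, the same holds for every polynomial; at a real point the terms with
  \<open>\<tau>\<close> are zero.\<close>

lemma pt_congr:
  assumes Q: "idl Q" and x: "\<And>k. mpoly_var k - (cst (Re (p k)) + cst (Im (p k)) * \<tau>) \<in> Q"
    and t: "\<tau>^2 + 1 \<in> Q \<or> (\<forall>k. Im (p k) = 0)"
  shows "f - (cst (Re (ev f p)) + cst (Im (ev f p)) * \<tau>) \<in> Q"
proof -
  have real: "Im (ev g p) = 0" if "\<forall>k. Im (p k) = 0" for g
    using that by (induction g rule: pp_induct) simp_all
  show ?thesis
  proof (induction f rule: pp_induct)
    case (const c) then show ?case using idl_zero[OF Q] by simp
  next
    case (var k) then show ?case using x by simp
  next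
    case (add f g)
    from idl_add[OF Q add] show ?case by (simp add: cst.hom_add algebra_simps)
  next
    case (mult f g)
    let ?A = "cst (Re (ev f p))" and ?B = "cst (Im (ev f p))" and ?C = "cst (Re (ev g p))" and ?D = "cst (Im (ev g p))"
    have "?B * ?D * (\<tau>^2 + 1) \<in> Q"
      using t real[of f] idl_mult[OF Q, of "\<tau>^2+1" "?B * ?D"] idl_zero[OF Q] by auto
    moreover have "(f - (?A + ?B * \<tau>)) * g + (?A + ?B * \<tau>) * (g - (?C + ?D * \<tau>)) \<in> Q"
      by (intro idl_add[OF Q] idl_mult2[OF Q mult(1)] idl_mult[OF Q mult(2)])
    ultimately have "(f - (?A + ?B * \<tau>)) * g + (?A + ?B * \<tau>) * (g - (?C + ?D * \<tau>)) + ?B * ?D * (\<tau>^2 + 1) \<in> Q"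
      using idl_add[OF Q] by blast
    moreover have "(f - (?A + ?B * \<tau>)) * g + (?A + ?B * \<tau>) * (g - (?C + ?D * \<tau>)) + ?B * ?D * (\<tau>^2 + 1)
       = f * g - ((?A * ?C - ?B * ?D) + (?A * ?D + ?B * ?C) * \<tau>)"
      by (simp add: power2_eq_square algebra_simps)
    ultimately show ?case
      by (simp add: cst.hom_add cst.hom_mult cst.hom_minus)
  qed
qed

lemma pt_ideal_sub:
  assumes Q: "idl Q" and x: "\<And>k. mpoly_var k - (cst (Re (p k)) + cst (Im (p k)) * \<tau>) \<in> Q"
    and t: "\<tau>^2 + 1 \<in> Q \<or> (\<forall>k. Im (p k) = 0)"
  shows "pt_ideal p \<subseteq> Q"
proof
  fix f assume "f \<in> pt_ideal p"
  then show "f \<in> Q" using pt_congr[OF Q x t, of f] by (simp add: pt_ideal_def)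
qed

lemma pt_ideal_eqI:
  assumes Q: "idl Q" and x: "\<And>k. mpoly_var k - (cst (Re (p k)) + cst (Im (p k)) * \<tau>) \<in> Q"
    and t: "\<tau>^2 + 1 \<in> Q \<or> (\<forall>k. Im (p k) = 0)" and n: "1 \<notin> Q"
  shows "Q = pt_ideal p"
  by (rule mxm_maximal[OF pt_ideal_mxm Q pt_ideal_sub[OF Q x t] n])

context growth begin

text \<open>Each variable is congruent modulo \<open>M\<close> to a real number or satisfies an
  irreducible real quadratic equation. One variable of the second kind provides an imaginary unit
  \<open>\<tau>\<close> of the residue field, and in terms of \<open>\<tau>\<close> the other
  quadratic equations split as well.\<close>

lemma nullstellensatz:
  assumes M: "mxm M" and ZM: "Z \<subseteq> M" and K: "\<And>k. k > K \<Longrightarrow> mpoly_var k \<in> Z"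
  shows "\<exists>p. M = pt_ideal p \<and> (\<forall>k>K. p k = 0)"
proof -
  note iM = mxm_idl[OF M] and pM = mxm_prm[OF M]
  have n1: "1 \<notin> M" using M by (simp add: mxm_def)
  have alt: "(\<exists>x. a - cst x \<in> M) \<or> (\<exists>r s. s \<noteq> 0 \<and> (a - cst r)^2 + cst (s^2) \<in> M)" for a
    using ex_annihilating_poly[OF M ZM, of a] root_in_prime[OF pM] by blast
  have out: "k > K \<Longrightarrow> mpoly_var k \<in> M" for k using K ZM by blast
  show ?thesis
  proof (cases "\<forall>k. \<exists>x. mpoly_var k - cst x \<in> M")
    case True
    then obtain x where x: "\<And>k. mpoly_var k - cst (x k) \<in> M" by metis
    define p where "p k = (if k > K then 0 else complex_of_real (x k))" for k
    have "M = pt_ideal p"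
      by (rule pt_ideal_eqI[OF iM _ _ n1, of p 0]) (auto simp: p_def x out)
    then show ?thesis by (auto simp: p_def)
  next
    case False
    then obtain j where j: "\<not> (\<exists>x. mpoly_var j - cst x \<in> M)" by blast
    then obtain r s where rs: "s \<noteq> 0" "(mpoly_var j - cst r)^2 + cst (s^2) \<in> M" using alt[of "mpoly_var j"] by blast
    define \<tau> where "\<tau> = cst (1/s) * (mpoly_var j - cst r)"
    have "cst (1/s)^2 * ((mpoly_var j - cst r)^2 + cst (s^2)) = \<tau>^2 + cst ((1/s)^2 * s^2)"
      by (simp add: \<tau>_def distrib_left power_mult_distrib cst.hom_mult cst.hom_power)
    also have "(1/s)^2 * s^2 = 1" using rs(1) by (simp add: power2_eq_square)
    finally have tau: "\<tau>^2 + 1 \<in> M" using idl_mult[OF iM rs(2)] by (metis cst.hom_one)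
    have "\<exists>c e. mpoly_var k - (cst c + cst e * \<tau>) \<in> M \<and> (k > K \<longrightarrow> c = 0 \<and> e = 0)" for k
    proof (cases "k > K")
      case True then show ?thesis using out[of k] by (intro exI[of _ 0]) simp
    next
      case False
      from alt[of "mpoly_var k"] show ?thesis
      proof
        assume "\<exists>x. mpoly_var k - cst x \<in> M"
        then obtain x where "mpoly_var k - cst x \<in> M" by blast
        then show ?thesis using False by (intro exI[of _ x] exI[of _ 0]) simp
      next
        assume "\<exists>r s. s \<noteq> 0 \<and> (mpoly_var k - cst r)^2 + cst (s^2) \<in> M"
        then obtain r s where rs: "(mpoly_var k - cst r)^2 + cst (s^2) \<in> M" by blast
        have "(mpoly_var k - (cst r + cst s * \<tau>)) * (mpoly_var k - (cst r + cst (- s) * \<tau>))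
          = (mpoly_var k - cst r)^2 + cst (s^2) - cst (s^2) * (\<tau>^2 + 1)"
          by (simp add: power2_eq_square cst.hom_mult cst.hom_uminus algebra_simps)
        also have "\<dots> \<in> M" by (intro idl_diff[OF iM] rs idl_mult[OF iM tau])
        finally have "mpoly_var k - (cst r + cst s * \<tau>) \<in> M \<or> mpoly_var k - (cst r + cst (- s) * \<tau>) \<in> M"
          using pM unfolding prm_def by blast
        then show ?thesis using False by blast
      qed
    qed
    then obtain c e where ce: "\<And>k. mpoly_var k - (cst (c k) + cst (e k) * \<tau>) \<in> M" "\<And>k. k > K \<Longrightarrow> c k = 0 \<and> e k = 0"
      by metis
    have "M = pt_ideal (\<lambda>k. Complex (c k) (e k))"
      by (rule pt_ideal_eqI[OF iM _ _ n1, of _ \<tau>]) (auto simp: ce tau)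
    then show ?thesis using ce(2) by (intro exI[of _ "\<lambda>k. Complex (c k) (e k)"]) (auto simp: complex_eq_iff)
  qed
qed

end

subsection \<open>Growth of the quadric and of its plane sections\<close>

lemma zmonI: assumes "\<And>i. i < d \<Longrightarrow> e i \<le> D" "b = (\<Prod>i<d. z i ^ e i)" shows "b \<in> zmon d z D"
  unfolding zmon_def by (rule image_eqI[of _ _ "restrict e {..<d}"]) (use assms in auto)

lemma zmon_one: "1 \<in> zmon d z D" by (rule zmonI[of _ "\<lambda>_. 0"]) auto

lemma zmon_power: assumes "i < d" "j \<le> D" shows "z i ^ j \<in> zmon d z D"
proof (rule zmonI[of _ "\<lambda>l. if l = i then j else 0"])
  have "(\<Prod>l<d. z l ^ (if l = i then j else 0)) = (\<Prod>l<d. if l = i then z i ^ j else 1)"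
    by (rule prod.cong) auto
  then show "z i ^ j = (\<Prod>l<d. z l ^ (if l = i then j else 0))" using assms by simp
qed (use assms in auto)

text \<open>The equation expresses \<open>x\<^sub>0\<^sup>2\<close> through the other variables:
  \<open>sg m 0 = 1\<close>.\<close>

lemma growth_quadric: assumes "m < n" shows "growth (Zq m n) n (\<lambda>i. mpoly_var (Suc i)) (mpoly_var 0)"
proof
  let ?Z = "Zq m n" and ?z = "\<lambda>i. mpoly_var (Suc i) :: pp" and ?w = "mpoly_var 0 :: pp"
  show Z: "idl ?Z" by (rule Zq_idl[OF assms])
  have base: "b \<in> zmon n ?z D \<Longrightarrow> b \<in> mspan ?Z (zmon n ?z D)" for b D
    by (rule mspan_base[OF Z finite_zmon])
  show "?w^2 \<in> mspan ?Z (zmon n ?z 2)"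
  proof (rule mspan_cong[OF Z])
    have "{..n} = insert 0 (Suc ` {..<n})" by (simp add: lessThan_Suc_atMost[symmetric] lessThan_Suc_eq_insert_0)
    then have "quadric_poly m n = ?w^2 + (\<Sum>i<n. cst (sg m (Suc i)) * ?z i ^ 2) - 1"
      using quadric_poly_eq[OF assms] by (simp add: sum.reindex sg_def)
    then have "?w^2 - (cst 1 * 1 + (\<Sum>i<n. cst (- sg m (Suc i)) * ?z i ^ 2)) = quadric_poly m n"
      by (simp add: cst.hom_uminus sum_negf)
    then show "?w^2 - (cst 1 * 1 + (\<Sum>i<n. cst (- sg m (Suc i)) * ?z i ^ 2)) \<in> ?Z"
      using Zq_quadric[OF assms] by simp
    show "cst 1 * 1 + (\<Sum>i<n. cst (- sg m (Suc i)) * ?z i ^ 2) \<in> mspan ?Z (zmon n ?z 2)"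
      by (intro mspan_add[OF Z] mspan_sum[OF Z] mspan_scale[OF Z] base zmon_one zmon_power) auto
  qed
  show "mpoly_var k \<in> mspan ?Z (zmon n ?z 1 \<union> (\<lambda>b. ?w * b) ` zmon n ?z 1)" for k
  proof (cases "k > n")
    case True
    then show ?thesis using mspan_cong[OF Z _ mspan_zero[OF Z]] Zq_var by auto
  next
    case False
    have "mpoly_var k \<in> zmon n ?z 1 \<union> (\<lambda>b. ?w * b) ` zmon n ?z 1"
    proof (cases k)
      case 0
      then show ?thesis using zmon_one[of n ?z 1] by force
    next
      case (Suc i)
      then show ?thesis using False zmon_power[of i n 1 1 ?z] by simp
    qed
    then show ?thesis by (intro mspan_base[OF Z]) (auto simp: finite_zmon)
  qed
qed

lemma growth_plane:
  assumes Z: "idl Z" and x: "\<And>k. mpoly_var k - (cst (a k) * s + cst (b k) * t) \<in> Z"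
    and eq: "cst \<alpha> * s^2 + cst \<beta> * t^2 - 1 \<in> Z" and \<alpha>: "\<alpha> \<noteq> 0"
  shows "growth Z 1 (\<lambda>_. t) s"
proof
  show "idl Z" by fact
  let ?z = "\<lambda>_::nat. t"
  show "s^2 \<in> mspan Z (zmon 1 ?z 2)"
  proof (rule mspan_cong[OF Z])
    have "s^2 - (cst (1/\<alpha>) * 1 + cst (- \<beta>/\<alpha>) * ?z 0 ^ 2) = cst (1/\<alpha>) * (cst \<alpha> * s^2 + cst \<beta> * t^2 - 1)"
    proof -
      have "cst (1/\<alpha>) * cst \<alpha> = 1" using \<alpha> by (simp add: cst.hom_mult[symmetric] del: cst.hom_mult)
      moreover have "cst (- \<beta>/\<alpha>) = - (cst (1/\<alpha>) * cst \<beta>)"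
        by (simp add: cst.hom_mult[symmetric] cst.hom_uminus[symmetric] del: cst.hom_mult cst.hom_uminus)
      ultimately show ?thesis by (simp add: right_diff_distrib distrib_left mult.assoc[symmetric])
    qed
    then show "s^2 - (cst (1/\<alpha>) * 1 + cst (- \<beta>/\<alpha>) * ?z 0 ^ 2) \<in> Z" using idl_mult[OF Z eq] by metis
    show "cst (1/\<alpha>) * 1 + cst (- \<beta>/\<alpha>) * ?z 0 ^ 2 \<in> mspan Z (zmon 1 ?z 2)"
      by (intro mspan_add[OF Z] mspan_scale[OF Z] mspan_base[OF Z finite_zmon] zmon_one zmon_power) auto
  qed
  fix k
  show "mpoly_var k \<in> mspan Z (zmon 1 ?z 1 \<union> (\<lambda>b. s * b) ` zmon 1 ?z 1)"
  proof (rule mspan_cong[OF Z x])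
    have "s * 1 \<in> (\<lambda>b. s * b) ` zmon 1 ?z 1" using zmon_one[of 1 ?z 1] by blast
    moreover have "t \<in> zmon 1 ?z 1" using zmon_power[of 0 1 1 1 ?z] by simp
    ultimately show "cst (a k) * s + cst (b k) * t \<in> mspan Z (zmon 1 ?z 1 \<union> (\<lambda>b. s * b) ` zmon 1 ?z 1)"
      by (intro mspan_add[OF Z] mspan_scale[OF Z] mspan_base[OF Z]) (auto simp: finite_zmon)
  qed
qed

lemma quadric_nullstellensatz:
  assumes mn: "m < n" and M: "mxm M" and ZM: "Zq m n \<subseteq> M"
  shows "\<exists>p\<in>quadric m n. M = pt_ideal p"
proof -
  interpret growth "Zq m n" n "\<lambda>i. mpoly_var (Suc i)" "mpoly_var 0" by (rule growth_quadric[OF mn])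
  obtain p where p: "M = pt_ideal p" "\<forall>k>n. p k = 0"
    using nullstellensatz[OF M ZM, of n] Zq_var by blast
  have "quadric_poly m n \<in> pt_ideal p" using ZM Zq_quadric[OF mn] p(1) by blast
  then have "p \<in> quadric m n" using p(2) by (simp add: pt_ideal_def ev_quadric_poly[OF mn] quadric_def)
  then show ?thesis using p by blast
qed

section \<open>Irreducibility by rational curves, and heights\<close>

definition van :: "(nat \<Rightarrow> complex) set \<Rightarrow> pp set" where "van Y = {f. \<forall>p\<in>Y. ev f p = 0}"

lemma van_idl: "idl (van Y)" by (auto simp: idl_def van_def)

definition rcurve :: "(nat \<Rightarrow> complex poly) \<Rightarrow> complex poly \<Rightarrow> complex \<Rightarrow> nat \<Rightarrow> complex"
  where "rcurve N d \<tau> = (\<lambda>k. poly (N k) \<tau> / poly d \<tau>)"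

text \<open>Polynomials in rational functions of \<open>\<tau>\<close> have the form
  \<open>F(\<tau>) / d(\<tau>)\<^sup>D\<close>.\<close>

lemma ev_rcurve:
  "\<exists>D F. \<forall>\<tau>. poly d \<tau> \<noteq> 0 \<longrightarrow> ev f (rcurve N d \<tau>) * poly d \<tau> ^ D = poly F \<tau>"
proof (induction f rule: pp_induct)
  case (const c) show ?case by (rule exI[of _ 0], rule exI[of _ "[:of_real c:]"]) simp
next
  case (var k) show ?case by (rule exI[of _ 1], rule exI[of _ "N k"]) (simp add: rcurve_def)
next
  case (add f g)
  then obtain D F E G where "\<And>\<tau>. poly d \<tau> \<noteq> 0 \<Longrightarrow> ev f (rcurve N d \<tau>) * poly d \<tau> ^ D = poly F \<tau>"
    "\<And>\<tau>. poly d \<tau> \<noteq> 0 \<Longrightarrow> ev g (rcurve N d \<tau>) * poly d \<tau> ^ E = poly G \<tau>" by blast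
  then have "poly d \<tau> \<noteq> 0 \<longrightarrow> ev (f + g) (rcurve N d \<tau>) * poly d \<tau> ^ (D + E) = poly (F * d ^ E + G * d ^ D) \<tau>" for \<tau>
    by (auto simp: power_add algebra_simps)
  then show ?case by blast
next
  case (mult f g)
  then obtain D F E G where "\<And>\<tau>. poly d \<tau> \<noteq> 0 \<Longrightarrow> ev f (rcurve N d \<tau>) * poly d \<tau> ^ D = poly F \<tau>"
    "\<And>\<tau>. poly d \<tau> \<noteq> 0 \<Longrightarrow> ev g (rcurve N d \<tau>) * poly d \<tau> ^ E = poly G \<tau>" by blast
  then have "poly d \<tau> \<noteq> 0 \<longrightarrow> ev (f * g) (rcurve N d \<tau>) * poly d \<tau> ^ (D + E) = poly (F * G) \<tau>" for \<tau>
    by (simp add: power_add) (metis mult.assoc mult.left_commute)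
  then show ?case by blast
qed

definition linked :: "(nat \<Rightarrow> complex) set \<Rightarrow> (nat \<Rightarrow> complex) \<Rightarrow> (nat \<Rightarrow> complex) \<Rightarrow> bool"
  where "linked Y p r \<longleftrightarrow> (\<exists>N d a b. poly d a \<noteq> 0 \<and> poly d b \<noteq> 0 \<and> rcurve N d a = p \<and> rcurve N d b = r \<and>
    (\<forall>\<tau>. poly d \<tau> \<noteq> 0 \<longrightarrow> rcurve N d \<tau> \<in> Y))"

text \<open>Along the curve, \<open>f\<close> and \<open>g\<close> become rational functions of
  one variable. Neither vanishes identically, so together they have only finitely many
  zeros.\<close>

lemma linked_nonvanishing:
  assumes "linked Y p r" "ev f p \<noteq> 0" "ev g r \<noteq> 0"
  shows "\<exists>q\<in>Y. ev f q \<noteq> 0 \<and> ev g q \<noteq> 0"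
proof -
  obtain N d a b where c: "poly d a \<noteq> 0" "poly d b \<noteq> 0" "rcurve N d a = p" "rcurve N d b = r"
    "\<And>\<tau>. poly d \<tau> \<noteq> 0 \<Longrightarrow> rcurve N d \<tau> \<in> Y" using assms(1) unfolding linked_def by blast
  obtain D F E G where F: "\<And>\<tau>. poly d \<tau> \<noteq> 0 \<Longrightarrow> ev f (rcurve N d \<tau>) * poly d \<tau> ^ D = poly F \<tau>"
    and G: "\<And>\<tau>. poly d \<tau> \<noteq> 0 \<Longrightarrow> ev g (rcurve N d \<tau>) * poly d \<tau> ^ E = poly G \<tau>"
    using ev_rcurve[of d f N] ev_rcurve[of d g N] by blast
  have "poly F a \<noteq> 0" "poly G b \<noteq> 0" using F[OF c(1)] G[OF c(2)] c assms by auto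
  then have "F * G * d \<noteq> 0" using c(1) by auto
  then have "finite {\<tau>. poly (F * G * d) \<tau> = 0}" by (rule poly_roots_finite)
  then obtain \<tau> where "poly (F * G * d) \<tau> \<noteq> 0"
    using infinite_UNIV_char_0[where 'a = complex] by (metis (mono_tags, lifting) UNIV_eq_I mem_Collect_eq)
  then have "poly F \<tau> \<noteq> 0" "poly G \<tau> \<noteq> 0" "poly d \<tau> \<noteq> 0" by auto
  then show ?thesis using F[of \<tau>] G[of \<tau>] c(5)[of \<tau>] by (metis mult_zero_left)
qed

lemma van_prm:
  assumes "Y \<noteq> {}" "\<And>p r. p \<in> Y \<Longrightarrow> r \<in> Y \<Longrightarrow> linked Y p r"
  shows "prm (van Y)"
  unfolding prm_def
proof (intro conjI allI impI)
  show "idl (van Y)" by (rule van_idl)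
  show "1 \<notin> van Y" using assms(1) by (auto simp: van_def)
  fix f g assume fg: "f * g \<in> van Y"
  show "f \<in> van Y \<or> g \<in> van Y"
  proof (rule ccontr)
    assume "\<not> ?thesis"
    then obtain p r where "p \<in> Y" "ev f p \<noteq> 0" "r \<in> Y" "ev g r \<noteq> 0" by (auto simp: van_def)
    then obtain q where "q \<in> Y" "ev f q \<noteq> 0" "ev g q \<noteq> 0"
      using linked_nonvanishing[OF assms(2)] by blast
    then show False using fg by (auto simp: van_def)
  qed
qed

subsection \<open>Charts of the quadric\<close>

text \<open>On the quadric, \<open>(x\<^sub>i - x\<^sub>j) (x\<^sub>i + x\<^sub>j)\<close> is a
  polynomial in the other coordinates when \<open>i \<le> m < j\<close>. With \<open>\<delta> =
  \<plusminus>1\<close>, the function \<open>u = x\<^sub>i - \<delta> x\<^sub>j\<close> and the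
  coordinates other than \<open>x\<^sub>i\<close>, \<open>x\<^sub>j\<close> are therefore
  coordinates on the open set where \<open>u\<close> does not vanish; \<open>chc\<close> lists
  them, with \<open>u\<close> at index \<open>i\<close>. A \<open>slice\<close> fixes some of
  these coordinates.\<close>

definition chc :: "nat \<Rightarrow> nat \<Rightarrow> real \<Rightarrow> nat \<Rightarrow> (nat \<Rightarrow> complex) \<Rightarrow> complex"
  where "chc i j \<delta> k p = (if k = i then p i - of_real \<delta> * p j else p k)"

definition slice :: "nat \<Rightarrow> nat \<Rightarrow> nat \<Rightarrow> nat \<Rightarrow> real \<Rightarrow> nat set \<Rightarrow> (nat \<Rightarrow> complex) \<Rightarrow> (nat \<Rightarrow> complex) set"
  where "slice m n i j \<delta> S a = {p \<in> quadric m n. chc i j \<delta> i p \<noteq> 0 \<and> (\<forall>k\<in>S. chc i j \<delta> k p = chc i j \<delta> k a)}"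

locale chart =
  fixes m n i j :: nat and \<delta> :: real
  assumes ij: "i \<le> m" "m < j" "j \<le> n" and d2: "\<delta> * \<delta> = 1"
begin

definition G :: "(nat \<Rightarrow> complex) \<Rightarrow> complex"
  where "G y = 1 - (\<Sum>k\<in>{..n} - {i, j}. sg m k * y k * y k)"

text \<open>The inverse of the chart: \<open>u = x\<^sub>i - \<delta> x\<^sub>j\<close> and
  \<open>G y = u (x\<^sub>i + \<delta> x\<^sub>j)\<close> determine \<open>x\<^sub>i\<close> and
  \<open>x\<^sub>j\<close>.\<close>

definition pnt :: "(nat \<Rightarrow> complex) \<Rightarrow> complex \<Rightarrow> nat \<Rightarrow> complex"
  where "pnt y u = (\<lambda>k. if k = i then (u * u + G y) / 2 / u
     else if k = j then of_real \<delta> * (G y - u * u) / 2 / u else if k \<le> n then y k else 0)"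

lemma dd: "complex_of_real \<delta> * (of_real \<delta> * x) = x"
  using d2 by (metis mult.assoc mult_1 of_real_1 of_real_mult)

lemma bil_split: "bil m n p p = p i * p i - p j * p j + (\<Sum>k\<in>{..n} - {i, j}. sg m k * p k * p k)"
  for p :: "nat \<Rightarrow> complex"
proof -
  have "{..n} = insert i (insert j ({..n} - {i, j}))" using ij by auto
  then have "bil m n p p = (\<Sum>k\<in>insert i (insert j ({..n} - {i, j})). sg m k * p k * p k)"
    unfolding bil_def by simp
  then show ?thesis using ij by (simp add: sg_def)
qed

lemma G_cong: "(\<And>k. k \<le> n \<Longrightarrow> k \<noteq> i \<Longrightarrow> k \<noteq> j \<Longrightarrow> y k = y' k) \<Longrightarrow> G y = G y'"
  unfolding G_def by (intro arg_cong[of _ _ "\<lambda>x. 1 - x"] sum.cong) auto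

lemma pnt_in: assumes "u \<noteq> 0" shows "pnt y u \<in> quadric m n" "chc i j \<delta> i (pnt y u) = u"
proof -
  have nij: "i \<noteq> j" using ij by simp
  have g: "(\<Sum>k\<in>{..n} - {i, j}. sg m k * pnt y u k * pnt y u k) = 1 - G y"
    unfolding G_def pnt_def by simp
  have "pnt y u i * pnt y u i - pnt y u j * pnt y u j = G y"
  proof -
    have "pnt y u j * pnt y u j = (G y - u * u) / 2 / u * ((G y - u * u) / 2 / u)"
      using nij dd[of "(G y - u * u) / 2 / u * ((G y - u * u) / 2 / u)"] by (simp add: pnt_def mult_ac)
    moreover have "pnt y u i = (u * u + G y) / 2 / u" by (simp add: pnt_def)
    moreover have "x * x - y' * y' = g" if "x = (u * u + g) / 2 / u" "y' = (g - u * u) / 2 / u" for x y' g :: complex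
      using assms by (simp add: that field_simps)
    ultimately show ?thesis by metis
  qed
  then show "pnt y u \<in> quadric m n" using g ij by (auto simp: quadric_def bil_split) (auto simp: pnt_def)
  have "of_real \<delta> * pnt y u j = (G y - u * u) / 2 / u"
    using nij dd[of "(G y - u * u) / 2 / u"] by (simp add: pnt_def)
  then show "chc i j \<delta> i (pnt y u) = u" using assms by (simp add: chc_def pnt_def field_simps)
qed

lemma pnt_self: assumes "p \<in> quadric m n" "chc i j \<delta> i p \<noteq> 0" shows "pnt p (chc i j \<delta> i p) = p"
proof -
  let ?u = "chc i j \<delta> i p" and ?v = "p i + of_real \<delta> * p j"
  have u: "?u = p i - of_real \<delta> * p j" by (simp add: chc_def)
  have G: "G p = ?u * ?v"
  proof -
    have "?u * ?v = p i * p i - of_real \<delta> * (of_real \<delta> * (p j * p j))" by (simp add: u algebra_simps)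
    then have "?u * ?v = p i * p i - p j * p j" unfolding dd .
    moreover have "p i * p i - p j * p j = G p"
      using assms(1) unfolding G_def by (simp add: quadric_def bil_split eq_diff_eq)
    ultimately show ?thesis by metis
  qed
  have "(x * x + x * v) / 2 / x = (x + v) / 2" "(x * v - x * x) / 2 / x = (v - x) / 2"
    if "x \<noteq> 0" for x v :: complex using that by (simp_all add: field_simps)
  note * = this[OF assms(2), of ?v]
  have i: "(?u * ?u + G p) / 2 / ?u = p i" unfolding G *(1) by (simp add: u)
  have "(G p - ?u * ?u) / 2 / ?u = (?v - ?u) / 2" unfolding G *(2) ..
  also have "\<dots> = of_real \<delta> * p j" by (simp add: u)
  finally have "of_real \<delta> * ((G p - ?u * ?u) / 2 / ?u) = p j" by (simp add: dd)
  then show ?thesis using i assms(1) by (auto simp: pnt_def quadric_def fun_eq_iff)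
qed

lemma chc_pnt: "k \<noteq> i \<Longrightarrow> k \<noteq> j \<Longrightarrow> k \<le> n \<Longrightarrow> chc i j \<delta> k (pnt y u) = y k"
  by (simp add: chc_def pnt_def)

lemma pnt_slice:
  assumes "S \<subseteq> {..n} - {j}" "u \<noteq> 0" "i \<in> S \<Longrightarrow> u = chc i j \<delta> i a" "\<And>k. k \<in> S \<Longrightarrow> k \<noteq> i \<Longrightarrow> y k = a k"
  shows "pnt y u \<in> slice m n i j \<delta> S a"
proof -
  have "chc i j \<delta> k (pnt y u) = chc i j \<delta> k a" if "k \<in> S" for k
    using that assms pnt_in(2)[OF assms(2)] chc_pnt[of k y u] by (cases "k = i") (auto simp: chc_def)
  then show ?thesis using pnt_in[OF assms(2)] assms(2) by (simp add: slice_def)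
qed

text \<open>In the coordinates of the chart a slice is an affine space without a hyperplane, so
  the line through two points joins them; \<open>pnt\<close> turns it into a rational curve with
  denominator \<open>u\<close>.\<close>

lemma slice_linked:
  assumes S: "S \<subseteq> {..n} - {j}" and p: "p \<in> slice m n i j \<delta> S a" and r: "r \<in> slice m n i j \<delta> S a"
  shows "linked (slice m n i j \<delta> S a) p r"
proof -
  define Y where "Y k = [:p k, r k - p k:]" for k
  define U where "U = [:chc i j \<delta> i p, chc i j \<delta> i r - chc i j \<delta> i p:]"
  define g where "g = 1 - (\<Sum>k\<in>{..n} - {i, j}. [:sg m k:] * Y k * Y k)"
  define N where "N k = (if k = i then smult (1/2) (U * U + g)
     else if k = j then smult (of_real \<delta> / 2) (g - U * U) else if k \<le> n then Y k * U else 0)" for k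
  have gG: "poly g \<tau> = G (\<lambda>k. poly (Y k) \<tau>)" for \<tau> by (simp add: g_def G_def poly_sum mult.assoc)
  have curve: "rcurve N U \<tau> = pnt (\<lambda>k. poly (Y k) \<tau>) (poly U \<tau>)" if "poly U \<tau> \<noteq> 0" for \<tau>
    using that ij unfolding rcurve_def N_def pnt_def gG[symmetric] by (auto simp: fun_eq_iff)
  have inY: "rcurve N U \<tau> \<in> slice m n i j \<delta> S a" if "poly U \<tau> \<noteq> 0" for \<tau>
    unfolding curve[OF that]
  proof (rule pnt_slice[OF S that])
    show "poly U \<tau> = chc i j \<delta> i a" if "i \<in> S" using that p r by (auto simp: U_def slice_def)
    show "poly (Y k) \<tau> = a k" if "k \<in> S" "k \<noteq> i" for k
    proof -
      have "chc i j \<delta> k p = chc i j \<delta> k a" "chc i j \<delta> k r = chc i j \<delta> k a"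
        using that(1) p r by (auto simp: slice_def)
      then show ?thesis using that(2) by (simp add: Y_def chc_def)
    qed
  qed
  have 0: "rcurve N U 0 = p" "poly U 0 \<noteq> 0"
    using p curve[of 0] pnt_self[of p] by (auto simp: U_def Y_def slice_def)
  have 1: "rcurve N U 1 = r" "poly U 1 \<noteq> 0"
    using r curve[of 1] pnt_self[of r] by (auto simp: U_def Y_def slice_def)
  show ?thesis unfolding linked_def using 0 1 inY by blast
qed

lemma slice_prm: "S \<subseteq> {..n} - {j} \<Longrightarrow> slice m n i j \<delta> S a \<noteq> {} \<Longrightarrow> prm (van (slice m n i j \<delta> S a))"
  by (rule van_prm) (auto intro: slice_linked)

text \<open>Fix the \<open>n\<close> chart coordinates of \<open>p\<close> one after the other.
  Each step shrinks the slice, and the ideals of the slices grow from that of the whole chart to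
  that of \<open>p\<close>.\<close>

lemma prime_chain:
  assumes p: "p \<in> quadric m n" "chc i j \<delta> i p \<noteq> 0"
  shows "\<exists>Q. (\<forall>l\<le>n. prm (Q l)) \<and> (\<forall>l<n. Q l \<subset> Q (Suc l)) \<and> Zq m n \<subseteq> Q 0 \<and> Q n = pt_ideal p"
proof -
  \<comment> \<open>enumerates the indices other than \<open>j\<close>\<close>
  define c where "c l = (if l < j then l else Suc l)" for l
  have inj: "c l = c l' \<longleftrightarrow> l = l'" for l l' by (auto simp: c_def)
  have cn: "l < n \<Longrightarrow> c l \<in> {..n} - {j}" for l using ij by (auto simp: c_def)
  have cimg: "c ` {..<n} = {..n} - {j}"
  proof
    show "c ` {..<n} \<subseteq> {..n} - {j}" using cn by auto
    show "{..n} - {j} \<subseteq> c ` {..<n}"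
    proof
      fix k assume k: "k \<in> {..n} - {j}"
      show "k \<in> c ` {..<n}"
      proof (cases "k < j")
        case True then show ?thesis using ij by (intro image_eqI[of _ _ k]) (auto simp: c_def)
      next
        case False then show ?thesis using k by (intro image_eqI[of _ _ "k - 1"]) (auto simp: c_def)
      qed
    qed
  qed
  let ?Y = "\<lambda>l. slice m n i j \<delta> (c ` {..<l}) p"
  have pY: "p \<in> ?Y l" for l using p by (simp add: slice_def)
  have sub: "l \<le> n \<Longrightarrow> c ` {..<l} \<subseteq> {..n} - {j}" for l
    using cn by (meson image_subsetI lessThan_iff less_le_trans)
  have "prm (van (?Y l))" if "l \<le> n" for l using slice_prm[OF sub[OF that]] pY by blast
  moreover have "van (?Y l) \<subset> van (?Y (Suc l))" if l: "l < n" for l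
  proof -
    have "?Y (Suc l) \<subseteq> ?Y l" by (auto simp: slice_def lessThan_Suc)
    then have s: "van (?Y l) \<subseteq> van (?Y (Suc l))" by (auto simp: van_def)
    define \<xi> where "\<xi> = (if c l = i then mpoly_var i - cst \<delta> * mpoly_var j else mpoly_var (c l))"
    have \<xi>: "ev \<xi> q = chc i j \<delta> (c l) q" for q by (auto simp: \<xi>_def chc_def)
    define A where "A = chc i j \<delta> (c l) p"
    \<comment> \<open>\<open>A\<close> is a root of this real polynomial in the next
      coordinate\<close>
    define f where "f = (\<xi> - cst (Re A))^2 + cst ((Im A)^2)"
    have "f \<in> van (?Y (Suc l))"
    proof -
      have "(A - of_real (Re A))^2 + of_real ((Im A)^2) = 0" by (simp add: complex_eq_iff power2_eq_square)
      then show ?thesis by (auto simp: van_def f_def \<xi> slice_def A_def)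
    qed
    moreover have "f \<notin> van (?Y l)"
    proof -
      \<comment> \<open>a value of the next coordinate that is neither \<open>A\<close>, nor its
        conjugate, nor 0\<close>
      define b where "b = complex_of_real (\<bar>Re A\<bar> + 1)"
      have b0: "b \<noteq> 0" unfolding b_def of_real_eq_0_iff by linarith
      define u where "u = (if c l = i then b else chc i j \<delta> i p)"
      define y where "y = p (c l := b)"
      have "c l \<notin> c ` {..<l}" using inj by auto
      have inY: "pnt y u \<in> ?Y l"
      proof (rule pnt_slice[OF sub])
        show "u \<noteq> 0" using b0 p by (simp add: u_def)
        show "u = chc i j \<delta> i p" if "i \<in> c ` {..<l}" using that \<open>c l \<notin> c ` {..<l}\<close> by (auto simp: u_def)
        show "y k = p k" if "k \<in> c ` {..<l}" for k
        proof -
          have "k \<noteq> c l" using that \<open>c l \<notin> c ` {..<l}\<close> by blast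
          then show ?thesis by (simp add: y_def)
        qed
      qed (use l in simp)
      have "chc i j \<delta> (c l) (pnt y u) = b"
      proof (cases "c l = i")
        case True then show ?thesis using pnt_in(2)[of u y] b0 by (simp add: u_def)
      next
        case False then show ?thesis using chc_pnt[of "c l" y u] cn[OF l] by (simp add: y_def)
      qed
      then have "ev f (pnt y u) = of_real ((\<bar>Re A\<bar> + 1 - Re A)^2 + (Im A)^2)"
        by (simp add: f_def \<xi> b_def)
      moreover have "(\<bar>Re A\<bar> + 1 - Re A)^2 + (Im A)^2 > 0"
        by (intro add_pos_nonneg zero_less_power) auto
      ultimately show ?thesis using inY unfolding van_def by (metis (mono_tags, lifting) less_irrefl mem_Collect_eq of_real_eq_0_iff)
    qed
    ultimately show ?thesis using s by blast
  qed
  moreover have "Zq m n \<subseteq> van (?Y 0)" using Zq_ev[of m n] ij by (auto simp: van_def slice_def)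
  moreover have "van (?Y n) = pt_ideal p"
  proof -
    have "q = p" if q: "q \<in> ?Y n" for q
    proof -
      have *: "chc i j \<delta> k q = chc i j \<delta> k p" if "k \<in> {..n} - {j}" for k
        using q that by (simp add: slice_def cimg)
      have u: "chc i j \<delta> i q = chc i j \<delta> i p" using *[of i] ij by auto
      have eq: "q k = p k" if "k \<le> n" "k \<noteq> i" "k \<noteq> j" for k using *[of k] that by (auto simp: chc_def)
      then have "G q = G p" by (intro G_cong) auto
      then have "pnt q (chc i j \<delta> i q) = pnt p (chc i j \<delta> i p)"
        unfolding u pnt_def using eq by (auto simp: fun_eq_iff)
      then show ?thesis using pnt_self[of q] pnt_self[OF p] q by (auto simp: slice_def)
    qed
    then have "?Y n = {p}" using pY by blast
    then show ?thesis by (auto simp: van_def pt_ideal_def)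
  qed
  ultimately show ?thesis by (intro exI[of _ "\<lambda>l. van (?Y l)"]) auto
qed

end

text \<open>The functions \<open>x\<^sub>i - x\<^sub>j\<close> and \<open>x\<^sub>i +
  x\<^sub>j\<close> with \<open>i \<le> m < j\<close> have no common zero on the quadric. Such
  pairs exist because \<open>m < n\<close>.\<close>

lemma ex_chart:
  assumes mn: "m < n" and p: "p \<in> quadric m n"
  shows "\<exists>i j \<delta>. chart m n i j \<delta> \<and> chc i j \<delta> i p \<noteq> 0"
proof -
  have "\<exists>i j. i \<le> m \<and> m < j \<and> j \<le> n \<and> (p i \<noteq> 0 \<or> p j \<noteq> 0)"
  proof (rule ccontr)
    assume "\<not> ?thesis"
    then have h: "p a = 0 \<and> p b = 0" if "a \<le> m" "m < b" "b \<le> n" for a b using that by blast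
    have "p k = 0" if "k \<le> n" for k
      using that mn h[of k n] h[of 0 k] by (cases "k \<le> m") auto
    then have "bil m n p p = 0" by (simp add: bil_def)
    then show False using p by (simp add: quadric_def)
  qed
  then obtain i j where ij: "i \<le> m" "m < j" "j \<le> n" "p i \<noteq> 0 \<or> p j \<noteq> 0" by blast
  have "p i - p j \<noteq> 0 \<or> p i + p j \<noteq> 0"
  proof (rule ccontr)
    assume a: "\<not> ?thesis"
    then have "2 * p i = 0" "2 * p j = 0" by (auto simp: algebra_simps eq_neg_iff_add_eq_0)
    then show False using ij(4) by simp
  qed
  then have "chc i j 1 i p \<noteq> 0 \<or> chc i j (-1) i p \<noteq> 0" by (simp add: chc_def)
  moreover have "chart m n i j 1" "chart m n i j (-1)" using ij by (auto simp: chart_def)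
  ultimately show ?thesis by blast
qed

text \<open>Each chart is irreducible, and any two charts meet: all of them contain the point
  \<open>e\<close>.\<close>

lemma quadric_irreducible:
  assumes mn: "m < n" and p: "p \<in> quadric m n" "ev f p \<noteq> 0" and r: "r \<in> quadric m n" "ev g r \<noteq> 0"
  shows "\<exists>q\<in>quadric m n. ev f q \<noteq> 0 \<and> ev g q \<noteq> 0"
proof -
  obtain i j \<delta> where c1: "chart m n i j \<delta>" "chc i j \<delta> i p \<noteq> 0" using ex_chart[OF mn p(1)] by blast
  obtain i' j' \<delta>' where c2: "chart m n i' j' \<delta>'" "chc i' j' \<delta>' i' r \<noteq> 0" using ex_chart[OF mn r(1)] by blast
  define u where "u = mpoly_var i' - cst \<delta>' * mpoly_var j'"
  have u: "ev u q = chc i' j' \<delta>' i' q" for q by (simp add: u_def chc_def)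
  let ?Y = "slice m n i j \<delta> {} p" and ?Y' = "slice m n i' j' \<delta>' {} r"
  \<comment> \<open>\<open>x\<^sub>i \<plusminus> x\<^sub>j\<close> does not vanish at this point
    for any \<open>i \<le> m < j\<close>\<close>
  define e where "e = (\<lambda>k. if k \<le> m then complex_of_real (1 / sqrt (of_nat (Suc m))) else 0)"
  have e0: "1 / sqrt (of_nat (Suc m)) \<noteq> 0" by simp
  have eX: "e \<in> quadric m n"
  proof -
    have "bil m n e e = (\<Sum>k\<le>n. if k \<le> m then of_real (1 / of_nat (Suc m)) else 0)"
      unfolding bil_def by (rule sum.cong) (auto simp: sg_def e_def of_real_mult[symmetric] simp del: of_real_mult)
    also have "\<dots> = (\<Sum>k\<in>{..m}. of_real (1 / of_nat (Suc m)))"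
      by (rule sum.mono_neutral_cong_right) (use mn in auto)
    also have "\<dots> = complex_of_real (\<Sum>k\<in>{..m}. 1 / of_nat (Suc m))" by (simp only: of_real_sum)
    also have "(\<Sum>k\<in>{..m}. 1 / of_nat (Suc m)) = (1::real)" by simp
    finally show ?thesis using mn by (auto simp: quadric_def e_def)
  qed
  have eC: "chc a b c a e \<noteq> 0" if "chart m n a b c" for a b c
    using that e0 by (auto simp: chart_def chc_def e_def)
  have pY: "p \<in> ?Y" "e \<in> ?Y" using p c1 eX eC by (auto simp: slice_def)
  obtain q where q: "q \<in> ?Y" "ev f q \<noteq> 0" "ev u q \<noteq> 0"
    using linked_nonvanishing[OF chart.slice_linked[OF c1(1) _ pY] p(2), of u] eC[OF c2(1)] u by auto
  then have qY: "q \<in> ?Y'" "r \<in> ?Y'" using r c2 by (auto simp: slice_def u)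
  show ?thesis
    using linked_nonvanishing[OF chart.slice_linked[OF c2(1) _ qY] q(2) r(2)] by (auto simp: slice_def)
qed

subsection \<open>Dimension and height\<close>

lemma (in presented) prime_height_ge:
  assumes "\<forall>l\<le>k. prm (Q l)" "\<forall>l<k. Q l \<subset> Q (Suc l)" "ker \<subseteq> Q 0"
  shows "enat k \<le> prime_height R (\<pi> ` Q k)"
  unfolding prime_height_def
proof (rule Sup_upper)
  have kQ: "ker \<subseteq> Q l" if "l \<le> k" for l
    using that
  proof (induction l)
    case (Suc l)
    then have "Q l \<subset> Q (Suc l)" "ker \<subseteq> Q l" using assms(2) by auto
    then show ?case by blast
  qed (use assms in simp)
  have pq: "pre (\<pi> ` Q l) = Q l" if "l \<le> k" for l
    using pre_image[OF prm_idl kQ[OF that]] assms(1) that by blast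
  have "chain_of_length (\<lambda>P. primeideal P R) k (\<lambda>l. \<pi> ` Q l)"
    unfolding chain_of_length_def
  proof (intro conjI allI impI)
    show "primeideal (\<pi> ` Q l) R" if "l \<le> k" for l using primeideal_image kQ assms(1) that by blast
    show "\<pi> ` Q l \<subset> \<pi> ` Q (Suc l)" if "l < k" for l
    proof -
      have "Q l \<subset> Q (Suc l)" using assms(2) that by blast
      moreover have "\<pi> ` Q l \<noteq> \<pi> ` Q (Suc l)"
      proof
        assume "\<pi> ` Q l = \<pi> ` Q (Suc l)"
        then have "pre (\<pi> ` Q l) = pre (\<pi> ` Q (Suc l))" by (rule arg_cong)
        then have "Q l = Q (Suc l)"
          unfolding pq[OF less_imp_le[OF that]] pq[OF Suc_leI[OF that]] .
        then show False using \<open>Q l \<subset> Q (Suc l)\<close> by blast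
      qed
      ultimately show ?thesis unfolding psubset_eq by (blast intro: image_mono)
    qed
  qed
  then show "enat k \<in> {enat ka |ka. \<exists>C. chain_of_length (\<lambda>P. primeideal P R) ka C \<and> C ka = \<pi> ` Q k}"
    by auto
qed

lemma prime_height_le_krull: "prime_height R P \<le> krull_dim R"
  unfolding prime_height_def krull_dim_def by (rule Sup_subset_mono) auto

text \<open>The upper bound comes from counting, the lower bound from the chain of primes below an
  arbitrary closed point.\<close>

lemma quadric_dimension:
  assumes mn: "m < n"
  shows "krull_dim (quadric_ring m n) = enat n"
    and "maximalideal M (quadric_ring m n) \<Longrightarrow> prime_height (quadric_ring m n) M = enat n"
proof -
  let ?R = "quadric_ring m n"
  interpret presented ?R "proj m n" by (rule presented_proj[OF mn])
  have kz: "ker = Zq m n" using ker_proj[OF mn] by simp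
  interpret gr: growth "Zq m n" n "\<lambda>i. mpoly_var (Suc i)" "mpoly_var 0" by (rule growth_quadric[OF mn])
  have le: "krull_dim ?R \<le> enat n"
  proof (rule krull_dim_le)
    fix k Q assume a: "\<And>i. i \<le> k \<Longrightarrow> prm (Q i)" "\<And>i. i < k \<Longrightarrow> Q i \<subset> Q (Suc i)" "ker \<subseteq> Q 0"
    show "k \<le> n" by (rule gr.chain_bound[of k Q, OF a(1,2) a(3)[unfolded kz]])
  qed
  have ht: "prime_height ?R M = enat n" if M: "maximalideal M ?R" for M
  proof -
    have iM: "ideal M ?R" using M by (simp add: maximalideal_def)
    obtain p where p: "p \<in> quadric m n" "pre M = pt_ideal p"
      using quadric_nullstellensatz[OF mn mxm_pre[OF M]] ker_sub[OF iM] kz by auto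
    obtain i j \<delta> where c: "chart m n i j \<delta>" "chc i j \<delta> i p \<noteq> 0" using ex_chart[OF mn p(1)] by blast
    obtain Q where Q: "\<forall>l\<le>n. prm (Q l)" "\<forall>l<n. Q l \<subset> Q (Suc l)" "Zq m n \<subseteq> Q 0" "Q n = pt_ideal p"
      using chart.prime_chain[OF c(1) p(1) c(2)] by blast
    have "enat n \<le> prime_height ?R (proj m n ` Q n)" by (rule prime_height_ge) (use Q kz in auto)
    moreover have "proj m n ` Q n = M" using Q(4) p(2) image_pre[OF ideal_carrier[OF iM]] by simp
    ultimately show ?thesis using prime_height_le_krull[of ?R M] le by (metis order_antisym order_trans)
  qed
  then show "maximalideal M ?R \<Longrightarrow> prime_height ?R M = enat n" .
  have "1 \<notin> Zq m n"
  proof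
    assume "1 \<in> Zq m n"
    have "(\<lambda>k. if k = 0 then 1 else 0) \<in> quadric m n"
      using mn by (auto simp: quadric_def bil_def sg_def if_distrib sum.delta cong: if_cong)
    then show False using Zq_ev[OF mn \<open>1 \<in> Zq m n\<close>] by auto
  qed
  then obtain M where "mxm M" "Zq m n \<subseteq> M" using ex_mxm[OF Zq_idl[OF mn]] by blast
  then have "maximalideal (proj m n ` M) ?R" using maximalideal_image kz by auto
  then have "enat n \<le> krull_dim ?R" using ht prime_height_le_krull by metis
  then show "krull_dim ?R = enat n" using le by simp
qed

section \<open>A Bertini theorem\<close>

lemma det_ne0_iff:
  fixes a :: "nat \<Rightarrow> nat \<Rightarrow> complex"
  shows "det (mat N N (\<lambda>(i, k). a i k)) \<noteq> 0 \<longleftrightarrow>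
    (\<forall>b. (\<forall>k<N. (\<Sum>i<N. b i * a i k) = 0) \<longrightarrow> (\<forall>i<N. b i = 0))"
proof -
  let ?A = "mat N N (\<lambda>(k, i). a i k)"
  have "det (mat N N (\<lambda>(i, k). a i k)) = det (transpose_mat (mat N N (\<lambda>(i, k). a i k)))"
    by (rule det_transpose[symmetric]) auto
  also have "transpose_mat (mat N N (\<lambda>(i, k). a i k)) = ?A" by (rule eq_matI) auto
  finally have d: "det (mat N N (\<lambda>(i, k). a i k)) = det ?A" .
  have mv: "?A *\<^sub>v v = 0\<^sub>v N \<longleftrightarrow> (\<forall>k<N. (\<Sum>i<N. v $ i * a i k) = 0)" if "v \<in> carrier_vec N" for v
    using that by (auto simp: vec_eq_iff scalar_prod_def atLeast0LessThan mult.commute)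
  have "det ?A = 0 \<longleftrightarrow> (\<exists>v. v \<in> carrier_vec N \<and> v \<noteq> 0\<^sub>v N \<and> ?A *\<^sub>v v = 0\<^sub>v N)"
    by (rule det_0_iff_vec_prod_zero) simp
  also have "\<dots> \<longleftrightarrow> (\<exists>b. (\<forall>k<N. (\<Sum>i<N. b i * a i k) = 0) \<and> \<not> (\<forall>i<N. b i = 0))"
  proof
    assume "\<exists>v. v \<in> carrier_vec N \<and> v \<noteq> 0\<^sub>v N \<and> ?A *\<^sub>v v = 0\<^sub>v N"
    then obtain v where v: "v \<in> carrier_vec N" "v \<noteq> 0\<^sub>v N" "?A *\<^sub>v v = 0\<^sub>v N" by blast
    then show "\<exists>b. (\<forall>k<N. (\<Sum>i<N. b i * a i k) = 0) \<and> \<not> (\<forall>i<N. b i = 0)"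
      using mv[OF v(1)] by (intro exI[of _ "\<lambda>i. v $ i"]) (auto simp: vec_eq_iff)
  next
    assume "\<exists>b. (\<forall>k<N. (\<Sum>i<N. b i * a i k) = 0) \<and> \<not> (\<forall>i<N. b i = 0)"
    then obtain b where b: "\<forall>k<N. (\<Sum>i<N. b i * a i k) = 0" "\<not> (\<forall>i<N. b i = 0)" by blast
    have "?A *\<^sub>v vec N b = 0\<^sub>v N" using b(1) mv[of "vec N b"] by simp
    moreover have "vec N b \<noteq> 0\<^sub>v N" using b(2) by (auto simp: vec_eq_iff)
    ultimately show "\<exists>v. v \<in> carrier_vec N \<and> v \<noteq> 0\<^sub>v N \<and> ?A *\<^sub>v v = 0\<^sub>v N"
      by (intro exI[of _ "vec N b"]) simp
  qed
  finally show ?thesis using d by auto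
qed

text \<open>The zero \<open>p\<close> of \<open>F\<close> is nondegenerate on the quadric: the
  differentials of the \<open>F i\<close> and of the equation are linearly independent.\<close>

definition nondeg :: "nat \<Rightarrow> nat \<Rightarrow> (nat \<Rightarrow> pp) \<Rightarrow> (nat \<Rightarrow> complex) \<Rightarrow> bool"
  where "nondeg m n F p \<longleftrightarrow>
    (\<forall>b c. (\<forall>k\<le>n. (\<Sum>i<n. b i * ev (pd k (F i)) p) + c * ev (pd k (quadric_poly m n)) p = 0)
       \<longrightarrow> (\<forall>i<n. b i = 0) \<and> c = 0)"

text \<open>The Jacobian determinant with rows \<open>r i\<close> and the gradient of the
  equation; it is square since there are \<open>n + 1\<close> variables.\<close>

definition jac :: "nat \<Rightarrow> nat \<Rightarrow> (nat \<Rightarrow> nat \<Rightarrow> pp) \<Rightarrow> pp"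
  where "jac m n r = det (mat (Suc n) (Suc n) (\<lambda>(i, k). if i < n then r i k else pd k (quadric_poly m n)))"

lemma ev_jac: "ev (jac m n r) p = det (mat (Suc n) (Suc n) (\<lambda>(i, k). if i < n then ev (r i k) p else ev (pd k (quadric_poly m n)) p))"
proof -
  have M: "map_mat (\<lambda>f. ev f p) (mat (Suc n) (Suc n) (\<lambda>(i, k). if i < n then r i k else pd k (quadric_poly m n)))
    = mat (Suc n) (Suc n) (\<lambda>(i, k). if i < n then ev (r i k) p else ev (pd k (quadric_poly m n)) p)"
    by (rule eq_matI) auto
  show ?thesis unfolding jac_def M[symmetric] by (rule ev.hom_det[symmetric])
qed

lemma ev_jac_ne0_iff:
  "ev (jac m n r) p \<noteq> 0 \<longleftrightarrow>
    (\<forall>b c. (\<forall>k\<le>n. (\<Sum>i<n. b i * ev (r i k) p) + c * ev (pd k (quadric_poly m n)) p = 0)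
       \<longrightarrow> (\<forall>i<n. b i = 0) \<and> c = 0)"
  (is "_ \<longleftrightarrow> ?R")
proof -
  let ?a = "\<lambda>i k. if i < n then ev (r i k) p else ev (pd k (quadric_poly m n)) p"
  have s: "(\<Sum>i<Suc n. b i * ?a i k) = (\<Sum>i<n. b i * ev (r i k) p) + b n * ev (pd k (quadric_poly m n)) p" for b k
    by simp
  have "ev (jac m n r) p \<noteq> 0 \<longleftrightarrow> (\<forall>b. (\<forall>k<Suc n. (\<Sum>i<Suc n. b i * ?a i k) = 0) \<longrightarrow> (\<forall>i<Suc n. b i = 0))"
    unfolding ev_jac by (rule det_ne0_iff)
  also have "\<dots> \<longleftrightarrow> ?R"
  proof
    assume L: "\<forall>b. (\<forall>k<Suc n. (\<Sum>i<Suc n. b i * ?a i k) = 0) \<longrightarrow> (\<forall>i<Suc n. b i = 0)"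
    show ?R
    proof (intro allI impI)
      fix b c assume h: "\<forall>k\<le>n. (\<Sum>i<n. b i * ev (r i k) p) + c * ev (pd k (quadric_poly m n)) p = 0"
      let ?b = "\<lambda>i. if i < n then b i else c"
      have "(\<Sum>i<Suc n. ?b i * ?a i k) = 0" if "k < Suc n" for k
        unfolding s using h that by simp
      then have z: "\<forall>i<Suc n. ?b i = 0" by (intro L[THEN spec[of _ ?b], THEN mp]) auto
      have "b i = 0" if "i < n" for i using z[rule_format, of i] that by simp
      moreover have "c = 0" using z[rule_format, of n] by simp
      ultimately show "(\<forall>i<n. b i = 0) \<and> c = 0" by blast
    qed
  next
    assume R: ?R
    show "\<forall>b. (\<forall>k<Suc n. (\<Sum>i<Suc n. b i * ?a i k) = 0) \<longrightarrow> (\<forall>i<Suc n. b i = 0)"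
      unfolding s
    proof (intro allI impI)
      fix b i assume h: "\<forall>k<Suc n. (\<Sum>i<n. b i * ev (r i k) p) + b n * ev (pd k (quadric_poly m n)) p = 0" and i: "i < Suc n"
      have "(\<forall>i<n. b i = 0) \<and> b n = 0"
        by (rule R[THEN spec[of _ b], THEN spec[of _ "b n"], THEN mp]) (intro allI impI h[rule_format] le_imp_less_Suc)
      then show "b i = 0" using i by (auto simp: less_Suc_eq)
    qed
  qed
  finally show ?thesis .
qed

lemma nonvanishing_point:
  fixes c :: "('i \<Rightarrow> nat) \<Rightarrow> real"
  assumes "finite I" "\<exists>e\<in>I \<rightarrow>\<^sub>E {..<E}. c e \<noteq> 0"
  shows "\<exists>\<mu>. (\<Sum>e\<in>I \<rightarrow>\<^sub>E {..<E}. c e * (\<Prod>i\<in>I. \<mu> i ^ e i)) \<noteq> 0"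
  using assms
proof (induction I arbitrary: c rule: finite_induct)
  case empty then show ?case by auto
next
  case (insert i S)
  define r where "r \<mu> l = (\<Sum>e\<in>S \<rightarrow>\<^sub>E {..<E}. c (e(i := l)) * (\<Prod>j\<in>S. \<mu> j ^ e j))" for \<mu> l
  have split: "(\<Sum>e\<in>insert i S \<rightarrow>\<^sub>E {..<E}. c e * (\<Prod>j\<in>insert i S. \<mu> j ^ e j)) = (\<Sum>l<E. \<mu> i ^ l * r \<mu> l)" for \<mu>
    unfolding sum_PiE_insert[OF insert.hyps(2,1)] r_def sum_distrib_left
  proof (intro sum.cong refl)
    fix l e
    have "(\<Prod>j\<in>S. \<mu> j ^ (e(i := l)) j) = (\<Prod>j\<in>S. \<mu> j ^ e j)"
      by (rule prod.cong) (use insert.hyps in auto)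
    then show "c (e(i := l)) * (\<Prod>j\<in>insert i S. \<mu> j ^ (e(i := l)) j) = \<mu> i ^ l * (c (e(i := l)) * (\<Prod>j\<in>S. \<mu> j ^ e j))"
      using insert.hyps by simp
  qed
  obtain e where e: "e \<in> insert i S \<rightarrow>\<^sub>E {..<E}" "c e \<noteq> 0" using insert.prems by blast
  then obtain l e' where l: "l < E" "e' \<in> S \<rightarrow>\<^sub>E {..<E}" "e = e'(i := l)" by (auto simp: PiE_insert_eq)
  then have "\<exists>e\<in>S \<rightarrow>\<^sub>E {..<E}. c (e(i := l)) \<noteq> 0" using e by blast
  from insert.IH[OF this] obtain \<mu> where \<mu>: "r \<mu> l \<noteq> 0" unfolding r_def by blast
  define P where "P = (\<Sum>l<E. monom (r \<mu> l) l)"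
  have "coeff P l = r \<mu> l" using l(1) by (simp add: P_def coeff_sum)
  then have "P \<noteq> 0" using \<mu> by auto
  then have "finite {x. poly P x = 0}" by (rule poly_roots_finite)
  then obtain x where x: "poly P x \<noteq> 0"
    using infinite_UNIV_char_0[where 'a = real] by (metis (mono_tags, lifting) UNIV_eq_I mem_Collect_eq)
  have "r (\<mu>(i := x)) l = r \<mu> l" for l
  proof -
    have "(\<Prod>j\<in>S. (\<mu>(i := x)) j ^ e j) = (\<Prod>j\<in>S. \<mu> j ^ e j)" for e
      by (rule prod.cong) (use insert.hyps in auto)
    then show ?thesis unfolding r_def by simp
  qed
  then have "(\<Sum>l<E. (\<mu>(i := x)) i ^ l * r (\<mu>(i := x)) l) = poly P x"
    by (simp add: P_def poly_sum poly_monom mult.commute)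
  then show ?case using x split[of "\<mu>(i := x)"] by (intro exI[of _ "\<mu>(i := x)"]) simp
qed

text \<open>With \<open>z = x / \<delta>\<close> for suitable coordinates \<open>x\<close> and
  small \<open>\<delta>\<close>, the rows are dominated by those of the coordinates. As a
  polynomial in \<open>\<delta>\<close> the rescaled determinant does not vanish at
  \<open>\<delta> = 0\<close>, hence not at some nonzero real \<open>\<delta>\<close>.\<close>

lemma bertini_start:
  assumes mn: "m < n" and p0: "p0 \<in> quadric m n" "ev H p0 \<noteq> 0"
  shows "\<exists>z. ev (jac m n (\<lambda>i k. H * pd k (f i + z i * H) - (f i + z i * H) * pd k H)) p0 \<noteq> 0"
proof -
  have "\<exists>k\<le>n. p0 k \<noteq> 0"
  proof (rule ccontr)
    assume "\<not> ?thesis"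
    then have "bil m n p0 p0 = 0" by (simp add: bil_def)
    then show False using p0(1) by (simp add: quadric_def)
  qed
  then obtain k0 where k0: "k0 \<le> n" "p0 k0 \<noteq> 0" by blast
  \<comment> \<open>the \<open>n\<close> coordinates other than \<open>x\<^sub>k\<^sub>0\<close>
    are independent on the tangent space at \<open>p0\<close>\<close>
  define c where "c i = (if i < k0 then i else Suc i)" for i
  have c: "c i = c i' \<longleftrightarrow> i = i'" "c i \<noteq> k0" "i < n \<Longrightarrow> c i \<le> n" for i i' using k0 by (auto simp: c_def)
  define R where "R i k = ev (H * pd k (f i) - f i * pd k H) p0" for i k
  define T where "T i k = ev H p0 ^ 2 * (if c i = k then 1 else 0)" for i k
  define M where "M = mat (Suc n) (Suc n) (\<lambda>(i, k). if i < n then [:T i k, R i k:] else [:ev (pd k (quadric_poly m n)) p0:])"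
  define D where "D = det M"
  have D: "poly D \<delta> = det (mat (Suc n) (Suc n) (\<lambda>(i, k). if i < n then T i k + \<delta> * R i k else ev (pd k (quadric_poly m n)) p0))" for \<delta>
  proof -
    interpret ph: comm_ring_hom "\<lambda>P. poly P \<delta>" by unfold_locales simp_all
    have M: "map_mat (\<lambda>P. poly P \<delta>) M = mat (Suc n) (Suc n) (\<lambda>(i, k). if i < n then T i k + \<delta> * R i k else ev (pd k (quadric_poly m n)) p0)"
      unfolding M_def by (rule eq_matI) auto
    show ?thesis unfolding D_def M[symmetric] by (rule ph.hom_det[symmetric])
  qed
  have "poly D 0 \<noteq> 0"
    unfolding D det_ne0_iff
  proof (intro allI impI)
    fix b i assume h: "\<forall>k<Suc n. (\<Sum>i<Suc n. b i * (if i < n then T i k + 0 * R i k else ev (pd k (quadric_poly m n)) p0)) = 0"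
    have h': "(\<Sum>i<n. b i * T i k) + b n * (2 * sg m k * p0 k) = 0" if "k \<le> n" for k
      using h that by (simp add: pd_quadric_poly[OF mn])
    have "(\<Sum>i<n. b i * T i k0) = 0" using c by (simp add: T_def)
    then have bn: "b n = 0" using h'[OF k0(1)] k0 by (auto simp: sg_def split: if_splits)
    have bi: "b i = 0" if "i < n" for i
    proof -
      have "(\<Sum>j<n. b j * T j (c i)) = (\<Sum>j<n. if j = i then b i * ev H p0 ^ 2 else 0)"
        by (rule sum.cong) (auto simp: T_def c)
      then show ?thesis using h'[of "c i"] c(3)[OF that] that bn p0 by simp
    qed
    assume "i < Suc n" then show "b i = 0" using bn bi by (auto simp: less_Suc_eq)
  qed
  then have "D \<noteq> 0" by auto
  then have fin: "finite {\<tau>. poly D \<tau> = 0}" by (rule poly_roots_finite)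
  have inf: "infinite (complex_of_real ` (UNIV - {0}))"
    by (subst finite_image_iff) (auto simp: inj_on_def infinite_UNIV_char_0)
  obtain \<delta> where \<delta>: "\<delta> \<noteq> (0::real)" "poly D (of_real \<delta>) \<noteq> 0"
  proof -
    have "\<not> complex_of_real ` (UNIV - {0}) \<subseteq> {\<tau>. poly D \<tau> = 0}" using fin inf finite_subset by blast
    then show thesis using that by blast
  qed
  define z where "z i = cst (1/\<delta>) * mpoly_var (c i)" for i
  have row: "ev (H * pd k (f i + z i * H) - (f i + z i * H) * pd k H) p0 = of_real (1/\<delta>) * (T i k + of_real \<delta> * R i k)" for i k
    using \<delta>(1) by (simp add: z_def T_def R_def power2_eq_square algebra_simps)
  have "ev (jac m n (\<lambda>i k. H * pd k (f i + z i * H) - (f i + z i * H) * pd k H)) p0 \<noteq> 0"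
    unfolding ev_jac_ne0_iff
  proof (intro allI impI)
    fix b c' assume h: "\<forall>k\<le>n. (\<Sum>i<n. b i * ev (H * pd k (f i + z i * H) - (f i + z i * H) * pd k H) p0) + c' * ev (pd k (quadric_poly m n)) p0 = 0"
    let ?b = "\<lambda>i. if i < n then b i * of_real (1/\<delta>) else c'"
    have "(\<Sum>i<Suc n. ?b i * (if i < n then T i k + of_real \<delta> * R i k else ev (pd k (quadric_poly m n)) p0)) = 0" if "k < Suc n" for k
    proof -
      have sm: "(\<Sum>i<n. b i * ev (H * pd k (f i + z i * H) - (f i + z i * H) * pd k H) p0) = (\<Sum>i<n. ?b i * (T i k + of_real \<delta> * R i k))"
        by (rule sum.cong) (simp_all only: row lessThan_iff if_True mult.assoc)
      have e1: "(\<Sum>i<Suc n. ?b i * (if i < n then T i k + of_real \<delta> * R i k else ev (pd k (quadric_poly m n)) p0))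
          = (\<Sum>i<n. ?b i * (T i k + of_real \<delta> * R i k)) + c' * ev (pd k (quadric_poly m n)) p0"
        by simp
      show ?thesis unfolding e1 sm[symmetric] by (rule h[rule_format]) (use that in simp)
    qed
    then have "\<forall>i<Suc n. ?b i = 0"
      by (intro \<delta>(2)[unfolded D det_ne0_iff, THEN spec[of _ ?b], THEN mp]) blast
    then have z: "?b i = 0" if "i < Suc n" for i using that by blast
    have "b i = 0" if "i < n" for i using z[of i] that \<delta>(1) by simp
    moreover have "c' = 0" using z[of n] by simp
    ultimately show "(\<forall>i<n. b i = 0) \<and> c' = 0" by blast
  qed
  then show ?thesis by blast
qed

text \<open>Where \<open>H\<close> does not vanish, the zeros of all \<open>a i - \<mu> i *
  H\<close> are the fibre over \<open>\<mu>\<close> of the map with components \<open>a i /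
  H\<close>, and up to a power of \<open>H\<close> the determinant \<open>W\<close> is the
  Jacobian of this map. The map is a submersion at one point, so \<open>W\<close> does not vanish
  identically. By counting, the \<open>n + 1\<close> functions \<open>a i / H\<close> and
  \<open>W\<close> satisfy an algebraic relation. After cancelling powers of \<open>W\<close>,
  which is allowed as the quadric is irreducible, its part of degree 0 in \<open>W\<close> is a
  nonzero polynomial in the \<open>a i / H\<close> that vanishes wherever \<open>W\<close> does.
  For \<open>\<mu>\<close> outside the zeros of this polynomial every point of the fibre is
  nondegenerate. This replaces an appeal to Sard's theorem and works with real
  \<open>\<mu>\<close>.\<close>

lemma bertini_step:
  assumes mn: "m < n"
  shows "\<exists>e. \<forall>p\<in>quadric m n. (\<forall>i<n. ev (f i + e i * H) p = 0) \<longrightarrow> ev H p \<noteq> 0 \<longrightarrow> nondeg m n (\<lambda>i. f i + e i * H) p"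
proof (cases "\<forall>p\<in>quadric m n. ev H p = 0")
  case True then show ?thesis by blast
next
  case False
  then obtain p0 where p0: "p0 \<in> quadric m n" "ev H p0 \<noteq> 0" by blast
  obtain z where z: "ev (jac m n (\<lambda>i k. H * pd k (f i + z i * H) - (f i + z i * H) * pd k H)) p0 \<noteq> 0"
    using bertini_start[OF mn p0] by blast
  define a where "a i = f i + z i * H" for i
  define W where "W = jac m n (\<lambda>i k. H * pd k (a i) - a i * pd k H)"
  have W0: "ev W p0 \<noteq> 0" using z by (simp add: W_def a_def)
  interpret gr: growth "Zq m n" n "\<lambda>i. mpoly_var (Suc i)" "mpoly_var 0" by (rule growth_quadric[OF mn])
  define a' where "a' i = (if i < n then a i else W)" for i
  obtain D0 where D0: "\<forall>i\<in>{..<Suc n}. a' i \<in> gr.V D0" using gr.V_common[of "{..<Suc n}" a'] by blast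
  obtain D1 where D1: "H \<in> gr.V D1" using gr.V_all by blast
  define D where "D = max D0 D1"
  have D: "a' i \<in> gr.V D" if "i < Suc n" for i using D0 that gr.V_mono[of D0 D "a' i"] by (auto simp: D_def)
  have DH: "H \<in> gr.V D" using D1 gr.V_mono[of D1 D] by (auto simp: D_def)
  \<comment> \<open>multiplying by \<open>H\<^sup>n\<^sup>E\<close> clears the denominators of the
    monomials in \<open>a i / H\<close>\<close>
  let ?g = "\<lambda>E e. (\<Prod>i<Suc n. a' i ^ e i) * H ^ (n * E - (\<Sum>i<n. e i))"
  have g: "?g E e \<in> gr.V ((Suc n * (D + 4) + n * (D + 2) + 2) * E)" if E: "E \<ge> 1" and e: "e \<in> {..<Suc n} \<rightarrow>\<^sub>E {..<E}" for E e
  proof -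
    have 1: "(\<Prod>i<Suc n. a' i ^ e i) \<in> gr.V (card {..<Suc n} * (E * (D + 2) + 2))"
      by (rule gr.V_prod) (use D e in \<open>auto simp: PiE_iff less_imp_le\<close>)
    have 2: "H ^ (n * E - (\<Sum>i<n. e i)) \<in> gr.V ((n * E - (\<Sum>i<n. e i)) * (D + 2))"
      by (rule gr.V_power[OF DH])
    have 3: "?g E e \<in> gr.V (card {..<Suc n} * (E * (D + 2) + 2) + (n * E - (\<Sum>i<n. e i)) * (D + 2) + 2)"
      by (rule gr.V_mult[OF 1 2])
    have "card {..<Suc n} * (E * (D + 2) + 2) \<le> Suc n * (D + 4) * E"
    proof -
      have "E * (D + 2) + 2 \<le> (D + 4) * E" using E by (simp add: algebra_simps)
      then have "Suc n * (E * (D + 2) + 2) \<le> Suc n * ((D + 4) * E)" by (rule mult_le_mono2)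
      then show ?thesis by (simp only: card_lessThan mult.assoc)
    qed
    moreover have "(n * E - (\<Sum>i<n. e i)) * (D + 2) \<le> n * (D + 2) * E"
    proof -
      have "(n * E - (\<Sum>i<n. e i)) * (D + 2) \<le> (n * E) * (D + 2)" by (rule mult_le_mono1) simp
      then show ?thesis by (simp only: mult_ac)
    qed
    moreover have "2 \<le> 2 * E" using E by simp
    ultimately have "card {..<Suc n} * (E * (D + 2) + 2) + (n * E - (\<Sum>i<n. e i)) * (D + 2) + 2
        \<le> Suc n * (D + 4) * E + n * (D + 2) * E + 2 * E" by linarith
    also have "\<dots> = (Suc n * (D + 4) + n * (D + 2) + 2) * E" by (simp only: distrib_right)
    finally show ?thesis using 3 gr.V_mono by blast
  qed
  obtain E cc where nz: "\<exists>e\<in>{..<Suc n} \<rightarrow>\<^sub>E {..<E}. cc e \<noteq> 0"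
    and inZ: "(\<Sum>e\<in>{..<Suc n} \<rightarrow>\<^sub>E {..<E}. cst (cc e) * ?g E e) \<in> Zq m n"
    using gr.dependent_family[OF lessI, of ?g, OF g] by blast
  define r where "r l = (\<Sum>e\<in>{..<n} \<rightarrow>\<^sub>E {..<E}. cst (cc (e(n := l))) * ((\<Prod>i<n. a i ^ e i) * H ^ (n * E - (\<Sum>i<n. e i))))" for l
  have ins: "{..<Suc n} = insert n {..<n}" by auto
  have "(\<Sum>e\<in>{..<Suc n} \<rightarrow>\<^sub>E {..<E}. cst (cc e) * ?g E e) = (\<Sum>l<E. W ^ l * r l)"
  proof -
    have t: "cst (cc (e(n := l))) * ((\<Prod>i\<in>insert n {..<n}. a' i ^ (e(n := l)) i) * H ^ (n * E - (\<Sum>i<n. (e(n := l)) i)))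
      = W ^ l * (cst (cc (e(n := l))) * ((\<Prod>i<n. a i ^ e i) * H ^ (n * E - (\<Sum>i<n. e i))))" for l e
    proof -
      have "(\<Prod>i<n. a' i ^ (e(n := l)) i) = (\<Prod>i<n. a i ^ e i)"
        by (rule prod.cong) (auto simp: a'_def)
      moreover have "(\<Sum>i<n. (e(n := l)) i) = (\<Sum>i<n. e i)" by (rule sum.cong) auto
      moreover have "a' n = W" by (simp add: a'_def)
      ultimately show ?thesis by (simp add: mult_ac)
    qed
    have nn: "n \<notin> {..<n}" by simp
    show ?thesis
      unfolding ins r_def sum_distrib_left sum_PiE_insert[OF nn finite_lessThan] t ..
  qed
  moreover
  let ?P = "\<lambda>l. l < E \<and> (\<exists>e\<in>{..<n} \<rightarrow>\<^sub>E {..<E}. cc (e(n := l)) \<noteq> 0)"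
  obtain e where e: "e \<in> {..<Suc n} \<rightarrow>\<^sub>E {..<E}" "cc e \<noteq> 0" using nz by blast
  then obtain l' e' where "l' < E" "e' \<in> {..<n} \<rightarrow>\<^sub>E {..<E}" "e = e'(n := l')"
    unfolding ins by (auto simp: PiE_insert_eq)
  then have ex: "\<exists>l. ?P l" using e by blast
  define l0 where "l0 = (LEAST l. ?P l)"
  have l0: "?P l0" unfolding l0_def by (rule LeastI_ex[OF ex])
  have low: "r l = 0" if "l < l0" for l
    unfolding r_def using not_less_Least[OF that[unfolded l0_def]] l0 that by (intro sum.neutral) auto
  ultimately obtain h where h: "(\<Sum>e\<in>{..<Suc n} \<rightarrow>\<^sub>E {..<E}. cst (cc e) * ?g E e) = W ^ l0 * (r l0 + W * h)"
    using sum_least_power[of l0 E r W] l0 by metis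
  have Gz: "ev (r l0 + W * h) p = 0" if p: "p \<in> quadric m n" for p
  proof (rule ccontr)
    assume "ev (r l0 + W * h) p \<noteq> 0"
    then obtain q where q: "q \<in> quadric m n" "ev (r l0 + W * h) q \<noteq> 0" "ev W q \<noteq> 0"
      using quadric_irreducible[OF mn p _ p0(1) W0] by blast
    have "ev (W ^ l0 * (r l0 + W * h)) q = 0" using Zq_ev[OF mn inZ[unfolded h] q(1)] .
    then show False using q by (simp only: ev.hom_mult ev.hom_power) simp
  qed
  obtain \<mu> where \<mu>: "(\<Sum>e\<in>{..<n} \<rightarrow>\<^sub>E {..<E}. cc (e(n := l0)) * (\<Prod>i<n. \<mu> i ^ e i)) \<noteq> (0::real)"
    using nonvanishing_point[of "{..<n}" E "\<lambda>e. cc (e(n := l0))"] l0 by auto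
  define e where "e i = z i - cst (\<mu> i)" for i
  have F: "f i + e i * H = a i - cst (\<mu> i) * H" for i by (simp add: e_def a_def algebra_simps)
  have "nondeg m n (\<lambda>i. f i + e i * H) p" if p: "p \<in> quadric m n" and zero: "\<forall>i<n. ev (f i + e i * H) p = 0" and Hp: "ev H p \<noteq> 0" for p
  proof -
    have ai: "ev (a i) p = of_real (\<mu> i) * ev H p" if "i < n" for i
      using zero that unfolding F by simp
    have "ev (r l0) p = (\<Sum>e\<in>{..<n} \<rightarrow>\<^sub>E {..<E}. of_real (cc (e(n := l0)) * (\<Prod>i<n. \<mu> i ^ e i)) * ev H p ^ (n * E))"
      unfolding r_def ev.hom_sum
    proof (rule sum.cong[OF refl])
      fix e assume e: "e \<in> {..<n} \<rightarrow>\<^sub>E {..<E}"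
      have "(\<Sum>i<n. e i) \<le> (\<Sum>i<n. E)" by (rule sum_mono) (use e in \<open>auto simp: PiE_iff less_imp_le\<close>)
      then have le: "(\<Sum>i<n. e i) \<le> n * E" by simp
      have "(\<Prod>i<n. ev (a i) p ^ e i) = (\<Prod>i<n. of_real (\<mu> i) ^ e i * ev H p ^ e i)"
        by (rule prod.cong) (simp_all add: ai power_mult_distrib)
      also have "\<dots> = (\<Prod>i<n. of_real (\<mu> i) ^ e i) * ev H p ^ (\<Sum>i<n. e i)"
        by (simp add: prod.distrib power_sum)
      finally have "(\<Prod>i<n. ev (a i) p ^ e i) * ev H p ^ (n * E - (\<Sum>i<n. e i)) = (\<Prod>i<n. of_real (\<mu> i) ^ e i) * ev H p ^ (n * E)"
        using le by (simp add: mult.assoc power_add[symmetric])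
      then show "ev (cst (cc (e(n := l0))) * ((\<Prod>i<n. a i ^ e i) * H ^ (n * E - (\<Sum>i<n. e i)))) p
         = of_real (cc (e(n := l0)) * (\<Prod>i<n. \<mu> i ^ e i)) * ev H p ^ (n * E)"
        by (simp add: mult.assoc)
    qed
    also have "\<dots> = of_real (\<Sum>e\<in>{..<n} \<rightarrow>\<^sub>E {..<E}. cc (e(n := l0)) * (\<Prod>i<n. \<mu> i ^ e i)) * ev H p ^ (n * E)"
      by (simp add: sum_distrib_right)
    finally have "ev (r l0) p \<noteq> 0" using \<mu> Hp by (simp del: of_real_sum)
    then have Wp: "ev W p \<noteq> 0" using Gz[OF p] by auto
    show ?thesis
      unfolding nondeg_def
    proof (intro allI impI)
      fix b c assume hb: "\<forall>k\<le>n. (\<Sum>i<n. b i * ev (pd k (f i + e i * H)) p) + c * ev (pd k (quadric_poly m n)) p = 0"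
      have row: "ev (H * pd k (a i) - a i * pd k H) p = ev H p * ev (pd k (f i + e i * H)) p" if "i < n" for i k
        unfolding F using ai[OF that] by (simp add: algebra_simps)
      have "(\<Sum>i<n. (b i / ev H p) * ev (H * pd k (a i) - a i * pd k H) p) = (\<Sum>i<n. b i * ev (pd k (f i + e i * H)) p)" for k
        by (rule sum.cong) (use Hp in \<open>simp_all only: lessThan_iff row\<close>, simp)
      then have "\<forall>k\<le>n. (\<Sum>i<n. (b i / ev H p) * ev (H * pd k (a i) - a i * pd k H) p) + c * ev (pd k (quadric_poly m n)) p = 0"
        using hb by simp
      then have "(\<forall>i<n. b i / ev H p = 0) \<and> c = 0"
        by (rule Wp[unfolded W_def ev_jac_ne0_iff, THEN spec[of _ "\<lambda>i. b i / ev H p"], THEN spec[of _ c], THEN mp])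
      then show "(\<forall>i<n. b i = 0) \<and> c = 0" using Hp by simp
    qed
  qed
  then show ?thesis by blast
qed

lemma nondeg_cong:
  assumes "\<And>i k. i < n \<Longrightarrow> k \<le> n \<Longrightarrow> ev (pd k (F i)) p = ev (pd k (F' i)) p" "nondeg m n F p"
  shows "nondeg m n F' p"
  unfolding nondeg_def
proof (intro allI impI)
  fix b c assume h: "\<forall>k\<le>n. (\<Sum>i<n. b i * ev (pd k (F' i)) p) + c * ev (pd k (quadric_poly m n)) p = 0"
  have "(\<Sum>i<n. b i * ev (pd k (F i)) p) = (\<Sum>i<n. b i * ev (pd k (F' i)) p)" if "k \<le> n" for k
    by (rule sum.cong) (use assms(1) that in auto)
  then show "(\<forall>i<n. b i = 0) \<and> c = 0" using h
    by (intro assms(2)[unfolded nondeg_def, THEN spec[of _ b], THEN spec[of _ c], THEN mp]) simp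
qed

text \<open>One function \<open>h j\<close> after the other. The square makes the value and the
  first derivatives of the correction vanish where \<open>h j\<close> does, so zeros treated
  before stay nondegenerate.\<close>

theorem bertini:
  fixes r :: nat
  assumes mn: "m < n"
  shows "\<exists>e. \<forall>p\<in>quadric m n. (\<forall>i<n. ev (f i + (\<Sum>j<r. h j ^ 2 * e i j)) p = 0) \<longrightarrow> (\<exists>j<r. ev (h j) p \<noteq> 0) \<longrightarrow>
     nondeg m n (\<lambda>i. f i + (\<Sum>j<r. h j ^ 2 * e i j)) p"
proof (induction r)
  case 0 show ?case by simp
next
  case (Suc r)
  then obtain e where e: "\<And>p. p \<in> quadric m n \<Longrightarrow> \<forall>i<n. ev (f i + (\<Sum>j<r. h j ^ 2 * e i j)) p = 0 \<Longrightarrow> \<exists>j<r. ev (h j) p \<noteq> 0 \<Longrightarrow>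
     nondeg m n (\<lambda>i. f i + (\<Sum>j<r. h j ^ 2 * e i j)) p" by blast
  define F where "F i = f i + (\<Sum>j<r. h j ^ 2 * e i j)" for i
  obtain g where g: "\<And>p. p \<in> quadric m n \<Longrightarrow> \<forall>i<n. ev (F i + g i * h r ^ 2) p = 0 \<Longrightarrow> ev (h r ^ 2) p \<noteq> 0 \<Longrightarrow>
      nondeg m n (\<lambda>i. F i + g i * h r ^ 2) p"
    using bertini_step[OF mn, of F "h r ^ 2"] by blast
  define e' where "e' i = (e i)(r := g i)" for i
  have F': "f i + (\<Sum>j<Suc r. h j ^ 2 * e' i j) = F i + g i * h r ^ 2" for i
  proof -
    have "(\<Sum>j<r. h j ^ 2 * e' i j) = (\<Sum>j<r. h j ^ 2 * e i j)" by (rule sum.cong) (auto simp: e'_def)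
    then show ?thesis by (simp add: F_def e'_def mult.commute add.assoc)
  qed
  show ?case
  proof (rule exI[of _ e'], intro ballI impI, unfold F')
    fix p assume p: "p \<in> quadric m n" and z: "\<forall>i<n. ev (F i + g i * h r ^ 2) p = 0" and ex: "\<exists>j<Suc r. ev (h j) p \<noteq> 0"
    show "nondeg m n (\<lambda>i. F i + g i * h r ^ 2) p"
    proof (cases "ev (h r) p = 0")
      case False then show ?thesis using g[OF p z] by simp
    next
      case True
      then have "\<exists>j<r. ev (h j) p \<noteq> 0" using ex by (metis less_Suc_eq)
      moreover have "\<forall>i<n. ev (F i) p = 0" using z True by simp
      ultimately have "nondeg m n F p" using e[OF p] unfolding F_def by blast
      then show ?thesis by (rule nondeg_cong[rotated]) (simp add: True)
    qed
  qed
qed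

section \<open>Generators of the maximal ideals and curves through the points\<close>

text \<open>The ideal generated by \<open>F 0, \<dots>, F (n - 1)\<close> together with
  \<open>Z\<close>.\<close>

definition gen :: "nat \<Rightarrow> (nat \<Rightarrow> 'p::comm_ring_1) \<Rightarrow> 'p set \<Rightarrow> 'p set"
  where "gen n F Z = {f. \<exists>c. f - (\<Sum>i<n. c i * F i) \<in> Z}"

lemma genI: "f - (\<Sum>i<n. c i * F i) \<in> Z \<Longrightarrow> f \<in> gen n F Z"
  unfolding gen_def by blast

lemma gen_idl: assumes "idl Z" shows "idl (gen n F Z)"
  unfolding idl_def
proof (intro conjI ballI allI)
  show "0 \<in> gen n F Z" unfolding gen_def using idl_zero[OF assms] by (auto intro: exI[of _ "\<lambda>_. 0"])
next
  fix a b assume "a \<in> gen n F Z" "b \<in> gen n F Z"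
  then obtain c d where cd: "a - (\<Sum>i<n. c i * F i) \<in> Z" "b - (\<Sum>i<n. d i * F i) \<in> Z" unfolding gen_def by blast
  have eq: "a + b - (\<Sum>i<n. (c i + d i) * F i) = (a - (\<Sum>i<n. c i * F i)) + (b - (\<Sum>i<n. d i * F i))"
    by (simp add: distrib_right sum.distrib)
  show "a + b \<in> gen n F Z"
    by (rule genI[where c = "\<lambda>i. c i + d i"]) (simp only: eq idl_add[OF assms cd])
next
  fix a r assume "a \<in> gen n F Z"
  then obtain c where c: "a - (\<Sum>i<n. c i * F i) \<in> Z" unfolding gen_def by blast
  have eq: "r * a - (\<Sum>i<n. (r * c i) * F i) = r * (a - (\<Sum>i<n. c i * F i))"
    by (simp add: right_diff_distrib sum_distrib_left mult.assoc)
  show "r * a \<in> gen n F Z"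
    by (rule genI[where c = "\<lambda>i. r * c i"]) (simp only: eq idl_mult[OF assms c])
qed

lemma gen_base: assumes "idl Z" shows "Z \<subseteq> gen n F Z"
  unfolding gen_def by (auto intro!: exI[of _ "\<lambda>_. 0"])

lemma gen_mem: assumes "idl Z" "i < n" shows "F i \<in> gen n F Z"
proof -
  have "(\<Sum>j<n. (if j = i then 1 else 0) * F j) = (\<Sum>j<n. if j = i then F j else 0)" by (rule sum.cong) auto
  then have eq: "F i - (\<Sum>j<n. (if j = i then 1 else 0) * F j) = 0" using assms by simp
  show ?thesis
    by (rule genI[where c = "\<lambda>j. if j = i then 1 else 0"]) (simp only: eq idl_zero[OF assms(1)])
qed

lemma gen_least: assumes "idl Q" "Z \<subseteq> Q" "\<And>i. i < n \<Longrightarrow> F i \<in> Q" shows "gen n F Z \<subseteq> Q"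
proof
  fix f assume "f \<in> gen n F Z"
  then obtain c where "f - (\<Sum>i<n. c i * F i) \<in> Z" unfolding gen_def by blast
  moreover have "(\<Sum>i<n. c i * F i) \<in> Q" by (intro idl_sum idl_mult assms) auto
  ultimately show "f \<in> Q" using idl_eqI[OF assms(1)] assms(2) by blast
qed

text \<open>The two properties of a closed point on which the theorem rests: its ideal is a
  complete intersection, and the point is principal on an integral curve. The growth condition
  says that the curve has dimension one.\<close>

definition good_point :: "nat \<Rightarrow> nat \<Rightarrow> (nat \<Rightarrow> complex) \<Rightarrow> bool"
  where "good_point m n p \<longleftrightarrow>
    (\<exists>L. pt_ideal p = gen n L (Zq m n) \<and> nondeg m n L p) \<and>
    (\<exists>P f z w. prm P \<and> Zq m n \<subseteq> P \<and> growth P 1 z w \<and> f \<notin> P \<and> pt_ideal p = isum P (princ f))"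

lemma bil_add: "bil m n (\<lambda>k. a k + b k) c = bil m n a c + bil m n b c"
  by (simp add: bil_def distrib_left distrib_right sum.distrib)
lemma bil_scale: "bil m n (\<lambda>k. s * a k) c = s * bil m n a c"
  by (simp add: bil_def sum_distrib_left mult_ac)
lemma bil_sym: "bil m n a b = bil m n b a"
  by (simp add: bil_def mult_ac)
lemma bil_of_real: "bil m n (\<lambda>k. complex_of_real (a k)) (\<lambda>k. complex_of_real (b k)) = of_real (bil m n a b)"
  by (simp add: bil_def of_real_sg)

lemma bil_comb:
  "bil m n (\<lambda>k. s * a k + t * b k) (\<lambda>k. s * a k + t * b k) = s^2 * bil m n a a + 2 * s * t * bil m n a b + t^2 * bil m n b b"
  for a b :: "nat \<Rightarrow> 'a::comm_ring_1"
proof -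
  have "bil m n (\<lambda>k. s * a k + t * b k) (\<lambda>k. s * a k + t * b k)
     = s * (s * bil m n a a + t * bil m n b a) + t * (s * bil m n a b + t * bil m n b b)"
    by (simp only: bil_add bil_scale bil_sym[of m n _ "\<lambda>k. s * a k + t * b k"])
  then show ?thesis by (simp add: bil_sym[of m n b a] power2_eq_square algebra_simps)
qed

text \<open>A section of the quadric by the plane spanned by two real vectors \<open>w\<close> and
  \<open>y\<close> that are orthogonal for the form. A nonzero minor of \<open>w\<close> and
  \<open>y\<close> allows to write the coordinates \<open>s\<close>, \<open>t\<close> on the
  plane, and the equations \<open>L k\<close> of the plane, with real coefficients. On the plane,
  the equation of the quadric reads \<open>\<alpha> s\<^sup>2 + \<beta> t\<^sup>2 =
  1\<close>.\<close>

locale section_plane =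
  fixes m n a b :: nat and w y :: "nat \<Rightarrow> real"
  assumes mn: "m < n" and sup: "\<And>k. k > n \<Longrightarrow> w k = 0 \<and> y k = 0" and ab: "a \<le> n" "b \<le> n"
    and indep: "w a * y b - w b * y a \<noteq> 0" and orth: "bil m n w y = 0"
begin

definition "\<Delta> = w a * y b - w b * y a"
definition "s = cst (y b / \<Delta>) * mpoly_var a - cst (y a / \<Delta>) * mpoly_var b"
definition "t = cst (w a / \<Delta>) * mpoly_var b - cst (w b / \<Delta>) * mpoly_var a"
definition "L k = mpoly_var k - (cst (w k) * s + cst (y k) * t)"
abbreviation "\<alpha> \<equiv> bil m n w w"
abbreviation "\<beta> \<equiv> bil m n y y"

lemma ne: "a \<noteq> b" using indep by auto

lemma \<Delta>0: "\<Delta> \<noteq> 0" using indep by (simp add: \<Delta>_def)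

lemma st_plane:
  assumes "p = (\<lambda>k. S * of_real (w k) + T * of_real (y k))"
  shows "ev s p = S" "ev t p = T" "ev (L k) p = 0"
proof -
  have D: "complex_of_real \<Delta> \<noteq> 0" using \<Delta>0 by simp
  have "ev s p * of_real \<Delta> = of_real (y b) * p a - of_real (y a) * p b"
    using D by (simp add: s_def field_simps)
  also have "\<dots> = S * of_real \<Delta>" by (simp add: assms \<Delta>_def algebra_simps)
  finally show s: "ev s p = S" using D by simp
  have "ev t p * of_real \<Delta> = of_real (w a) * p b - of_real (w b) * p a"
    using D by (simp add: t_def field_simps)
  also have "\<dots> = T * of_real \<Delta>" by (simp add: assms \<Delta>_def algebra_simps)
  finally show t: "ev t p = T" using D by simp
  show "ev (L k) p = 0" using s t by (simp add: L_def assms)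
qed

lemma L_ab: "ev (L a) p = 0" "ev (L b) p = 0" "L a = 0" "L b = 0"
proof -
  have "L a = mpoly_var a - ((cst (w a) * cst (y b / \<Delta>) - cst (y a) * cst (w b / \<Delta>)) * mpoly_var a
     + (cst (y a) * cst (w a / \<Delta>) - cst (w a) * cst (y a / \<Delta>)) * mpoly_var b)"
    by (simp add: L_def s_def t_def algebra_simps)
  also have "cst (w a) * cst (y b / \<Delta>) - cst (y a) * cst (w b / \<Delta>) = cst ((w a * y b - w b * y a) / \<Delta>)"
    by (simp only: cst.hom_mult[symmetric] cst.hom_minus[symmetric]) (simp add: diff_divide_distrib mult.commute)
  also have "(w a * y b - w b * y a) / \<Delta> = 1" using \<Delta>0 by (simp add: \<Delta>_def)
  also have "cst (y a) * cst (w a / \<Delta>) - cst (w a) * cst (y a / \<Delta>) = 0"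
    by (simp only: cst.hom_mult[symmetric] cst.hom_minus[symmetric]) (simp add: mult.commute)
  finally show a: "L a = 0" by simp
  have "L b = mpoly_var b - ((cst (y b) * cst (w a / \<Delta>) - cst (w b) * cst (y a / \<Delta>)) * mpoly_var b
     + (cst (w b) * cst (y b / \<Delta>) - cst (y b) * cst (w b / \<Delta>)) * mpoly_var a)"
    by (simp add: L_def s_def t_def algebra_simps)
  also have "cst (y b) * cst (w a / \<Delta>) - cst (w b) * cst (y a / \<Delta>) = cst ((w a * y b - w b * y a) / \<Delta>)"
    by (simp only: cst.hom_mult[symmetric] cst.hom_minus[symmetric]) (simp add: diff_divide_distrib mult.commute)
  also have "(w a * y b - w b * y a) / \<Delta> = 1" using \<Delta>0 by (simp add: \<Delta>_def)
  also have "cst (w b) * cst (y b / \<Delta>) - cst (y b) * cst (w b / \<Delta>) = 0"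
    by (simp only: cst.hom_mult[symmetric] cst.hom_minus[symmetric]) (simp add: mult.commute)
  finally show b: "L b = 0" by simp
  show "ev (L a) p = 0" "ev (L b) p = 0" by (simp_all add: a b)
qed

lemma ideal_facts:
  assumes Q: "idl Q" "Zq m n \<subseteq> Q" and LQ: "\<And>k. k \<le> n \<Longrightarrow> k \<noteq> a \<Longrightarrow> k \<noteq> b \<Longrightarrow> L k \<in> Q"
  shows "L k \<in> Q" "cst \<alpha> * s^2 + cst \<beta> * t^2 - 1 \<in> Q"
proof -
  show L: "L k \<in> Q" for k
  proof (cases "k \<le> n")
    case True then show ?thesis using LQ[of k] L_ab idl_zero[OF Q(1)] by (cases "k = a \<or> k = b") auto
  next
    case False
    then have "mpoly_var k \<in> Q" using Zq_var[of n k m] Q(2) by auto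
    then show ?thesis using sup[of k] False by (simp add: L_def)
  qed
  let ?x = "\<lambda>k. cst (w k) * s + cst (y k) * t"
  have sq: "mpoly_var k ^ 2 - ?x k ^ 2 \<in> Q" for k
  proof -
    have "mpoly_var k ^ 2 - ?x k ^ 2 = L k * (mpoly_var k + ?x k)" by (simp add: L_def power2_eq_square algebra_simps)
    then show ?thesis using idl_mult2[OF Q(1) L] by simp
  qed
  have "(\<Sum>k\<le>n. cst (sg m k) * ?x k ^ 2) = cst \<alpha> * s^2 + cst (2 * bil m n w y) * (s * t) + cst \<beta> * t^2"
    by (simp add: bil_def cst.hom_sum cst.hom_mult sum_distrib_left sum_distrib_right power2_eq_square algebra_simps sum.distrib
        del: mult_cancel_left mult_cancel_right cst.hom_numeral)
  then have e: "(\<Sum>k\<le>n. cst (sg m k) * ?x k ^ 2) = cst \<alpha> * s^2 + cst \<beta> * t^2" using orth by simp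
  have "(cst \<alpha> * s^2 + cst \<beta> * t^2 - 1) - quadric_poly m n = - (\<Sum>k\<le>n. cst (sg m k) * (mpoly_var k ^ 2 - ?x k ^ 2))"
    unfolding e[symmetric] quadric_poly_eq[OF mn] by (simp add: right_diff_distrib sum_subtractf)
  also have "\<dots> \<in> Q" by (intro idl_minus[OF Q(1)] idl_sum[OF Q(1)] idl_mult[OF Q(1)] sq)
  finally show "cst \<alpha> * s^2 + cst \<beta> * t^2 - 1 \<in> Q"
    using idl_eqI[OF Q(1)] Zq_quadric[OF mn] Q(2) by blast
qed

lemma pd_s: "ev (pd k s) p = (if k = a then of_real (y b / \<Delta>) else if k = b then - of_real (y a / \<Delta>) else 0)"
  using ne by (auto simp: s_def)
lemma pd_t: "ev (pd k t) p = (if k = b then of_real (w a / \<Delta>) else if k = a then - of_real (w b / \<Delta>) else 0)"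
  using ne by (auto simp: t_def)

lemma contract_st:
  fixes v :: "nat \<Rightarrow> real"
  shows "(\<Sum>k\<le>n. of_real (v k) * ev (pd k s) p) = of_real ((y b * v a - y a * v b) / \<Delta>)"
    "(\<Sum>k\<le>n. of_real (v k) * ev (pd k t) p) = of_real ((w a * v b - w b * v a) / \<Delta>)"
proof -
  have two: "(\<Sum>k\<le>n. of_real (v k) * (if k = a then A else if k = b then B else 0)) = of_real (v a) * A + of_real (v b) * B" for A B :: complex
  proof -
    have "(\<Sum>k\<le>n. of_real (v k) * (if k = a then A else if k = b then B else 0)) = (\<Sum>k\<in>{a, b}. of_real (v k) * (if k = a then A else if k = b then B else 0))"
      by (rule sum.mono_neutral_right) (use ab in auto)
    then show ?thesis using ne by simp
  qed
  show "(\<Sum>k\<le>n. of_real (v k) * ev (pd k s) p) = of_real ((y b * v a - y a * v b) / \<Delta>)"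
    unfolding pd_s two using \<Delta>0 by (simp add: field_simps)
  have sw: "(if k = b then A else if k = a then B else 0) = (if k = a then B else if k = b then A else 0)" for k and A B :: complex
    using ne by auto
  show "(\<Sum>k\<le>n. of_real (v k) * ev (pd k t) p) = of_real ((w a * v b - w b * v a) / \<Delta>)"
    unfolding pd_t sw two using \<Delta>0 by (simp add: field_simps)
qed

text \<open>The hypotheses on \<open>f\<close> say that \<open>f\<close> is a local parameter of
  the conic at \<open>p\<close> and vanishes at no other closed point of it. They give generators
  of the ideal of \<open>p\<close>: the linear equations of the plane and \<open>f\<close>. The
  rational parametrization \<open>rcurve N d\<close> makes the ideal of the curve prime.\<close>

lemma plane_point:
  assumes p: "p \<in> quadric m n" "p = (\<lambda>k. S0 * of_real (w k) + T0 * of_real (y k))"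
    and f: "ev f p = 0" "\<And>k. ev (pd k f) p = A * ev (pd k s) p + B * ev (pd k t) p"
    and AB: "A * bil m n p (\<lambda>k. of_real (y k)) - B * bil m n p (\<lambda>k. of_real (w k)) \<noteq> 0"
    and cont: "\<And>Q. idl Q \<Longrightarrow> (\<And>k. L k \<in> Q) \<Longrightarrow> cst \<alpha> * s^2 + cst \<beta> * t^2 - 1 \<in> Q \<Longrightarrow> f \<in> Q \<Longrightarrow> pt_ideal p \<subseteq> Q"
    and ab0: "\<alpha> \<noteq> 0 \<or> \<beta> \<noteq> 0"
    and curve: "\<And>\<tau>. poly d \<tau> \<noteq> 0 \<Longrightarrow> \<exists>S T. rcurve N d \<tau> = (\<lambda>k. S * of_real (w k) + T * of_real (y k)) \<and> of_real \<alpha> * S^2 + of_real \<beta> * T^2 = 1"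
    and cp: "poly d \<tau>0 \<noteq> 0" "rcurve N d \<tau>0 = p" and cf: "poly d \<tau>1 \<noteq> 0" "ev f (rcurve N d \<tau>1) \<noteq> 0"
  shows "good_point m n p"
  unfolding good_point_def
proof
  let ?Z = "Zq m n" and ?q = "quadric_poly m n"
  note Z = Zq_idl[OF mn]
  let ?I = "{..n} - {a, b}"
  have "card ?I = n - 1" using ab ne by (simp add: card_Diff_subset)
  then obtain h where h: "bij_betw h {..<n - 1} ?I"
    using ex_bij_betw_nat_finite[of ?I] by (auto simp: atLeast0LessThan)
  define K where "K i = (if i < n - 1 then L (h i) else f)" for i
  have n: "n = Suc (n - 1)" using mn by simp
  have hI: "h i \<in> ?I" if "i < n - 1" for i using h that by (auto simp: bij_betw_def)
  show "\<exists>L. pt_ideal p = gen n L ?Z \<and> nondeg m n L p"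
  proof (intro exI[of _ K] conjI)
    show "pt_ideal p = gen n K ?Z"
    proof
      have LQ: "L k \<in> gen n K ?Z" if k: "k \<le> n" "k \<noteq> a" "k \<noteq> b" for k
      proof -
        obtain i where i: "i < n - 1" "h i = k" using h k unfolding bij_betw_def by (metis (no_types, lifting) DiffI atMost_iff imageE insertE lessThan_iff singletonD)
        have "K i \<in> gen n K ?Z" using i by (intro gen_mem[OF Z]) simp
        then show ?thesis using i by (simp add: K_def)
      qed
      have "K (n - 1) \<in> gen n K ?Z" using n by (intro gen_mem[OF Z]) simp
      then have "f \<in> gen n K ?Z" by (simp add: K_def)
      then show "pt_ideal p \<subseteq> gen n K ?Z"
        using cont[OF gen_idl[OF Z]] ideal_facts[OF gen_idl[OF Z] gen_base[OF Z] LQ] by blast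
      show "gen n K ?Z \<subseteq> pt_ideal p"
      proof (rule gen_least[OF mxm_idl[OF pt_ideal_mxm]])
        show "?Z \<subseteq> pt_ideal p" using Zq_ev[OF mn _ p(1)] by (auto simp: pt_ideal_def)
        show "K i \<in> pt_ideal p" if "i < n" for i
          using st_plane(3)[OF p(2)] f(1) by (simp add: K_def pt_ideal_def)
      qed
    qed
    show "nondeg m n K p"
      unfolding nondeg_def
    proof (intro allI impI)
      fix b' c assume hyp: "\<forall>k\<le>n. (\<Sum>i<n. b' i * ev (pd k (K i)) p) + c * ev (pd k ?q) p = 0"
      define B' where "B' = b' (n - 1)"
      have hyp': "(\<Sum>i<n - 1. b' i * ev (pd k (L (h i))) p) + B' * (A * ev (pd k s) p + B * ev (pd k t) p)
          + c * (2 * sg m k * p k) = 0" if "k \<le> n" for k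
      proof -
        have "(\<Sum>i<n. b' i * ev (pd k (K i)) p) = (\<Sum>i<Suc (n - 1). b' i * ev (pd k (K i)) p)"
          using n by (rule arg_cong)
        also have "\<dots> = (\<Sum>i<n - 1. b' i * ev (pd k (L (h i))) p) + B' * ev (pd k f) p"
          by (simp add: K_def B'_def)
        finally have eq: "(\<Sum>i<n. b' i * ev (pd k (K i)) p) = (\<Sum>i<n - 1. b' i * ev (pd k (L (h i))) p) + B' * ev (pd k f) p" .
        show ?thesis using hyp[rule_format, OF that] unfolding eq f(2) pd_quadric_poly[OF mn that] .
      qed
      have pdL: "ev (pd k (L l)) p = (if l = k then 1 else 0) - (of_real (w l) * ev (pd k s) p + of_real (y l) * ev (pd k t) p)" for k l
        by (simp add: L_def)
      \<comment> \<open>contract the linear relation between differentials with the vector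
        \<open>v\<close>; the choices \<open>v = w\<close> and \<open>v = y\<close> isolate the
        coefficients of \<open>f\<close> and of the equation\<close>
      have con: "(\<Sum>i<n - 1. b' i * (of_real (v (h i)) - (of_real (w (h i)) * of_real ((y b * v a - y a * v b) / \<Delta>) + of_real (y (h i)) * of_real ((w a * v b - w b * v a) / \<Delta>))))
          + B' * (A * of_real ((y b * v a - y a * v b) / \<Delta>) + B * of_real ((w a * v b - w b * v a) / \<Delta>))
          + 2 * c * bil m n p (\<lambda>k. of_real (v k)) = 0" for v :: "nat \<Rightarrow> real"
      proof -
        have "(\<Sum>k\<le>n. of_real (v k) * ((\<Sum>i<n - 1. b' i * ev (pd k (L (h i))) p) + B' * (A * ev (pd k s) p + B * ev (pd k t) p)
          + c * (2 * sg m k * p k))) = 0"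
        proof (rule sum.neutral, intro ballI)
          fix k assume "k \<in> {..n}"
          then have "k \<le> n" by simp
          show "of_real (v k) * ((\<Sum>i<n - 1. b' i * ev (pd k (L (h i))) p) + B' * (A * ev (pd k s) p + B * ev (pd k t) p)
            + c * (2 * sg m k * p k)) = 0" by (simp only: hyp'[OF \<open>k \<le> n\<close>] mult_zero_right)
        qed
        also have "(\<Sum>k\<le>n. of_real (v k) * ((\<Sum>i<n - 1. b' i * ev (pd k (L (h i))) p) + B' * (A * ev (pd k s) p + B * ev (pd k t) p)
          + c * (2 * sg m k * p k)))
          = (\<Sum>i<n - 1. b' i * (\<Sum>k\<le>n. of_real (v k) * ev (pd k (L (h i))) p))
           + B' * (A * (\<Sum>k\<le>n. of_real (v k) * ev (pd k s) p) + B * (\<Sum>k\<le>n. of_real (v k) * ev (pd k t) p))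
           + 2 * c * bil m n p (\<lambda>k. of_real (v k))"
        proof -
          have "(\<Sum>k\<le>n. of_real (v k) * (\<Sum>i<n - 1. b' i * ev (pd k (L (h i))) p))
             = (\<Sum>i<n - 1. b' i * (\<Sum>k\<le>n. of_real (v k) * ev (pd k (L (h i))) p))"
            unfolding sum_distrib_left by (subst sum.swap) (simp add: mult_ac)
          then show ?thesis
            by (simp add: bil_def distrib_left sum.distrib sum_distrib_left mult_ac)
        qed
        finally have E: "(\<Sum>i<n - 1. b' i * (\<Sum>k\<le>n. of_real (v k) * ev (pd k (L (h i))) p))
           + B' * (A * (\<Sum>k\<le>n. of_real (v k) * ev (pd k s) p) + B * (\<Sum>k\<le>n. of_real (v k) * ev (pd k t) p))
           + 2 * c * bil m n p (\<lambda>k. of_real (v k)) = 0" .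
        have "(\<Sum>k\<le>n. of_real (v k) * ev (pd k (L l)) p) = of_real (v l)
            - (of_real (w l) * (\<Sum>k\<le>n. of_real (v k) * ev (pd k s) p) + of_real (y l) * (\<Sum>k\<le>n. of_real (v k) * ev (pd k t) p))"
          if "l \<le> n" for l
        proof -
          have "(\<Sum>k\<le>n. of_real (v k) * (if l = k then 1 else 0)) = complex_of_real (v l)"
            using that by (simp add: if_distrib cong: if_cong)
          then show ?thesis unfolding pdL right_diff_distrib distrib_left sum_subtractf sum.distrib
            by (simp add: sum_distrib_left mult_ac)
        qed
        then have "(\<Sum>i<n - 1. b' i * (\<Sum>k\<le>n. of_real (v k) * ev (pd k (L (h i))) p))
          = (\<Sum>i<n - 1. b' i * (of_real (v (h i)) - (of_real (w (h i)) * (\<Sum>k\<le>n. of_real (v k) * ev (pd k s) p) + of_real (y (h i)) * (\<Sum>k\<le>n. of_real (v k) * ev (pd k t) p))))"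
          by (intro sum.cong) (use hI in auto)
        then show ?thesis using E unfolding contract_st by simp
      qed
      have ww: "(y b * w a - y a * w b) / \<Delta> = 1" "(w a * w b - w b * w a) / \<Delta> = 0"
        and yy: "(y b * y a - y a * y b) / \<Delta> = 0" "(w a * y b - w b * y a) / \<Delta> = 1"
        using \<Delta>0 by (simp_all add: \<Delta>_def mult.commute)
      have 1: "B' * A + 2 * c * bil m n p (\<lambda>k. of_real (w k)) = 0"
        using con[of w] unfolding ww by simp
      have 2: "B' * B + 2 * c * bil m n p (\<lambda>k. of_real (y k)) = 0"
        using con[of y] unfolding yy by simp
      let ?bw = "bil m n p (\<lambda>k. of_real (w k))" and ?by = "bil m n p (\<lambda>k. of_real (y k))"
      have "B' * (A * ?by - B * ?bw) = (B' * A + 2 * c * ?bw) * ?by - (B' * B + 2 * c * ?by) * ?bw"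
        by (simp add: algebra_simps)
      then have B0: "B' = 0" using AB unfolding 1 2 by simp
      then have "c * ?bw = 0" "c * ?by = 0" using 1 2 by auto
      then have c0: "c = 0" using AB by auto
      have "b' i = 0" if i: "i < n - 1" for i
      proof -
        have "(\<Sum>j<n - 1. b' j * ev (pd (h i) (L (h j))) p) = (\<Sum>j<n - 1. if j = i then b' i else 0)"
        proof (rule sum.cong[OF refl])
          fix j assume j: "j \<in> {..<n - 1}"
          have "h j = h i \<longleftrightarrow> j = i" using h i j unfolding bij_betw_def inj_on_def by auto
          then show "b' j * ev (pd (h i) (L (h j))) p = (if j = i then b' i else 0)"
            using hI[OF i] by (simp add: pdL pd_s pd_t)
        qed
        then show ?thesis using hyp'[of "h i"] hI[OF i] i B0 c0 by simp
      qed
      moreover have "b' (n - 1) = 0" using B0 by (simp add: B'_def)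
      ultimately have "b' i = 0" if "i < n" for i
      proof (cases "i < n - 1")
        case False
        then have "i = n - 1" using that by linarith
        then show ?thesis using \<open>b' (n - 1) = 0\<close> by simp
      qed (use \<open>\<And>i. i < n - 1 \<Longrightarrow> b' i = 0\<close> in blast)
      then show "(\<forall>i<n. b' i = 0) \<and> c = 0" using c0 by blast
    qed
  qed
  define Y where "Y = {rcurve N d \<tau> | \<tau>. poly d \<tau> \<noteq> 0}"
  have prmY: "prm (van Y)"
  proof (rule van_prm)
    show "Y \<noteq> {}" using cp by (auto simp: Y_def)
    fix u v assume "u \<in> Y" "v \<in> Y"
    then show "linked Y u v" unfolding linked_def Y_def by blast
  qed
  have plane: "\<exists>S T. u = (\<lambda>k. S * of_real (w k) + T * of_real (y k)) \<and> of_real \<alpha> * S^2 + of_real \<beta> * T^2 = 1" if "u \<in> Y" for u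
    using that curve unfolding Y_def by blast
  have YX: "Y \<subseteq> quadric m n"
  proof
    fix u assume "u \<in> Y"
    then obtain S T where u: "u = (\<lambda>k. S * of_real (w k) + T * of_real (y k))" "of_real \<alpha> * S^2 + of_real \<beta> * T^2 = 1"
      using plane by blast
    have "bil m n u u = 1" unfolding u(1) bil_comb bil_of_real using u(2) orth by (simp add: mult.commute)
    then show "u \<in> quadric m n" using sup by (simp add: quadric_def u(1))
  qed
  have ZY: "?Z \<subseteq> van Y" using Zq_ev[OF mn] YX by (auto simp: van_def)
  have LY: "L k \<in> van Y" for k using plane st_plane(3) by (fastforce simp: van_def)
  have eqY: "cst \<alpha> * s^2 + cst \<beta> * t^2 - 1 \<in> van Y"
    unfolding van_def
  proof (intro CollectI ballI)
    fix u assume "u \<in> Y"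
    then obtain S T where u: "u = (\<lambda>k. S * of_real (w k) + T * of_real (y k))" "of_real \<alpha> * S^2 + of_real \<beta> * T^2 = 1"
      using plane by blast
    show "ev (cst \<alpha> * s^2 + cst \<beta> * t^2 - 1) u = 0" using st_plane(1,2)[OF u(1)] u(2) by simp
  qed
  have gr: "\<exists>z w'. growth (van Y) 1 z w'"
  proof (cases "\<alpha> = 0")
    case False
    show ?thesis using growth_plane[OF van_idl _ eqY False, of w y] LY unfolding L_def by blast
  next
    case True
    have LY': "mpoly_var k - (cst (y k) * t + cst (w k) * s) \<in> van Y" for k using LY[of k] by (simp add: L_def add.commute)
    have eqY': "cst \<beta> * t^2 + cst \<alpha> * s^2 - 1 \<in> van Y" using eqY by (simp add: add.commute)
    show ?thesis using growth_plane[OF van_idl LY' eqY'] ab0 True by blast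
  qed
  have fY: "f \<notin> van Y" using cf by (auto simp: van_def Y_def)
  have pY: "p \<in> Y" using cp by (auto simp: Y_def)
  have "pt_ideal p = isum (van Y) (princ f)"
  proof
    note i = isum_idl[OF van_idl princ_idl]
    have l: "van Y \<subseteq> isum (van Y) (princ f)" by (rule isum_l[OF princ_idl])
    have "f \<in> princ f" unfolding princ_def by (rule range_eqI[of _ _ 1]) simp
    then have "f \<in> isum (van Y) (princ f)" using isum_r[OF van_idl] by blast
    then show "pt_ideal p \<subseteq> isum (van Y) (princ f)" using cont[OF i] l LY eqY by blast
    show "isum (van Y) (princ f) \<subseteq> pt_ideal p"
      using pY f(1) by (auto simp: isum_def princ_def van_def pt_ideal_def)
  qed
  then show "\<exists>P f z w. prm P \<and> ?Z \<subseteq> P \<and> growth P 1 z w \<and> f \<notin> P \<and> pt_ideal p = isum P (princ f)"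
    using prmY ZY gr fY by blast
qed

lemma bil_plane:
  fixes p :: "nat \<Rightarrow> complex"
  assumes "p = (\<lambda>k. S0 * of_real (w k) + T0 * of_real (y k))"
  shows "bil m n p (\<lambda>k. of_real (y k)) = T0 * of_real \<beta>" "bil m n p (\<lambda>k. of_real (w k)) = S0 * of_real \<alpha>"
  using orth by (simp_all add: assms bil_add bil_scale bil_of_real bil_sym[of m n y w])

text \<open>The parametrization of \<open>X\<^sup>2 - Y\<^sup>2 = 1\<close> by \<open>X = (\<tau>
  + 1/\<tau>) / 2\<close>, \<open>Y = (\<tau> - 1/\<tau>) / 2\<close>, rescaled by complex square
  roots.\<close>

lemma hyperbola:
  assumes r: "\<rho>^2 = complex_of_real \<alpha>" "\<kappa>^2 = - complex_of_real \<beta>" "\<rho> \<noteq> 0" "\<kappa> \<noteq> 0" and \<tau>: "\<tau> \<noteq> 0"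
  defines "N \<equiv> \<lambda>k. [:of_real (w k) / (2 * \<rho>) - of_real (y k) / (2 * \<kappa>), 0, of_real (w k) / (2 * \<rho>) + of_real (y k) / (2 * \<kappa>):]"
    and "S \<equiv> (\<tau> + 1 / \<tau>) / (2 * \<rho>)" and "T \<equiv> (\<tau> - 1 / \<tau>) / (2 * \<kappa>)"
  shows "rcurve N [:0, 1:] \<tau> = (\<lambda>k. S * of_real (w k) + T * of_real (y k))" "of_real \<alpha> * S^2 + of_real \<beta> * T^2 = 1"
proof -
  show "rcurve N [:0, 1:] \<tau> = (\<lambda>k. S * of_real (w k) + T * of_real (y k))"
    using r \<tau> by (auto simp: rcurve_def N_def S_def T_def fun_eq_iff field_simps)
  have "of_real \<alpha> * S^2 = (\<tau> + 1 / \<tau>)^2 / 4" using r(3) by (simp add: r(1)[symmetric] S_def power_divide power_mult_distrib)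
  moreover have "of_real \<beta> * T^2 = - ((\<tau> - 1 / \<tau>)^2 / 4)"
  proof -
    have "of_real \<beta> = - (\<kappa>^2)" using r(2) by simp
    then show ?thesis using r(4) by (simp add: T_def power_divide power_mult_distrib)
  qed
  moreover have "(\<tau> + 1 / \<tau>)^2 / 4 + - ((\<tau> - 1 / \<tau>)^2 / 4) = 1"
    using \<tau> by (simp add: power2_eq_square field_simps)
  ultimately show "of_real \<alpha> * S^2 + of_real \<beta> * T^2 = 1" by (simp only:)
qed

end

lemma bil_zero_vector: "\<forall>k\<le>n. a k = 0 \<Longrightarrow> bil m n a b = 0"
  by (simp add: bil_def)

lemma ex_minor:
  fixes w y :: "nat \<Rightarrow> real"
  assumes "bil m n w w \<noteq> 0" "bil m n w y = 0" "\<exists>k\<le>n. y k \<noteq> 0"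
  shows "\<exists>a\<le>n. \<exists>b\<le>n. w a * y b - w b * y a \<noteq> 0"
proof (rule ccontr)
  assume "\<not> ?thesis"
  then have z: "w a * y b = w b * y a" if "a \<le> n" "b \<le> n" for a b using that by auto
  have "y b = 0" if b: "b \<le> n" for b
  proof -
    have "bil m n w w * y b = (\<Sum>k\<le>n. sg m k * w k * (w k * y b))"
      unfolding bil_def sum_distrib_right by (simp only: mult.assoc)
    also have "\<dots> = (\<Sum>k\<le>n. w b * (sg m k * w k * y k))" by (rule sum.cong) (use z b in \<open>auto simp: mult_ac\<close>)
    also have "\<dots> = w b * bil m n w y" by (simp add: bil_def sum_distrib_left)
    finally show ?thesis using assms by simp
  qed
  then show False using assms(3) by blast
qed

text \<open>Take \<open>w = p\<close>, of square 1, and a vector \<open>y\<close> orthogonal to it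
  with square \<open>-1\<close>; it exists because \<open>m < n\<close>. The section is the
  hyperbola \<open>s\<^sup>2 - t\<^sup>2 = 1\<close>, and the line \<open>s + t = 1\<close>,
  parallel to an asymptote, meets it at \<open>p\<close> alone. On a circle no real line could do
  this transversally, which is why spheres behave differently.\<close>

lemma real_point_good:
  assumes mn: "m < n" and p: "p \<in> quadric m n" and re: "\<And>k. Im (p k) = 0"
  shows "good_point m n p"
proof -
  define w where "w k = Re (p k)" for k
  have pw: "p = (\<lambda>k. of_real (w k))" using re by (auto simp: w_def complex_eq_iff)
  have sup: "w k = 0" if "k > n" for k using p that by (simp add: w_def quadric_def)
  have \<alpha>: "bil m n w w = 1" using p unfolding quadric_def pw by (simp add: bil_of_real del: of_real_eq_1_iff) (simp add: bil_of_real)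
  define e :: "nat \<Rightarrow> real" where "e k = (if k = n then 1 else 0)" for k
  have ee: "bil m n e e = -1" using mn by (simp add: bil_def e_def sg_def if_distrib cong: if_cong)
  \<comment> \<open>project the last basis vector, of square \<open>-1\<close>, to the orthogonal
    complement of \<open>w\<close>: the square becomes \<open>-(1 + c\<^sup>2)\<close>\<close>
  define c where "c = bil m n e w"
  define y' where "y' k = 1 * e k + (- c) * w k" for k
  have y'y': "bil m n y' y' = - (1 + c^2)"
    unfolding y'_def[abs_def] bil_comb ee \<alpha> c_def[symmetric] by (simp add: power2_eq_square)
  have "bil m n y' w = 0"
    unfolding y'_def[abs_def] bil_add bil_scale \<alpha> by (simp add: c_def)
  then have wy': "bil m n w y' = 0" by (simp only: bil_sym[of m n w y'])
  define r where "r = sqrt (1 + c^2)"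
  have r2: "r * r = 1 + c^2" by (simp add: r_def)
  have "1 + c^2 > 0" by (simp add: add_pos_nonneg)
  then have r0: "r \<noteq> 0" using r2 by auto
  define y where "y k = (1 / r) * y' k" for k
  have \<beta>: "bil m n y y = -1"
  proof -
    have "bil m n y y = (1/r) * ((1/r) * bil m n y' y')"
      unfolding y_def[abs_def] bil_scale bil_sym[of m n y' "\<lambda>k. 1 / r * y' k"] ..
    also have "\<dots> = (1/r) * ((1/r) * (- (r * r)))" unfolding y'y' r2 ..
    also have "\<dots> = -1" using r0 by simp
    finally show ?thesis .
  qed
  have "bil m n y w = (1/r) * bil m n y' w" unfolding y_def[abs_def] bil_scale ..
  then have "bil m n y w = 0" using \<open>bil m n y' w = 0\<close> by (simp only: mult_zero_right)
  then have orth: "bil m n w y = 0" by (simp only: bil_sym[of m n w y])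
  have "\<exists>k\<le>n. y k \<noteq> 0" using bil_zero_vector[of n y m y] \<beta> by force
  then obtain a b where ab: "a \<le> n" "b \<le> n" "w a * y b - w b * y a \<noteq> 0" using ex_minor[of m n w y] \<alpha> orth by auto
  interpret section_plane m n a b w y
    by unfold_locales (use mn ab orth sup in \<open>auto simp: y_def y'_def e_def\<close>)
  have pp: "p = (\<lambda>k. 1 * of_real (w k) + 0 * of_real (y k))" using pw by simp
  note st = st_plane[OF pp]
  define N where "N k = [:complex_of_real (w k) / (2 * 1) - of_real (y k) / (2 * 1), 0, of_real (w k) / (2 * 1) + of_real (y k) / (2 * 1):]" for k
  have hyp: "rcurve N [:0, 1:] \<tau> = (\<lambda>k. (\<tau> + 1 / \<tau>) / (2 * 1) * of_real (w k) + (\<tau> - 1 / \<tau>) / (2 * 1) * of_real (y k))"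
    "of_real (bil m n w w) * ((\<tau> + 1 / \<tau>) / (2 * 1))^2 + of_real (bil m n y y) * ((\<tau> - 1 / \<tau>) / (2 * 1))^2 = 1" if "\<tau> \<noteq> 0" for \<tau>
    using hyperbola[of 1 1 \<tau>] that \<alpha> \<beta> unfolding N_def[abs_def] by simp_all
  let ?f = "s + t - 1"
  show ?thesis
  proof (rule plane_point[OF p pp, where f = ?f and A = 1 and B = 1 and d = "[:0, 1:]" and N = N and ?\<tau>0.0 = 1 and ?\<tau>1.0 = 2])
    show "ev ?f p = 0" by (simp add: st)
    show "1 * bil m n p (\<lambda>k. of_real (y k)) - 1 * bil m n p (\<lambda>k. of_real (w k)) \<noteq> 0"
      unfolding bil_plane[OF pp] using \<alpha> by simp
    show "\<exists>S T. rcurve N [:0, 1:] \<tau> = (\<lambda>k. S * of_real (w k) + T * of_real (y k)) \<and> of_real (bil m n w w) * S^2 + of_real (bil m n y y) * T^2 = 1"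
      if "poly [:0, 1:] \<tau> \<noteq> 0" for \<tau>
    proof -
      have "\<tau> \<noteq> 0" using that by simp
      from hyp[OF this] show ?thesis by blast
    qed
    show "rcurve N [:0, 1:] 1 = p" using hyp(1)[of 1] pp by simp
    have "ev s (rcurve N [:0, 1:] 2) = (2 + 1 / 2) / (2 * 1)" "ev t (rcurve N [:0, 1:] 2) = (2 - 1 / 2) / (2 * 1)"
      using st_plane(1,2)[OF hyp(1)[of 2]] by simp_all
    then have "ev ?f (rcurve N [:0, 1:] 2) = (2 + 1 / 2) / (2 * 1) + (2 - 1 / 2) / (2 * 1) - 1" by (simp only: ev_simps)
    then show "ev ?f (rcurve N [:0, 1:] 2) \<noteq> 0" by simp
    fix Q assume Q: "idl Q" "\<And>k. L k \<in> Q" "cst \<alpha> * s^2 + cst \<beta> * t^2 - 1 \<in> Q" "?f \<in> Q"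
    have q: "s^2 - t^2 - 1 \<in> Q" using Q(3) \<alpha> \<beta> by (simp add: cst.hom_uminus)
    have "s - t - 1 = (s^2 - t^2 - 1) - ?f * (s - t)" by (simp add: power2_eq_square algebra_simps)
    then have g: "s - t - 1 \<in> Q" using idl_diff[OF Q(1) q idl_mult2[OF Q(1) Q(4)]] by metis
    have half: "cst (1/2) * (u + u) = u" for u :: pp
    proof -
      have "cst (1/2) * (u + u) = (cst (1/2) + cst (1/2)) * u" by (simp only: distrib_left distrib_right)
      also have "cst (1/2) + cst (1/2) = 1" by (simp only: cst.hom_add[symmetric]) simp
      finally show ?thesis by simp
    qed
    have e1: "?f + (s - t - 1) = (s - 1) + (s - 1)" and e2: "?f - (s - t - 1) = t + t" by (simp_all add: algebra_simps)
    have s1: "s - 1 \<in> Q"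
      using idl_mult[OF Q(1) idl_add[OF Q(1) Q(4) g], of "cst (1/2)"] unfolding e1 half .
    have t0: "t \<in> Q"
      using idl_mult[OF Q(1) idl_diff[OF Q(1) Q(4) g], of "cst (1/2)"] unfolding e2 half .
    show "pt_ideal p \<subseteq> Q"
    proof (rule pt_ideal_sub[OF Q(1), of p 0])
      fix k
      have "mpoly_var k - (cst (Re (p k)) + cst (Im (p k)) * 0) = L k + (cst (w k) * (s - 1) + cst (y k) * t)"
        by (simp add: L_def w_def algebra_simps)
      then show "mpoly_var k - (cst (Re (p k)) + cst (Im (p k)) * 0) \<in> Q"
        using idl_add[OF Q(1) Q(2) idl_add[OF Q(1) idl_mult[OF Q(1) s1] idl_mult[OF Q(1) t0]]] by simp
    qed (use re in simp)
  qed (use \<alpha> in simp_all)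
qed

text \<open>Write \<open>p = x + iy\<close>; then \<open>x\<close> and \<open>y\<close> are
  orthogonal, and \<open>x\<^sup>2 - y\<^sup>2 = 1\<close> for the form. If \<open>y\<close> is
  not isotropic, use the plane of \<open>y\<close> and \<open>x\<close>, or of \<open>y\<close>
  and any other orthogonal vector when \<open>x = 0\<close>: the line \<open>s = \<sigma>\<close>
  meets the section in \<open>p\<close> and its conjugate, which are the same closed point. The
  section is a conic, or the pair of conjugate lines \<open>t = \<plusminus>\<i>\<close> if
  \<open>w\<close> is isotropic. If \<open>y\<close> is isotropic, the section is the pair of
  lines \<open>s = \<plusminus>1\<close>; the curve is the line \<open>s = 1\<close>, and
  \<open>f\<close> has to restrict to \<open>1 + t\<^sup>2\<close> there and to a unit on the line
  \<open>s = -1\<close>.\<close>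

lemma nonreal_point_good:
  assumes mn: "m < n" and p: "p \<in> quadric m n" and im: "\<exists>k. Im (p k) \<noteq> 0"
  shows "good_point m n p"
proof -
  have n1: "1 \<le> n" using mn by simp
  define x where "x k = Re (p k)" for k
  define y where "y k = Im (p k)" for k
  have pxy: "p = (\<lambda>k. 1 * of_real (x k) + \<i> * of_real (y k))" by (auto simp: x_def y_def complex_eq_iff)
  have sup: "x k = 0 \<and> y k = 0" if "k > n" for k using p that by (simp add: x_def y_def quadric_def)
  have "bil m n p p = of_real (bil m n x x - bil m n y y) + 2 * \<i> * of_real (bil m n x y)"
    unfolding pxy bil_comb bil_of_real by simp
  then have "of_real (bil m n x x - bil m n y y) + 2 * \<i> * of_real (bil m n x y) = (1::complex)" using p by (simp add: quadric_def)
  then have xy: "bil m n x x - bil m n y y = 1" "bil m n x y = 0" by (simp_all add: complex_eq_iff)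
  have y0: "\<exists>k\<le>n. y k \<noteq> 0" using im sup unfolding y_def by (metis not_le)
  show ?thesis
  proof (cases "bil m n y y = 0")
    case True
    then have \<alpha>: "bil m n x x = 1" using xy by simp
    obtain a b where ab: "a \<le> n" "b \<le> n" "x a * y b - x b * y a \<noteq> 0" using ex_minor[of m n x y] \<alpha> xy y0 by auto
    interpret section_plane m n a b x y
      by unfold_locales (use mn ab xy sup in auto)
    note st = st_plane[OF pxy]
    define N where "N k = [:complex_of_real (x k), of_real (y k):]" for k
    have cv: "rcurve N 1 \<tau> = (\<lambda>k. 1 * of_real (x k) + \<tau> * of_real (y k))" for \<tau> by (simp add: rcurve_def N_def)
    let ?f = "1 + cst (1/2) * (t^2 * (1 + s))"
    show ?thesis
    proof (rule plane_point[OF p pxy, where f = ?f and A = "-1/2" and B = "2 * \<i>" and d = 1 and N = N and ?\<tau>0.0 = "\<i>" and ?\<tau>1.0 = 0])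
      show "ev ?f p = 0" by (simp add: st)
      show "ev (pd k ?f) p = - 1 / 2 * ev (pd k s) p + 2 * \<i> * ev (pd k t) p" for k
        by (simp add: st algebra_simps)
      show "-1/2 * bil m n p (\<lambda>k. of_real (y k)) - 2 * \<i> * bil m n p (\<lambda>k. of_real (x k)) \<noteq> 0"
        unfolding bil_plane[OF pxy] using \<alpha> True by simp
      show "\<exists>S T. rcurve N 1 \<tau> = (\<lambda>k. S * of_real (x k) + T * of_real (y k)) \<and> of_real (bil m n x x) * S^2 + of_real (bil m n y y) * T^2 = 1" for \<tau>
        by (rule exI[of _ 1], rule exI[of _ \<tau>]) (use cv \<alpha> True in simp)
      show "rcurve N 1 \<i> = p" by (simp only: cv pxy)
      show "ev ?f (rcurve N 1 0) \<noteq> 0" using st_plane(1,2)[OF cv[of 0]] by simp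
      fix Q assume Q: "idl Q" "\<And>k. L k \<in> Q" "cst \<alpha> * s^2 + cst \<beta> * t^2 - 1 \<in> Q" "?f \<in> Q"
      have q: "s^2 - 1 \<in> Q" using Q(3) \<alpha> True by simp
      have "1 - s = (1 - s) * ?f + cst (1/2) * t^2 * (s^2 - 1)" by (simp add: power2_eq_square algebra_simps)
      then have s1: "1 - s \<in> Q" using idl_add[OF Q(1) idl_mult[OF Q(1) Q(4)] idl_mult[OF Q(1) q]] by metis
      have hh: "cst (1/2) + cst (1/2) = (1::pp)" by (simp only: cst.hom_add[symmetric]) simp
      have "?f + cst (1/2) * t^2 * (1 - s) = 1 + (cst (1/2) + cst (1/2)) * t^2" by (simp add: algebra_simps)
      also have "\<dots> = t^2 + 1" unfolding hh by simp
      finally have t1: "t^2 + 1 \<in> Q" using idl_add[OF Q(1) Q(4) idl_mult[OF Q(1) s1]] by metis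
      show "pt_ideal p \<subseteq> Q"
      proof (rule pt_ideal_sub[OF Q(1), of p t])
        fix k
        have "mpoly_var k - (cst (Re (p k)) + cst (Im (p k)) * t) = L k - cst (x k) * (1 - s)"
          by (simp add: L_def x_def[symmetric] y_def[symmetric] algebra_simps)
        then show "mpoly_var k - (cst (Re (p k)) + cst (Im (p k)) * t) \<in> Q"
          using idl_diff[OF Q(1) Q(2) idl_mult[OF Q(1) s1]] by simp
      qed (use t1 in simp)
    qed (use \<alpha> in simp_all)
  next
    case False
    have "\<exists>w \<sigma>. (\<forall>k>n. w k = 0) \<and> bil m n w y = 0 \<and> (\<exists>k\<le>n. w k \<noteq> 0) \<and> (\<forall>k. x k = \<sigma> * w k)"
    proof (cases "\<exists>k\<le>n. x k \<noteq> 0")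
      case True
      then show ?thesis using xy sup by (intro exI[of _ x] exI[of _ 1]) auto
    next
      case x0: False
      have "\<exists>j\<le>n. \<exists>k\<le>n. bil m n y y * (if k = j then 1 else 0) - sg m j * y j * y k \<noteq> 0"
      proof (rule ccontr)
        assume "\<not> ?thesis"
        then have z: "bil m n y y * (if k = j then 1 else 0) = sg m j * y j * y k" if "j \<le> n" "k \<le> n" for j k using that by force
        have "y 0 \<noteq> 0" using z[of 0 0] False by auto
        moreover have "y 1 \<noteq> 0" using z[of 1 1] False n1 by auto
        ultimately show False using z[of 0 1] n1 by (simp add: sg_def)
      qed
      then obtain j where j: "j \<le> n" "\<exists>k\<le>n. bil m n y y * (if k = j then 1 else 0) - sg m j * y j * y k \<noteq> 0" by blast
      define w where "w k = bil m n y y * (if k = j then 1 else 0) + (- (sg m j * y j)) * y k" for k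
      have "bil m n (\<lambda>k. if k = j then 1 else 0) y = sg m j * y j"
        using j(1) by (simp add: bil_def if_distrib[of "\<lambda>u. _ * u"] if_distrib[of "\<lambda>u. u * _"] sum.delta' cong: if_cong)
      then have "bil m n w y = 0" unfolding w_def[abs_def] bil_add bil_scale by simp
      moreover have "w k = 0" if "k > n" for k using that j sup by (auto simp: w_def)
      moreover have "\<exists>k\<le>n. w k \<noteq> 0" using j(2) by (simp add: w_def)
      moreover have "x k = 0 * w k" for k using x0 sup[of k] by (cases "k \<le> n") auto
      ultimately show ?thesis by blast
    qed
    then obtain w \<sigma> where w: "\<And>k. k > n \<Longrightarrow> w k = 0" "bil m n w y = 0" "\<exists>k\<le>n. w k \<noteq> 0" "\<And>k. x k = \<sigma> * w k" by blast
    obtain b a where "b \<le> n" "a \<le> n" "y b * w a - y a * w b \<noteq> 0" using ex_minor[of m n y w] False w bil_sym[of m n w y] by auto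
    then have ab: "a \<le> n" "b \<le> n" "w a * y b - w b * y a \<noteq> 0" by (simp_all add: mult.commute)
    interpret section_plane m n a b w y
      by unfold_locales (use mn ab w sup in auto)
    have pp: "p = (\<lambda>k. of_real \<sigma> * of_real (w k) + \<i> * of_real (y k))" using pxy w(4) by simp
    note st = st_plane[OF pp]
    have \<alpha>\<sigma>: "bil m n w w * \<sigma>^2 - bil m n y y = 1"
    proof -
      have "bil m n x x = \<sigma> * (\<sigma> * bil m n w w)"
        using w(4) by (simp add: bil_def sum_distrib_left mult_ac)
      then show ?thesis using xy(1) by (simp add: power2_eq_square mult_ac)
    qed
    let ?f = "s - cst \<sigma>"
    have f0: "ev ?f p = 0" by (simp add: st)
    have pf: "ev (pd k ?f) p = 1 * ev (pd k s) p + 0 * ev (pd k t) p" for k by simp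
    have AB: "1 * bil m n p (\<lambda>k. of_real (y k)) - 0 * bil m n p (\<lambda>k. of_real (w k)) \<noteq> 0"
      unfolding bil_plane[OF pp] using False by simp
    have cont: "pt_ideal p \<subseteq> Q" if Q: "idl Q" "\<And>k. L k \<in> Q" "cst \<alpha> * s^2 + cst \<beta> * t^2 - 1 \<in> Q" "?f \<in> Q" for Q
    proof (rule pt_ideal_sub[OF Q(1), of p t])
      fix k
      have "mpoly_var k - (cst (Re (p k)) + cst (Im (p k)) * t) = L k + cst (w k) * ?f"
        using w(4)[of k] by (simp add: L_def x_def[symmetric] y_def[symmetric] cst.hom_mult algebra_simps)
      then show "mpoly_var k - (cst (Re (p k)) + cst (Im (p k)) * t) \<in> Q"
        using idl_add[OF Q(1) Q(2) idl_mult[OF Q(1) Q(4)]] by simp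
    next
      have one: "cst \<alpha> * cst \<sigma>^2 - 1 = cst \<beta>"
      proof -
        have "cst \<alpha> * cst \<sigma>^2 - 1 = cst (\<alpha> * \<sigma>^2 - 1)" by (simp add: cst.hom_mult cst.hom_power cst.hom_minus)
        then show ?thesis using \<alpha>\<sigma> by (simp add: algebra_simps)
      qed
      have "(cst \<alpha> * s^2 + cst \<beta> * t^2 - 1) - cst \<alpha> * (s + cst \<sigma>) * ?f = cst \<beta> * t^2 + (cst \<alpha> * cst \<sigma>^2 - 1)"
        by (simp add: power2_eq_square algebra_simps)
      also have "\<dots> = cst \<beta> * (t^2 + 1)" unfolding one by (simp add: algebra_simps)
      finally have "cst \<beta> * (t^2 + 1) \<in> Q" using idl_diff[OF Q(1) Q(3) idl_mult[OF Q(1) Q(4)]] by metis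
      then have "cst (1/\<beta>) * (cst \<beta> * (t^2 + 1)) \<in> Q" by (rule idl_mult[OF Q(1)])
      moreover have "cst (1/\<beta>) * (cst \<beta> * (t^2 + 1)) = t^2 + 1"
        using False by (simp add: mult.assoc[symmetric] cst.hom_mult[symmetric] del: cst.hom_mult)
      ultimately show "t^2 + 1 \<in> Q \<or> (\<forall>k. Im (p k) = 0)" by simp
    qed
    show ?thesis
    proof (cases "bil m n w w = 0")
      case \<alpha>0: True
      then have \<beta>: "bil m n y y = -1" using \<alpha>\<sigma> by simp
      define N where "N k = [:\<i> * of_real (y k), complex_of_real (w k):]" for k
      have cv: "rcurve N 1 \<tau> = (\<lambda>k. \<tau> * of_real (w k) + \<i> * of_real (y k))" for \<tau> by (simp add: rcurve_def N_def add.commute)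
      show ?thesis
      proof (rule plane_point[OF p pp f0 pf AB cont, where d = 1 and N = N and ?\<tau>0.0 = "of_real \<sigma>" and ?\<tau>1.0 = "of_real \<sigma> + 1"])
        show "\<exists>S T. rcurve N 1 \<tau> = (\<lambda>k. S * of_real (w k) + T * of_real (y k)) \<and> of_real (bil m n w w) * S^2 + of_real (bil m n y y) * T^2 = 1" for \<tau>
          by (rule exI[of _ \<tau>], rule exI[of _ "\<i>"]) (use cv \<alpha>0 \<beta> in simp)
        show "rcurve N 1 (of_real \<sigma>) = p" by (simp only: cv pp)
        show "ev ?f (rcurve N 1 (of_real \<sigma> + 1)) \<noteq> 0" using st_plane(1,2)[OF cv[of "of_real \<sigma> + 1"]] by simp
      qed (use False in simp_all)
    next
      case \<alpha>0: False
      define \<rho> where "\<rho> = csqrt (of_real (bil m n w w))"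
      define \<kappa> where "\<kappa> = csqrt (- of_real (bil m n y y))"
      have r: "\<rho>^2 = of_real (bil m n w w)" "\<kappa>^2 = - of_real (bil m n y y)" by (simp_all add: \<rho>_def \<kappa>_def)
      have r0: "\<rho> \<noteq> 0" "\<kappa> \<noteq> 0" using r \<alpha>0 False by auto
      define N where "N k = [:of_real (w k) / (2 * \<rho>) - of_real (y k) / (2 * \<kappa>), 0, of_real (w k) / (2 * \<rho>) + of_real (y k) / (2 * \<kappa>):]" for k
      note hyp = hyperbola[OF r r0, folded N_def[abs_def]]
      define \<tau> where "\<tau> = \<rho> * of_real \<sigma> + \<kappa> * \<i>"
      define \<tau>' where "\<tau>' = \<rho> * of_real \<sigma> - \<kappa> * \<i>"
      have "\<tau> * \<tau>' = \<rho>^2 * of_real \<sigma>^2 + \<kappa>^2" by (simp add: \<tau>_def \<tau>'_def power2_eq_square algebra_simps)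
      also have "\<dots> = of_real (bil m n w w * \<sigma>^2 - bil m n y y)" by (simp add: r)
      finally have tt: "\<tau> * \<tau>' = 1" using \<alpha>\<sigma> by simp
      then have t0: "\<tau> \<noteq> 0" by auto
      then have ti: "1 / \<tau> = \<tau>'" using tt by (simp add: divide_eq_eq mult.commute)
      have S: "(\<tau> + 1 / \<tau>) / (2 * \<rho>) = of_real \<sigma>" "(\<tau> - 1 / \<tau>) / (2 * \<kappa>) = \<i>"
        unfolding ti using r0 by (simp_all add: \<tau>_def \<tau>'_def)
      have "\<exists>\<tau>. \<tau> \<noteq> 0 \<and> ev ?f (rcurve N [:0, 1:] \<tau>) \<noteq> 0"
      proof (rule ccontr)
        assume a: "\<not> ?thesis"
        have z: "ev ?f (rcurve N [:0, 1:] \<tau>) = (\<tau> + 1 / \<tau>) / (2 * \<rho>) - of_real \<sigma>" if "\<tau> \<noteq> 0" for \<tau>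
          using st_plane(1)[OF hyp(1)[OF that]] by simp
        have "ev ?f (rcurve N [:0, 1:] 1) = 0" "ev ?f (rcurve N [:0, 1:] (-1)) = 0"
          using a[simplified, rule_format, of 1] a[simplified, rule_format, of "-1"] by simp_all
        then have "(1 + 1 / 1) / (2 * \<rho>) = (- 1 + 1 / (- 1)) / (2 * \<rho>)" using z[of 1] z[of "-1"] by simp
        then show False using r0 by (simp add: field_simps)
      qed
      then obtain \<tau>1 where \<tau>1: "\<tau>1 \<noteq> 0" "ev ?f (rcurve N [:0, 1:] \<tau>1) \<noteq> 0" by blast
      show ?thesis
      proof (rule plane_point[OF p pp f0 pf AB cont, where d = "[:0, 1:]" and N = N and ?\<tau>0.0 = \<tau> and ?\<tau>1.0 = \<tau>1])
        show "\<exists>S T. rcurve N [:0, 1:] \<tau> = (\<lambda>k. S * of_real (w k) + T * of_real (y k)) \<and> of_real (bil m n w w) * S^2 + of_real (bil m n y y) * T^2 = 1"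
          if "poly [:0, 1:] \<tau> \<noteq> 0" for \<tau>
        proof -
          have "\<tau> \<noteq> 0" using that by simp
          from hyp[OF this] show ?thesis by blast
        qed
        show "rcurve N [:0, 1:] \<tau> = p" unfolding hyp(1)[OF t0] S using pp by simp
        show "poly [:0, 1:] \<tau> \<noteq> 0" "poly [:0, 1:] \<tau>1 \<noteq> 0" using t0 \<tau>1 by simp_all
        show "ev ?f (rcurve N [:0, 1:] \<tau>1) \<noteq> 0" by (rule \<tau>1)
      qed (use False in simp_all)
    qed
  qed
qed

theorem every_point_good: "m < n \<Longrightarrow> p \<in> quadric m n \<Longrightarrow> good_point m n p"
  using real_point_good nonreal_point_good by (cases "\<exists>k. Im (p k) \<noteq> 0") auto

section \<open>Complete intersections\<close>

text \<open>The ideal \<open>N\<^sup>2 + Z\<close>.\<close>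

definition sq :: "'p::comm_ring_1 set \<Rightarrow> 'p set \<Rightarrow> 'p set"
  where "sq Z N = \<Inter>{Q. idl Q \<and> Z \<subseteq> Q \<and> (\<forall>a\<in>N. \<forall>b\<in>N. a * b \<in> Q)}"

lemma idl_Inter: "(\<And>Q. Q \<in> C \<Longrightarrow> idl Q) \<Longrightarrow> idl (\<Inter>C)"
  by (auto simp: idl_def)

lemma sq_idl: "idl (sq Z N)" unfolding sq_def by (rule idl_Inter) blast
lemma sq_contains: "Z \<subseteq> sq Z N" unfolding sq_def by blast
lemma sq_mult: "a \<in> N \<Longrightarrow> b \<in> N \<Longrightarrow> a * b \<in> sq Z N" unfolding sq_def by blast
lemma sq_least: "idl Q \<Longrightarrow> Z \<subseteq> Q \<Longrightarrow> (\<And>a b. a \<in> N \<Longrightarrow> b \<in> N \<Longrightarrow> a * b \<in> Q) \<Longrightarrow> sq Z N \<subseteq> Q"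
  unfolding sq_def by blast
lemma sq_sub: "idl N \<Longrightarrow> Z \<subseteq> N \<Longrightarrow> sq Z N \<subseteq> N"
  by (rule sq_least) (auto intro: idl_mult)

text \<open>Eliminate the \<open>h i\<close> one at a time. Modulo \<open>M\<close> the system is
  the identity, so each pivot is congruent to 1, and the product of the pivots serves as
  \<open>s\<close>.\<close>

lemma nakayama:
  fixes h :: "nat \<Rightarrow> 'p::comm_ring_1"
  assumes J: "idl J" and M: "idl M"
    and h: "\<And>i. i < r \<Longrightarrow> \<exists>e. (\<forall>j<r. e j \<in> M) \<and> h i - (\<Sum>j<r. e j * h j) \<in> J"
  shows "\<exists>s. 1 - s \<in> M \<and> (\<forall>i<r. s * h i \<in> J)"
proof -
  have "\<exists>s. 1 - s \<in> M \<and> (\<forall>i<r. \<exists>e. (\<forall>j<(0::nat). e j \<in> M) \<and> s * h i - (\<Sum>j<0. e j * h j) \<in> J)"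
  proof (rule inc_induct[of 0 r])
    show "\<exists>s. 1 - s \<in> M \<and> (\<forall>i<r. \<exists>e. (\<forall>j<r. e j \<in> M) \<and> s * h i - (\<Sum>j<r. e j * h j) \<in> J)"
      using h idl_zero[OF M] by (intro exI[of _ 1]) auto
    fix k assume k: "k < r"
    assume "\<exists>s. 1 - s \<in> M \<and> (\<forall>i<r. \<exists>e. (\<forall>j<Suc k. e j \<in> M) \<and> s * h i - (\<Sum>j<Suc k. e j * h j) \<in> J)"
    then obtain s where s: "1 - s \<in> M"
      and ex: "\<And>i. i < r \<Longrightarrow> \<exists>e. (\<forall>j<Suc k. e j \<in> M) \<and> s * h i - (\<Sum>j<Suc k. e j * h j) \<in> J" by blast
    obtain e where e: "\<And>j. j < Suc k \<Longrightarrow> e j \<in> M" "s * h k - (\<Sum>j<Suc k. e j * h j) \<in> J" using ex[OF k] by blast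
    let ?s = "(s - e k) * s"
    have "1 - ?s = (1 - s) * (1 + s) + s * e k" by (simp add: algebra_simps)
    then have s': "1 - ?s \<in> M" using idl_add[OF M idl_mult2[OF M s] idl_mult[OF M e(1)[of k]]] by simp
    have "\<exists>e'. (\<forall>j<k. e' j \<in> M) \<and> ?s * h i - (\<Sum>j<k. e' j * h j) \<in> J" if i: "i < r" for i
    proof -
      obtain d where d: "\<And>j. j < Suc k \<Longrightarrow> d j \<in> M" "s * h i - (\<Sum>j<Suc k. d j * h j) \<in> J" using ex[OF i] by blast
      let ?e = "\<lambda>j. (s - e k) * d j + d k * e j"
      have "?s * h i - (\<Sum>j<k. ?e j * h j) = (s - e k) * (s * h i - (\<Sum>j<Suc k. d j * h j)) + d k * (s * h k - (\<Sum>j<Suc k. e j * h j))"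
      proof -
        have "(\<Sum>j<k. ?e j * h j) = (s - e k) * (\<Sum>j<k. d j * h j) + d k * (\<Sum>j<k. e j * h j)"
          by (simp add: distrib_right sum.distrib sum_distrib_left mult.assoc)
        then show ?thesis by (simp add: algebra_simps)
      qed
      moreover have "\<dots> \<in> J" by (intro idl_add[OF J] idl_mult[OF J] d e)
      moreover have "?e j \<in> M" if "j < k" for j using that by (intro idl_add[OF M] idl_mult[OF M] d e) auto
      ultimately show ?thesis by (intro exI[of _ ?e]) auto
    qed
    then show "\<exists>s. 1 - s \<in> M \<and> (\<forall>i<r. \<exists>e. (\<forall>j<k. e j \<in> M) \<and> s * h i - (\<Sum>j<k. e j * h j) \<in> J)"
      using s' by (intro exI[of _ ?s]) blast
  qed simp
  then show ?thesis by auto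
qed

text \<open>The elements \<open>x\<close> that multiply some finite intersection of members of
  \<open>C\<close> into \<open>J\<close> form an ideal, which by the local hypothesis lies in no
  maximal ideal. This is the compactness of the spectrum.\<close>

lemma finite_intersection:
  fixes J :: "'p::comm_ring_1 set"
  assumes J: "idl J" and loc: "\<And>M. mxm M \<Longrightarrow> J \<subseteq> M \<Longrightarrow> \<exists>A\<in>C. \<exists>s. s \<notin> M \<and> (\<forall>a\<in>A. s * a \<in> J)"
  shows "\<exists>B. finite B \<and> B \<subseteq> C \<and> \<Inter>B \<subseteq> J"
proof -
  define S where "S = {x. \<exists>B. finite B \<and> B \<subseteq> C \<and> (\<forall>a\<in>\<Inter>B. x * a \<in> J)}"
  have S: "idl S"
    unfolding idl_def
  proof (intro conjI ballI allI)
    show "0 \<in> S" unfolding S_def using idl_zero[OF J] by (auto intro: exI[of _ "{}"])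
  next
    fix x y assume "x \<in> S" "y \<in> S"
    then obtain B D where B: "finite B" "B \<subseteq> C" "\<forall>a\<in>\<Inter>B. x * a \<in> J" "finite D" "D \<subseteq> C" "\<forall>a\<in>\<Inter>D. y * a \<in> J"
      unfolding S_def by blast
    have "\<forall>a\<in>\<Inter>(B \<union> D). (x + y) * a \<in> J" using B idl_add[OF J] by (auto simp: distrib_right)
    then show "x + y \<in> S" unfolding S_def using B by (intro CollectI exI[of _ "B \<union> D"]) auto
  next
    fix x r assume "x \<in> S"
    then obtain B where B: "finite B" "B \<subseteq> C" "\<forall>a\<in>\<Inter>B. x * a \<in> J" unfolding S_def by blast
    then show "r * x \<in> S" unfolding S_def using idl_mult[OF J] by (intro CollectI exI[of _ B]) (auto simp: mult.assoc)
  qed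
  have JS: "J \<subseteq> S" unfolding S_def using idl_mult2[OF J] by (auto intro: exI[of _ "{}"])
  have "1 \<in> S"
  proof (rule ccontr)
    assume "1 \<notin> S"
    then obtain M where M: "mxm M" "S \<subseteq> M" using ex_mxm[OF S] by blast
    then obtain A s where "A \<in> C" "s \<notin> M" "\<forall>a\<in>A. s * a \<in> J" using loc[of M] JS by blast
    then have "s \<in> S" unfolding S_def by (intro CollectI exI[of _ "{A}"]) auto
    then show False using \<open>s \<notin> M\<close> M by blast
  qed
  then show ?thesis unfolding S_def by auto
qed

text \<open>Iterating \<open>N = (F) + N\<^sup>2\<close> gives \<open>N \<subseteq> (F) +
  M\<^sup>r\<close> for all \<open>r\<close>. Large powers of \<open>M\<close> lie in the ideal
  generated by the products of \<open>M\<close> with the \<open>L i ^ k i\<close>, and the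
  \<open>L i ^ k i\<close> lie in \<open>N\<close>, so Nakayama's lemma applies to these finitely
  many elements.\<close>

lemma gen_primary_local:
  fixes L :: "nat \<Rightarrow> 'p::comm_ring_1"
  assumes Z: "idl Z" and M: "M = gen n L Z" and N: "idl N" "Z \<subseteq> N" "N \<subseteq> M"
    and k: "\<And>i. i < n \<Longrightarrow> L i ^ k i \<in> N" and F: "\<And>i. i < n \<Longrightarrow> F i \<in> N" and g: "N \<subseteq> gen n F (sq Z N)"
  shows "\<exists>s. 1 - s \<in> M \<and> (\<forall>a\<in>N. s * a \<in> gen n F Z)"
proof -
  let ?J = "gen n F Z"
  note J = gen_idl[OF Z, of n F]
  have iM: "idl M" unfolding M by (rule gen_idl[OF Z])
  \<comment> \<open>the power \<open>M\<^sup>r\<close> modulo \<open>Z\<close>, generated by the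
    monomials of degree at least \<open>r\<close> in the \<open>L i\<close>\<close>
  define G where "G r = \<Inter>{Q. idl Q \<and> Z \<subseteq> Q \<and> (\<forall>e. r \<le> (\<Sum>i<n. e i) \<longrightarrow> (\<Prod>i<n. L i ^ e i) \<in> Q)}" for r
  have Gi: "idl (G r)" for r unfolding G_def by (rule idl_Inter) blast
  have GZ: "Z \<subseteq> G r" for r unfolding G_def by blast
  have Gm: "(\<Prod>i<n. L i ^ e i) \<in> G r" if "r \<le> (\<Sum>i<n. e i)" for r e unfolding G_def using that by blast
  have Gl: "G r \<subseteq> Q" if "idl Q" "Z \<subseteq> Q" "\<And>e. r \<le> (\<Sum>i<n. e i) \<Longrightarrow> (\<Prod>i<n. L i ^ e i) \<in> Q" for r Q
    unfolding G_def using that by blast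
  have mono: "L i * (\<Prod>j<n. L j ^ e j) = (\<Prod>j<n. L j ^ (e(i := Suc (e i))) j)" "(\<Sum>j<n. (e(i := Suc (e i))) j) = Suc (\<Sum>j<n. e j)" if "i < n" for i e
  proof -
    have i: "i \<in> {..<n}" using that by simp
    have "(\<Prod>j\<in>{..<n} - {i}. L j ^ (e(i := Suc (e i))) j) = (\<Prod>j\<in>{..<n} - {i}. L j ^ e j)" by (rule prod.cong) auto
    then show "L i * (\<Prod>j<n. L j ^ e j) = (\<Prod>j<n. L j ^ (e(i := Suc (e i))) j)"
      by (simp add: prod.remove[OF finite_lessThan i] mult.assoc)
    have "(\<Sum>j\<in>{..<n} - {i}. (e(i := Suc (e i))) j) = (\<Sum>j\<in>{..<n} - {i}. e j)" by (rule sum.cong) auto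
    then show "(\<Sum>j<n. (e(i := Suc (e i))) j) = Suc (\<Sum>j<n. e j)"
      by (simp add: sum.remove[OF finite_lessThan i])
  qed
  have MG: "a * x \<in> G (Suc r)" if a: "a \<in> M" and x: "x \<in> G r" for a x r
  proof -
    have Lx: "L i * x \<in> G (Suc r)" if i: "i < n" for i
    proof -
      have "G r \<subseteq> {x. L i * x \<in> G (Suc r)}"
      proof (rule Gl)
        show "idl {x. L i * x \<in> G (Suc r)}"
          using Gi[of "Suc r"] unfolding idl_def by (auto simp: distrib_left mult.left_commute)
        show "Z \<subseteq> {x. L i * x \<in> G (Suc r)}" using GZ idl_mult[OF Gi] by blast
        show "(\<Prod>j<n. L j ^ e j) \<in> {x. L i * x \<in> G (Suc r)}" if "r \<le> (\<Sum>j<n. e j)" for e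
          using mono[OF i, of e] Gm[of "Suc r" "e(i := Suc (e i))"] that by simp
      qed
      then show ?thesis using x by blast
    qed
    obtain c where c: "a - (\<Sum>i<n. c i * L i) \<in> Z" using a unfolding M gen_def by blast
    have "a * x = (a - (\<Sum>i<n. c i * L i)) * x + (\<Sum>i<n. c i * (L i * x))"
      by (simp add: left_diff_distrib sum_distrib_right mult.assoc)
    also have "\<dots> \<in> G (Suc r)"
    proof (rule idl_add[OF Gi])
      show "(a - (\<Sum>i<n. c i * L i)) * x \<in> G (Suc r)" using c GZ by (intro idl_mult2[OF Gi]) blast
      show "(\<Sum>i<n. c i * (L i * x)) \<in> G (Suc r)" 
      proof (rule idl_sum[OF Gi])
        fix i assume "i \<in> {..<n}"
        then have "L i * x \<in> G (Suc r)" using Lx by simp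
        then show "c i * (L i * x) \<in> G (Suc r)" by (rule idl_mult[OF Gi])
      qed
    qed
    finally show ?thesis .
  qed
  have NG: "N \<subseteq> isum ?J (G (Suc r))" for r
  proof (induction r)
    case 0
    have "M \<subseteq> G (Suc 0)" unfolding M
    proof (rule gen_least[OF Gi GZ])
      fix i assume "i < n"
      then show "L i \<in> G (Suc 0)"
        using mono[of i "\<lambda>_. 0"] Gm[of "Suc 0" "(\<lambda>_. 0)(i := Suc 0)"] by simp
    qed
    then show ?case using N isum_r[OF J] by blast
  next
    case (Suc r)
    let ?Q = "isum ?J (G (Suc (Suc r)))"
    have Q: "idl ?Q" by (rule isum_idl[OF J Gi])
    have "sq Z N \<subseteq> ?Q"
    proof (rule sq_least[OF Q])
      show "Z \<subseteq> ?Q" using gen_base[OF Z] isum_l[OF Gi] by blast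
      fix a b assume a: "a \<in> N" and b: "b \<in> N"
      obtain j x where jx: "b = j + x" "j \<in> ?J" "x \<in> G (Suc r)" using Suc b unfolding isum_def by blast
      have "a * j \<in> ?Q" using idl_mult[OF J jx(2)] isum_l[OF Gi] by blast
      moreover have "a * x \<in> ?Q" using MG[OF _ jx(3)] a N isum_r[OF J] by blast
      ultimately show "a * b \<in> ?Q" using idl_add[OF Q] by (simp add: jx(1) distrib_left)
    qed
    moreover have "F i \<in> ?Q" if "i < n" for i using gen_mem[OF Z that] isum_l[OF Gi] by blast
    ultimately show ?case using g gen_least[OF Q, of "sq Z N" n F] by blast
  qed
  define h where "h i = L i ^ k i" for i
  \<comment> \<open>the ideal generated by \<open>F\<close>, \<open>Z\<close> and the products of
    \<open>M\<close> with the \<open>h j\<close>\<close>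
  define U where "U = {x. \<exists>e. (\<forall>j<n. e j \<in> M) \<and> x - (\<Sum>j<n. e j * h j) \<in> ?J}"
  have Ui: "idl U"
    unfolding idl_def
  proof (intro conjI ballI allI)
    show "0 \<in> U" unfolding U_def using idl_zero[OF J] idl_zero[OF iM] by (auto intro: exI[of _ "\<lambda>_. 0"])
  next
    fix x y assume "x \<in> U" "y \<in> U"
    then obtain e d where *: "\<forall>j<n. e j \<in> M" "x - (\<Sum>j<n. e j * h j) \<in> ?J" "\<forall>j<n. d j \<in> M" "y - (\<Sum>j<n. d j * h j) \<in> ?J"
      unfolding U_def by blast
    have eq: "x + y - (\<Sum>j<n. (e j + d j) * h j) = (x - (\<Sum>j<n. e j * h j)) + (y - (\<Sum>j<n. d j * h j))"
      by (simp add: distrib_right sum.distrib)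
    have "x + y - (\<Sum>j<n. (e j + d j) * h j) \<in> ?J" unfolding eq by (rule idl_add[OF J *(2,4)])
    moreover have "\<forall>j<n. e j + d j \<in> M" using * idl_add[OF iM] by blast
    ultimately show "x + y \<in> U" unfolding U_def by (intro CollectI exI[of _ "\<lambda>j. e j + d j"]) simp
  next
    fix x r assume "x \<in> U"
    then obtain e where *: "\<forall>j<n. e j \<in> M" "x - (\<Sum>j<n. e j * h j) \<in> ?J" unfolding U_def by blast
    have eq: "r * x - (\<Sum>j<n. (r * e j) * h j) = r * (x - (\<Sum>j<n. e j * h j))"
      by (simp add: right_diff_distrib sum_distrib_left mult.assoc)
    have "r * x - (\<Sum>j<n. (r * e j) * h j) \<in> ?J" unfolding eq by (rule idl_mult[OF J *(2)])
    moreover have "\<forall>j<n. r * e j \<in> M" using * idl_mult[OF iM] by blast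
    ultimately show "r * x \<in> U" unfolding U_def by (intro CollectI exI[of _ "\<lambda>j. r * e j"]) simp
  qed
  have JU: "?J \<subseteq> U" unfolding U_def using idl_zero[OF iM] by (auto intro!: exI[of _ "\<lambda>_. 0"])
  have "G (Suc (\<Sum>i<n. k i)) \<subseteq> U"
  proof (rule Gl[OF Ui])
    show "Z \<subseteq> U" using gen_base[OF Z] JU by blast
    fix e assume e: "Suc (\<Sum>i<n. k i) \<le> (\<Sum>i<n. e i)"
    have "\<exists>i<n. k i < e i"
    proof (rule ccontr)
      assume "\<not> ?thesis"
      then have "e i \<le> k i" if "i < n" for i using that not_less by blast
      then have "(\<Sum>i<n. e i) \<le> (\<Sum>i<n. k i)" by (intro sum_mono) simp
      then show False using e by simp
    qed
    then obtain i where i: "i < n" "k i < e i" by blast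
    define x where "x = L i ^ (e i - Suc (k i)) * (\<Prod>j\<in>{..<n} - {i}. L j ^ e j)"
    have "(\<Prod>j<n. L j ^ e j) = L i ^ e i * (\<Prod>j\<in>{..<n} - {i}. L j ^ e j)"
      using i by (intro prod.remove) auto
    also have "L i ^ e i = L i * L i ^ (e i - Suc (k i)) * h i"
    proof -
      have "e i = Suc (e i - Suc (k i)) + k i" using i by simp
      then show ?thesis unfolding h_def by (metis power_Suc power_add)
    qed
    finally have eq: "(\<Prod>j<n. L j ^ e j) = (x * L i) * h i" by (simp add: x_def mult_ac)
    have "(\<Sum>j<n. (if j = i then x * L i else 0) * h j) = (\<Sum>j<n. if j = i then x * L i * h i else 0)"
      by (rule sum.cong) auto
    then have "(\<Prod>j<n. L j ^ e j) - (\<Sum>j<n. (if j = i then x * L i else 0) * h j) \<in> ?J"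
      using i idl_zero[OF J] by (simp add: eq)
    moreover have "x * L i \<in> M" unfolding M by (intro idl_mult[OF gen_idl[OF Z]] gen_mem[OF Z i(1)])
    ultimately show "(\<Prod>j<n. L j ^ e j) \<in> U" unfolding U_def using idl_zero[OF iM]
      by (intro CollectI exI[of _ "\<lambda>j. if j = i then x * L i else 0"]) auto
  qed
  then have NU: "N \<subseteq> U" using NG[of "\<Sum>i<n. k i"] JU idl_add[OF Ui] unfolding isum_def by blast
  have hU: "\<exists>e. (\<forall>j<n. e j \<in> M) \<and> h i - (\<Sum>j<n. e j * h j) \<in> ?J" if "i < n" for i
    using NU k[OF that] unfolding h_def[symmetric] U_def by blast
  obtain s where s: "1 - s \<in> M" "\<And>i. i < n \<Longrightarrow> s * h i \<in> ?J" using nakayama[OF J iM hU] by blast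
  have "s * a \<in> ?J" if aN: "a \<in> N" for a
  proof -
    obtain e where e: "a - (\<Sum>j<n. e j * h j) \<in> ?J" using aN NU unfolding U_def by blast
    have "s * a = s * (a - (\<Sum>j<n. e j * h j)) + (\<Sum>j<n. e j * (s * h j))"
      by (simp add: right_diff_distrib sum_distrib_left mult_ac)
    also have "\<dots> \<in> ?J"
    proof (rule idl_add[OF J idl_mult[OF J e] idl_sum[OF J]])
      fix j assume "j \<in> {..<n}"
      then have "s * h j \<in> ?J" using s(2) by simp
      then show "e j * (s * h j) \<in> ?J" by (rule idl_mult[OF J])
    qed
    finally show ?thesis .
  qed
  then show ?thesis using s(1) by blast
qed

subsection \<open>Nondegenerate zeros\<close>

text \<open>Functions that vanish at \<open>p\<close> to second order on the quadric.\<close>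

definition crit :: "nat \<Rightarrow> nat \<Rightarrow> (nat \<Rightarrow> complex) \<Rightarrow> pp set"
  where "crit m n p = {f. ev f p = 0 \<and> (\<exists>e. \<forall>k\<le>n. ev (pd k f) p = e * ev (pd k (quadric_poly m n)) p)}"

lemma crit_idl: "idl (crit m n p)"
  unfolding idl_def
proof (intro conjI ballI allI)
  show "0 \<in> crit m n p" by (auto simp: crit_def intro: exI[of _ 0])
next
  fix f g assume "f \<in> crit m n p" "g \<in> crit m n p"
  then obtain e d where "ev f p = 0" "ev g p = 0" "\<forall>k\<le>n. ev (pd k f) p = e * ev (pd k (quadric_poly m n)) p"
    "\<forall>k\<le>n. ev (pd k g) p = d * ev (pd k (quadric_poly m n)) p" unfolding crit_def by blast
  then show "f + g \<in> crit m n p" unfolding crit_def by (auto simp: distrib_right[symmetric])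
next
  fix f r assume "f \<in> crit m n p"
  then obtain e where "ev f p = 0" "\<forall>k\<le>n. ev (pd k f) p = e * ev (pd k (quadric_poly m n)) p" unfolding crit_def by blast
  then show "r * f \<in> crit m n p" unfolding crit_def by (auto simp: mult.assoc[symmetric])
qed

lemma sq_crit: assumes "m < n" "p \<in> quadric m n" shows "sq (Zq m n) (pt_ideal p) \<subseteq> crit m n p"
proof (rule sq_least[OF crit_idl])
  show "Zq m n \<subseteq> crit m n p" using Zq_ev[OF assms(1) _ assms(2)] Zq_pd[OF assms(1) _ assms(2)] by (auto simp: crit_def)
  show "a * b \<in> crit m n p" if "a \<in> pt_ideal p" "b \<in> pt_ideal p" for a b
    using that by (auto simp: crit_def pt_ideal_def intro: exI[of _ 0])
qed

text \<open>Modulo \<open>M\<^sup>2\<close> the differentials of \<open>F\<close> are obtained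
  from those of \<open>L\<close> by the matrix \<open>c\<close>, and a singular matrix would make
  the former dependent.\<close>

lemma nondeg_matrix:
  assumes mn: "m < n" and p: "p \<in> quadric m n" and nd: "nondeg m n F p" and L: "\<And>i. i < n \<Longrightarrow> L i \<in> pt_ideal p"
    and c: "\<And>j. j < n \<Longrightarrow> F j - (\<Sum>i<n. L i * c i j) \<in> sq (Zq m n) (pt_ideal p)"
  shows "ev (det (mat n n (\<lambda>(i, j). c i j))) p \<noteq> 0"
proof -
  let ?q = "quadric_poly m n"
  have "\<exists>e. \<forall>k\<le>n. ev (pd k (F j - (\<Sum>i<n. L i * c i j))) p = e * ev (pd k ?q) p" if "j < n" for j
  proof -
    have "F j - (\<Sum>i<n. L i * c i j) \<in> crit m n p" using c[OF that] sq_crit[OF mn p] by blast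
    then show ?thesis unfolding crit_def by blast
  qed
  then obtain e where e: "\<And>j k. j < n \<Longrightarrow> k \<le> n \<Longrightarrow> ev (pd k (F j - (\<Sum>i<n. L i * c i j))) p = e j * ev (pd k ?q) p"
    by metis
  have pF: "ev (pd k (F j)) p = (\<Sum>i<n. ev (c i j) p * ev (pd k (L i)) p) + e j * ev (pd k ?q) p" if "j < n" "k \<le> n" for j k
  proof -
    have "ev (pd k (\<Sum>i<n. L i * c i j)) p = (\<Sum>i<n. ev (c i j) p * ev (pd k (L i)) p)"
      unfolding pd_sum by (rule sum.cong) (use L in \<open>auto simp: pt_ideal_def\<close>)
    then show ?thesis using e[OF that] unfolding pd_diff by (simp add: algebra_simps)
  qed
  have t: "map_mat (\<lambda>f. ev f p) (mat n n (\<lambda>(i, j). c i j)) = mat n n (\<lambda>(i, j). ev (c i j) p)" by (rule eq_matI) auto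
  have "ev (det (mat n n (\<lambda>(i, j). c i j))) p = det (mat n n (\<lambda>(i, j). ev (c i j) p))"
    unfolding t[symmetric] by (rule ev.hom_det[symmetric])
  also have "\<dots> = det (transpose_mat (mat n n (\<lambda>(i, j). ev (c i j) p)))"
    by (rule det_transpose[symmetric]) auto
  also have "transpose_mat (mat n n (\<lambda>(i, j). ev (c i j) p)) = mat n n (\<lambda>(j, i). ev (c i j) p)" by (rule eq_matI) auto
  also have "det (mat n n (\<lambda>(j, i). ev (c i j) p)) \<noteq> 0"
    unfolding det_ne0_iff
  proof (rule allI, rule impI)
    fix b assume b: "\<forall>i<n. (\<Sum>j<n. b j * ev (c i j) p) = 0"
    have "(\<Sum>j<n. b j * ev (pd k (F j)) p) + (- (\<Sum>j<n. b j * e j)) * ev (pd k ?q) p = 0" if k: "k \<le> n" for k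
    proof -
      have "(\<Sum>j<n. b j * ev (pd k (F j)) p) = (\<Sum>j<n. b j * (\<Sum>i<n. ev (c i j) p * ev (pd k (L i)) p) + b j * e j * ev (pd k ?q) p)"
        by (rule sum.cong) (use pF k in \<open>auto simp: distrib_left mult.assoc\<close>)
      also have "\<dots> = (\<Sum>j<n. b j * (\<Sum>i<n. ev (c i j) p * ev (pd k (L i)) p)) + (\<Sum>j<n. b j * e j) * ev (pd k ?q) p"
        by (simp only: sum.distrib sum_distrib_right)
      also have "(\<Sum>j<n. b j * (\<Sum>i<n. ev (c i j) p * ev (pd k (L i)) p)) = (\<Sum>i<n. (\<Sum>j<n. b j * ev (c i j) p) * ev (pd k (L i)) p)"
        unfolding sum_distrib_left sum_distrib_right by (subst sum.swap) (simp only: mult.assoc)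
      also have "\<dots> = 0" by (rule sum.neutral) (use b in auto)
      finally show ?thesis by simp
    qed
    then have "(\<forall>j<n. b j = 0) \<and> - (\<Sum>j<n. b j * e j) = 0"
      by (intro nd[unfolded nondeg_def, THEN spec[of _ b], THEN spec[of _ "- (\<Sum>j<n. b j * e j)"], THEN mp]) blast
    then show "\<forall>j<n. b j = 0" by blast
  qed
  finally show ?thesis .
qed

text \<open>The matrix that expresses \<open>F\<close> through the generators \<open>L\<close> is
  invertible modulo \<open>M\<close>; its adjugate expresses the \<open>L i\<close> through
  \<open>F\<close> modulo \<open>M\<^sup>2\<close>.\<close>

lemma nondeg_gen:
  assumes mn: "m < n" and p: "p \<in> quadric m n" and M: "pt_ideal p = gen n L (Zq m n)"
    and F: "\<And>i. i < n \<Longrightarrow> F i \<in> pt_ideal p" and nd: "nondeg m n F p"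
  shows "pt_ideal p \<subseteq> gen n F (sq (Zq m n) (pt_ideal p))"
proof -
  let ?Z = "Zq m n" and ?S = "sq (Zq m n) (pt_ideal p)"
  note Z = Zq_idl[OF mn] and Si = sq_idl[of ?Z "pt_ideal p"]
  have "\<forall>j\<in>{..<n}. \<exists>c. F j - (\<Sum>i<n. c i * L i) \<in> ?Z" using F unfolding M gen_def by auto
  then obtain c where c: "\<And>j. j < n \<Longrightarrow> F j - (\<Sum>i<n. c j i * L i) \<in> ?Z"
    unfolding bchoice_iff by auto
  let ?C = "mat n n (\<lambda>(i, j). c j i)"
  define D where "D = det ?C"
  have L: "L i \<in> pt_ideal p" if "i < n" for i unfolding M by (rule gen_mem[OF Z that])
  have "ev D p \<noteq> 0" unfolding D_def
    by (rule nondeg_matrix[OF mn p nd L]) (use c sq_contains in \<open>auto simp: mult.commute\<close>)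
  then have "D \<notin> pt_ideal p" by (simp add: pt_ideal_def)
  then obtain r where r: "1 - r * D \<in> pt_ideal p" using pt_ideal_mxm by (auto simp: mxm_def)
  have C: "?C \<in> carrier_mat n n" by simp
  let ?A = "adj_mat ?C"
  have A: "?A \<in> carrier_mat n n" "?C * ?A = D \<cdot>\<^sub>m 1\<^sub>m n" using adj_mat[OF C] by (auto simp: D_def)
  have CA: "(\<Sum>j<n. c j i * ?A $$ (j, l)) = (if i = l then D else 0)" if "i < n" "l < n" for i l
  proof -
    have "(?C * ?A) $$ (i, l) = (\<Sum>j<n. c j i * ?A $$ (j, l))"
      using that A(1) by (simp add: scalar_prod_def atLeast0LessThan)
    moreover have "(D \<cdot>\<^sub>m 1\<^sub>m n) $$ (i, l) = (if i = l then D else 0)" using that by simp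
    ultimately show ?thesis unfolding A(2) by (rule trans[OF sym])
  qed
  have LS: "L l \<in> gen n F ?S" if l: "l < n" for l
  proof (rule genI[where c = "\<lambda>j. r * ?A $$ (j, l)"])
    have "(\<Sum>j<n. ?A $$ (j, l) * (\<Sum>i<n. c j i * L i)) = (\<Sum>i<n. (\<Sum>j<n. c j i * ?A $$ (j, l)) * L i)"
      unfolding sum_distrib_left sum_distrib_right by (subst sum.swap) (simp only: mult_ac)
    also have "\<dots> = (\<Sum>i<n. if i = l then D * L l else 0)" by (rule sum.cong) (use CA l in auto)
    finally have DL: "(\<Sum>j<n. ?A $$ (j, l) * (\<Sum>i<n. c j i * L i)) = D * L l" using l by simp
    have "L l - (\<Sum>j<n. r * ?A $$ (j, l) * F j) = (1 - r * D) * L l - r * (\<Sum>j<n. ?A $$ (j, l) * (F j - (\<Sum>i<n. c j i * L i)))"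
      unfolding right_diff_distrib sum_subtractf DL by (simp add: left_diff_distrib right_diff_distrib sum_distrib_left mult.assoc)
    also have "\<dots> \<in> ?S"
    proof (rule idl_diff[OF Si])
      show "(1 - r * D) * L l \<in> ?S" by (rule sq_mult[OF r L[OF l]])
      show "r * (\<Sum>j<n. ?A $$ (j, l) * (F j - (\<Sum>i<n. c j i * L i))) \<in> ?S"
        using c sq_contains by (intro idl_mult[OF Si] idl_sum[OF Si]) blast
    qed
    finally show "L l - (\<Sum>j<n. r * ?A $$ (j, l) * F j) \<in> ?S" .
  qed
  have "?Z \<subseteq> gen n F ?S" using gen_base[OF Si, of n F] sq_contains by blast
  from gen_least[OF gen_idl[OF Si] this LS] show ?thesis unfolding M .
qed

subsection \<open>Moving a primary ideal to a reduced one\<close>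

text \<open>The functions \<open>h i = L i ^ k i\<close> have no common zero on the quadric
  besides \<open>p\<close> and its conjugate, and they lie in \<open>N\<close>, so corrections by
  multiples of \<open>h i\<^sup>2\<close> stay in \<open>N\<^sup>2\<close>. After the correction
  given by \<open>bertini\<close>, the ideal \<open>(F)\<close> agrees with \<open>N\<close>
  locally at \<open>p\<close> and with the maximal ideal locally at each other zero.\<close>

lemma move_primary:
  assumes mn: "m < n" and p: "p \<in> quadric m n" and N: "idl N" "Zq m n \<subseteq> N" "N \<subseteq> pt_ideal p"
    and rad: "\<And>a. a \<in> pt_ideal p \<Longrightarrow> \<exists>k::nat. a ^ k \<in> N"
    and f: "\<And>i. i < n \<Longrightarrow> f i \<in> N" "N \<subseteq> gen n f (sq (Zq m n) N)"
  shows "\<exists>F B. (\<forall>i<n. F i - f i \<in> sq (Zq m n) N) \<and> finite B \<and>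
    (\<forall>M\<in>B. mxm M \<and> Zq m n \<subseteq> M \<and> M \<noteq> pt_ideal p) \<and> gen n F (Zq m n) = N \<inter> \<Inter>B"
proof -
  let ?Z = "Zq m n" and ?M = "pt_ideal p"
  note Z = Zq_idl[OF mn]
  have "\<exists>L. pt_ideal p = gen n L ?Z" using every_point_good[OF mn p] unfolding good_point_def by blast
  then obtain L where L: "?M = gen n L ?Z" by blast
  have "\<exists>k. i < n \<longrightarrow> L i ^ k \<in> N" for i using rad gen_mem[OF Z, of i n L] L by blast
  then obtain k where k: "\<And>i. i < n \<Longrightarrow> L i ^ k i \<in> N" by metis
  define h where "h i = L i ^ k i" for i
  obtain e where e: "\<And>q. q \<in> quadric m n \<Longrightarrow> \<forall>i<n. ev (f i + (\<Sum>j<n. h j ^ 2 * e i j)) q = 0 \<Longrightarrow> \<exists>j<n. ev (h j) q \<noteq> 0 \<Longrightarrow>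
     nondeg m n (\<lambda>i. f i + (\<Sum>j<n. h j ^ 2 * e i j)) q" using bertini[OF mn, where f = f and h = h and r = n] by blast
  define F where "F i = f i + (\<Sum>j<n. h j ^ 2 * e i j)" for i
  have hN: "h j \<in> N" if "j < n" for j unfolding h_def by (rule k[OF that])
  note Si = sq_idl[of ?Z N]
  have Ff: "F i - f i \<in> sq ?Z N" for i
  proof -
    have "(\<Sum>j<n. h j ^ 2 * e i j) \<in> sq ?Z N"
      by (intro idl_sum[OF Si] idl_mult2[OF Si]) (use sq_mult[of _ N _ ?Z] hN in \<open>auto simp: power2_eq_square\<close>)
    then show ?thesis by (simp add: F_def)
  qed
  have FN: "F i \<in> N" if "i < n" for i
    using idl_eqI[OF N(1), of "F i" "f i"] Ff sq_sub[OF N(1,2)] f(1)[OF that] by blast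
  have NF: "N \<subseteq> gen n F (sq ?Z N)"
  proof -
    have "f i \<in> gen n F (sq ?Z N)" if "i < n" for i
      using idl_eqI[OF gen_idl[OF Si] _ gen_mem[OF Si that]] idl_diff_sym[OF Si Ff] gen_base[OF Si] by blast
    then have "gen n f (sq ?Z N) \<subseteq> gen n F (sq ?Z N)" by (intro gen_least[OF gen_idl[OF Si] gen_base[OF Si]])
    then show ?thesis using f(2) by blast
  qed
  let ?J = "gen n F ?Z"
  note J = gen_idl[OF Z, of n F]
  define C where "C = insert N {M'. mxm M' \<and> ?J \<subseteq> M' \<and> M' \<noteq> ?M}"
  have ZJ: "?Z \<subseteq> ?J" by (rule gen_base[OF Z])
  have "\<exists>A\<in>C. \<exists>s. s \<notin> M' \<and> (\<forall>a\<in>A. s * a \<in> ?J)" if M': "mxm M'" "?J \<subseteq> M'" for M'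
  proof -
    have unit: "s \<notin> M'" if "1 - s \<in> M'" for s
      using that M'(1) idl_add[OF mxm_idl[OF M'(1)], of "1 - s" s] by (auto simp: mxm_def)
    show ?thesis
    proof (cases "M' = ?M")
      case True
      obtain s where "1 - s \<in> ?M" "\<forall>a\<in>N. s * a \<in> ?J"
        using gen_primary_local[OF Z L N k FN NF] by blast
      then show ?thesis using unit True unfolding C_def by blast
    next
      case False
      obtain p' where p': "p' \<in> quadric m n" "M' = pt_ideal p'"
        using quadric_nullstellensatz[OF mn M'(1)] ZJ M'(2) by blast
      have z: "\<forall>i<n. ev (F i) p' = 0" using M'(2) gen_mem[OF Z, of _ n F] p'(2) by (auto simp: pt_ideal_def)
      have "\<exists>j<n. ev (h j) p' \<noteq> 0"
      proof (rule ccontr)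
        assume "\<not> ?thesis"
        then have "h j \<in> M'" if "j < n" for j using that p'(2) by (simp add: pt_ideal_def)
        then have "L j \<in> M'" if "j < n" for j using prm_power[OF mxm_prm[OF M'(1)]] that unfolding h_def by blast
        then have "?M \<subseteq> M'" unfolding L using M' ZJ by (intro gen_least[OF mxm_idl[OF M'(1)]]) auto
        then show False using mxm_maximal[OF pt_ideal_mxm mxm_idl[OF M'(1)]] M'(1) False by (auto simp: mxm_def)
      qed
      then have nd: "nondeg m n F p'" using e[OF p'(1)] z unfolding F_def by blast
      have "\<exists>L'. pt_ideal p' = gen n L' ?Z" using every_point_good[OF mn p'(1)] unfolding good_point_def by blast
      then obtain L' where L': "pt_ideal p' = gen n L' ?Z" by blast
      have FM: "F i \<in> pt_ideal p'" if "i < n" for i using z that by (simp add: pt_ideal_def)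
      have "M' \<subseteq> gen n F (sq ?Z M')" using nondeg_gen[OF mn p'(1) L' FM nd] p'(2) by simp
      note sub = this
      have M'eq: "M' = gen n L' ?Z" using L' p'(2) by simp
      have pw: "L' i ^ Suc 0 \<in> M'" if "i < n" for i using gen_mem[OF Z that, of L'] M'eq by simp
      have ZM': "?Z \<subseteq> M'" using ZJ M'(2) by blast
      obtain s where "1 - s \<in> M'" "\<forall>a\<in>M'. s * a \<in> ?J"
        using gen_primary_local[OF Z M'eq mxm_idl[OF M'(1)] ZM' subset_refl pw FM[folded p'(2)] sub] by blast
      then show ?thesis using unit M' False unfolding C_def by blast
    qed
  qed
  from finite_intersection[OF J this] obtain B where B: "finite B" "B \<subseteq> C" "\<Inter>B \<subseteq> ?J" by blast
  have JN: "?J \<subseteq> N" by (rule gen_least[OF N(1,2) FN])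
  have "gen n F ?Z = N \<inter> \<Inter>(B - {N})"
  proof
    show "?J \<subseteq> N \<inter> \<Inter>(B - {N})" using JN B(2) unfolding C_def by blast
    show "N \<inter> \<Inter>(B - {N}) \<subseteq> ?J" using B(3) by blast
  qed
  moreover have "\<forall>M\<in>B - {N}. mxm M \<and> ?Z \<subseteq> M \<and> M \<noteq> ?M" using B(2) ZJ unfolding C_def by blast
  ultimately show ?thesis using Ff B(1) by (intro exI[of _ F] exI[of _ "B - {N}"]) auto
qed

subsection \<open>Every orientation of a closed point is global\<close>

definition blk :: "(nat \<Rightarrow> nat \<Rightarrow> 'a::comm_ring_1) \<Rightarrow> nat \<Rightarrow> nat \<Rightarrow> 'a"
  where "blk A i j = (if i < 2 \<and> j < 2 then A i j else if i = j then 1 else 0)"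

lemma sum_blk:
  fixes L :: "nat \<Rightarrow> 'p::comm_ring_1"
  assumes n: "2 \<le> n" and j: "j < n"
  shows "(\<Sum>i<n. L i * blk A i j) = (if j < 2 then L 0 * A 0 j + L 1 * A 1 j else L j)"
proof (cases "j < 2")
  case True
  have "(\<Sum>i<n. L i * blk A i j) = (\<Sum>i\<in>{0, 1}. L i * blk A i j)"
    by (rule sum.mono_neutral_right) (use n True in \<open>auto simp: blk_def\<close>)
  then show ?thesis using True by (simp add: blk_def)
next
  case False
  have "(\<Sum>i<n. L i * blk A i j) = (\<Sum>i<n. if i = j then L j else 0)"
    by (rule sum.cong) (use False in \<open>auto simp: blk_def\<close>)
  then show ?thesis using False j by simp
qed

lemma det_2x2: "det (mat 2 2 (\<lambda>(i, j). A i j)) = A 0 0 * A 1 1 - A 0 1 * A 1 (0::nat)"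
  for A :: "nat \<Rightarrow> nat \<Rightarrow> 'a::comm_ring_1"
proof -
  let ?M = "mat 2 2 (\<lambda>(i, j). A i j)"
  have M: "?M \<in> carrier_mat 2 2" by simp
  have d: "det (mat_delete ?M i j) = mat_delete ?M i j $$ (0, 0)" for i j
    by (rule det_single) (simp add: mat_delete_def)
  have "det ?M = (\<Sum>i<2. ?M $$ (i, 0) * cofactor ?M i 0)" by (rule laplace_expansion_column[OF M]) simp
  also have "\<dots> = ?M $$ (0, 0) * cofactor ?M 0 0 + ?M $$ (1, 0) * cofactor ?M 1 0"
    by (simp add: numeral_2_eq_2)
  finally show ?thesis unfolding cofactor_def d by (simp add: mat_delete_def mult.commute)
qed

lemma det_blk:
  fixes A :: "nat \<Rightarrow> nat \<Rightarrow> complex"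
  assumes "2 \<le> n"
  shows "det (mat n n (\<lambda>(i, j). blk A i j)) = A 0 0 * A 1 1 - A 0 1 * A 1 0"
proof -
  have "mat n n (\<lambda>(i, j). blk A i j) = four_block_mat (mat 2 2 (\<lambda>(i, j). A i j)) (0\<^sub>m 2 (n - 2)) (0\<^sub>m (n - 2) 2) (1\<^sub>m (n - 2))"
    using assms by (intro eq_matI) (auto simp: blk_def)
  then show ?thesis
    using det_four_block_mat_lower_left_zero[of "mat 2 2 (\<lambda>(i, j). A i j)" 2 "0\<^sub>m 2 (n - 2)" "n - 2" "0\<^sub>m (n - 2) 2" "1\<^sub>m (n - 2)"]
    by (simp add: det_2x2)
qed

lemma gen_blk_eqI:
  fixes L :: "nat \<Rightarrow> 'p::comm_ring_1"
  assumes Z: "idl Z" and n: "2 \<le> n" and Q: "Q = gen n (\<lambda>j. \<Sum>i<n. L i * blk A i j) Z"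
    and 01: "L 0 \<in> Q" "L 1 \<in> Q"
  shows "Q = gen n L Z"
proof
  have iQ: "idl Q" unfolding Q by (rule gen_idl[OF Z])
  have L: "L i \<in> Q" if i: "i < n" for i
  proof (cases "i < 2")
    case True then show ?thesis using 01 by (auto simp: less_2_cases_iff)
  next
    case False
    then have "(\<Sum>l<n. L l * blk A l i) = L i" using sum_blk[OF n i, of L A] by simp
    then show ?thesis using gen_mem[OF Z i, of "\<lambda>j. \<Sum>i<n. L i * blk A i j"] unfolding Q by simp
  qed
  show "gen n L Z \<subseteq> Q" using gen_base[OF Z] unfolding Q
    by (intro gen_least[OF gen_idl[OF Z]]) (auto simp: L[unfolded Q])
  show "Q \<subseteq> gen n L Z" unfolding Q
  proof (rule gen_least[OF gen_idl[OF Z] gen_base[OF Z]])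
    show "(\<Sum>i<n. L i * blk A i j) \<in> gen n L Z" if "j < n" for j
      by (intro idl_sum[OF gen_idl[OF Z]] idl_mult2[OF gen_idl[OF Z]] gen_mem[OF Z]) simp
  qed
qed

text \<open>With \<open>w = x a + y b\<close> and \<open>u v + w = 1\<close> modulo the remaining
  generators, the elements \<open>y w - a v\<close> and \<open>- (x w + b v)\<close> generate the
  same ideal as \<open>a\<close> and \<open>b\<close>, and the matrix of this change has
  determinant \<open>v\<^sup>2\<close>. Indeed, modulo the new ideal \<open>v w\<close>, then
  \<open>a v\<close> and \<open>b v\<close>, then \<open>w\<^sup>2\<close> vanish, and \<open>u v
  + w = 1\<close> makes \<open>v\<close> invertible.\<close>

lemma swan_towber:
  fixes L :: "nat \<Rightarrow> 'p::comm_ring_1"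
  assumes Z: "idl Z" and n: "2 \<le> n" and uv: "1 - u * v \<in> gen n L Z"
  shows "\<exists>A. A 0 0 * A 1 1 - A 0 1 * A 1 0 = v^2 \<and> gen n (\<lambda>j. \<Sum>i<n. L i * blk A i j) Z = gen n L Z"
proof -
  obtain c where c: "1 - u * v - (\<Sum>i<n. c i * L i) \<in> Z" using uv unfolding gen_def by blast
  define x where "x = c 0"
  define y where "y = c 1"
  define A where "A i j = (if i = 0 then (if j = 0 then x * y - v else - (x^2)) else (if j = 0 then y^2 else - (x * y) - v))" for i j :: nat
  define a where "a = L 0"
  define b where "b = L 1"
  define Q where "Q = gen n (\<lambda>j. \<Sum>i<n. L i * blk A i j) Z"
  have Qi: "idl Q" unfolding Q_def by (rule gen_idl[OF Z])
  define w where "w = x * a + y * b"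
  have mem: "(\<Sum>i<n. L i * blk A i j) \<in> Q" if "j < n" for j
    unfolding Q_def using gen_mem[OF Z that, of "\<lambda>j. \<Sum>i<n. L i * blk A i j"] .
  have a': "y * w - a * v \<in> Q"
    using mem[of 0] sum_blk[OF n, of 0 L A] n by (simp add: A_def w_def a_def b_def power2_eq_square algebra_simps)
  have b': "x * w + b * v \<in> Q"
  proof -
    have "(\<Sum>i<n. L i * blk A i 1) = a * - (x^2) + b * (- (x * y) - v)"
      using sum_blk[OF n, of 1 L A] n by (simp add: A_def a_def b_def)
    also have "\<dots> = - (x * w + b * v)" by (simp add: w_def power2_eq_square algebra_simps)
    finally have "- (x * w + b * v) \<in> Q" using mem[of 1] n by simp
    from idl_minus[OF Qi this] show ?thesis by (simp add: add.commute)
  qed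
  have rest: "L i \<in> Q" if "i < n" "\<not> i < 2" for i using mem[OF that(1)] sum_blk[OF n that(1), of L A] that(2) by simp
  have one: "1 - (u * v + w) \<in> Q"
  proof -
    have "(\<Sum>i<n. c i * L i) = w + (\<Sum>i\<in>{..<n} - {0, 1}. c i * L i)"
    proof -
      have "{..<n} = {0, 1} \<union> ({..<n} - {0, 1})" using n by auto
      then have "(\<Sum>i<n. c i * L i) = (\<Sum>i\<in>{0, 1} \<union> ({..<n} - {0, 1}). c i * L i)" by simp
      also have "\<dots> = (\<Sum>i\<in>{0, 1}. c i * L i) + (\<Sum>i\<in>{..<n} - {0, 1}. c i * L i)"
        by (rule sum.union_disjoint) auto
      finally show ?thesis by (simp add: w_def x_def y_def a_def b_def)
    qed
    then have "1 - (u * v + w) = (1 - u * v - (\<Sum>i<n. c i * L i)) + (\<Sum>i\<in>{..<n} - {0, 1}. c i * L i)" by simp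
    also have "\<dots> \<in> Q"
    proof (rule idl_add[OF Qi])
      show "1 - u * v - (\<Sum>i<n. c i * L i) \<in> Q" using c gen_base[OF Z] unfolding Q_def by blast
      show "(\<Sum>i\<in>{..<n} - {0, 1}. c i * L i) \<in> Q"
        by (intro idl_sum[OF Qi] idl_mult[OF Qi] rest) auto
    qed
    finally show ?thesis .
  qed
  have vw: "v * w \<in> Q"
  proof -
    have "v * w = y * (x * w + b * v) - x * (y * w - a * v)" by (simp add: w_def algebra_simps)
    then show ?thesis using idl_diff[OF Qi idl_mult[OF Qi b'] idl_mult[OF Qi a']] by metis
  qed
  have av: "a * v \<in> Q"
  proof -
    have "a * v = a * v * (1 - (u * v + w)) + u * (y * (v * w) - v * (y * w - a * v)) + a * (v * w)"
      by (simp add: algebra_simps)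
    then show ?thesis
      using idl_add[OF Qi idl_add[OF Qi idl_mult[OF Qi one] idl_mult[OF Qi idl_diff[OF Qi idl_mult[OF Qi vw] idl_mult[OF Qi a']]]] idl_mult[OF Qi vw]] by metis
  qed
  have bv: "b * v \<in> Q"
  proof -
    have "b * v = b * v * (1 - (u * v + w)) + u * (v * (x * w + b * v) - x * (v * w)) + b * (v * w)"
      by (simp add: algebra_simps)
    then show ?thesis
      using idl_add[OF Qi idl_add[OF Qi idl_mult[OF Qi one] idl_mult[OF Qi idl_diff[OF Qi idl_mult[OF Qi b'] idl_mult[OF Qi vw]]]] idl_mult[OF Qi vw]] by metis
  qed
  have yw: "y * w \<in> Q" using idl_add[OF Qi a' av] by simp
  have xw: "x * w \<in> Q" using idl_diff[OF Qi b' bv] by simp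
  have ww: "w * w \<in> Q"
  proof -
    have "w * w = a * (x * w) + b * (y * w)" by (simp add: w_def algebra_simps)
    then show ?thesis using idl_add[OF Qi idl_mult[OF Qi xw] idl_mult[OF Qi yw]] by metis
  qed
  have kill: "z \<in> Q" if zv: "z * v \<in> Q" for z
  proof -
    have "z = (z + z * w) * (1 - (u * v + w)) + u * (z * v) + z * u * (v * w) + z * (w * w)"
      by (simp add: algebra_simps)
    also have "\<dots> \<in> Q"
      by (intro idl_add[OF Qi idl_add[OF Qi idl_add[OF Qi idl_mult[OF Qi one] idl_mult[OF Qi zv]] idl_mult[OF Qi vw]] idl_mult[OF Qi ww]])
    finally show ?thesis .
  qed
  have "Q = gen n L Z"
    by (rule gen_blk_eqI[OF Z n Q_def]) (use kill[OF av] kill[OF bv] in \<open>simp_all add: a_def b_def\<close>)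
  moreover have "A 0 0 * A 1 1 - A 0 1 * A 1 0 = v^2" by (simp add: A_def power2_eq_square algebra_simps)
  ultimately show ?thesis unfolding Q_def by blast
qed

text \<open>A nonreal coordinate of \<open>p\<close> generates the complex numbers.\<close>

lemma ex_complex_value:
  assumes "Im (p k) \<noteq> 0" shows "\<exists>v. ev v p = z"
proof -
  define t where "t = cst (1 / Im (p k)) * (mpoly_var k - cst (Re (p k)))"
  have "ev t p = \<i>" using assms by (simp add: t_def complex_eq_iff)
  then have "ev (cst (Re z) + cst (Im z) * t) p = z" by (simp add: complex_eq_iff)
  then show ?thesis by blast
qed

text \<open>Let \<open>L\<close> be the generators provided by \<open>every_point_good\<close> and
  \<open>d\<close> the determinant that compares them with \<open>g\<close> in the residue field.
  A matrix of determinant \<open>1 / d\<close> that preserves the ideal, applied to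
  \<open>L\<close>, produces global generators \<open>F\<close> with determinant 1 relative to
  \<open>g\<close>.\<close>

lemma point_orientation_global:
  assumes mn: "m < n" and n: "2 \<le> n" and p: "p \<in> quadric m n"
    and g: "\<And>i. i < n \<Longrightarrow> g i \<in> pt_ideal p" "pt_ideal p \<subseteq> gen n g (sq (Zq m n) (pt_ideal p))"
  shows "\<exists>F c. gen n F (Zq m n) = pt_ideal p \<and> (\<forall>j<n. F j - (\<Sum>i<n. g i * c i j) \<in> sq (Zq m n) (pt_ideal p)) \<and>
    det (mat n n (\<lambda>(i, j). c i j)) - 1 \<in> pt_ideal p"
proof -
  let ?Z = "Zq m n" and ?M = "pt_ideal p" and ?S = "sq (Zq m n) (pt_ideal p)"
  note Z = Zq_idl[OF mn] and Si = sq_idl[of ?Z ?M]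
  obtain L where L: "?M = gen n L ?Z" and nd: "nondeg m n L p" using every_point_good[OF mn p] unfolding good_point_def by blast
  have "\<forall>j\<in>{..<n}. \<exists>c. L j - (\<Sum>i<n. g i * c i) \<in> ?S"
  proof
    fix j assume "j \<in> {..<n}"
    then have "L j \<in> ?M" unfolding L by (intro gen_mem[OF Z]) simp
    then have "L j \<in> gen n g ?S" using g(2) by blast
    then show "\<exists>c. L j - (\<Sum>i<n. g i * c i) \<in> ?S" unfolding gen_def by (simp add: mult.commute)
  qed
  then obtain r' where r': "\<And>j. j < n \<Longrightarrow> L j - (\<Sum>i<n. g i * r' j i) \<in> ?S" unfolding bchoice_iff by auto
  define \<rho> where "\<rho> i j = r' j i" for i j
  have \<rho>: "L j - (\<Sum>i<n. g i * \<rho> i j) \<in> ?S" if "j < n" for j unfolding \<rho>_def by (rule r'[OF that])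
  define d where "d = ev (det (mat n n (\<lambda>(i, j). \<rho> i j))) p"
  have d0: "d \<noteq> 0" unfolding d_def by (rule nondeg_matrix[OF mn p nd g(1) \<rho>])
  have "\<exists>A. ev (A 0 0 * A 1 1 - A 0 1 * A 1 0) p = 1 / d \<and> gen n (\<lambda>j. \<Sum>i<n. L i * blk A i j) ?Z = gen n L ?Z"
  proof (cases "\<exists>k. Im (p k) \<noteq> 0")
    case True
    then obtain v where v: "ev v p = csqrt (1 / d)" using ex_complex_value by blast
    then have "v \<notin> ?M" using d0 by (simp add: pt_ideal_def)
    then obtain u where "1 - u * v \<in> ?M" using pt_ideal_mxm by (auto simp: mxm_def)
    then obtain A where A: "A 0 0 * A 1 1 - A 0 1 * A 1 0 = v^2" "gen n (\<lambda>j. \<Sum>i<n. L i * blk A i j) ?Z = gen n L ?Z"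
      using swan_towber[OF Z n, of u v L] L by auto
    have "ev (A 0 0 * A 1 1 - A 0 1 * A 1 0) p = 1 / d" unfolding A(1) using v by simp
    then show ?thesis using A(2) by blast
  next
    case False
    then have re: "cnj (p k) = p k" for k by (simp add: complex_eq_iff)
    have "cnj d = d" unfolding d_def ev_cnj[symmetric] re ..
    then obtain r where r: "d = of_real r" by (metis Reals_cnj_iff Reals_cases)
    define A where "A i j = (if i = 0 \<and> j = 0 then cst (1 / r) else if i = j then 1 else (0::pp))" for i j :: nat
    define Q where "Q = gen n (\<lambda>j. \<Sum>i<n. L i * blk A i j) ?Z"
    have Qi: "idl Q" unfolding Q_def by (rule gen_idl[OF Z])
    have mem: "(\<Sum>i<n. L i * blk A i j) \<in> Q" if "j < n" for j
      unfolding Q_def using gen_mem[OF Z that, of "\<lambda>j. \<Sum>i<n. L i * blk A i j"] .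
    have "L 0 * cst (1 / r) \<in> Q" using mem[of 0] sum_blk[OF n, of 0 L A] n by (simp add: A_def)
    then have "cst r * (L 0 * cst (1 / r)) \<in> Q" by (rule idl_mult[OF Qi])
    moreover have "cst r * (L 0 * cst (1 / r)) = L 0"
    proof -
      have "cst r * cst (1 / r) = 1" using d0 r by (simp add: cst.hom_mult[symmetric] del: cst.hom_mult)
      then show ?thesis by (metis mult.assoc mult.commute mult_1)
    qed
    ultimately have "L 0 \<in> Q" by simp
    moreover have "L 1 \<in> Q" using mem[of 1] sum_blk[OF n, of 1 L A] n by (simp add: A_def)
    ultimately have "Q = gen n L ?Z" using gen_blk_eqI[OF Z n Q_def] by blast
    moreover have "ev (A 0 0 * A 1 1 - A 0 1 * A 1 0) p = 1 / d" by (simp add: A_def r)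
    ultimately show ?thesis unfolding Q_def by blast
  qed
  then obtain A where A: "ev (A 0 0 * A 1 1 - A 0 1 * A 1 0) p = 1 / d" "gen n (\<lambda>j. \<Sum>i<n. L i * blk A i j) ?Z = gen n L ?Z" by blast
  define F where "F j = (\<Sum>i<n. L i * blk A i j)" for j
  define c where "c i j = (\<Sum>l<n. \<rho> i l * blk A l j)" for i j
  have "F j - (\<Sum>i<n. g i * c i j) \<in> ?S" for j
  proof -
    have "(\<Sum>i<n. g i * c i j) = (\<Sum>l<n. (\<Sum>i<n. g i * \<rho> i l) * blk A l j)"
      unfolding c_def sum_distrib_left sum_distrib_right by (subst sum.swap) (simp only: mult.assoc)
    then have "F j - (\<Sum>i<n. g i * c i j) = (\<Sum>l<n. (L l - (\<Sum>i<n. g i * \<rho> i l)) * blk A l j)"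
      by (simp add: F_def left_diff_distrib sum_subtractf)
    also have "\<dots> \<in> ?S" using \<rho> by (intro idl_sum[OF Si] idl_mult2[OF Si]) simp
    finally show ?thesis .
  qed
  moreover have "det (mat n n (\<lambda>(i, j). c i j)) - 1 \<in> ?M"
  proof -
    have "mat n n (\<lambda>(i, j). c i j) = mat n n (\<lambda>(i, j). \<rho> i j) * mat n n (\<lambda>(i, j). blk A i j)"
      by (rule eq_matI) (auto simp: c_def scalar_prod_def atLeast0LessThan)
    then have D: "det (mat n n (\<lambda>(i, j). c i j)) = det (mat n n (\<lambda>(i, j). \<rho> i j)) * det (mat n n (\<lambda>(i, j). blk A i j))"
      by (simp add: det_mult[of _ n])
    have t: "map_mat (\<lambda>f. ev f p) (mat n n (\<lambda>(i, j). blk A i j)) = mat n n (\<lambda>(i, j). blk (\<lambda>i j. ev (A i j) p) i j)"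
      by (rule eq_matI) (auto simp: blk_def)
    have "ev (det (mat n n (\<lambda>(i, j). blk A i j))) p = det (mat n n (\<lambda>(i, j). blk (\<lambda>i j. ev (A i j) p) i j))"
      unfolding t[symmetric] by (rule ev.hom_det[symmetric])
    also have "\<dots> = 1 / d" using A(1) by (simp add: det_blk[OF n])
    finally have "ev (det (mat n n (\<lambda>(i, j). c i j))) p = 1" unfolding D using d0 by (simp add: d_def[symmetric] del: ev.hom_det)
    then show ?thesis by (simp add: pt_ideal_def)
  qed
  moreover have "gen n F ?Z = ?M" using A(2) L unfolding F_def by simp
  ultimately show ?thesis by blast
qed

section \<open>Orientations in coordinates\<close>

definition pvec :: "nat \<Rightarrow> ('p \<Rightarrow> 'b) \<Rightarrow> (nat \<Rightarrow> 'p) \<Rightarrow> nat \<Rightarrow> 'b"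
  where "pvec n q c = (\<lambda>i\<in>{..<n}. q (c i))"

context presented begin

lemma pvec_carrier: "pvec n \<pi> c \<in> carrier (free_module R n)"
  by (auto simp: pvec_def free_module_def)

lemma pvec_cases:
  assumes "v \<in> carrier (free_module R n)" obtains c where "v = pvec n \<pi> c"
proof -
  have "\<forall>i\<in>{..<n}. \<exists>x. v i = \<pi> x" using assms ex_lift by (auto simp: free_module_def PiE_iff)
  then obtain c where c: "\<And>i. i < n \<Longrightarrow> v i = \<pi> (c i)" unfolding bchoice_iff by auto
  have "v = pvec n \<pi> c"
    using assms c by (intro extensionalityI[of _ "{..<n}"]) (auto simp: pvec_def free_module_def PiE_iff)
  then show thesis by (rule that)
qed

lemma pvec_add: "pvec n \<pi> c \<oplus>\<^bsub>free_module R n\<^esub> pvec n \<pi> d = pvec n \<pi> (\<lambda>i. c i + d i)"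
  by (auto simp: pvec_def free_module_def pi_add)

lemma pvec_smult: "\<pi> a \<odot>\<^bsub>free_module R n\<^esub> pvec n \<pi> c = pvec n \<pi> (\<lambda>i. a * c i)"
  by (auto simp: pvec_def free_module_def pi_mult)

lemma pi_scaled:
  assumes "e = 1 \<or> e = -1" shows "add_pow R (e :: int) (\<pi> x) = \<pi> (of_int e * x)"
  using assms add.int_pow_neg[of "\<pi> x" 1] add.int_pow_1[of "\<pi> x"] by (auto simp: pi_minus)

lemma ring_det_lift:
  assumes "\<And>i j. i < n \<Longrightarrow> j < n \<Longrightarrow> A i j = \<pi> (c i j)"
  shows "ring_det R n A = \<pi> (det (mat n n (\<lambda>(i, j). c i j)))"
proof -
  have fp: "finite {p. p permutes {..<n}}" by (rule finite_permutations) simp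
  have "ring_det R n A = (\<Oplus>p\<in>{p. p permutes {..<n}}. \<pi> (of_int (sign p) * (\<Prod>i<n. c i (p i))))"
    unfolding ring_det_def
  proof (rule finsum_cong')
    fix p assume p: "p \<in> {p. p permutes {..<n}}"
    have "(\<Otimes>i\<in>{..<n}. A i (p i)) = (\<Otimes>i\<in>{..<n}. \<pi> (c i (p i)))"
    proof (rule finprod_cong')
      fix i assume i: "i \<in> {..<n}"
      then have "p i \<in> {..<n}" using p permutes_in_image[of p "{..<n}" i] by simp
      then show "A i (p i) = \<pi> (c i (p i))" using assms i by simp
    qed auto
    also have "\<dots> = \<pi> (\<Prod>i<n. c i (p i))" by (simp add: pi_prod)
    finally show "add_pow R (sign p :: int) (\<Otimes>i\<in>{..<n}. A i (p i)) = \<pi> (of_int (sign p) * (\<Prod>i<n. c i (p i)))"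
      using pi_scaled[of "sign p"] sign_cases[of p] by auto
  qed auto
  also have "\<dots> = \<pi> (\<Sum>p\<in>{p. p permutes {..<n}}. of_int (sign p) * (\<Prod>i<n. c i (p i)))"
    using fp by (simp add: pi_sum)
  also have "(\<Sum>p\<in>{p. p permutes {..<n}}. of_int (sign p) * (\<Prod>i<n. c i (p i))) = det (mat n n (\<lambda>(i, j). c i j))"
  proof -
    have "(\<Prod>i<n. mat n n (\<lambda>(i, j). c i j) $$ (i, p i)) = (\<Prod>i<n. c i (p i))" if "p permutes {..<n}" for p
      by (rule prod.cong) (use permutes_in_image[OF that] in auto)
    then show ?thesis
      unfolding det_def'[OF mat_carrier] atLeast0LessThan by (intro sum.cong) simp_all
  qed
  finally show ?thesis .
qed

lemma mat_vec_lift: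
  assumes "\<And>i j. i < n \<Longrightarrow> j < n \<Longrightarrow> A i j = \<pi> (c i j)"
  shows "mat_vec R n A (pvec n \<pi> d) = pvec n \<pi> (\<lambda>i. \<Sum>j<n. c i j * d j)"
proof -
  have "(\<Oplus>j\<in>{..<n}. A i j \<otimes> pvec n \<pi> d j) = \<pi> (\<Sum>j<n. c i j * d j)" if i: "i < n" for i
  proof -
    have "(\<Oplus>j\<in>{..<n}. A i j \<otimes> pvec n \<pi> d j) = (\<Oplus>j\<in>{..<n}. \<pi> (c i j * d j))"
      by (rule finsum_cong') (use assms i in \<open>auto simp: pvec_def pi_mult\<close>)
    then show ?thesis by (simp add: pi_sum)
  qed
  then show ?thesis by (auto simp: mat_vec_def pvec_def)
qed

lemma mem_coset: assumes "ideal J R" shows "\<pi> x \<in> J +> \<pi> r \<longleftrightarrow> x - r \<in> pre J"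
proof -
  interpret ideal J R by fact
  have "\<pi> x \<in> J +> \<pi> r \<longleftrightarrow> \<pi> x \<ominus> \<pi> r \<in> J"
    using a_rcos_module[of "\<pi> r" "\<pi> x"] by (simp add: minus_eq)
  then show ?thesis by (simp add: pi_diff)
qed

lemma coset_cases:
  assumes "ideal J R" "a \<in> J +> \<pi> r" obtains x where "a = \<pi> x" "x - r \<in> pre J"
proof -
  interpret ideal J R by fact
  have "a \<in> carrier R" using assms(2) a_r_coset_subset_G[OF a_subset] by blast
  then obtain x where "a = \<pi> x" using ex_lift by blast
  then show thesis using that mem_coset[OF assms(1)] assms(2) by blast
qed

lemma coset_absorb:
  assumes J: "ideal J R" and N: "ideal N R" and JN: "J \<subseteq> N"
  shows "N <+>\<^bsub>R\<^esub> (J +> \<pi> x) = N +> \<pi> x"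
proof
  note iN = idl_pre[OF N]
  show "N <+>\<^bsub>R\<^esub> (J +> \<pi> x) \<subseteq> N +> \<pi> x"
  proof
    fix a assume "a \<in> N <+>\<^bsub>R\<^esub> (J +> \<pi> x)"
    then obtain u b where u: "u \<in> N" "b \<in> J +> \<pi> x" "a = u \<oplus> b" unfolding set_add_def' by blast
    obtain u' where u': "u = \<pi> u'" using ex_lift[of u] u(1) ideal_carrier[OF N] by blast
    obtain y where y: "b = \<pi> y" "y - x \<in> pre J" using coset_cases[OF J u(2)] by blast
    have "y - x \<in> pre N" using y(2) JN by auto
    then have "u' + (y - x) \<in> pre N" using u(1) u' by (intro idl_add[OF iN]) auto
    then have "(u' + y) - x \<in> pre N" by (simp add: add_diff_eq)
    then show "a \<in> N +> \<pi> x" using mem_coset[OF N, of "u' + y" x] by (simp add: u(3) u' y(1) pi_add)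
  qed
  show "N +> \<pi> x \<subseteq> N <+>\<^bsub>R\<^esub> (J +> \<pi> x)"
  proof
    fix a assume "a \<in> N +> \<pi> x"
    then obtain y where y: "a = \<pi> y" "y - x \<in> pre N" using coset_cases[OF N] by blast
    have "a = \<pi> (y - x) \<oplus> \<pi> x" by (simp add: y(1) pi_add[symmetric])
    moreover have "\<pi> x \<in> J +> \<pi> x" using mem_coset[OF J, of x x] idl_zero[OF idl_pre[OF J]] by simp
    ultimately show "a \<in> N <+>\<^bsub>R\<^esub> (J +> \<pi> x)" unfolding set_add_def' using y(2) by auto
  qed
qed

abbreviation sqr :: "'a set \<Rightarrow> 'a set" where "sqr J \<equiv> J \<cdot>\<^bsub>R\<^esub> J"

lemma sqr_ideal: "ideal J R \<Longrightarrow> ideal (sqr J) R" by (rule ideal_prod_is_ideal)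

lemma pre_sqr: assumes J: "ideal J R" shows "pre (sqr J) = sq ker (pre J)"
proof
  let ?S = "sq ker (pre J)"
  note iS = sq_idl[of ker "pre J"]
  have pq: "pre (\<pi> ` ?S) = ?S" by (rule pre_image[OF iS sq_contains])
  have "sqr J \<subseteq> \<pi> ` ?S"
  proof
    fix a assume "a \<in> sqr J"
    then show "a \<in> \<pi> ` ?S"
    proof (induction rule: ideal_prod.induct)
      case (prod i j)
      obtain x where x: "i = \<pi> x" using ex_lift[of i] prod(1) ideal_carrier[OF J] by blast
      obtain y where y: "j = \<pi> y" using ex_lift[of j] prod(2) ideal_carrier[OF J] by blast
      have "x * y \<in> ?S" using prod x y by (intro sq_mult) auto
      then show ?case by (metis imageI pi_mult x y)
    next
      case (sum s1 s2)
      then obtain x y where "x \<in> ?S" "y \<in> ?S" "s1 = \<pi> x" "s2 = \<pi> y" by blast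
      then show ?case using idl_add[OF iS] by (metis imageI pi_add)
    qed
  qed
  then show "pre (sqr J) \<subseteq> ?S" using pq by (auto simp: pre_def)
  show "?S \<subseteq> pre (sqr J)"
  proof (rule sq_least[OF idl_pre[OF sqr_ideal[OF J]] ker_sub[OF sqr_ideal[OF J]]])
    fix a b assume "a \<in> pre J" "b \<in> pre J"
    then show "a * b \<in> pre (sqr J)" by (simp add: pi_mult ideal_prod.prod)
  qed
qed

lemma sqr_mult: "ideal J R \<Longrightarrow> a \<in> pre J \<Longrightarrow> b \<in> pre J \<Longrightarrow> a * b \<in> pre (sqr J)"
  by (simp add: pi_mult ideal_prod.prod)

lemma sqr_mono: assumes "ideal J R" "ideal N R" "J \<subseteq> N" shows "sqr J \<subseteq> sqr N"
proof
  fix a assume "a \<in> sqr J"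
  then show "a \<in> sqr N" by (induction rule: ideal_prod.induct) (use assms in \<open>auto intro: ideal_prod.intros\<close>)
qed

lemma coset_smult:
  assumes J: "ideal J R" and y: "y \<in> pre J"
  shows "rcoset_mult R (sqr J) (J +> \<pi> r) (sqr J +> \<pi> y) = sqr J +> \<pi> (r * y)"
proof -
  note S = sqr_ideal[OF J] and iJ = idl_pre[OF J] and iS = idl_pre[OF sqr_ideal[OF J]]
  have eq: "sqr J +> (a \<otimes> b) = sqr J +> \<pi> (r * y)" if ab: "a \<in> J +> \<pi> r" "b \<in> sqr J +> \<pi> y" for a b
  proof -
    obtain x where x: "a = \<pi> x" "x - r \<in> pre J" using coset_cases[OF J ab(1)] by blast
    obtain z where z: "b = \<pi> z" "z - y \<in> pre (sqr J)" using coset_cases[OF S ab(2)] by blast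
    have "x * z - r * y = x * (z - y) + (x - r) * y" by (simp add: algebra_simps)
    then have "x * z - r * y \<in> pre (sqr J)"
      using idl_add[OF iS idl_mult[OF iS z(2)] sqr_mult[OF J x(2) y]] by metis
    then show ?thesis using coset_eq_iff[OF S] by (simp add: x(1) z(1) pi_mult[symmetric])
  qed
  have m: "\<pi> r \<in> J +> \<pi> r" "\<pi> y \<in> sqr J +> \<pi> y"
    using mem_coset[OF J, of r r] mem_coset[OF S, of y y] idl_zero[OF iJ] idl_zero[OF iS] by simp_all
  show ?thesis unfolding rcoset_mult_def
  proof
    show "(\<Union>a\<in>J +> \<pi> r. \<Union>b\<in>sqr J +> \<pi> y. sqr J +> a \<otimes> b) \<subseteq> sqr J +> \<pi> (r * y)" using eq by blast
    show "sqr J +> \<pi> (r * y) \<subseteq> (\<Union>a\<in>J +> \<pi> r. \<Union>b\<in>sqr J +> \<pi> y. sqr J +> a \<otimes> b)" using eq[OF m] m by blast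
  qed
qed

text \<open>The map \<open>(R / J)\<^sup>n \<rightarrow> J / J\<^sup>2\<close> that sends the
  \<open>i\<close>-th basis vector to the class of \<open>f i\<close>. It does not depend on the
  representatives chosen by \<open>SOME\<close> (\<open>cmap_pvec\<close>).\<close>

definition cmap :: "nat \<Rightarrow> 'a set \<Rightarrow> (nat \<Rightarrow> 'p) \<Rightarrow> (nat \<Rightarrow> 'a set) \<Rightarrow> 'a set"
  where "cmap n J f = (\<lambda>v\<in>carrier (free_module (R Quot J) n).
    sqr J +> \<pi> (\<Sum>i<n. (SOME c. v = pvec n (\<lambda>x. J +> \<pi> x) c) i * f i))"

definition generating :: "nat \<Rightarrow> 'a set \<Rightarrow> (nat \<Rightarrow> 'p) \<Rightarrow> bool"
  where "generating n J f \<longleftrightarrow> (\<forall>i<n. f i \<in> pre J) \<and> pre J \<subseteq> gen n f (pre (sqr J))"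

lemma cmap_pvec:
  assumes J: "ideal J R" and f: "\<forall>i<n. f i \<in> pre J"
  shows "cmap n J f (pvec n (\<lambda>x. J +> \<pi> x) c) = sqr J +> \<pi> (\<Sum>i<n. c i * f i)"
proof -
  interpret Q: presented "R Quot J" "\<lambda>x. J +> \<pi> x" by (rule presented_Quot[OF J])
  note S = sqr_ideal[OF J]
  let ?v = "pvec n (\<lambda>x. J +> \<pi> x) c"
  define d where "d = (SOME c. ?v = pvec n (\<lambda>x. J +> \<pi> x) c)"
  have "?v = pvec n (\<lambda>x. J +> \<pi> x) d" unfolding d_def by (rule someI[of _ c]) simp
  then have "J +> \<pi> (d i) = J +> \<pi> (c i)" if "i < n" for i using that unfolding pvec_def by (metis lessThan_iff restrict_apply')
  then have dc: "d i - c i \<in> pre J" if "i < n" for i using coset_eq_iff[OF J] that by blast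
  have "(\<Sum>i<n. d i * f i) - (\<Sum>i<n. c i * f i) = (\<Sum>i<n. (d i - c i) * f i)"
    by (simp add: left_diff_distrib sum_subtractf)
  also have "\<dots> \<in> pre (sqr J)"
    by (rule idl_sum[OF idl_pre[OF S]]) (use dc f sqr_mult[OF J] in blast)
  finally have "sqr J +> \<pi> (\<Sum>i<n. d i * f i) = sqr J +> \<pi> (\<Sum>i<n. c i * f i)" using coset_eq_iff[OF S] by blast
  then show ?thesis unfolding cmap_def d_def using Q.pvec_carrier by simp
qed

lemma cmap_surjection:
  assumes J: "ideal J R" and g: "generating n J f"
  shows "cmap n J f \<in> conormal_surjections R n J"
proof -
  interpret Q: presented "R Quot J" "\<lambda>x. J +> \<pi> x" by (rule presented_Quot[OF J])
  note S = sqr_ideal[OF J] and iJ = idl_pre[OF J]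
  interpret Q2: presented "R Quot (sqr J)" "\<lambda>x. sqr J +> \<pi> x" by (rule presented_Quot[OF S])
  let ?M = "free_module (R Quot J) n" and ?N = "conormal_module R J"
  let ?v = "pvec n (\<lambda>x. J +> \<pi> x)"
  have fA: "\<forall>i<n. f i \<in> pre J" using g by (simp add: generating_def)
  then have f: "f i \<in> pre J" if "i < n" for i using that by blast
  note cv = cmap_pvec[OF J fA]
  have sJ: "(\<Sum>i<n. c i * f i) \<in> pre J" for c by (intro idl_sum[OF iJ] idl_mult[OF iJ] f) simp
  have N: "carrier ?N = (\<lambda>x. sqr J +> x) ` J" by (simp add: conormal_module_def)
  show ?thesis
    unfolding conormal_surjections_def module_epis_def
  proof (intro CollectI conjI ballI)
    have "cmap n J f v \<in> carrier ?N" if vM: "v \<in> carrier ?M" for v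
    proof -
      obtain c where "v = ?v c" using Q.pvec_cases[OF vM] by blast
      then show ?thesis using cv sJ[of c] unfolding N by auto
    qed
    then show "cmap n J f \<in> carrier ?M \<rightarrow>\<^sub>E carrier ?N" unfolding cmap_def by auto
  next
    fix u v assume "u \<in> carrier ?M" "v \<in> carrier ?M"
    then obtain c d where uv: "u = ?v c" "v = ?v d" using Q.pvec_cases by metis
    have "cmap n J f (u \<oplus>\<^bsub>?M\<^esub> v) = sqr J +> \<pi> ((\<Sum>i<n. c i * f i) + (\<Sum>i<n. d i * f i))"
      unfolding uv Q.pvec_add cv by (simp add: distrib_right sum.distrib)
    also have "\<dots> = (sqr J +> \<pi> (\<Sum>i<n. c i * f i)) <+>\<^bsub>R\<^esub> (sqr J +> \<pi> (\<Sum>i<n. d i * f i))"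
      unfolding Q2.pi_add by (simp add: FactRing_def)
    finally show "cmap n J f (u \<oplus>\<^bsub>?M\<^esub> v) = cmap n J f u \<oplus>\<^bsub>?N\<^esub> cmap n J f v"
      unfolding uv cv by (simp add: conormal_module_def)
  next
    fix a u assume a: "a \<in> carrier (R Quot J)" and "u \<in> carrier ?M"
    then obtain c where u: "u = ?v c" using Q.pvec_cases by metis
    obtain r where r: "a = J +> \<pi> r" using Q.ex_lift[OF a] by blast
    have "cmap n J f (a \<odot>\<^bsub>?M\<^esub> u) = sqr J +> \<pi> (r * (\<Sum>i<n. c i * f i))"
      unfolding u r Q.pvec_smult cv by (simp add: sum_distrib_left mult.assoc)
    also have "\<dots> = rcoset_mult R (sqr J) a (sqr J +> \<pi> (\<Sum>i<n. c i * f i))"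
      unfolding r by (rule coset_smult[OF J sJ, symmetric])
    finally show "cmap n J f (a \<odot>\<^bsub>?M\<^esub> u) = a \<odot>\<^bsub>?N\<^esub> cmap n J f u"
      unfolding u cv by (simp add: conormal_module_def)
  next
    show "cmap n J f ` carrier ?M = carrier ?N"
    proof
      show "cmap n J f ` carrier ?M \<subseteq> carrier ?N"
      proof
        fix b assume "b \<in> cmap n J f ` carrier ?M"
        then obtain v where v: "v \<in> carrier ?M" "b = cmap n J f v" by blast
        obtain c where "v = ?v c" using Q.pvec_cases[OF v(1)] by blast
        then show "b \<in> carrier ?N" using v(2) cv sJ[of c] unfolding N by auto
      qed
      show "carrier ?N \<subseteq> cmap n J f ` carrier ?M"
      proof
        fix b assume "b \<in> carrier ?N"
        then obtain a where a: "a \<in> J" "b = sqr J +> a" unfolding N by blast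
        obtain x where x: "a = \<pi> x" using ex_lift[of a] a(1) ideal_carrier[OF J] by blast
        have "x \<in> gen n f (pre (sqr J))" using g a(1) x unfolding generating_def by auto
        then obtain c where "x - (\<Sum>i<n. c i * f i) \<in> pre (sqr J)" unfolding gen_def by blast
        then have "b = cmap n J f (?v c)" unfolding cv a(2) x using coset_eq_iff[OF S] by blast
        then show "b \<in> cmap n J f ` carrier ?M" using Q.pvec_carrier by blast
      qed
    qed
  qed
qed

lemma map_eqI:
  assumes J: "ideal J R" and "\<alpha> \<in> extensional (carrier (free_module (R Quot J) n))" "\<beta> \<in> extensional (carrier (free_module (R Quot J) n))"
    and eq: "\<And>c. \<alpha> (pvec n (\<lambda>x. J +> \<pi> x) c) = \<beta> (pvec n (\<lambda>x. J +> \<pi> x) c)"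
  shows "\<alpha> = \<beta>"
proof (rule extensionalityI[OF assms(2,3)])
  interpret Q: presented "R Quot J" "\<lambda>x. J +> \<pi> x" by (rule presented_Quot[OF J])
  fix v assume "v \<in> carrier (free_module (R Quot J) n)"
  then obtain c where "v = pvec n (\<lambda>x. J +> \<pi> x) c" using Q.pvec_cases by metis
  then show "\<alpha> v = \<beta> v" using eq by simp
qed

lemma surjection_extensional: "\<beta> \<in> conormal_surjections R n J \<Longrightarrow> \<beta> \<in> extensional (carrier (free_module (R Quot J) n))"
  by (simp add: conormal_surjections_def module_epis_def PiE_def)

lemma cmap_extensional: "cmap n J f \<in> extensional (carrier (free_module (R Quot J) n))"
  by (simp add: cmap_def)

text \<open>A linear map is determined by the images of the basis vectors.\<close>

lemma surjection_cmap:
  assumes J: "ideal J R" and b: "\<beta> \<in> conormal_surjections R n J"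
  shows "\<exists>f. generating n J f \<and> \<beta> = cmap n J f"
proof -
  interpret Q: presented "R Quot J" "\<lambda>x. J +> \<pi> x" by (rule presented_Quot[OF J])
  note S = sqr_ideal[OF J] and iJ = idl_pre[OF J]
  interpret Q2: presented "R Quot (sqr J)" "\<lambda>x. sqr J +> \<pi> x" by (rule presented_Quot[OF S])
  let ?M = "free_module (R Quot J) n" and ?N = "conormal_module R J"
  let ?v = "pvec n (\<lambda>x. J +> \<pi> x)"
  have N: "carrier ?N = (\<lambda>x. sqr J +> x) ` J" by (simp add: conormal_module_def)
  have b1: "\<beta> v \<in> carrier ?N" if "v \<in> carrier ?M" for v
    using b that by (auto simp: conormal_surjections_def module_epis_def PiE_iff)
  have b2: "\<beta> (u \<oplus>\<^bsub>?M\<^esub> v) = \<beta> u <+>\<^bsub>R\<^esub> \<beta> v" if "u \<in> carrier ?M" "v \<in> carrier ?M" for u v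
    using b that by (auto simp: conormal_surjections_def module_epis_def conormal_module_def)
  have b3: "\<beta> (a \<odot>\<^bsub>?M\<^esub> v) = rcoset_mult R (sqr J) a (\<beta> v)" if "a \<in> carrier (R Quot J)" "v \<in> carrier ?M" for a v
    using b that by (auto simp: conormal_surjections_def module_epis_def conormal_module_def)
  have b4: "\<beta> ` carrier ?M = carrier ?N" using b by (simp add: conormal_surjections_def module_epis_def)
  have val: "\<exists>y. y \<in> pre J \<and> \<beta> v = sqr J +> \<pi> y" if v: "v \<in> carrier ?M" for v
  proof -
    obtain a where a: "a \<in> J" "\<beta> v = sqr J +> a" using b1[OF v] unfolding N by blast
    obtain y where "a = \<pi> y" using ex_lift[of a] a(1) ideal_carrier[OF J] by blast
    then show ?thesis using a by auto
  qed
  define e where "e k i = (if i = k then 1 else (0::'p))" for k i :: nat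
  have "\<forall>k. \<exists>y. y \<in> pre J \<and> \<beta> (?v (e k)) = sqr J +> \<pi> y" using val[OF Q.pvec_carrier] by blast
  then obtain f where f: "\<And>k. f k \<in> pre J" "\<And>k. \<beta> (?v (e k)) = sqr J +> \<pi> (f k)" by metis
  have fA: "\<forall>i<n. f i \<in> pre J" using f(1) by blast
  \<comment> \<open>additivity is only available for two summands at a time, so build the vector
    up coordinate by coordinate\<close>
  have part: "\<beta> (?v (\<lambda>i. if i < k then c i else 0)) = sqr J +> \<pi> (\<Sum>i<k. c i * f i)" if "k \<le> n" for k c
    using that
  proof (induction k)
    case 0
    obtain y where y: "y \<in> pre J" "\<beta> (?v (\<lambda>i. 0)) = sqr J +> \<pi> y" using val[OF Q.pvec_carrier] by blast
    have "?v (\<lambda>i. 0) = (J +> \<pi> 0) \<odot>\<^bsub>?M\<^esub> ?v (\<lambda>i. 0)" unfolding Q.pvec_smult by simp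
    then have "\<beta> (?v (\<lambda>i. 0)) = \<beta> ((J +> \<pi> 0) \<odot>\<^bsub>?M\<^esub> ?v (\<lambda>i. 0))" by (rule arg_cong)
    also have "\<dots> = rcoset_mult R (sqr J) (J +> \<pi> 0) (\<beta> (?v (\<lambda>i. 0)))"
      by (rule b3[OF Q.pi_closed Q.pvec_carrier])
    also have "\<dots> = rcoset_mult R (sqr J) (J +> \<pi> 0) (sqr J +> \<pi> y)" unfolding y(2) ..
    also have "\<dots> = sqr J +> \<pi> (0 * y)" by (rule coset_smult[OF J y(1)])
    finally show ?case by simp
  next
    case (Suc k)
    have "?v (\<lambda>i. if i < Suc k then c i else 0) = ?v (\<lambda>i. if i < k then c i else 0) \<oplus>\<^bsub>?M\<^esub> ((J +> \<pi> (c k)) \<odot>\<^bsub>?M\<^esub> ?v (e k))"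
      unfolding Q.pvec_smult Q.pvec_add by (rule arg_cong[of _ _ ?v]) (auto simp: e_def less_Suc_eq)
    moreover have "(J +> \<pi> (c k)) \<odot>\<^bsub>?M\<^esub> ?v (e k) \<in> carrier ?M" unfolding Q.pvec_smult by (rule Q.pvec_carrier)
    ultimately have "\<beta> (?v (\<lambda>i. if i < Suc k then c i else 0)) = \<beta> (?v (\<lambda>i. if i < k then c i else 0)) <+>\<^bsub>R\<^esub> rcoset_mult R (sqr J) (J +> \<pi> (c k)) (\<beta> (?v (e k)))"
      using b2[OF Q.pvec_carrier] b3[OF Q.pi_closed Q.pvec_carrier] by simp
    also have "\<dots> = (sqr J +> \<pi> (\<Sum>i<k. c i * f i)) <+>\<^bsub>R\<^esub> (sqr J +> \<pi> (c k * f k))"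
      using Suc coset_smult[OF J f(1)] f(2) by simp
    also have "\<dots> = sqr J +> \<pi> ((\<Sum>i<k. c i * f i) + c k * f k)"
      unfolding Q2.pi_add by (simp add: FactRing_def)
    finally show ?case by simp
  qed
  have full: "\<beta> (?v c) = sqr J +> \<pi> (\<Sum>i<n. c i * f i)" for c
  proof -
    have "?v c = ?v (\<lambda>i. if i < n then c i else 0)" unfolding pvec_def by (rule restrict_ext) simp
    then show ?thesis using part[of n c] by simp
  qed
  have "\<beta> = cmap n J f"
    by (rule map_eqI[OF J surjection_extensional[OF b] cmap_extensional]) (simp only: full cmap_pvec[OF J fA])
  moreover have "generating n J f"
    unfolding generating_def
  proof (intro conjI allI impI subsetI)
    fix x assume x: "x \<in> pre J"
    then have "sqr J +> \<pi> x \<in> carrier ?N" unfolding N by auto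
    then obtain v where v: "v \<in> carrier ?M" "sqr J +> \<pi> x = \<beta> v" using b4 by blast
    obtain c where "v = ?v c" using Q.pvec_cases[OF v(1)] by blast
    then have "x - (\<Sum>i<n. c i * f i) \<in> pre (sqr J)" using v(2) full coset_eq_iff[OF S] by simp
    then show "x \<in> gen n f (pre (sqr J))" by (rule genI)
  qed (rule f(1))
  ultimately show ?thesis by blast
qed

abbreviation tmat :: "nat \<Rightarrow> (nat \<Rightarrow> 'p) \<Rightarrow> (nat \<Rightarrow> nat \<Rightarrow> 'p) \<Rightarrow> nat \<Rightarrow> 'p"
  where "tmat n f c \<equiv> (\<lambda>j. \<Sum>i<n. f i * c i j)"

abbreviation mdet :: "nat \<Rightarrow> (nat \<Rightarrow> nat \<Rightarrow> 'p) \<Rightarrow> 'p"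
  where "mdet n c \<equiv> det (mat n n (\<lambda>(i, j). c i j))"

lemma tmat_pre: "ideal J R \<Longrightarrow> (\<And>i. i < n \<Longrightarrow> f i \<in> pre J) \<Longrightarrow> tmat n f c j \<in> pre J"
  by (intro idl_sum[OF idl_pre] idl_mult2[OF idl_pre]) auto

lemma rel_cmapI:
  assumes J: "ideal J R" and f: "generating n J f" and g: "generating n J g"
    and gc: "\<And>j. j < n \<Longrightarrow> g j - tmat n f c j \<in> pre (sqr J)" and dc: "mdet n c - 1 \<in> pre J"
  shows "(cmap n J f, cmap n J g) \<in> orientation_rel R n J"
proof -
  interpret Q: presented "R Quot J" "\<lambda>x. J +> \<pi> x" by (rule presented_Quot[OF J])
  note S = sqr_ideal[OF J] and iS = idl_pre[OF sqr_ideal[OF J]]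
  let ?\<sigma> = "\<lambda>i j. J +> \<pi> (c i j)"
  have "ring_det (R Quot J) n ?\<sigma> = J +> \<pi> (mdet n c)" by (rule Q.ring_det_lift) simp
  also have "\<dots> = \<one>\<^bsub>R Quot J\<^esub>" using coset_eq_iff[OF J, of "mdet n c" 1] dc Q.pi_one by simp
  finally have \<sigma>: "?\<sigma> \<in> special_linear (R Quot J) n" unfolding special_linear_def using Q.pi_closed by blast
  have fJ: "\<forall>i<n. f i \<in> pre J" and gJ: "\<forall>i<n. g i \<in> pre J" using f g by (simp_all add: generating_def)
  have "cmap n J g v = cmap n J f (mat_vec (R Quot J) n ?\<sigma> v)" if v: "v \<in> carrier (free_module (R Quot J) n)" for v
  proof -
    obtain d where d: "v = pvec n (\<lambda>x. J +> \<pi> x) d" using Q.pvec_cases[OF v] by blast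
    have mv: "mat_vec (R Quot J) n ?\<sigma> v = pvec n (\<lambda>x. J +> \<pi> x) (\<lambda>i. \<Sum>j<n. c i j * d j)"
      unfolding d by (rule Q.mat_vec_lift) simp
    have "(\<Sum>j<n. d j * g j) - (\<Sum>i<n. (\<Sum>j<n. c i j * d j) * f i) = (\<Sum>j<n. d j * (g j - tmat n f c j))"
    proof -
      have "(\<Sum>i<n. (\<Sum>j<n. c i j * d j) * f i) = (\<Sum>j<n. d j * tmat n f c j)"
        unfolding sum_distrib_left sum_distrib_right by (subst sum.swap) (simp only: mult_ac)
      then show ?thesis by (simp add: right_diff_distrib sum_subtractf)
    qed
    also have "\<dots> \<in> pre (sqr J)" using gc by (intro idl_sum[OF iS] idl_mult[OF iS]) simp
    finally show ?thesis unfolding mv unfolding d cmap_pvec[OF J gJ] cmap_pvec[OF J fJ] using coset_eq_iff[OF S] by blast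
  qed
  then have "\<forall>v\<in>carrier (free_module (R Quot J) n). cmap n J g v = cmap n J f (mat_vec (R Quot J) n ?\<sigma> v)" by (rule ballI)
  then have "\<exists>\<sigma>\<in>special_linear (R Quot J) n. \<forall>v\<in>carrier (free_module (R Quot J) n). cmap n J g v = cmap n J f (mat_vec (R Quot J) n \<sigma> v)"
    by (rule bexI[OF _ \<sigma>])
  then show ?thesis unfolding orientation_rel_def using cmap_surjection[OF J f] cmap_surjection[OF J g] by simp
qed

lemma rel_cmapD:
  assumes J: "ideal J R" and f: "generating n J f" and r: "(cmap n J f, \<beta>) \<in> orientation_rel R n J"
  shows "\<exists>c. mdet n c - 1 \<in> pre J \<and> generating n J (tmat n f c) \<and> \<beta> = cmap n J (tmat n f c)"
proof -
  interpret Q: presented "R Quot J" "\<lambda>x. J +> \<pi> x" by (rule presented_Quot[OF J])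
  note S = sqr_ideal[OF J]
  have b: "\<beta> \<in> conormal_surjections R n J" using r by (simp add: orientation_rel_def)
  have "\<exists>\<sigma>\<in>special_linear (R Quot J) n. \<forall>v\<in>carrier (free_module (R Quot J) n). \<beta> v = cmap n J f (mat_vec (R Quot J) n \<sigma> v)"
    using r by (simp add: orientation_rel_def)
  then obtain \<sigma> where \<sigma>: "\<sigma> \<in> special_linear (R Quot J) n"
    and eq': "\<forall>v\<in>carrier (free_module (R Quot J) n). \<beta> v = cmap n J f (mat_vec (R Quot J) n \<sigma> v)" by (elim bexE)
  note eq = bspec[OF eq']
  define c where "c i j = (SOME x. \<sigma> i j = J +> \<pi> x)" for i j
  have c: "\<sigma> i j = J +> \<pi> (c i j)" if ij: "i < n" "j < n" for i j
  proof -
    have "\<sigma> i j \<in> carrier (R Quot J)" using \<sigma> ij unfolding special_linear_def by simp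
    from someI_ex[OF Q.ex_lift[OF this]] show ?thesis unfolding c_def .
  qed
  have "ring_det (R Quot J) n \<sigma> = J +> \<pi> (mdet n c)" by (rule Q.ring_det_lift[OF c])
  then have "J +> \<pi> (mdet n c) = J +> \<pi> 1" using \<sigma> Q.pi_one by (simp add: special_linear_def)
  then have dc: "mdet n c - 1 \<in> pre J" using coset_eq_iff[OF J] by blast
  have fJ: "\<forall>i<n. f i \<in> pre J" using f by (simp add: generating_def)
  have tJ: "tmat n f c j \<in> pre J" for j by (rule tmat_pre[OF J]) (use fJ in blast)
  have tA: "\<forall>j<n. tmat n f c j \<in> pre J" using tJ by blast
  have val: "\<beta> (pvec n (\<lambda>x. J +> \<pi> x) d) = sqr J +> \<pi> (\<Sum>j<n. d j * tmat n f c j)" for d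
  proof -
    have mv: "mat_vec (R Quot J) n \<sigma> (pvec n (\<lambda>x. J +> \<pi> x) d) = pvec n (\<lambda>x. J +> \<pi> x) (\<lambda>i. \<Sum>j<n. c i j * d j)"
      by (rule Q.mat_vec_lift[OF c])
    have "(\<Sum>i<n. (\<Sum>j<n. c i j * d j) * f i) = (\<Sum>j<n. d j * tmat n f c j)"
      unfolding sum_distrib_left sum_distrib_right by (subst sum.swap) (simp only: mult_ac)
    then show ?thesis unfolding eq[OF Q.pvec_carrier] mv cmap_pvec[OF J fJ] by simp
  qed
  have bc: "\<beta> = cmap n J (tmat n f c)"
    by (rule map_eqI[OF J surjection_extensional[OF b] cmap_extensional]) (simp only: val cmap_pvec[OF J tA])
  have "generating n J (tmat n f c)"
    unfolding generating_def
  proof (intro conjI allI impI subsetI)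
    fix x assume x: "x \<in> pre J"
    have "sqr J +> \<pi> x \<in> \<beta> ` carrier (free_module (R Quot J) n)"
      using b x by (auto simp: conormal_surjections_def module_epis_def conormal_module_def)
    then obtain v where v: "v \<in> carrier (free_module (R Quot J) n)" "sqr J +> \<pi> x = \<beta> v" by blast
    obtain d where "v = pvec n (\<lambda>x. J +> \<pi> x) d" using Q.pvec_cases[OF v(1)] by blast
    then have "x - (\<Sum>i<n. d i * tmat n f c i) \<in> pre (sqr J)" using v(2) val coset_eq_iff[OF S] by simp
    then show "x \<in> gen n (tmat n f c) (pre (sqr J))" by (rule genI)
  qed (rule tJ)
  then show ?thesis using dc bc by blast
qed

lemma rel_refl:
  assumes J: "ideal J R" and f: "generating n J f"
  shows "(cmap n J f, cmap n J f) \<in> orientation_rel R n J"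
proof (rule rel_cmapI[OF J f f, where c = "\<lambda>i j. if i = j then 1 else 0"])
  have "tmat n f (\<lambda>i j. if i = j then 1 else 0) j = f j" if "j < n" for j
  proof -
    have "tmat n f (\<lambda>i j. if i = j then 1 else 0) j = (\<Sum>i<n. if i = j then f j else 0)" by (rule sum.cong) auto
    then show ?thesis using that by simp
  qed
  then show "f j - tmat n f (\<lambda>i j. if i = j then 1 else 0) j \<in> pre (sqr J)" if "j < n" for j
    using that idl_zero[OF idl_pre[OF sqr_ideal[OF J]]] by simp
  have "mat n n (\<lambda>(i, j). if i = j then 1 else 0) = (1\<^sub>m n :: 'p mat)" by (rule eq_matI) auto
  then show "mdet n (\<lambda>i j. if i = j then 1 else 0) - 1 \<in> pre J"
    using idl_zero[OF idl_pre[OF J]] by simp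
qed

lemma rel_trans:
  assumes J: "ideal J R" and f: "generating n J f"
    and r: "(cmap n J f, \<beta>) \<in> orientation_rel R n J" "(\<beta>, \<gamma>) \<in> orientation_rel R n J"
  shows "(cmap n J f, \<gamma>) \<in> orientation_rel R n J"
proof -
  obtain c where c: "mdet n c - 1 \<in> pre J" "generating n J (tmat n f c)" "\<beta> = cmap n J (tmat n f c)"
    using rel_cmapD[OF J f r(1)] by blast
  obtain d where d: "mdet n d - 1 \<in> pre J" "generating n J (tmat n (tmat n f c) d)" "\<gamma> = cmap n J (tmat n (tmat n f c) d)"
    using rel_cmapD[OF J c(2)] r(2) c(3) by blast
  let ?e = "\<lambda>i j. \<Sum>l<n. c i l * d l j"
  have te: "tmat n (tmat n f c) d j = tmat n f ?e j" for j
    unfolding sum_distrib_left sum_distrib_right by (subst sum.swap) (simp only: mult.assoc)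
  have "mat n n (\<lambda>(i, j). ?e i j) = mat n n (\<lambda>(i, j). c i j) * mat n n (\<lambda>(i, j). d i j)"
    by (rule eq_matI) (auto simp: scalar_prod_def atLeast0LessThan)
  then have "mdet n ?e = mdet n c * mdet n d" by (simp add: det_mult[of _ n])
  then have "mdet n ?e - 1 = (mdet n c - 1) * mdet n d + (mdet n d - 1)" by (simp add: algebra_simps)
  then have "mdet n ?e - 1 \<in> pre J"
    using idl_add[OF idl_pre[OF J] idl_mult2[OF idl_pre[OF J] c(1)] d(1)] by metis
  moreover have "tmat n (tmat n f c) d j - tmat n f ?e j \<in> pre (sqr J)" for j
    using idl_zero[OF idl_pre[OF sqr_ideal[OF J]]] unfolding te by simp
  ultimately show ?thesis unfolding d(3) by (intro rel_cmapI[OF J f d(2), where c = ?e])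
qed

text \<open>The same tuple \<open>f\<close> represents a local orientation of \<open>J\<close> and
  the induced one of a component \<open>N\<close>, since both maps send basis vectors to the
  classes of the \<open>f i\<close>.\<close>

lemma induced_cmap:
  assumes J: "ideal J R" and N: "ideal N R" and JN: "J \<subseteq> N" and f: "generating n J f" and fN: "generating n N f"
  shows "induced_orientation R n J (orientation_rel R n J `` {cmap n J f}) N = orientation_rel R n N `` {cmap n N f}"
proof -
  interpret Q: presented "R Quot J" "\<lambda>x. J +> \<pi> x" by (rule presented_Quot[OF J])
  note SJ = sqr_ideal[OF J] and SN = sqr_ideal[OF N]
  let ?vJ = "pvec n (\<lambda>x. J +> \<pi> x)" and ?vN = "pvec n (\<lambda>x. N +> \<pi> x)"
  have red: "(\<lambda>i\<in>{..<n}. N <+>\<^bsub>R\<^esub> ?vJ c i) = ?vN c" for c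
    unfolding pvec_def by (rule restrict_ext) (simp add: coset_absorb[OF J N JN])
  have ind: "induces_surjection R n J N (cmap n J g) \<beta> \<longleftrightarrow> \<beta> = cmap n N g"
    if g: "generating n J g" and gN: "generating n N g" for g \<beta>
  proof -
    have gJ: "\<forall>i<n. g i \<in> pre J" and gN': "\<forall>i<n. g i \<in> pre N" using g gN by (simp_all add: generating_def)
    have v: "sqr N <+>\<^bsub>R\<^esub> cmap n J g (?vJ c) = cmap n N g (?vN c)" for c
      unfolding cmap_pvec[OF J gJ] cmap_pvec[OF N gN'] by (rule coset_absorb[OF SJ SN sqr_mono[OF J N JN]])
    show ?thesis
    proof
      assume "induces_surjection R n J N (cmap n J g) \<beta>"
      then have b: "\<beta> \<in> conormal_surjections R n N"
        and eq: "\<And>v. v \<in> carrier (free_module (R Quot J) n) \<Longrightarrow> \<beta> (\<lambda>i\<in>{..<n}. N <+>\<^bsub>R\<^esub> v i) = sqr N <+>\<^bsub>R\<^esub> cmap n J g v"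
        unfolding induces_surjection_def by blast+
      show "\<beta> = cmap n N g"
      proof (rule map_eqI[OF N surjection_extensional[OF b] cmap_extensional])
        fix c show "\<beta> (?vN c) = cmap n N g (?vN c)" using eq[OF Q.pvec_carrier, of c] unfolding red v .
      qed
    next
      assume b: "\<beta> = cmap n N g"
      show "induces_surjection R n J N (cmap n J g) \<beta>"
        unfolding induces_surjection_def
      proof (intro conjI ballI)
        show "\<beta> \<in> conormal_surjections R n N" unfolding b by (rule cmap_surjection[OF N gN])
        fix u assume "u \<in> carrier (free_module (R Quot J) n)"
        then obtain c where u: "u = ?vJ c" using Q.pvec_cases by metis
        show "\<beta> (\<lambda>i\<in>{..<n}. N <+>\<^bsub>R\<^esub> u i) = sqr N <+>\<^bsub>R\<^esub> cmap n J g u" unfolding u red v b ..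
      qed
    qed
  qed
  let ?T = "{\<beta>. \<exists>\<alpha>\<in>orientation_rel R n J `` {cmap n J f}. induces_surjection R n J N \<alpha> \<beta>}"
  have in1: "cmap n N f \<in> ?T" using rel_refl[OF J f] ind[OF f fN] by blast
  have in2: "(cmap n N f, \<beta>) \<in> orientation_rel R n N" if bT: "\<beta> \<in> ?T" for \<beta>
  proof -
    obtain \<alpha> where a: "(cmap n J f, \<alpha>) \<in> orientation_rel R n J" "induces_surjection R n J N \<alpha> \<beta>" using bT by blast
    obtain c where c: "mdet n c - 1 \<in> pre J" "generating n J (tmat n f c)" "\<alpha> = cmap n J (tmat n f c)"
      using rel_cmapD[OF J f a(1)] by blast
    have cN: "mdet n c - 1 \<in> pre N" using c(1) JN by auto
    have gN: "generating n N (tmat n f c)"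
    proof -
      let ?C = "mat n n (\<lambda>(i, j). c i j)"
      let ?A = "adj_mat ?C"
      have C: "?C \<in> carrier_mat n n" by simp
      have A: "?A \<in> carrier_mat n n" "?C * ?A = det ?C \<cdot>\<^sub>m 1\<^sub>m n" using adj_mat[OF C] by auto
      have CA: "(\<Sum>j<n. c i j * ?A $$ (j, l)) = (if i = l then mdet n c else 0)" if "i < n" "l < n" for i l
      proof -
        have "(?C * ?A) $$ (i, l) = (\<Sum>j<n. c i j * ?A $$ (j, l))"
          using that A(1) by (simp add: scalar_prod_def atLeast0LessThan)
        moreover have "(det ?C \<cdot>\<^sub>m 1\<^sub>m n) $$ (i, l) = (if i = l then det ?C else 0)" using that by simp
        ultimately show ?thesis unfolding A(2) by (rule trans[OF sym])
      qed
      have fN': "f i \<in> pre N" if "i < n" for i using fN that by (simp add: generating_def)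
      let ?G = "gen n (tmat n f c) (pre (sqr N))"
      note iS = idl_pre[OF SN]
      have "f l \<in> ?G" if l: "l < n" for l
      proof (rule genI[where c = "\<lambda>j. ?A $$ (j, l)"])
        have "(\<Sum>j<n. ?A $$ (j, l) * tmat n f c j) = (\<Sum>i<n. (\<Sum>j<n. c i j * ?A $$ (j, l)) * f i)"
          unfolding sum_distrib_left sum_distrib_right by (subst sum.swap) (simp only: mult_ac)
        also have "\<dots> = (\<Sum>i<n. if i = l then mdet n c * f l else 0)" by (rule sum.cong) (use CA l in auto)
        finally have "f l - (\<Sum>j<n. ?A $$ (j, l) * tmat n f c j) = - ((mdet n c - 1) * f l)"
          using l by (simp add: algebra_simps)
        also have "\<dots> \<in> pre (sqr N)" by (rule idl_minus[OF iS sqr_mult[OF N cN fN'[OF l]]])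
        finally show "f l - (\<Sum>j<n. ?A $$ (j, l) * tmat n f c j) \<in> pre (sqr N)" .
      qed
      then have "gen n f (pre (sqr N)) \<subseteq> ?G" by (intro gen_least[OF gen_idl[OF iS] gen_base[OF iS]])
      moreover have "pre N \<subseteq> gen n f (pre (sqr N))" using fN unfolding generating_def by (rule conjunct2)
      ultimately have "pre N \<subseteq> ?G" by (rule order_trans[rotated])
      moreover have "\<forall>j<n. tmat n f c j \<in> pre N" by (intro allI impI tmat_pre[OF N fN'])
      ultimately show ?thesis unfolding generating_def by (rule conjI[rotated])
    qed
    have "\<beta> = cmap n N (tmat n f c)" using a(2) unfolding c(3) ind[OF c(2) gN] .
    then show ?thesis
      using rel_cmapI[OF N fN gN _ cN] idl_zero[OF idl_pre[OF SN]] by simp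
  qed
  show ?thesis unfolding induced_orientation_def
  proof
    show "orientation_rel R n N `` ?T \<subseteq> orientation_rel R n N `` {cmap n N f}"
      using in2 rel_trans[OF N fN] by blast
    show "orientation_rel R n N `` {cmap n N f} \<subseteq> orientation_rel R n N `` ?T" using in1 by blast
  qed
qed

lemma lifts_cmap:
  assumes J: "ideal J R" and f: "gen n f ker = pre J"
  shows "lifts_to_surjection R n J (cmap n J f)"
proof -
  have Z: "idl ker" by (rule idl_pre) (rule zeroideal)
  have fJ: "f i \<in> pre J" if "i < n" for i using gen_mem[OF Z that, of f] f by simp
  then have fA: "\<forall>i<n. f i \<in> pre J" by blast
  note iJ = idl_pre[OF J]
  have sJ: "(\<Sum>i<n. c i * f i) \<in> pre J" for c by (intro idl_sum[OF iJ] idl_mult[OF iJ] fJ) simp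
  let ?M = "free_module R n"
  define \<phi> where "\<phi> = (\<lambda>v\<in>carrier ?M. \<Oplus>i\<in>{..<n}. v i \<otimes> \<pi> (f i))"
  have ph: "\<phi> (pvec n \<pi> c) = \<pi> (\<Sum>i<n. c i * f i)" for c
  proof -
    have "(\<Oplus>i\<in>{..<n}. pvec n \<pi> c i \<otimes> \<pi> (f i)) = (\<Oplus>i\<in>{..<n}. \<pi> (c i * f i))"
      by (rule finsum_cong') (auto simp: pvec_def pi_mult)
    then show ?thesis unfolding \<phi>_def using pvec_carrier by (simp add: pi_sum)
  qed
  have "\<phi> \<in> module_epis R ?M (ideal_module R J)"
    unfolding module_epis_def
  proof (intro CollectI conjI ballI)
    have "\<phi> v \<in> J" if vM: "v \<in> carrier ?M" for v
    proof -
      obtain c where "v = pvec n \<pi> c" using pvec_cases[OF vM] by blast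
      then show ?thesis using ph sJ[of c] by simp
    qed
    then show "\<phi> \<in> carrier ?M \<rightarrow>\<^sub>E carrier (ideal_module R J)" by (auto simp: \<phi>_def ideal_module_def)
  next
    fix u v assume "u \<in> carrier ?M" "v \<in> carrier ?M"
    then obtain c d where uv: "u = pvec n \<pi> c" "v = pvec n \<pi> d" using pvec_cases by metis
    show "\<phi> (u \<oplus>\<^bsub>?M\<^esub> v) = \<phi> u \<oplus>\<^bsub>ideal_module R J\<^esub> \<phi> v"
      unfolding uv pvec_add ph by (simp add: ideal_module_def distrib_right sum.distrib pi_add)
  next
    fix a u assume a: "a \<in> carrier R" and "u \<in> carrier ?M"
    then obtain c where u: "u = pvec n \<pi> c" using pvec_cases by metis
    obtain r where r: "a = \<pi> r" using ex_lift[OF a] by blast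
    have "\<phi> (a \<odot>\<^bsub>?M\<^esub> u) = \<pi> (r * (\<Sum>i<n. c i * f i))"
      unfolding u r pvec_smult ph by (simp add: sum_distrib_left mult.assoc)
    then show "\<phi> (a \<odot>\<^bsub>?M\<^esub> u) = a \<odot>\<^bsub>ideal_module R J\<^esub> \<phi> u"
      unfolding u r ph pi_mult by (simp add: ideal_module_def)
  next
    show "\<phi> ` carrier ?M = carrier (ideal_module R J)"
    proof
      show "\<phi> ` carrier ?M \<subseteq> carrier (ideal_module R J)"
      proof
        fix b assume "b \<in> \<phi> ` carrier ?M"
        then obtain v where v: "v \<in> carrier ?M" "b = \<phi> v" by blast
        obtain c where "v = pvec n \<pi> c" using pvec_cases[OF v(1)] by blast
        then show "b \<in> carrier (ideal_module R J)" using v(2) ph sJ[of c] by (simp add: ideal_module_def)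
      qed
      show "carrier (ideal_module R J) \<subseteq> \<phi> ` carrier ?M"
      proof
        fix b assume "b \<in> carrier (ideal_module R J)"
        then have b: "b \<in> J" by (simp add: ideal_module_def)
        obtain x where x: "b = \<pi> x" using ex_lift[of b] b ideal_carrier[OF J] by blast
        have "x \<in> gen n f ker" using b x f by simp
        then obtain c where "x - (\<Sum>i<n. c i * f i) \<in> ker" unfolding gen_def by blast
        then have "\<pi> x = \<pi> (\<Sum>i<n. c i * f i)" using pi_add[of "x - (\<Sum>i<n. c i * f i)" "\<Sum>i<n. c i * f i"] by simp
        then have "b = \<phi> (pvec n \<pi> c)" by (simp add: x ph)
        then show "b \<in> \<phi> ` carrier ?M" using pvec_carrier by blast
      qed
    qed
  qed
  moreover have "cmap n J f (\<lambda>i\<in>{..<n}. J +> v i) = sqr J +> \<phi> v" if v: "v \<in> carrier ?M" for v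
  proof -
    obtain c where c: "v = pvec n \<pi> c" using pvec_cases[OF v] by blast
    have "(\<lambda>i\<in>{..<n}. J +> v i) = pvec n (\<lambda>x. J +> \<pi> x) c" unfolding c pvec_def by (rule restrict_ext) simp
    then show ?thesis by (simp add: cmap_pvec[OF J fA] ph c)
  qed
  ultimately show ?thesis unfolding lifts_to_surjection_def by blast
qed

end

section \<open>Vanishing of the Euler class group\<close>

lemma trivial_quotient_free_group:
  assumes H: "H \<subseteq> carrier (free_Abelian_group S)"
    and g: "\<And>x. x \<in> S \<Longrightarrow> frag_of x \<in> generate (free_Abelian_group S) H"
  shows "trivial_group (free_Abelian_group S Mod generate (free_Abelian_group S) H)"
proof -
  let ?G = "free_Abelian_group S"
  interpret G: comm_group ?G by (rule abelian_free_Abelian_group)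
  let ?K = "generate ?G H"
  have sub: "subgroup ?K ?G" by (rule G.generate_is_subgroup[OF H])
  interpret K: subgroup ?K ?G by (rule sub)
  have nK: "?K \<lhd> ?G" by (rule G.subgroup_imp_normal[OF sub])
  have "c \<in> ?K" if "c \<in> carrier ?G" for c
  proof -
    have "Poly_Mapping.keys c \<subseteq> S" using that by simp
    then show ?thesis
    proof (rule free_Abelian_group_induct[where P = "\<lambda>c. c \<in> ?K"])
      show "0 \<in> ?K" using K.one_closed by simp
      show "x - y \<in> ?K" if xy: "Poly_Mapping.keys x \<subseteq> S" "Poly_Mapping.keys y \<subseteq> S" "x \<in> ?K" "y \<in> ?K" for x y
      proof -
        have "x \<otimes>\<^bsub>?G\<^esub> inv\<^bsub>?G\<^esub> y \<in> ?K" by (rule K.m_closed[OF xy(3) K.m_inv_closed[OF xy(4)]])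
        then show ?thesis using xy by simp
      qed
      show "frag_of a \<in> ?K" if "a \<in> S" for a by (rule g[OF that])
    qed
  qed
  then have K: "?K = carrier ?G" using K.subset by blast
  have "group (?G Mod ?K)" by (rule normal.factorgroup_is_group[OF nK])
  moreover have "carrier (?G Mod ?K) = {\<one>\<^bsub>?G Mod ?K\<^esub>}"
  proof -
    have "?K #>\<^bsub>?G\<^esub> x = ?K" if "x \<in> carrier ?G" for x
      using G.coset_join2[OF that sub] that unfolding K by simp
    then have "rcosets\<^bsub>?G\<^esub> ?K = {?K}" unfolding RCOSETS_def using G.one_closed by blast
    then show ?thesis by (simp add: FactGroup_def)
  qed
  ultimately show ?thesis unfolding trivial_group_def by blast
qed

text \<open>A product with one factor from each ideal lies in the intersection.\<close>

lemma prm_Inter: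
  assumes Q: "prm Q" and B: "finite B" "\<And>A. A \<in> B \<Longrightarrow> idl A" "\<Inter>B \<subseteq> Q"
  shows "\<exists>A\<in>B. A \<subseteq> Q"
  using B
proof (induction B rule: finite_induct)
  case empty then show ?case using Q by (auto simp: prm_def)
next
  case (insert A B)
  show ?case
  proof (cases "A \<subseteq> Q")
    case False
    then obtain a where a: "a \<in> A" "a \<notin> Q" by blast
    have "\<Inter>B \<subseteq> Q"
    proof
      fix b assume b: "b \<in> \<Inter>B"
      have "a * b \<in> A" by (rule idl_mult2[OF insert.prems(1)[OF insertI1] a(1)])
      moreover have "a * b \<in> \<Inter>B" using b insert.prems(1) idl_mult by blast
      ultimately have "a * b \<in> Q" using insert.prems(2) by blast
      then show "b \<in> Q" using Q a(2) unfolding prm_def by blast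
    qed
    then show ?thesis using insert by blast
  qed blast
qed

context presented begin

lemma pre_radical: assumes "ideal N R" shows "x \<in> pre (ideal_radical R N) \<longleftrightarrow> (\<exists>k::nat. x ^ k \<in> pre N)"
  by (simp add: ideal_radical_def pi_power)

text \<open>Closure under addition is the binomial expansion of \<open>(x + y) ^ (a + b)\<close>:
  every term contains \<open>x ^ a\<close> or \<open>y ^ b\<close>.\<close>

lemma radical_prime:
  assumes N: "primary_ideal R N"
  shows "prm (pre (ideal_radical R N))" "pre N \<subseteq> pre (ideal_radical R N)"
proof -
  have iN: "ideal N R" using N by (simp add: primary_ideal_def)
  note i = idl_pre[OF iN]
  let ?P = "pre (ideal_radical R N)"
  note rad = pre_radical[OF iN]
  show sub: "pre N \<subseteq> ?P" using rad by (metis power_one_right subsetI)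
  have zero: "0 \<in> ?P" using sub idl_zero[OF i] by blast
  have add: "x + y \<in> ?P" if xy: "x \<in> ?P" "y \<in> ?P" for x y
  proof -
    obtain a where a: "x ^ a \<in> pre N" using xy(1) unfolding rad by blast
    obtain b where b: "y ^ b \<in> pre N" using xy(2) unfolding rad by blast
    have "(x + y) ^ (a + b) = (\<Sum>k\<le>a + b. of_nat ((a + b) choose k) * x ^ k * y ^ (a + b - k))"
      by (rule binomial_ring)
    also have "\<dots> \<in> pre N"
    proof (rule idl_sum[OF i])
      fix k assume "k \<in> {..a + b}"
      then have k: "k \<le> a + b" by simp
      show "of_nat ((a + b) choose k) * x ^ k * y ^ (a + b - k) \<in> pre N"
      proof (cases "a \<le> k")
        case True
        then have "x ^ k = x ^ (k - a) * x ^ a" by (simp add: power_add[symmetric])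
        then have "x ^ k \<in> pre N" using idl_mult[OF i a] by simp
        then show ?thesis by (rule idl_mult2[OF i idl_mult[OF i]])
      next
        case False
        then have "y ^ (a + b - k) = y ^ (a - k) * y ^ b" by (simp add: power_add[symmetric])
        then have "y ^ (a + b - k) \<in> pre N" using idl_mult[OF i b] by simp
        then show ?thesis by (rule idl_mult[OF i])
      qed
    qed
    finally show ?thesis unfolding rad by blast
  qed
  have mult: "r * x \<in> ?P" if x: "x \<in> ?P" for r x
  proof -
    obtain a where a: "x ^ a \<in> pre N" using x unfolding rad by blast
    have "(r * x) ^ a \<in> pre N" unfolding power_mult_distrib by (rule idl_mult[OF i a])
    then show ?thesis unfolding rad by blast
  qed
  have one: "1 \<notin> ?P"
  proof
    assume "1 \<in> ?P"
    then have "1 \<in> pre N" unfolding rad by simp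
    then have "pre N = UNIV" by (rule idl_unit[OF i])
    then have "N = carrier R" using image_pre[OF ideal_carrier[OF iN]] pi_range by simp
    then show False using N by (simp add: primary_ideal_def)
  qed
  have prime: "x \<in> ?P \<or> y \<in> ?P" if xy: "x * y \<in> ?P" for x y
  proof -
    obtain k where k: "(x * y) ^ k \<in> pre N" using xy unfolding rad by blast
    then have "\<pi> (x ^ k) \<otimes> \<pi> (y ^ k) \<in> N" by (simp add: power_mult_distrib pi_mult)
    then have "\<pi> (x ^ k) \<in> N \<or> \<pi> (y ^ k) \<in> ideal_radical R N" using N pi_closed unfolding primary_ideal_def by blast
    then show ?thesis
    proof
      assume "\<pi> (x ^ k) \<in> N" then have "x ^ k \<in> pre N" by simp
      then show ?thesis unfolding rad by blast
    next
      assume "\<pi> (y ^ k) \<in> ideal_radical R N"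
      then have "y ^ k \<in> ?P" by simp
      then obtain l where "(y ^ k) ^ l \<in> pre N" unfolding rad by blast
      then have "y ^ (k * l) \<in> pre N" by (simp only: power_mult)
      then show ?thesis unfolding rad by blast
    qed
  qed
  show "prm ?P" unfolding prm_def idl_def using zero add mult one prime by blast
qed

lemma radical_least:
  assumes N: "ideal N R" and Q: "prm Q" "pre N \<subseteq> Q" shows "pre (ideal_radical R N) \<subseteq> Q"
proof
  fix x assume "x \<in> pre (ideal_radical R N)"
  then obtain k where "x ^ k \<in> pre N" unfolding pre_radical[OF N] by blast
  then show "x \<in> Q" using prm_power[OF Q(1)] Q(2) by blast
qed

lemma radical_carrier: "ideal_radical R N \<subseteq> carrier R" by (auto simp: ideal_radical_def)

lemma maximal_primary:
  assumes M: "maximalideal M R" shows "primary_ideal R M" "ideal_radical R M = M"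
proof -
  have iM: "ideal M R" using M by (simp add: maximalideal_def)
  note mx = mxm_pre[OF M]
  have "pre (ideal_radical R M) = pre M"
  proof
    show "pre (ideal_radical R M) \<subseteq> pre M" by (rule radical_least[OF iM mxm_prm[OF mx] subset_refl])
    show "pre M \<subseteq> pre (ideal_radical R M)" using pre_radical[OF iM] by (metis power_one_right subsetI)
  qed
  then show r: "ideal_radical R M = M" by (rule pre_inj[OF radical_carrier ideal_carrier[OF iM]])
  have "M \<noteq> carrier R" using M by (metis maximalideal.I_notcarr)
  moreover have "x \<in> M \<or> y \<in> M" if "x \<in> carrier R" "y \<in> carrier R" "x \<otimes> y \<in> M" for x y
    using primeideal.I_prime[OF maximalideal_prime[OF M] that] .
  ultimately show "primary_ideal R M" unfolding primary_ideal_def r using iM by blast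
qed

lemma ideal_height_single:
  assumes P: "primeideal P R" "I \<subseteq> P" and u: "\<And>Q. primeideal Q R \<Longrightarrow> I \<subseteq> Q \<Longrightarrow> prime_height R Q = h" and hP: "prime_height R P = h"
  shows "ideal_height R I = h"
proof -
  have "prime_height R ` {P. primeideal P R \<and> I \<subseteq> P} = {h}" using P u hP by blast
  then show ?thesis unfolding ideal_height_def by simp
qed

lemma prime_height_strict:
  assumes P: "primeideal P R" and Q: "primeideal Q R" and PQ: "P \<subset> Q" and h: "enat h \<le> prime_height R P"
  shows "enat (Suc h) \<le> prime_height R Q"
proof -
  have "\<exists>k C. h \<le> k \<and> chain_of_length (\<lambda>P. primeideal P R) k C \<and> C k = P"
  proof (cases h)
    case 0
    have "chain_of_length (\<lambda>P. primeideal P R) 0 (\<lambda>_. P)" using P by (simp add: chain_of_length_def)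
    then show ?thesis using 0 by (intro exI[of _ 0] exI[of _ "\<lambda>_. P"]) simp
  next
    case (Suc h')
    show ?thesis
    proof (rule ccontr)
      assume "\<not> ?thesis"
      then have "\<not> h \<le> k" if "chain_of_length (\<lambda>P. primeideal P R) k C" "C k = P" for k C
        using that by blast
      then have "k \<le> h'" if "chain_of_length (\<lambda>P. primeideal P R) k C" "C k = P" for k C
        using that Suc by fastforce
      then have "prime_height R P \<le> enat h'" unfolding prime_height_def by (intro Sup_least) auto
      then have "enat h \<le> enat h'" using h order_trans by blast
      then show False using Suc by simp
    qed
  qed
  then obtain k C where C: "h \<le> k" "chain_of_length (\<lambda>P. primeideal P R) k C" "C k = P" by blast
  define D where "D i = (if i \<le> k then C i else Q)" for i
  have "chain_of_length (\<lambda>P. primeideal P R) (Suc k) D"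
    using C PQ Q unfolding chain_of_length_def D_def by (auto simp: le_Suc_eq less_Suc_eq)
  moreover have "D (Suc k) = Q" by (simp add: D_def)
  ultimately have "enat (Suc k) \<le> prime_height R Q" unfolding prime_height_def by (intro Sup_upper) blast
  moreover have "enat (Suc h) \<le> enat (Suc k)" using C(1) by simp
  ultimately show ?thesis by (rule order_trans[rotated])
qed

text \<open>The radicals are distinct maximal ideals, so no maximal ideal contains
  \<open>N\<close> together with another component.\<close>

lemma comaximal_component:
  assumes S: "finite S" "\<And>Q. Q \<in> S \<Longrightarrow> primary_ideal R Q" "\<And>Q. Q \<in> S \<Longrightarrow> maximalideal (ideal_radical R Q) R"
    and inj: "inj_on (ideal_radical R) S" and N: "N \<in> S"
  shows "\<exists>e. (\<forall>Q\<in>S - {N}. e \<in> pre Q) \<and> 1 - e \<in> pre N"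
proof -
  have iS: "ideal Q R" if "Q \<in> S" for Q using S(2)[OF that] by (simp add: primary_ideal_def)
  let ?O = "\<Inter>(pre ` (S - {N}))"
  have iO: "idl ?O" by (rule idl_Inter) (use iS idl_pre in blast)
  note iN = idl_pre[OF iS[OF N]]
  have "1 \<in> isum ?O (pre N)"
  proof (rule ccontr)
    assume "1 \<notin> isum ?O (pre N)"
    then obtain M where M: "mxm M" "isum ?O (pre N) \<subseteq> M" using ex_mxm[OF isum_idl[OF iO iN]] by blast
    have rad: "pre (ideal_radical R Q) = M" if Q: "Q \<in> S" "pre Q \<subseteq> M" for Q
    proof -
      have "pre (ideal_radical R Q) \<subseteq> M" by (rule radical_least[OF iS[OF Q(1)] mxm_prm[OF M(1)] Q(2)])
      then show ?thesis
        using mxm_maximal[OF mxm_pre[OF S(3)[OF Q(1)]] mxm_idl[OF M(1)]] M(1) by (auto simp: mxm_def)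
    qed
    have "?O \<subseteq> M" "pre N \<subseteq> M" using M(2) isum_l[OF iN] isum_r[OF iO] by blast+
    moreover have "idl B" if "B \<in> pre ` (S - {N})" for B using that iS idl_pre by blast
    ultimately obtain Q where Q: "Q \<in> S - {N}" "pre Q \<subseteq> M"
      using prm_Inter[OF mxm_prm[OF M(1)], of "pre ` (S - {N})"] S(1) by auto
    have "pre (ideal_radical R Q) = pre (ideal_radical R N)" using rad[of Q] rad[OF N \<open>pre N \<subseteq> M\<close>] Q by simp
    then have "ideal_radical R Q = ideal_radical R N" by (rule pre_inj[OF radical_carrier radical_carrier])
    then show False using inj Q(1) N unfolding inj_on_def by blast
  qed
  then obtain e a where ea: "1 = e + a" "e \<in> ?O" "a \<in> pre N" unfolding isum_def by blast
  have "1 - e = a" unfolding ea(1) by simp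
  then show ?thesis using ea by (intro exI[of _ e]) (auto simp del: mem_pre)
qed

text \<open>Multiplication by an element \<open>e\<close> of all other components that is
  congruent to 1 modulo \<open>N\<close> moves \<open>N\<close> into \<open>J\<close> and changes
  nothing modulo \<open>N\<^sup>2\<close>.\<close>

lemma generating_component:
  assumes S: "finite S" "\<And>Q. Q \<in> S \<Longrightarrow> primary_ideal R Q" "\<And>Q. Q \<in> S \<Longrightarrow> maximalideal (ideal_radical R Q) R"
    and inj: "inj_on (ideal_radical R) S" and N: "N \<in> S" and J: "ideal J R" "\<Inter>S = J" and f: "generating n J f"
  shows "generating n N f"
proof -
  have iN: "ideal N R" using S(2)[OF N] by (simp add: primary_ideal_def)
  have JN: "J \<subseteq> N" using J(2) N by blast
  obtain e where e: "\<And>Q. Q \<in> S - {N} \<Longrightarrow> e \<in> pre Q" "1 - e \<in> pre N" using comaximal_component[OF S inj N] by blast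
  let ?G = "gen n f (pre (sqr N))"
  have iG: "idl ?G" by (rule gen_idl[OF idl_pre[OF sqr_ideal[OF iN]]])
  have "pre J \<subseteq> ?G"
  proof -
    have "pre (sqr J) \<subseteq> pre (sqr N)" using sqr_mono[OF J(1) iN JN] by auto
    then have "gen n f (pre (sqr J)) \<subseteq> ?G" unfolding gen_def by blast
    then show ?thesis using f unfolding generating_def by blast
  qed
  moreover have "e * x \<in> pre J" if x: "x \<in> pre N" for x
  proof -
    have "e * x \<in> pre Q" if Q: "Q \<in> S" for Q
    proof (cases "Q = N")
      case True then show ?thesis using idl_mult[OF idl_pre[OF iN] x] by simp
    next
      case False
      have "idl (pre Q)" using S(2)[OF Q] idl_pre by (simp add: primary_ideal_def)
      then show ?thesis using idl_mult2 e(1) False Q by blast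
    qed
    then show ?thesis using J(2) by auto
  qed
  moreover have "(1 - e) * x \<in> ?G" if x: "x \<in> pre N" for x
    using sqr_mult[OF iN e(2) x] gen_base[OF idl_pre[OF sqr_ideal[OF iN]]] by blast
  ultimately have "e * x + (1 - e) * x \<in> ?G" if "x \<in> pre N" for x using idl_add[OF iG] that by blast
  moreover have "e * x + (1 - e) * x = x" for x by (simp add: algebra_simps)
  ultimately have "pre N \<subseteq> ?G" by auto
  moreover have "\<forall>i<n. f i \<in> pre N" using f JN unfolding generating_def by auto
  ultimately show ?thesis unfolding generating_def by (rule conjI[rotated])
qed

end

locale quad =
  fixes m n :: nat assumes mn: "m < n" and n2: "2 \<le> n"

sublocale quad \<subseteq> presented "quadric_ring m n" "proj m n"
  by (rule presented_proj[OF mn])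

context quad begin

abbreviation "A \<equiv> quadric_ring m n"

lemma kerZ: "ker = Zq m n" by (rule ker_proj[OF mn])

lemma height_maximal: "maximalideal M A \<Longrightarrow> prime_height A M = enat n"
  by (rule quadric_dimension(2)[OF mn])

lemma maximal_point: assumes M: "maximalideal M A" shows "\<exists>p\<in>quadric m n. pre M = pt_ideal p"
proof -
  have iM: "ideal M A" using M by (simp add: maximalideal_def)
  show ?thesis using quadric_nullstellensatz[OF mn mxm_pre[OF M]] ker_sub[OF iM] unfolding kerZ by blast
qed

lemma prime_in_maximal: assumes P: "primeideal P A" shows "\<exists>M. maximalideal M A \<and> P \<subseteq> M"
proof -
  have iP: "ideal P A" using P by (simp add: primeideal_def)
  obtain Q where Q: "mxm Q" "pre P \<subseteq> Q" using ex_mxm[of "pre P"] prm_pre[OF P] by (auto simp: prm_def)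
  then have k: "ker \<subseteq> Q" using ker_sub[OF iP] by blast
  have "P \<subseteq> proj m n ` Q" using image_pre[OF ideal_carrier[OF iP]] Q(2) by blast
  then show ?thesis using maximalideal_image[OF Q(1) k] by blast
qed

lemma maximal_height_prime:
  assumes P: "primeideal P A" "enat n \<le> prime_height A P" shows "maximalideal P A"
proof -
  obtain M where M: "maximalideal M A" "P \<subseteq> M" using prime_in_maximal[OF P(1)] by blast
  have "P = M"
  proof (rule ccontr)
    assume "P \<noteq> M"
    then have "enat (Suc n) \<le> prime_height A M"
      using prime_height_strict[OF P(1) maximalideal_prime[OF M(1)] _ P(2)] M(2) by blast
    then show False using height_maximal[OF M(1)] by simp
  qed
  then show ?thesis using M by simp
qed

lemma maximal_unique:
  assumes M: "maximalideal M A" and P: "primeideal P A" "M \<subseteq> P" shows "P = M"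
proof -
  have iM: "ideal M A" and iP: "ideal P A" using M P by (simp_all add: maximalideal_def primeideal_def)
  have "1 \<notin> pre P" using prm_pre[OF P(1)] unfolding prm_def by blast
  moreover have "pre M \<subseteq> pre P" using P(2) by auto
  ultimately have "pre P = pre M" using mxm_maximal[OF mxm_pre[OF M] idl_pre[OF iP]] by blast
  then show ?thesis using pre_inj[OF ideal_carrier[OF iP] ideal_carrier[OF iM]] by blast
qed

lemma primary_height:
  assumes N: "primary_ideal A N" and M: "maximalideal (ideal_radical A N) A"
  shows "ideal_height A N = enat n"
proof -
  have iN: "ideal N A" using N by (simp add: primary_ideal_def)
  let ?M = "ideal_radical A N"
  have NM: "N \<subseteq> ?M" using radical_prime(2)[OF N] pre_mono_iff[OF ideal_carrier[OF iN]] by blast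
  show ?thesis
  proof (rule ideal_height_single[OF maximalideal_prime[OF M] NM _ height_maximal[OF M]])
    fix Q assume Q: "primeideal Q A" "N \<subseteq> Q"
    have "pre N \<subseteq> pre Q" using Q(2) by auto
    then have "pre ?M \<subseteq> pre Q" by (rule radical_least[OF iN prm_pre[OF Q(1)]])
    then have "?M \<subseteq> Q" using pre_mono_iff[OF radical_carrier] by blast
    then have "Q = ?M" by (rule maximal_unique[OF M Q(1)])
    then show "prime_height A Q = enat n" using height_maximal[OF M] by simp
  qed
qed

lemma oriented_primaries_iff:
  "(N, \<omega>) \<in> oriented_primaries A n \<longleftrightarrow> primary_ideal A N \<and> maximalideal (ideal_radical A N) A \<and> \<omega> \<in> local_orientations A n N"
proof -
  have "ideal_height A (ideal_radical A N) = enat n" if M: "maximalideal (ideal_radical A N) A"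
    using primary_height[OF maximal_primary(1)[OF M]] maximal_primary(2)[OF M] M by simp
  then show ?thesis unfolding oriented_primaries_def using primary_height by auto
qed

lemma local_orientations_cmap:
  assumes N: "ideal N A"
  shows "\<omega> \<in> local_orientations A n N \<longleftrightarrow> (\<exists>f. generating n N f \<and> \<omega> = orientation_rel A n N `` {cmap n N f})"
proof
  assume "\<omega> \<in> local_orientations A n N"
  then obtain \<beta> where b: "\<beta> \<in> conormal_surjections A n N" "\<omega> = orientation_rel A n N `` {\<beta>}"
    unfolding local_orientations_def by (rule quotientE)
  obtain f where f: "generating n N f" "\<beta> = cmap n N f" using surjection_cmap[OF N b(1)] by (elim exE conjE)
  show "\<exists>f. generating n N f \<and> \<omega> = orientation_rel A n N `` {cmap n N f}"
    unfolding b(2) f(2) by (rule exI[of _ f]) (intro conjI f(1) refl)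
next
  assume "\<exists>f. generating n N f \<and> \<omega> = orientation_rel A n N `` {cmap n N f}"
  then obtain f where f: "generating n N f" "\<omega> = orientation_rel A n N `` {cmap n N f}" by (elim exE conjE)
  show "\<omega> \<in> local_orientations A n N"
    unfolding local_orientations_def f(2) by (rule quotientI[OF cmap_surjection[OF N f(1)]])
qed

text \<open>The radical of a component has height at least \<open>n\<close>, and a prime strictly
  below a closed point has smaller height than that point, which has height
  \<open>n\<close>.\<close>

lemma component_maximal:
  assumes h: "ideal_height A J = enat n" and JN: "J \<subseteq> N" and N: "primary_ideal A N"
  shows "maximalideal (ideal_radical A N) A"
proof -
  let ?P = "ideal_radical A N"
  have iN: "ideal N A" using N by (simp add: primary_ideal_def)
  note rp = radical_prime[OF N]
  have k: "ker \<subseteq> pre ?P" using ker_sub[OF iN] rp(2) by blast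
  have P: "primeideal ?P A" using primeideal_image[OF rp(1) k] image_pre[OF radical_carrier] by simp
  have "N \<subseteq> ?P" using rp(2) pre_mono_iff[OF ideal_carrier[OF iN]] by blast
  then have "J \<subseteq> ?P" using JN by blast
  then have "ideal_height A J \<le> prime_height A ?P" unfolding ideal_height_def using P by (intro Inf_lower) blast
  then show ?thesis using maximal_height_prime[OF P] h by simp
qed

lemma global_cycles_carrier: "global_orientation_cycles A n \<subseteq> carrier (free_Abelian_group (oriented_primaries A n))"
proof
  fix c assume "c \<in> global_orientation_cycles A n"
  then obtain J \<omega> S where J: "ideal J A" "ideal_height A J = enat n" and w: "\<omega> \<in> global_orientations A n J"
    and S: "irredundant_primary_decomposition A J S" and c: "c = (\<Sum>N\<in>S. frag_of (N, induced_orientation A n J \<omega> N))"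
    unfolding global_orientation_cycles_def by blast
  obtain f where f: "generating n J f" "\<omega> = orientation_rel A n J `` {cmap n J f}"
    using w local_orientations_cmap[OF J(1)] unfolding global_orientations_def by blast
  have S': "finite S" "\<And>Q. Q \<in> S \<Longrightarrow> primary_ideal A Q" "\<Inter>S = J" "inj_on (ideal_radical A) S"
    using S unfolding irredundant_primary_decomposition_def by blast+
  have mx: "maximalideal (ideal_radical A Q) A" if "Q \<in> S" for Q
    by (rule component_maximal[OF J(2) _ S'(2)[OF that]]) (use S'(3) that in blast)
  show "c \<in> carrier (free_Abelian_group (oriented_primaries A n))"
    unfolding c
  proof (rule sum_closed_free_Abelian_group)
    fix N assume N: "N \<in> S"
    have iN: "ideal N A" using S'(2)[OF N] by (simp add: primary_ideal_def)
    have g: "generating n N f" by (rule generating_component[OF S'(1,2) mx S'(4) N J(1) S'(3) f(1)])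
    have "induced_orientation A n J \<omega> N = orientation_rel A n N `` {cmap n N f}"
      unfolding f(2) by (rule induced_cmap[OF J(1) iN _ f(1) g]) (use S'(3) N in blast)
    then have "induced_orientation A n J \<omega> N \<in> local_orientations A n N" using local_orientations_cmap[OF iN] g by blast
    then show "frag_of (N, induced_orientation A n J \<omega> N) \<in> carrier (free_Abelian_group (oriented_primaries A n))"
      using oriented_primaries_iff mx[OF N] S'(2)[OF N] by simp
  qed
qed

text \<open>The remaining conditions in the definition of a global orientation cycle are
  automatic: the primes over the intersection are the radicals of the components, all of height
  \<open>n\<close>, and comaximality makes the decomposition irredundant.\<close>

lemma global_cycleI:
  assumes S: "finite S" "S \<noteq> {}" "\<And>Q. Q \<in> S \<Longrightarrow> primary_ideal A Q" "\<And>Q. Q \<in> S \<Longrightarrow> maximalideal (ideal_radical A Q) A"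
    and inj: "inj_on (ideal_radical A) S" and F: "gen n F ker = (\<Inter>Q\<in>S. pre Q)"
  shows "(\<Sum>N\<in>S. frag_of (N, orientation_rel A n N `` {cmap n N F})) \<in> global_orientation_cycles A n"
    and "\<And>N. N \<in> S \<Longrightarrow> generating n N F"
proof -
  define J where "J = \<Inter>S"
  have iS: "ideal Q A" if "Q \<in> S" for Q using S(3)[OF that] by (simp add: primary_ideal_def)
  have iJ: "ideal J A" unfolding J_def by (rule i_Intersect) (use iS S(2) in auto)
  have preJ: "pre J = gen n F ker" unfolding F J_def by auto
  have Zk: "idl ker" by (rule idl_pre[OF zeroideal])
  have g: "generating n J F" unfolding generating_def preJ
  proof (intro conjI allI impI)
    show "F i \<in> gen n F ker" if "i < n" for i by (rule gen_mem[OF Zk that])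
    show "gen n F ker \<subseteq> gen n F (pre (sqr J))" unfolding gen_def using ker_sub[OF sqr_ideal[OF iJ]] by blast
  qed
  have gS: "generating n N F" if N: "N \<in> S" for N
    by (rule generating_component[OF S(1,3,4) inj N iJ _ g]) (simp_all add: J_def)
  then show "\<And>N. N \<in> S \<Longrightarrow> generating n N F" .
  let ?w = "orientation_rel A n J `` {cmap n J F}"
  have w: "?w \<in> global_orientations A n J"
    unfolding global_orientations_def
    using local_orientations_cmap[OF iJ] g rel_refl[OF iJ g] lifts_cmap[OF iJ preJ[symmetric]] by blast
  have over: "\<exists>N\<in>S. Q = ideal_radical A N" if Q: "primeideal Q A" "J \<subseteq> Q" for Q
  proof -
    have "\<Inter>(pre ` S) \<subseteq> pre Q"
    proof
      fix x assume "x \<in> \<Inter>(pre ` S)"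
      then have "proj m n x \<in> J" unfolding J_def by auto
      then show "x \<in> pre Q" using Q(2) by auto
    qed
    moreover have "idl B" if "B \<in> pre ` S" for B using that iS idl_pre by blast
    ultimately have "\<exists>B\<in>pre ` S. B \<subseteq> pre Q" using prm_Inter[OF prm_pre[OF Q(1)], of "pre ` S"] S(1) by blast
    then obtain N where N: "N \<in> S" "pre N \<subseteq> pre Q" by blast
    have "pre (ideal_radical A N) \<subseteq> pre Q" by (rule radical_least[OF iS[OF N(1)] prm_pre[OF Q(1)] N(2)])
    then have "ideal_radical A N \<subseteq> Q" using pre_mono_iff[OF radical_carrier] by blast
    then have "Q = ideal_radical A N" by (rule maximal_unique[OF S(4)[OF N(1)] Q(1)])
    then show ?thesis using N(1) by blast
  qed
  obtain N0 where N0: "N0 \<in> S" using S(2) by blast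
  have h: "ideal_height A J = enat n"
  proof (rule ideal_height_single[OF maximalideal_prime[OF S(4)[OF N0]]])
    have "N0 \<subseteq> ideal_radical A N0" using radical_prime(2)[OF S(3)[OF N0]] pre_mono_iff[OF ideal_carrier[OF iS[OF N0]]] by blast
    then show "J \<subseteq> ideal_radical A N0" using N0 unfolding J_def by blast
    show "prime_height A Q = enat n" if "primeideal Q A" "J \<subseteq> Q" for Q
      using over[OF that] height_maximal S(4) by blast
    show "prime_height A (ideal_radical A N0) = enat n" by (rule height_maximal[OF S(4)[OF N0]])
  qed
  have irr: "\<not> \<Inter>(S - {Q}) \<subseteq> Q" if Q: "Q \<in> S" for Q
  proof
    assume sub: "\<Inter>(S - {Q}) \<subseteq> Q"
    obtain e where e: "\<And>N. N \<in> S - {Q} \<Longrightarrow> e \<in> pre N" "1 - e \<in> pre Q"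
      using comaximal_component[OF S(1,3,4) inj Q] by blast
    have "proj m n e \<in> \<Inter>(S - {Q})" using e(1) by auto
    then have "e \<in> pre Q" using sub by auto
    then have "1 \<in> pre Q" using idl_add[OF idl_pre[OF iS[OF Q]] e(2)] by fastforce
    then have "1 \<in> pre (ideal_radical A Q)" using radical_prime(2)[OF S(3)[OF Q]] by blast
    then show False using radical_prime(1)[OF S(3)[OF Q]] unfolding prm_def by blast
  qed
  have dec: "irredundant_primary_decomposition A J S"
    unfolding irredundant_primary_decomposition_def using S(1,3) inj irr J_def by blast
  have ind: "induced_orientation A n J ?w N = orientation_rel A n N `` {cmap n N F}" if N: "N \<in> S" for N
    by (rule induced_cmap[OF iJ iS[OF N] _ g gS[OF N]]) (use N in \<open>auto simp: J_def\<close>)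
  have eq: "(\<Sum>N\<in>S. frag_of (N, orientation_rel A n N `` {cmap n N F})) = (\<Sum>N\<in>S. frag_of (N, induced_orientation A n J ?w N))"
    by (rule sum.cong[OF refl]) (simp only: ind)
  show "(\<Sum>N\<in>S. frag_of (N, orientation_rel A n N `` {cmap n N F})) \<in> global_orientation_cycles A n"
    unfolding global_orientation_cycles_def eq using iJ h w dec by blast
qed

text \<open>The \<open>F i\<close> and \<open>f i\<close> have the same classes in \<open>N /
  N\<^sup>2\<close>.\<close>

lemma cmap_cong:
  assumes N: "ideal N A" and f: "generating n N f" and F: "\<And>i. i < n \<Longrightarrow> F i - f i \<in> pre (sqr N)" "\<And>i. i < n \<Longrightarrow> F i \<in> pre N"
  shows "cmap n N F = cmap n N f"
proof (rule map_eqI[OF N cmap_extensional cmap_extensional])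
  fix c
  have fA: "\<forall>i<n. f i \<in> pre N" and FA: "\<forall>i<n. F i \<in> pre N" using f F unfolding generating_def by blast+
  note iS = idl_pre[OF sqr_ideal[OF N]]
  have "(\<Sum>i<n. c i * F i) - (\<Sum>i<n. c i * f i) = (\<Sum>i<n. c i * (F i - f i))"
    by (simp add: right_diff_distrib sum_subtractf)
  also have "\<dots> \<in> pre (sqr N)" using F(1) by (intro idl_sum[OF iS] idl_mult[OF iS]) simp
  finally show "cmap n N F (pvec n (\<lambda>x. N +>\<^bsub>A\<^esub> proj m n x) c) = cmap n N f (pvec n (\<lambda>x. N +>\<^bsub>A\<^esub> proj m n x) c)"
    unfolding cmap_pvec[OF N fA] cmap_pvec[OF N FA] using coset_eq_iff[OF sqr_ideal[OF N]] by blast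
qed

lemma point_cycle:
  assumes M: "maximalideal M A" and g: "generating n M g"
  shows "frag_of (M, orientation_rel A n M `` {cmap n M g}) \<in> global_orientation_cycles A n"
proof -
  have iM: "ideal M A" using M by (simp add: maximalideal_def)
  obtain p where p: "p \<in> quadric m n" "pre M = pt_ideal p" using maximal_point[OF M] by blast
  have sq: "pre (sqr M) = sq (Zq m n) (pt_ideal p)" unfolding pre_sqr[OF iM] kerZ p(2) ..
  have gM: "g i \<in> pt_ideal p" if "i < n" for i using g that p(2) unfolding generating_def by blast
  have gg: "pt_ideal p \<subseteq> gen n g (sq (Zq m n) (pt_ideal p))" using g unfolding generating_def sq p(2) by blast
  have "\<exists>F c. gen n F (Zq m n) = pt_ideal p \<and> (\<forall>j<n. F j - tmat n g c j \<in> sq (Zq m n) (pt_ideal p)) \<and> mdet n c - 1 \<in> pt_ideal p"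
    by (rule point_orientation_global[OF mn n2 p(1) gM gg])
  then obtain F c where F1: "gen n F (Zq m n) = pt_ideal p" and F2: "\<forall>j<n. F j - tmat n g c j \<in> sq (Zq m n) (pt_ideal p)"
    and c: "mdet n c - 1 \<in> pt_ideal p" by (elim exE conjE)
  note F = F1 F2[rule_format]
  let ?S = "{M}"
  have rad: "ideal_radical A M = M" by (rule maximal_primary(2)[OF M])
  have *: "finite ?S" "?S \<noteq> {}" "\<And>Q. Q \<in> ?S \<Longrightarrow> primary_ideal A Q" "\<And>Q. Q \<in> ?S \<Longrightarrow> maximalideal (ideal_radical A Q) A"
    "inj_on (ideal_radical A) ?S" using maximal_primary(1)[OF M] M rad by auto
  have FM: "gen n F ker = (\<Inter>Q\<in>?S. pre Q)" unfolding kerZ F(1) p(2)[symmetric] by simp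
  note gl = global_cycleI[OF * FM]
  have gF: "generating n M F" by (rule gl(2)) simp_all
  have r: "(cmap n M g, cmap n M F) \<in> orientation_rel A n M"
    by (rule rel_cmapI[OF iM g gF, where c = c]) (use F(2) c in \<open>simp_all only: sq p(2)\<close>)
  let ?w = "orientation_rel A n M `` {cmap n M g}"
  have w: "?w \<in> global_orientations A n M"
  proof -
    have "lifts_to_surjection A n M (cmap n M F)" by (rule lifts_cmap[OF iM]) (simp add: FM)
    then show ?thesis unfolding global_orientations_def using local_orientations_cmap[OF iM] g r by blast
  qed
  have ind: "induced_orientation A n M ?w M = ?w" by (rule induced_cmap[OF iM iM subset_refl g g])
  have h: "ideal_height A M = enat n" using primary_height[OF maximal_primary(1)[OF M]] M rad by simp
  have "\<not> UNIV \<subseteq> M" using ideal_carrier[OF iM] maximalideal.I_notcarr[OF M] by blast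
  then have dec: "irredundant_primary_decomposition A M ?S"
    unfolding irredundant_primary_decomposition_def using *(3) by simp
  have "frag_of (M, ?w) = (\<Sum>N\<in>?S. frag_of (N, induced_orientation A n M ?w N))" using ind by simp
  then show ?thesis unfolding global_orientation_cycles_def using iM h w dec by blast
qed

lemma sum_in_subgroup:
  assumes "subgroup K (free_Abelian_group S)" "\<And>i. i \<in> I \<Longrightarrow> x i \<in> K" shows "sum x I \<in> K"
  using assms(2)
proof (induction I rule: infinite_finite_induct)
  case (insert i I)
  then show ?case using subgroup.m_closed[OF assms(1), of "x i" "sum x I"] by simp
qed (use subgroup.one_closed[OF assms(1)] in simp_all)

text \<open>The relation supplied by \<open>move_primary\<close> contains \<open>(N,
  \<omega>)\<close> once, and all its other terms are classes of closed points, which vanish by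
  \<open>point_cycle\<close>.\<close>

lemma primary_cycle:
  assumes N: "(N, \<omega>) \<in> oriented_primaries A n"
  shows "frag_of (N, \<omega>) \<in> generate (free_Abelian_group (oriented_primaries A n)) (global_orientation_cycles A n)"
    (is "_ \<in> ?K")
proof -
  let ?G = "free_Abelian_group (oriented_primaries A n)"
  interpret G: comm_group ?G by (rule abelian_free_Abelian_group)
  have sub: "subgroup ?K ?G" by (rule G.generate_is_subgroup[OF global_cycles_carrier])
  have N': "primary_ideal A N" "maximalideal (ideal_radical A N) A" "\<omega> \<in> local_orientations A n N"
    using N oriented_primaries_iff by auto
  let ?M = "ideal_radical A N"
  have iN: "ideal N A" using N'(1) by (simp add: primary_ideal_def)
  obtain f where f: "generating n N f" "\<omega> = orientation_rel A n N `` {cmap n N f}"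
    using N'(3) local_orientations_cmap[OF iN] by blast
  obtain p where p: "p \<in> quadric m n" "pre ?M = pt_ideal p" using maximal_point[OF N'(2)] by blast
  have sq: "pre (sqr N) = sq (Zq m n) (pre N)" unfolding pre_sqr[OF iN] kerZ ..
  have NM: "pre N \<subseteq> pt_ideal p" using radical_prime(2)[OF N'(1)] p(2) by simp
  have rad: "\<exists>k::nat. a ^ k \<in> pre N" if "a \<in> pt_ideal p" for a using that unfolding p(2)[symmetric] pre_radical[OF iN] .
  have fN: "f i \<in> pre N" if "i < n" for i using f(1) that unfolding generating_def by blast
  have Nf: "pre N \<subseteq> gen n f (sq (Zq m n) (pre N))" using f(1) unfolding generating_def sq by blast
  have ZN: "Zq m n \<subseteq> pre N" using ker_sub[OF iN] unfolding kerZ .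
  have "\<exists>F B. (\<forall>i<n. F i - f i \<in> sq (Zq m n) (pre N)) \<and> finite B \<and>
    (\<forall>Q\<in>B. mxm Q \<and> Zq m n \<subseteq> Q \<and> Q \<noteq> pt_ideal p) \<and> gen n F (Zq m n) = pre N \<inter> \<Inter>B"
    by (rule move_primary[OF mn p(1) idl_pre[OF iN] ZN NM rad fN Nf])
  then obtain F B where FB': "\<forall>i<n. F i - f i \<in> sq (Zq m n) (pre N)" and B1: "finite B"
    and B2: "\<forall>Q\<in>B. mxm Q \<and> Zq m n \<subseteq> Q \<and> Q \<noteq> pt_ideal p" and FB: "gen n F (Zq m n) = pre N \<inter> \<Inter>B"
    by (elim exE conjE)
  note F = FB'[rule_format] and B = B1 bspec[OF B2]
  let ?T = "(\<lambda>Q. proj m n ` Q) ` B"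
  let ?S = "insert N ?T"
  have pB: "pre (proj m n ` Q) = Q" and mB: "maximalideal (proj m n ` Q) A" if "Q \<in> B" for Q
    using B(2)[OF that] pre_image[OF mxm_idl] maximalideal_image unfolding kerZ by blast+
  have radT: "ideal_radical A Q = Q" "maximalideal Q A" "Q \<noteq> ?M" if Q: "Q \<in> ?T" for Q
  proof -
    obtain Q' where Q': "Q' \<in> B" "Q = proj m n ` Q'" using Q by blast
    show mx: "maximalideal Q A" using mB[OF Q'(1)] Q'(2) by simp
    show "ideal_radical A Q = Q" by (rule maximal_primary(2)[OF mx])
    show "Q \<noteq> ?M" using pB[OF Q'(1)] B(2)[OF Q'(1)] p(2) Q'(2) by auto
  qed
  have NT: "N \<notin> ?T" using radT(1)[of N] radT(3)[of N] by blast
  have *: "finite ?S" "?S \<noteq> {}" using B(1) by auto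
  have 3: "primary_ideal A Q" if "Q \<in> ?S" for Q using that N'(1) radT(2)[of Q] maximal_primary(1) by blast
  have 4: "maximalideal (ideal_radical A Q) A" if "Q \<in> ?S" for Q using that N'(2) radT(1,2)[of Q] by auto
  have 5: "inj_on (ideal_radical A) ?S"
  proof (rule inj_onI)
    fix Q Q' assume Q: "Q \<in> ?S" and Q': "Q' \<in> ?S" and eq: "ideal_radical A Q = ideal_radical A Q'"
    show "Q = Q'"
    proof (cases "Q \<in> ?T")
      case True
      then have "Q' \<in> ?T" using eq radT(1)[OF True] radT(3)[OF True] Q' by auto
      then show ?thesis using eq radT(1)[OF True] radT(1)[of Q'] by simp
    next
      case False
      then have "Q = N" using Q by blast
      then show ?thesis using eq radT(1)[of Q'] radT(3)[of Q'] Q' by auto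
    qed
  qed
  have 6: "gen n F ker = (\<Inter>Q\<in>?S. pre Q)"
  proof -
    have "(\<Inter>Q\<in>?T. pre Q) = \<Inter>B" using pB by auto
    then show ?thesis unfolding kerZ FB by auto
  qed
  note gl = global_cycleI[OF * 3 4 5 6]
  have gl2: "generating n Q F" if "Q \<in> ?S" for Q by (rule gl(2)[OF _ _ that])
  have FN: "F i \<in> pre N" if "i < n" for i using gl2[OF insertI1] that unfolding generating_def by blast
  have wN: "orientation_rel A n N `` {cmap n N F} = \<omega>"
    unfolding f(2) using cmap_cong[OF iN f(1) _ FN] F unfolding sq by simp
  let ?x = "\<lambda>Q. frag_of (Q, orientation_rel A n Q `` {cmap n Q F})"
  have "sum ?x ?S \<in> global_orientation_cycles A n" by (rule gl(1))
  then have tot: "sum ?x ?S \<in> ?K" by (rule generate.incl)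
  have rest: "sum ?x ?T \<in> ?K"
  proof (rule sum_in_subgroup[OF sub])
    fix Q assume Q: "Q \<in> ?T"
    then have "?x Q \<in> global_orientation_cycles A n" by (intro point_cycle radT(2) gl2) auto
    then show "?x Q \<in> ?K" by (rule generate.incl)
  qed
  have "sum ?x ?S = frag_of (N, \<omega>) + sum ?x ?T" using NT B(1) wN by simp
  then have eq: "frag_of (N, \<omega>) = sum ?x ?S - sum ?x ?T" by simp
  have "sum ?x ?S \<otimes>\<^bsub>?G\<^esub> inv\<^bsub>?G\<^esub> (sum ?x ?T) \<in> ?K"
    using subgroup.m_closed[OF sub tot subgroup.m_inv_closed[OF sub rest]] .
  moreover have "Poly_Mapping.keys (sum ?x ?T) \<subseteq> oriented_primaries A n"
  proof -
    have "sum ?x ?T \<in> carrier ?G" using subgroup.subset[OF sub] rest by blast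
    then show ?thesis by (simp only: carrier_free_Abelian_group_iff)
  qed
  ultimately show ?thesis unfolding eq by simp
qed

theorem euler_class_group_trivial: "trivial_group (euler_class_group A)"
proof -
  have "the_enat (krull_dim A) = n" using quadric_dimension(1)[OF mn] by simp
  then show ?thesis unfolding euler_class_group_def
    using trivial_quotient_free_group[OF global_cycles_carrier] primary_cycle by (auto simp: Let_def)
qed

end

section \<open>Vanishing of the Chow group of zero-cycles\<close>

subsection \<open>Localization of a domain at a maximal ideal\<close>

text \<open>Fractions \<open>x / s\<close> over a domain, with \<open>s\<close> outside the
  maximal ideal \<open>P\<close>. Since the ring is a domain, equality of fractions is
  cross-multiplication.\<close>

locale local_domain = presented B q for B :: "('a, 'b) ring_scheme" (structure) and q :: "'p::comm_ring_1 \<Rightarrow> 'a" +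
  fixes P :: "'a set"
  assumes K: "prm ker" and P: "mxm (pre P)" and KP: "ker \<subseteq> pre P"
begin

abbreviation "S \<equiv> carrier B - P"
abbreviation "L \<equiv> localization B S"

definition fr :: "'p \<Rightarrow> 'p \<Rightarrow> ('a \<times> 'a) set" where "fr x s = loc_frac B S (q x) (q s)"

lemma iK: "idl ker" by (rule prm_idl[OF K])

lemma S_mult: "s \<notin> pre P \<Longrightarrow> t \<notin> pre P \<Longrightarrow> s * t \<notin> pre P"
  using mxm_prm[OF P] unfolding prm_def by blast

lemma S_one: "1 \<notin> pre P" using P unfolding mxm_def by blast

lemma K_cancel: "s \<notin> pre P \<Longrightarrow> s * x \<in> ker \<Longrightarrow> x \<in> ker"
  using K KP unfolding prm_def by blast

lemma mem_fr: "(q y, q t) \<in> fr x s \<longleftrightarrow> t \<notin> pre P \<and> x * t - y * s \<in> ker"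
proof -
  have "(\<exists>u\<in>S. u \<otimes> (q x \<otimes> q t \<ominus> q y \<otimes> q s) = \<zero>) \<longleftrightarrow> x * t - y * s \<in> ker"
  proof
    assume "\<exists>u\<in>S. u \<otimes> (q x \<otimes> q t \<ominus> q y \<otimes> q s) = \<zero>"
    then obtain u where u: "u \<in> S" "u \<otimes> (q x \<otimes> q t \<ominus> q y \<otimes> q s) = \<zero>" by (rule bexE)
    from u(1) have uc: "u \<in> carrier B" by (rule DiffD1)
    obtain v where v: "u = q v" using ex_lift[OF uc] by blast
    have "v * (x * t - y * s) \<in> ker" using u(2) unfolding v by (simp add: pi_mult pi_diff)
    moreover have "v \<notin> pre P" using u(1) unfolding v by simp
    ultimately show "x * t - y * s \<in> ker" by (rule K_cancel[rotated])
  next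
    assume "x * t - y * s \<in> ker"
    then have "\<one> \<otimes> (q x \<otimes> q t \<ominus> q y \<otimes> q s) = \<zero>" by (simp add: pi_mult pi_diff)
    moreover have "\<one> \<in> S" using S_one by (simp add: pi_one)
    ultimately show "\<exists>u\<in>S. u \<otimes> (q x \<otimes> q t \<ominus> q y \<otimes> q s) = \<zero>" by (rule bexI)
  qed
  then show ?thesis unfolding fr_def loc_frac_def by simp
qed

lemma fr_cases:
  assumes "z \<in> fr x s" obtains y t where "z = (q y, q t)" "t \<notin> pre P" "x * t - y * s \<in> ker"
proof -
  obtain b c where z: "z = (b, c)" "b \<in> carrier B" "c \<in> S" using assms unfolding fr_def loc_frac_def by auto
  obtain y where y: "b = q y" using ex_lift[OF z(2)] by blast
  obtain t where t: "c = q t" using ex_lift[OF DiffD1[OF z(3)]] by blast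
  show thesis using that[of y t] assms unfolding z(1) y t mem_fr by simp
qed

lemma fr_eqI: assumes s: "s \<notin> pre P" and t: "t \<notin> pre P" and e: "x * t - y * s \<in> ker" shows "fr x s = fr y t"
proof -
  have sub: "fr x s \<subseteq> fr y t" if s: "s \<notin> pre P" and e: "x * t - y * s \<in> ker" for x s y t
  proof
    fix z assume "z \<in> fr x s"
    then obtain v r where z: "z = (q v, q r)" "r \<notin> pre P" "x * r - v * s \<in> ker" by (rule fr_cases)
    have "s * (y * r - v * t) = t * (x * r - v * s) - r * (x * t - y * s)" by (simp add: algebra_simps)
    also have "\<dots> \<in> ker" by (intro idl_diff[OF iK] idl_mult[OF iK] z e)
    finally have "y * r - v * t \<in> ker" by (rule K_cancel[OF s])
    then show "z \<in> fr y t" using z(2) unfolding z(1) mem_fr by (intro conjI)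
  qed
  have "y * s - x * t \<in> ker" by (rule idl_diff_sym[OF iK e])
  then show ?thesis by (intro equalityI sub s t e)
qed

lemma fr_self: "s \<notin> pre P \<Longrightarrow> (q x, q s) \<in> fr x s"
  unfolding mem_fr using idl_zero[OF iK] by simp

lemma fr_eq_iff: assumes s: "s \<notin> pre P" and t: "t \<notin> pre P" shows "fr x s = fr y t \<longleftrightarrow> x * t - y * s \<in> ker"
proof
  assume "fr x s = fr y t"
  then have "(q y, q t) \<in> fr x s" using fr_self[OF t] by simp
  then show "x * t - y * s \<in> ker" unfolding mem_fr by (rule conjunct2)
qed (rule fr_eqI[OF s t])

lemma L_carrier: "carrier L = {fr x s | x s. s \<notin> pre P}"
proof
  show "carrier L \<subseteq> {fr x s | x s. s \<notin> pre P}"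
  proof
    fix z assume "z \<in> carrier L"
    then obtain a c where z: "z = loc_frac B S a c" "a \<in> carrier B" "c \<in> S" unfolding localization_def by auto
    obtain x where "a = q x" using ex_lift[OF z(2)] by blast
    moreover obtain s where "c = q s" using ex_lift[OF DiffD1[OF z(3)]] by blast
    ultimately have "z = fr x s" "s \<notin> pre P" using z unfolding fr_def by simp_all
    then show "z \<in> {fr x s | x s. s \<notin> pre P}" by blast
  qed
  show "{fr x s | x s. s \<notin> pre P} \<subseteq> carrier L"
  proof
    fix z assume "z \<in> {fr x s | x s. s \<notin> pre P}"
    then obtain x s where z: "z = fr x s" "s \<notin> pre P" by blast
    then have "q x \<in> carrier B" "q s \<in> S" by simp_all
    then show "z \<in> carrier L" unfolding localization_def z(1) fr_def by auto
  qed
qed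

lemma L_cases: assumes "z \<in> carrier L" obtains x s where "z = fr x s" "s \<notin> pre P"
  using assms unfolding L_carrier by blast

lemma fr_closed: "s \<notin> pre P \<Longrightarrow> fr x s \<in> carrier L" unfolding L_carrier by blast

lemma UN_const: "z0 \<in> U \<Longrightarrow> w0 \<in> V \<Longrightarrow> (\<And>z w. z \<in> U \<Longrightarrow> w \<in> V \<Longrightarrow> h z w = c) \<Longrightarrow> (\<Union>z\<in>U. \<Union>w\<in>V. h z w) = c"
  by blast

lemma L_mult: assumes s: "s \<notin> pre P" and t: "t \<notin> pre P"
  shows "fr x s \<otimes>\<^bsub>L\<^esub> fr y t = fr (x * y) (s * t)"
proof -
  have "loc_frac B S (fst z \<otimes> fst w) (snd z \<otimes> snd w) = fr (x * y) (s * t)" if z: "z \<in> fr x s" and w: "w \<in> fr y t" for z w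
  proof -
    obtain a c where z': "z = (q a, q c)" "c \<notin> pre P" "x * c - a * s \<in> ker" using z by (rule fr_cases)
    obtain b d where w': "w = (q b, q d)" "d \<notin> pre P" "y * d - b * t \<in> ker" using w by (rule fr_cases)
    have "(a * b) * (s * t) - (x * y) * (c * d) = - (y * d * (x * c - a * s) + a * s * (y * d - b * t))" by (simp add: algebra_simps)
    also have "\<dots> \<in> ker" by (intro idl_minus[OF iK] idl_add[OF iK] idl_mult[OF iK] z' w')
    finally have "fr (a * b) (c * d) = fr (x * y) (s * t)" by (intro fr_eqI S_mult z' w' s t)
    then show ?thesis unfolding z' w' by (simp add: fr_def pi_mult)
  qed
  from UN_const[OF fr_self[OF s] fr_self[OF t] this] show ?thesis by (simp add: localization_def)
qed

lemma L_add: assumes s: "s \<notin> pre P" and t: "t \<notin> pre P"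
  shows "fr x s \<oplus>\<^bsub>L\<^esub> fr y t = fr (x * t + y * s) (s * t)"
proof -
  have "loc_frac B S (fst z \<otimes> snd w \<oplus> fst w \<otimes> snd z) (snd z \<otimes> snd w) = fr (x * t + y * s) (s * t)" if z: "z \<in> fr x s" and w: "w \<in> fr y t" for z w
  proof -
    obtain a c where z': "z = (q a, q c)" "c \<notin> pre P" "x * c - a * s \<in> ker" using z by (rule fr_cases)
    obtain b d where w': "w = (q b, q d)" "d \<notin> pre P" "y * d - b * t \<in> ker" using w by (rule fr_cases)
    have "(a * d + b * c) * (s * t) - (x * t + y * s) * (c * d) = - (d * t * (x * c - a * s) + c * s * (y * d - b * t))" by (simp add: algebra_simps)
    also have "\<dots> \<in> ker" by (intro idl_minus[OF iK] idl_add[OF iK] idl_mult[OF iK] z' w')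
    finally have "fr (a * d + b * c) (c * d) = fr (x * t + y * s) (s * t)" by (intro fr_eqI S_mult z' w' s t)
    then show ?thesis unfolding z' w' by (simp add: fr_def pi_mult pi_add)
  qed
  from UN_const[OF fr_self[OF s] fr_self[OF t] this] show ?thesis by (simp add: localization_def)
qed

lemma L_one: "\<one>\<^bsub>L\<^esub> = fr 1 1" by (simp add: localization_def fr_def pi_one)
lemma L_zero: "\<zero>\<^bsub>L\<^esub> = fr 0 1" by (simp add: localization_def fr_def pi_one)

lemma fr_eq0: "s \<notin> pre P \<Longrightarrow> t \<notin> pre P \<Longrightarrow> x * t - y * s = 0 \<Longrightarrow> fr x s = fr y t"
  by (rule fr_eqI, assumption, assumption) (simp only: idl_zero[OF iK])

lemmas S_rules = S_mult S_one

lemma cring_L: "cring L"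
proof (rule cringI)
  show "abelian_group L"
  proof (rule abelian_groupI)
    fix a assume a: "a \<in> carrier L"
    then obtain x s where a': "a = fr x s" "s \<notin> pre P" by (rule L_cases)
    show "\<zero>\<^bsub>L\<^esub> \<oplus>\<^bsub>L\<^esub> a = a"
      unfolding a' L_zero L_add[OF S_one a'(2)] by (rule fr_eq0) (use a' S_rules in \<open>auto simp del: mem_pre\<close>)
    have "fr (- x) s \<oplus>\<^bsub>L\<^esub> a = \<zero>\<^bsub>L\<^esub>"
      unfolding a' L_zero L_add[OF a'(2) a'(2)] by (rule fr_eq0) (use a' S_rules in \<open>auto simp del: mem_pre\<close>)
    then show "\<exists>y\<in>carrier L. y \<oplus>\<^bsub>L\<^esub> a = \<zero>\<^bsub>L\<^esub>" using fr_closed[OF a'(2)] by blast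
    fix b assume b: "b \<in> carrier L"
    then obtain y t where b': "b = fr y t" "t \<notin> pre P" by (rule L_cases)
    show "a \<oplus>\<^bsub>L\<^esub> b \<in> carrier L" unfolding a' b' L_add[OF a'(2) b'(2)] by (intro fr_closed S_mult a' b')
    show "a \<oplus>\<^bsub>L\<^esub> b = b \<oplus>\<^bsub>L\<^esub> a"
      unfolding a' b' L_add[OF a'(2) b'(2)] L_add[OF b'(2) a'(2)] by (simp add: add.commute mult.commute)
    fix c assume c: "c \<in> carrier L"
    then obtain z r where c': "c = fr z r" "r \<notin> pre P" by (rule L_cases)
    show "a \<oplus>\<^bsub>L\<^esub> b \<oplus>\<^bsub>L\<^esub> c = a \<oplus>\<^bsub>L\<^esub> (b \<oplus>\<^bsub>L\<^esub> c)"
      unfolding a' b' c' L_add[OF a'(2) b'(2)] L_add[OF b'(2) c'(2)] L_add[OF S_mult[OF a'(2) b'(2)] c'(2)] L_add[OF a'(2) S_mult[OF b'(2) c'(2)]]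
      by (rule fr_eq0) (intro S_mult a' b' c', intro S_mult a' b' c', simp add: algebra_simps)
  next
    show "\<zero>\<^bsub>L\<^esub> \<in> carrier L" unfolding L_zero by (rule fr_closed[OF S_one])
  qed
  show "Group.comm_monoid L"
  proof (rule comm_monoidI)
    show "\<one>\<^bsub>L\<^esub> \<in> carrier L" unfolding L_one by (rule fr_closed[OF S_one])
    fix a assume a: "a \<in> carrier L"
    then obtain x s where a': "a = fr x s" "s \<notin> pre P" by (rule L_cases)
    show "\<one>\<^bsub>L\<^esub> \<otimes>\<^bsub>L\<^esub> a = a" unfolding a' L_one L_mult[OF S_one a'(2)] by simp
    fix b assume b: "b \<in> carrier L"
    then obtain y t where b': "b = fr y t" "t \<notin> pre P" by (rule L_cases)
    show "a \<otimes>\<^bsub>L\<^esub> b \<in> carrier L" unfolding a' b' L_mult[OF a'(2) b'(2)] by (intro fr_closed S_mult a' b')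
    show "a \<otimes>\<^bsub>L\<^esub> b = b \<otimes>\<^bsub>L\<^esub> a"
      unfolding a' b' L_mult[OF a'(2) b'(2)] L_mult[OF b'(2) a'(2)] by (simp add: mult.commute)
    fix c assume c: "c \<in> carrier L"
    then obtain z r where c': "c = fr z r" "r \<notin> pre P" by (rule L_cases)
    show "a \<otimes>\<^bsub>L\<^esub> b \<otimes>\<^bsub>L\<^esub> c = a \<otimes>\<^bsub>L\<^esub> (b \<otimes>\<^bsub>L\<^esub> c)"
      unfolding a' b' c' L_mult[OF a'(2) b'(2)] L_mult[OF b'(2) c'(2)] L_mult[OF S_mult[OF a'(2) b'(2)] c'(2)] L_mult[OF a'(2) S_mult[OF b'(2) c'(2)]]
      by (simp add: mult.assoc)
  qed
  fix a b c assume a: "a \<in> carrier L" and b: "b \<in> carrier L" and c: "c \<in> carrier L"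
  obtain x s where a': "a = fr x s" "s \<notin> pre P" using a by (rule L_cases)
  obtain y t where b': "b = fr y t" "t \<notin> pre P" using b by (rule L_cases)
  obtain z r where c': "c = fr z r" "r \<notin> pre P" using c by (rule L_cases)
  show "(a \<oplus>\<^bsub>L\<^esub> b) \<otimes>\<^bsub>L\<^esub> c = a \<otimes>\<^bsub>L\<^esub> c \<oplus>\<^bsub>L\<^esub> b \<otimes>\<^bsub>L\<^esub> c"
    unfolding a' b' c' L_add[OF a'(2) b'(2)] L_mult[OF a'(2) c'(2)] L_mult[OF b'(2) c'(2)]
      L_mult[OF S_mult[OF a'(2) b'(2)] c'(2)] L_add[OF S_mult[OF a'(2) c'(2)] S_mult[OF b'(2) c'(2)]]
    by (rule fr_eq0) (intro S_mult a' b' c', intro S_mult a' b' c', simp add: algebra_simps)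
qed

lemma PIdl_fr: "PIdl\<^bsub>L\<^esub> (fr f 1) = {fr (x * f) s | x s. s \<notin> pre P}"
proof -
  have "PIdl\<^bsub>L\<^esub> (fr f 1) = {z \<otimes>\<^bsub>L\<^esub> fr f 1 | z. z \<in> carrier L}" by (simp add: cgenideal_def)
  also have "\<dots> = {fr x s \<otimes>\<^bsub>L\<^esub> fr f 1 | x s. s \<notin> pre P}" unfolding L_carrier by blast
  also have "\<dots> = {fr (x * f) s | x s. s \<notin> pre P}"
  proof -
    have "fr x s \<otimes>\<^bsub>L\<^esub> fr f 1 = fr (x * f) s" if "s \<notin> pre P" for x s using L_mult[OF that S_one] by simp
    then show ?thesis by (intro Collect_cong ex_cong1 rev_conj_cong refl) (simp only: simp_thms)
  qed
  finally show ?thesis .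
qed

lemma vanishing_order_eq:
  "vanishing_order B P (q f) = the_enat (ring_length (L Quot (PIdl\<^bsub>L\<^esub> (fr f 1))))"
  by (simp add: vanishing_order_def Let_def fr_def pi_one)

text \<open>The quotient is the zero ring, which has a single ideal.\<close>

lemma vanishing_order_unit:
  assumes f: "f \<notin> pre P" shows "vanishing_order B P (q f) = 0"
proof -
  interpret L: cring L by (rule cring_L)
  have I: "PIdl\<^bsub>L\<^esub> (fr f 1) = carrier L"
  proof
    show "PIdl\<^bsub>L\<^esub> (fr f 1) \<subseteq> carrier L" unfolding PIdl_fr L_carrier by blast
    show "carrier L \<subseteq> PIdl\<^bsub>L\<^esub> (fr f 1)"
    proof
      fix z assume "z \<in> carrier L"
      then obtain x s where z: "z = fr x s" "s \<notin> pre P" by (rule L_cases)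
      have "fr x s = fr (x * f) (s * f)"
        by (rule fr_eq0) (intro z, intro S_mult z f, simp add: algebra_simps)
      then show "z \<in> PIdl\<^bsub>L\<^esub> (fr f 1)" unfolding PIdl_fr z(1) using S_mult[OF z(2) f] by blast
    qed
  qed
  have car: "carrier (L Quot carrier L) = {carrier L}"
  proof -
    have "carrier L +>\<^bsub>L\<^esub> a = carrier L" if "a \<in> carrier L" for a
      using that abelian_subgroup.a_rcos_const[OF abelian_subgroupI3[OF ideal.axioms(1)[OF L.oneideal] L.abelian_group_axioms]] by blast
    then show ?thesis unfolding FactRing_def A_RCOSETS_def' using L.zero_closed by auto
  qed
  have triv: "J = {carrier L}" if J: "ideal J (L Quot carrier L)" for J
  proof -
    have "J \<subseteq> {carrier L}" unfolding car[symmetric] by (rule subsetI, rule ideal.Icarr[OF J])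
    moreover have "J \<noteq> {}" using additive_subgroup.zero_closed[OF ideal.axioms(1)[OF J]] by blast
    ultimately show ?thesis by blast
  qed
  have "ring_length (L Quot carrier L) \<le> 0"
    unfolding ring_length_def
  proof (rule Sup_least)
    fix x assume "x \<in> {enat k | k. \<exists>C. chain_of_length (\<lambda>I. ideal I (L Quot carrier L)) k C}"
    then obtain k C where x: "x = enat k" and C: "chain_of_length (\<lambda>I. ideal I (L Quot carrier L)) k C" by blast
    have "k = 0"
    proof (rule ccontr)
      assume "k \<noteq> 0"
      then have c: "C 0 \<subset> C (Suc 0)" "ideal (C 0) (L Quot carrier L)" "ideal (C (Suc 0)) (L Quot carrier L)"
        using C unfolding chain_of_length_def by auto
      then show False using c(1) unfolding triv[OF c(2)] triv[OF c(3)] by simp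
    qed
    then show "x \<le> 0" by (simp add: x zero_enat_def)
  qed
  then have "ring_length (L Quot carrier L) = 0" by simp
  then show ?thesis unfolding vanishing_order_eq I by (simp add: zero_enat_def)
qed

text \<open>The quotient is the residue field, with exactly two ideals.\<close>

lemma vanishing_order_generator:
  assumes f: "pre P = isum ker (princ f)" shows "vanishing_order B P (q f) = 1"
proof -
  interpret L: cring L by (rule cring_L)
  let ?I = "PIdl\<^bsub>L\<^esub> (fr f 1)"
  have fP: "f \<in> pre P"
  proof -
    have "f \<in> princ f" unfolding princ_def by (rule range_eqI[of _ _ 1]) simp
    then show ?thesis unfolding f using isum_r[OF iK] by blast
  qed
  have iI: "ideal ?I L" by (rule L.cgenideal_ideal[OF fr_closed[OF S_one]])
  have memI: "fr x s \<in> ?I \<longleftrightarrow> x \<in> pre P" if s: "s \<notin> pre P" for x s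
  proof
    assume "fr x s \<in> ?I"
    then obtain y t where y: "fr x s = fr (y * f) t" "t \<notin> pre P" unfolding PIdl_fr by blast
    have "x * t - y * f * s \<in> ker" using y(1) unfolding fr_eq_iff[OF s y(2)] .
    then have "x * t - y * f * s \<in> pre P" using KP by blast
    moreover have "y * f * s \<in> pre P" by (intro idl_mult2[OF mxm_idl[OF P]] idl_mult[OF mxm_idl[OF P]] fP)
    ultimately have "x * t \<in> pre P" using idl_eqI[OF mxm_idl[OF P]] by blast
    then show "x \<in> pre P" using mxm_prm[OF P] y(2) unfolding prm_def by blast
  next
    assume "x \<in> pre P"
    then obtain k r where x: "x = k + r * f" "k \<in> ker" unfolding f isum_def princ_def by blast
    have "x * s - r * f * s = k * s" by (simp add: x algebra_simps)
    then have "x * s - (r * f) * s \<in> ker" using idl_mult2[OF iK x(2)] by simp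
    then have "fr x s = fr (r * f) s" by (rule fr_eqI[OF s s])
    then show "fr x s \<in> ?I" unfolding PIdl_fr using s by blast
  qed
  have one: "\<one>\<^bsub>L\<^esub> \<notin> ?I" unfolding L_one using memI[OF S_one] S_one by blast
  have mx: "maximalideal ?I L"
  proof (rule maximalidealI[OF iI])
    show "carrier L \<noteq> ?I" using one L.one_closed by (rule_tac notI) simp
    fix J assume J: "ideal J L" "?I \<subseteq> J" "J \<subseteq> carrier L"
    show "J = ?I \<or> J = carrier L"
    proof (cases "J = ?I")
      case False
      then obtain z where z: "z \<in> J" "z \<notin> ?I" using J(2) by blast
      obtain x s where x: "z = fr x s" "s \<notin> pre P" using subsetD[OF J(3) z(1)] by (rule L_cases)
      have xP: "x \<notin> pre P" using z(2) memI[OF x(2)] x(1) by blast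
      have "fr s x \<otimes>\<^bsub>L\<^esub> z \<in> J" by (rule ideal.I_l_closed[OF J(1) z(1) fr_closed[OF xP]])
      moreover have "fr s x \<otimes>\<^bsub>L\<^esub> z = \<one>\<^bsub>L\<^esub>"
        unfolding x(1) L_mult[OF xP x(2)] L_one by (rule fr_eq0) (intro S_mult x xP, rule S_one, simp add: mult.commute)
      ultimately have "J = carrier L" using ideal.one_imp_carrier[OF J(1)] by simp
      then show ?thesis by blast
    qed simp
  qed
  let ?Q = "L Quot ?I"
  interpret F: field ?Q by (rule maximalideal.quotient_is_field[OF mx L.cring_axioms])
  have ids: "J = {\<zero>\<^bsub>?Q\<^esub>} \<or> J = carrier ?Q" if "ideal J ?Q" for J using F.all_ideals that by auto
  have "ring_length ?Q = 1"
  proof (rule antisym)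
    show "ring_length ?Q \<le> 1" unfolding ring_length_def
    proof (rule Sup_least)
      fix x assume "x \<in> {enat k | k. \<exists>C. chain_of_length (\<lambda>I. ideal I ?Q) k C}"
      then obtain k C where x: "x = enat k" and C: "chain_of_length (\<lambda>I. ideal I ?Q) k C" by blast
      have "k \<le> 1"
      proof (rule ccontr)
        assume "\<not> k \<le> 1"
        then have k: "0 < k" "1 < k" by auto
        have c: "C 0 \<subset> C 1" "C 1 \<subset> C 2" "ideal (C 0) ?Q" "ideal (C 1) ?Q" "ideal (C 2) ?Q"
          using C k unfolding chain_of_length_def by (auto simp: numeral_2_eq_2)
        have "\<zero>\<^bsub>?Q\<^esub> \<in> C 0" using c(3) by (simp add: additive_subgroup.zero_closed ideal.axioms(1))
        then have "C 1 \<noteq> {\<zero>\<^bsub>?Q\<^esub>}" using c(1) by auto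
        then have "C 1 = carrier ?Q" using ids[OF c(4)] by simp
        moreover have "C 2 \<subseteq> carrier ?Q" by (rule subsetI, rule ideal.Icarr[OF c(5)])
        ultimately show False using c(2) by auto
      qed
      then show "x \<le> 1" by (simp add: x one_enat_def)
    qed
    have "chain_of_length (\<lambda>I. ideal I ?Q) 1 (\<lambda>i. if i = 0 then {\<zero>\<^bsub>?Q\<^esub>} else carrier ?Q)"
      (is "chain_of_length _ 1 ?C")
    proof -
      have "{\<zero>\<^bsub>?Q\<^esub>} \<subset> carrier ?Q" using F.one_closed F.zero_closed F.zero_not_one by blast
      then show ?thesis unfolding chain_of_length_def using F.zeroideal F.oneideal by simp
    qed
    then show "1 \<le> ring_length ?Q" unfolding ring_length_def one_enat_def
      by (intro Sup_upper CollectI exI conjI) (rule refl, assumption)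
  qed
  then show ?thesis unfolding vanishing_order_eq by (simp add: one_enat_def)
qed

end

subsection \<open>A point that is principal on a curve is rationally trivial\<close>

text \<open>On the curve, \<open>f\<close> generates the ideal of \<open>M\<close> and is
  therefore a unit at every other point; the divisor of \<open>f / 1\<close> is
  \<open>M\<close>.\<close>

lemma (in presented) principal_point:
  assumes p: "primeideal p R" and dim: "krull_dim (R Quot p) = 1" and M: "maximalideal M R" and pM: "p \<subseteq> M"
    and f: "f \<notin> pre p" "pre M = isum (pre p) (princ f)"
  shows "frag_of M \<in> principal_zero_cycles R"
proof -
  have ip: "ideal p R" using p by (simp add: primeideal_def)
  interpret Q: presented "R Quot p" "\<lambda>x. p +> \<pi> x" by (rule presented_Quot[OF ip])
  have kQ: "Q.ker = pre p" by (rule ker_Quot[OF ip])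
  let ?q = "\<lambda>x. p +> \<pi> x"
  have img: "Q.pre ((\<lambda>x. p +> x) ` M') = pre M'" if M': "ideal M' R" "p \<subseteq> M'" for M'
  proof -
    have "?q x \<in> (\<lambda>x. p +> x) ` M' \<longleftrightarrow> \<pi> x \<in> M'" for x
    proof
      assume "?q x \<in> (\<lambda>x. p +> x) ` M'"
      then obtain a where a: "a \<in> M'" "?q x = p +> a" by blast
      obtain y where y: "a = \<pi> y" using ex_lift[OF subsetD[OF ideal_carrier[OF M'(1)] a(1)]] by blast
      have "x - y \<in> pre p" using a(2) unfolding y coset_eq_iff[OF ip] .
      then have "x - y \<in> pre M'" using M'(2) by auto
      moreover have "y \<in> pre M'" using a(1) y by simp
      ultimately have "x \<in> pre M'" by (rule idl_eqI[OF idl_pre[OF M'(1)]])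
      then show "\<pi> x \<in> M'" by simp
    qed blast
    then show ?thesis unfolding Q.pre_def pre_def by blast
  qed
  have loc: "local_domain (R Quot p) ?q ((\<lambda>x. p +> x) ` M')" if M': "maximalideal M' R" "p \<subseteq> M'" for M'
  proof
    have iM: "ideal M' R" using M' by (simp add: maximalideal_def)
    note im = img[OF iM M'(2)]
    show "prm Q.ker" unfolding kQ by (rule prm_pre[OF p])
    show "mxm (Q.pre ((\<lambda>x. p +> x) ` M'))" unfolding im by (rule mxm_pre[OF M'(1)])
    show "Q.ker \<subseteq> Q.pre ((\<lambda>x. p +> x) ` M')" unfolding im kQ using M'(2) by auto
  qed
  have iM: "ideal M R" using M by (simp add: maximalideal_def)
  have fM: "f \<in> pre M"
  proof -
    have "f \<in> princ f" unfolding princ_def by (rule range_eqI[of _ _ 1]) simp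
    then show ?thesis unfolding f using isum_r[OF idl_pre[OF ip]] by blast
  qed
  have ord1: "vanishing_order (R Quot p) ((\<lambda>x. p +> x) ` M') (?q 1) = 0" if M': "maximalideal M' R" "p \<subseteq> M'" for M'
  proof (rule local_domain.vanishing_order_unit[OF loc[OF M']])
    have iM: "ideal M' R" using M' by (simp add: maximalideal_def)
    show "1 \<notin> Q.pre ((\<lambda>x. p +> x) ` M')" unfolding img[OF iM M'(2)] using mxm_pre[OF M'(1)] by (simp add: mxm_def)
  qed
  have ordf: "vanishing_order (R Quot p) ((\<lambda>x. p +> x) ` M') (?q f) = (if M' = M then 1 else 0)" if M': "maximalideal M' R" "p \<subseteq> M'" for M'
  proof (cases "M' = M")
    case True
    have "vanishing_order (R Quot p) ((\<lambda>x. p +> x) ` M) (?q f) = 1"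
      by (rule local_domain.vanishing_order_generator[OF loc[OF M pM]]) (simp only: img[OF iM pM] kQ f(2))
    then show ?thesis using True by simp
  next
    case False
    have iM': "ideal M' R" using M' by (simp add: maximalideal_def)
    have "f \<notin> pre M'"
    proof
      assume fM': "f \<in> pre M'"
      have "pre p \<subseteq> pre M'" using M'(2) by auto
      moreover have "princ f \<subseteq> pre M'" unfolding princ_def using idl_mult[OF idl_pre[OF iM'] fM'] by blast
      ultimately have "a + b \<in> pre M'" if "a \<in> pre p" "b \<in> princ f" for a b
        using that by (intro idl_add[OF idl_pre[OF iM']]) (erule subsetD, assumption)+
      then have "pre M \<subseteq> pre M'" unfolding f(2) isum_def by auto
      moreover have "1 \<notin> pre M'" using mxm_pre[OF M'(1)] unfolding mxm_def by (elim conjE)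
      ultimately have "pre M' = pre M" by (rule mxm_maximal[OF mxm_pre[OF M] idl_pre[OF iM']])
      then show False using False pre_inj[OF ideal_carrier[OF iM'] ideal_carrier[OF iM]] by blast
    qed
    then have "vanishing_order (R Quot p) ((\<lambda>x. p +> x) ` M') (?q f) = 0"
      by (intro local_domain.vanishing_order_unit[OF loc[OF M']]) (simp only: img[OF iM' M'(2)] not_False_eq_True)
    then show ?thesis using False by simp
  qed
  have div: "is_divisor_on_curve R p (?q f) (?q 1) (frag_of M)"
    unfolding is_divisor_on_curve_def
  proof (intro conjI ballI)
    show "Poly_Mapping.keys (frag_of M) \<subseteq> max_spectrum R" using M by (simp add: max_spectrum_def)
    fix M' assume "M' \<in> max_spectrum R"
    then have M': "maximalideal M' R" by (simp add: max_spectrum_def)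
    show "Poly_Mapping.lookup (frag_of M) M' =
      (if p \<subseteq> M' then int (vanishing_order (R Quot p) ((\<lambda>x. p +> x) ` M') (?q f))
          - int (vanishing_order (R Quot p) ((\<lambda>x. p +> x) ` M') (?q 1)) else 0)"
    proof (cases "p \<subseteq> M'")
      case True
      then show ?thesis using ordf[OF M' True] ord1[OF M' True] by (simp add: lookup_single when_def)
    next
      case False
      then have "M' \<noteq> M" using pM by blast
      then show ?thesis using False by (simp add: lookup_single when_def)
    qed
  qed
  have nz: "?q x \<in> carrier (R Quot p) - {\<zero>\<^bsub>R Quot p\<^esub>}" if "x \<notin> pre p" for x
  proof -
    have "x \<notin> Q.ker" unfolding kQ by (rule that)
    then show ?thesis by simp
  qed
  have "1 \<notin> pre p" using prm_pre[OF p] unfolding prm_def by blast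
  then show ?thesis unfolding principal_zero_cycles_def
    by (intro CollectI exI conjI) (rule p dim nz[OF f(1)] nz[of 1] div | assumption)+
qed

context quad begin

lemma point_principal: assumes M: "maximalideal M A" shows "frag_of M \<in> principal_zero_cycles A"
proof -
  have iM: "ideal M A" using M by (simp add: maximalideal_def)
  obtain x where x: "x \<in> quadric m n" "pre M = pt_ideal x" using maximal_point[OF M] by blast
  obtain P f z w where P: "prm P" "Zq m n \<subseteq> P" and gr: "growth P 1 z w" and f: "f \<notin> P" "pt_ideal x = isum P (princ f)"
    using every_point_good[OF mn x(1)] unfolding good_point_def by blast
  let ?p = "proj m n ` P"
  have kP: "ker \<subseteq> P" unfolding kerZ by (rule P(2))
  have pp: "primeideal ?p A" by (rule primeideal_image[OF P(1) kP])
  have ip: "ideal ?p A" using pp by (simp add: primeideal_def)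
  have preP: "pre ?p = P" by (rule pre_image[OF prm_idl[OF P(1)] kP])
  have PM: "P \<subseteq> pre M" unfolding x(2) f(2) by (rule isum_l[OF princ_idl])
  then have pM: "?p \<subseteq> M" by auto
  interpret Q: presented "A Quot ?p" "\<lambda>x. ?p +>\<^bsub>A\<^esub> proj m n x" by (rule presented_Quot[OF ip])
  have kQ: "Q.ker = P" using ker_Quot[OF ip] preP by simp
  interpret gr: growth P 1 z w by (rule gr)
  have le: "krull_dim (A Quot ?p) \<le> enat 1"
  proof (rule Q.krull_dim_le)
    fix k C assume a: "\<And>i. i \<le> k \<Longrightarrow> prm (C i)" "\<And>i. i < k \<Longrightarrow> C i \<subset> C (Suc i)" "Q.ker \<subseteq> C 0"
    show "k \<le> 1" by (rule gr.chain_bound[of k C, OF a(1,2) a(3)[unfolded kQ]])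
  qed
  let ?C = "\<lambda>i::nat. if i = 0 then P else pre M"
  have fM: "f \<in> pre M"
  proof -
    have "f \<in> princ f" unfolding princ_def by (rule range_eqI[of _ _ 1]) simp
    then show ?thesis unfolding x(2) f(2) using isum_r[OF prm_idl[OF P(1)]] by blast
  qed
  have "enat 1 \<le> prime_height (A Quot ?p) ((\<lambda>x. ?p +>\<^bsub>A\<^esub> proj m n x) ` ?C 1)"
  proof (rule Q.prime_height_ge)
    show "\<forall>l\<le>1. prm (?C l)" using P(1) mxm_prm[OF mxm_pre[OF M]] by simp
    show "\<forall>l<1. ?C l \<subset> ?C (Suc l)" using PM f(1) fM by auto
    show "Q.ker \<subseteq> ?C 0" unfolding kQ by simp
  qed
  then have "enat 1 \<le> krull_dim (A Quot ?p)" using prime_height_le_krull order_trans by blast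
  then have dim: "krull_dim (A Quot ?p) = 1" using le by (simp add: one_enat_def)
  show ?thesis by (rule principal_point[OF pp dim M pM, of f]) (simp_all only: preP f x not_False_eq_True)
qed

theorem chow_group_trivial: "trivial_group (chow_group_0 A)"
proof -
  have H: "principal_zero_cycles A \<subseteq> carrier (free_Abelian_group (max_spectrum A))"
  proof
    fix c assume "c \<in> principal_zero_cycles A"
    then have "Poly_Mapping.keys c \<subseteq> max_spectrum A"
      unfolding principal_zero_cycles_def is_divisor_on_curve_def by blast
    then show "c \<in> carrier (free_Abelian_group (max_spectrum A))" by simp
  qed
  have "frag_of M \<in> generate (free_Abelian_group (max_spectrum A)) (principal_zero_cycles A)" if "M \<in> max_spectrum A" for M
    using point_principal that by (auto simp: max_spectrum_def intro: generate.incl)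
  then show ?thesis unfolding chow_group_0_def Let_def by (rule trivial_quotient_free_group[OF H])
qed

end

theorem mainTheorem5:
  fixes m n :: nat
  assumes "n \<ge> 2" and "m < n"
  shows "trivial_group (euler_class_group (quadric_ring m n)) \<and>
         trivial_group (chow_group_0 (quadric_ring m n))"
proof -
  interpret quad m n by unfold_locales (use assms in auto)
  show ?thesis using euler_class_group_trivial chow_group_trivial by blast
qed

end
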